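(* Let $m=4$ and, for $x=(x_1,x_2)\in\mathbb{T}^2$, let $$\theta_1(x)=[0,1]^\top\sin(x_1),\quad \theta_2(x)=[0,1]^\top\cos(x_1),\quad \theta_3(x)=[1,1]^\top\sin(x_1-x_2),\quad \theta_4(x)=[1,1]^\top\cos(x_1-x_2).$$ Then the control system $$\partial_t v+(v\cdot\nabla)v+\nabla p=\sum_{j=1}^4 u_j(t)\theta_j(x),\qquad \operatorname{div} v=0,\qquad v(0,\cdot)=0\qquad\text{on }\mathbb{T}^2$$ is relaxation enhancing. That is, for every $\tau,\delta>0$ there exists $u=[u_1,\dots,u_4]^\top\in L^2([0,\tau];\mathbb{R}^4)$ such that, $v$ being the solution on $[0,\tau]$ of the Euler system $\partial_t v+(v\cdot\nabla)v+\nabla p=\sum_{j=1}^4 u_j(t)\theta_j(x)$, $\operatorname{div} v=0$, $v(0,\cdot)=0$ on $\mathbb{T}^2$ with this control $u$, for every $f\in L^2(\mathbb{T}^2)$ with $\|f\|_{L^2(\mathbb{T}^2)}\leq 1$ and $\int_{\mathbb{T}^2}f(x)\,dx=0$ the solution $\varphi_v$ of $$\partial_t\varphi_v+v\cdot\nabla\varphi_v-\Delta\varphi_v=0\ \text{ in }(0,\tau)\times\mathbb{T}^2,\qquad \varphi_v(0,\cdot)=f,$$ satisfies $\|\varphi_v(\tau,\cdot)\|_{L^2(\mathbb{T}^2)}<\delta$.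
   Context: $\mathbb{T}^2=\mathbb{R}^2/2\pi\mathbb{Z}^2$. The pressure $p$ is a ($2\pi$-periodic) scalar function on $\mathbb{T}^2$. For an integer $k\geq 3$, the 2D Euler system with forcing in $L^1([0,\tau];H^k)$, where the forcing is divergence-free with zero average, and zero initial data has a unique solution $v\in C([0,\tau];H^k)\cap W^{1,1}([0,\tau];H^{k-1})$ with $v(t,\cdot)$ divergence-free and of zero average; this is the solution meant. For $f\in L^2(\mathbb{T}^2)$, $\varphi_v$ is the usual weak (energy) solution of the advection–diffusion equation. Note that the control $u$ does not depend on $f$. *)

theory Defs
  imports "HOL-Analysis.Analysis"
begin

text \<open>
  Functions on the torus are represented by functions on the plane which are
  \<open>2\<pi>\<close>-periodic in each coordinate, and integrated over one period cell. Elements of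
  \<open>L\<^sup>2\<close> and \<open>H\<^sup>s\<close> are representatives of their almost-everywhere classes.
\<close>

definition torus :: "(real^2) measure" where
  "torus = lebesgue_on (cbox 0 (\<chi> j. 2 * pi))"

definition torus_periodic :: "(real^2 \<Rightarrow> real) \<Rightarrow> bool" where
  "torus_periodic f \<longleftrightarrow> (\<forall>x j. f (x + axis j (2 * pi)) = f x)"

definition torus_L2 :: "(real^2 \<Rightarrow> real) set" where
  "torus_L2 = {f. torus_periodic f \<and> f \<in> borel_measurable torus \<and>
                  integrable torus (\<lambda>x. (f x)\<^sup>2)}"

definition L2_norm_torus :: "(real^2 \<Rightarrow> real) \<Rightarrow> real" where
  "L2_norm_torus f = sqrt (\<integral>x. (f x)\<^sup>2 \<partial>torus)"

definition fourier_coeff :: "(real^2 \<Rightarrow> real) \<Rightarrow> int^2 \<Rightarrow> complex" where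
  "fourier_coeff f n =
     (\<integral>x. complex_of_real (f x) * cis (- (\<Sum>j\<in>UNIV. of_int (n $ j) * x $ j)) \<partial>torus)
       / complex_of_real ((2 * pi)\<^sup>2)"

definition sobolev_weight :: "nat \<Rightarrow> int^2 \<Rightarrow> real" where
  "sobolev_weight s n = (1 + (\<Sum>j\<in>UNIV. (real_of_int (n $ j))\<^sup>2)) ^ s"

definition sobolev :: "nat \<Rightarrow> (real^2 \<Rightarrow> real) set" where
  "sobolev s = {f \<in> torus_L2.
     (\<lambda>n. sobolev_weight s n * (cmod (fourier_coeff f n))\<^sup>2) summable_on UNIV}"

definition sobolev_norm :: "nat \<Rightarrow> (real^2 \<Rightarrow> real) \<Rightarrow> real" where
  "sobolev_norm s f =
     sqrt (\<Sum>\<^sub>\<infinity>n. sobolev_weight s n * (cmod (fourier_coeff f n))\<^sup>2)"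

text \<open>
  Distributional gradient, for \<open>f\<close> and its gradient in \<open>L\<^sup>2\<close>. It suffices to test against the
  characters \<open>exp (-i n\<cdot>x)\<close>, since trigonometric polynomials are dense in the smooth functions
  on the torus.
\<close>

definition weak_gradient :: "(real^2 \<Rightarrow> real) \<Rightarrow> (real^2 \<Rightarrow> real^2) \<Rightarrow> bool" where
  "weak_gradient f G \<longleftrightarrow> f \<in> torus_L2 \<and>
     (\<forall>j. (\<lambda>x. G x $ j) \<in> torus_L2 \<and>
          (\<forall>n. fourier_coeff (\<lambda>x. G x $ j) n = \<i> * of_int (n $ j) * fourier_coeff f n))"

definition continuous_into_L2 :: "real \<Rightarrow> (real \<Rightarrow> real^2 \<Rightarrow> real) \<Rightarrow> bool" where
  "continuous_into_L2 \<tau> g \<longleftrightarrow> (\<forall>t\<in>{0..\<tau>}. g t \<in> torus_L2 \<and>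
     ((\<lambda>r. L2_norm_torus (\<lambda>x. g r x - g t x)) \<longlongrightarrow> 0) (at t within {0..\<tau>}))"

definition continuous_into_sobolev :: "nat \<Rightarrow> real \<Rightarrow> (real \<Rightarrow> real^2 \<Rightarrow> real) \<Rightarrow> bool" where
  "continuous_into_sobolev s \<tau> g \<longleftrightarrow> (\<forall>t\<in>{0..\<tau>}. g t \<in> sobolev s \<and>
     ((\<lambda>r. sobolev_norm s (\<lambda>x. g r x - g t x)) \<longlongrightarrow> 0) (at t within {0..\<tau>}))"

text \<open>
  Bochner measurability: almost everywhere in time, \<open>g\<close> is the limit in \<open>H\<^sup>s\<close> of measurable
  functions taking finitely many values.
\<close>

definition strongly_measurable_sobolev :: "nat \<Rightarrow> real \<Rightarrow> (real \<Rightarrow> real^2 \<Rightarrow> real) \<Rightarrow> bool" where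
  "strongly_measurable_sobolev s \<tau> g \<longleftrightarrow> (\<exists>S :: nat \<Rightarrow> real \<Rightarrow> real^2 \<Rightarrow> real.
     (\<forall>m. finite (S m ` {0..\<tau>}) \<and> S m ` {0..\<tau>} \<subseteq> sobolev s \<and>
          (\<forall>h. {t \<in> {0..\<tau>}. S m t = h} \<in> sets lebesgue)) \<and>
     (AE t in lebesgue_on {0..\<tau>}. g t \<in> sobolev s \<and>
          (\<lambda>m. sobolev_norm s (\<lambda>x. g t x - S m t x)) \<longlonglongrightarrow> 0))"

definition bochner_Lp_sobolev :: "nat \<Rightarrow> nat \<Rightarrow> real \<Rightarrow> (real \<Rightarrow> real^2 \<Rightarrow> real) \<Rightarrow> bool" where
  "bochner_Lp_sobolev p s \<tau> g \<longleftrightarrow> strongly_measurable_sobolev s \<tau> g \<and>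
     integrable (lebesgue_on {0..\<tau>}) (\<lambda>t. sobolev_norm s (g t) ^ p)"

text \<open>
  \<open>g\<close> is absolutely continuous with derivative \<open>g'\<close> in \<open>L\<^sup>1([0,\<tau>]; H\<^sup>s)\<close>, i.e.
  \<open>g t = g 0 + \<integral>\<^sub>0\<^sup>t g' r dr\<close>. The Fourier coefficients are bounded linear functionals that
  separate points, hence they determine the Bochner integral on the right.
\<close>

definition has_W11_derivative ::
    "nat \<Rightarrow> real \<Rightarrow> (real \<Rightarrow> real^2 \<Rightarrow> real) \<Rightarrow> (real \<Rightarrow> real^2 \<Rightarrow> real) \<Rightarrow> bool" where
  "has_W11_derivative s \<tau> g g' \<longleftrightarrow> bochner_Lp_sobolev 1 s \<tau> g' \<and>
     (\<forall>t\<in>{0..\<tau>}. \<forall>n. fourier_coeff (g t) n =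
        fourier_coeff (g 0) n + (\<integral>r. fourier_coeff (g' r) n \<partial>lebesgue_on {0..t}))"

text \<open>
  Solution in \<open>C([0,\<tau>]; H\<^sup>k) \<inter> W\<^sup>1\<^sup>,\<^sup>1([0,\<tau>]; H\<^sup>k\<^sup>-\<^sup>1)\<close> with zero initial data. The row \<open>Dv t x $ i\<close>
  is the gradient of the \<open>i\<close>-th velocity component, so that the convective term
  \<open>(v \<cdot> \<nabla>) v\<close> is \<open>Dv *v v\<close> and the divergence is the trace of \<open>Dv\<close>.
\<close>

definition euler_solution ::
    "nat \<Rightarrow> real \<Rightarrow> (real \<Rightarrow> real^2 \<Rightarrow> real^2) \<Rightarrow> (real \<Rightarrow> real^2 \<Rightarrow> real^2) \<Rightarrow> bool" where
  "euler_solution k \<tau> F v \<longleftrightarrow>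
     (\<forall>i. continuous_into_sobolev k \<tau> (\<lambda>t x. v t x $ i)) \<and>
     (\<forall>t\<in>{0..\<tau>}. \<forall>i. (\<integral>x. v t x $ i \<partial>torus) = 0) \<and>
     (AE x in torus. v 0 x = 0) \<and>
     (\<exists>(v' :: real \<Rightarrow> real^2 \<Rightarrow> real^2) (Dv :: real \<Rightarrow> real^2 \<Rightarrow> real^2^2)
       (p :: real \<Rightarrow> real^2 \<Rightarrow> real) (Dp :: real \<Rightarrow> real^2 \<Rightarrow> real^2).
        (\<forall>i. has_W11_derivative (k - 1) \<tau> (\<lambda>t x. v t x $ i) (\<lambda>t x. v' t x $ i)) \<and>
        (\<forall>t\<in>{0..\<tau>}. (\<forall>i. weak_gradient (\<lambda>x. v t x $ i) (\<lambda>x. Dv t x $ i)) \<and>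
                    (AE x in torus. trace (Dv t x) = 0)) \<and>
        (AE t in lebesgue_on {0..\<tau>}. weak_gradient (p t) (Dp t) \<and>
           (AE x in torus. v' t x + Dv t x *v v t x + Dp t x = F t x)))"

text \<open>
  Energy solution in \<open>C([0,\<tau>]; L\<^sup>2) \<inter> L\<^sup>2(0,\<tau>; H\<^sup>1)\<close>, with the equation integrated in time and
  tested against every \<open>\<psi>\<close> in \<open>H\<^sup>1\<close>. For bounded \<open>v\<close> this identity is equivalent to
  \<open>\<partial>\<^sub>t \<phi>\<close> being in \<open>L\<^sup>2(0,\<tau>; H\<^sup>-\<^sup>1)\<close> together with the equation in \<open>H\<^sup>-\<^sup>1\<close> at almost every time.
\<close>

definition advection_diffusion_solution ::
    "real \<Rightarrow> (real \<Rightarrow> real^2 \<Rightarrow> real^2) \<Rightarrow> (real^2 \<Rightarrow> real) \<Rightarrow> (real \<Rightarrow> real^2 \<Rightarrow> real) \<Rightarrow> bool" where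
  "advection_diffusion_solution \<tau> v f \<phi> \<longleftrightarrow>
     continuous_into_L2 \<tau> \<phi> \<and>
     bochner_Lp_sobolev 2 1 \<tau> \<phi> \<and>
     (AE x in torus. \<phi> 0 x = f x) \<and>
     (\<exists>D\<phi> :: real \<Rightarrow> real^2 \<Rightarrow> real^2.
        (AE t in lebesgue_on {0..\<tau>}. weak_gradient (\<phi> t) (D\<phi> t)) \<and>
        (\<forall>\<psi> D\<psi>. weak_gradient \<psi> D\<psi> \<longrightarrow> (\<forall>t\<in>{0..\<tau>}.
           (\<integral>x. \<phi> t x * \<psi> x \<partial>torus) +
           (\<integral>r. (\<integral>x. (v r x \<bullet> D\<phi> r x) * \<psi> x + D\<phi> r x \<bullet> D\<psi> x \<partial>torus) \<partial>lebesgue_on {0..t})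
           = (\<integral>x. f x * \<psi> x \<partial>torus))))"

definition L2_control :: "real \<Rightarrow> (real \<Rightarrow> real^'m::finite) \<Rightarrow> bool" where
  "L2_control \<tau> u \<longleftrightarrow> u \<in> borel_measurable (lebesgue_on {0..\<tau>}) \<and>
     integrable (lebesgue_on {0..\<tau>}) (\<lambda>t. (norm (u t))\<^sup>2)"

definition control_force ::
    "('m::finite \<Rightarrow> real^2 \<Rightarrow> real^2) \<Rightarrow> (real \<Rightarrow> real^'m) \<Rightarrow> real \<Rightarrow> real^2 \<Rightarrow> real^2" where
  "control_force \<theta> u t x = (\<Sum>j\<in>UNIV. u t $ j *\<^sub>R \<theta> j x)"

text \<open>
  Solutions are determined only up to null sets in space, so ``the solution satisfies P'' is
  rendered as: a solution exists, and every solution satisfies P.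
\<close>

definition relaxation_enhancing ::
    "nat \<Rightarrow> ('m::finite \<Rightarrow> real^2 \<Rightarrow> real^2) \<Rightarrow> bool" where
  "relaxation_enhancing k \<theta> \<longleftrightarrow>
     (\<forall>\<tau> > 0. \<forall>\<delta> > 0. \<exists>u :: real \<Rightarrow> real^'m. L2_control \<tau> u \<and>
        (\<exists>v. euler_solution k \<tau> (control_force \<theta> u) v) \<and>
        (\<forall>v. euler_solution k \<tau> (control_force \<theta> u) v \<longrightarrow>
           (\<forall>f \<in> torus_L2. L2_norm_torus f \<le> 1 \<longrightarrow> (\<integral>x. f x \<partial>torus) = 0 \<longrightarrow>
              (\<exists>\<phi>. advection_diffusion_solution \<tau> v f \<phi>) \<and>
              (\<forall>\<phi>. advection_diffusion_solution \<tau> v f \<phi> \<longrightarrow> L2_norm_torus (\<phi> \<tau>) < \<delta>))))"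

end

theory Submission
  imports Defs
begin

text \<open>Use only the shears \<open>b\<^sub>1 t sin x\<^sub>1 (0,1)\<close> on the first half of the time interval and
  \<open>b\<^sub>2 t sin (x\<^sub>1 - x\<^sub>2) (1,1)\<close> on the second. Each shear is a stationary solution of the Euler system
  with zero pressure and the amplitudes have disjoint supports, so the controls \<open>b\<^sub>1'\<close>, \<open>b\<^sub>2'\<close> produce
  exactly this flow, and an energy estimate shows that the Euler system has no other solution.

  For the Fourier coefficients \<open>c n\<close> the advection-diffusion equation couples \<open>n\<close> only to its neighbours
  \<open>n \<plusminus> e\<close> on a line of direction \<open>e = (1,0)\<close> or \<open>e = (1,-1)\<close>, with a coupling constant that is the same along
  the line and vanishes only if \<open>n\<close> is parallel to \<open>e\<close>. When the amplitude is large, the quantities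
  \<open>|c n|\<^sup>2 + c (n - e) \<bullet> c (n + e)\<close>, averaged in time, are almost constant along such a line; being summable
  they are small, and this makes \<open>|c n|\<^sup>2\<close> almost convex along the line, hence small as well. With the
  diffusion acting on the high frequencies, a half interval dissipates almost all the energy except on
  the frequencies parallel to \<open>e\<close>. The second shear acts nontrivially on those that survive the first, since
  only the mean, which is zero, is parallel to both directions.\<close>

section \<open>Fourier series on the torus\<close>

text \<open>Where the correlations come from: under transport alone the time derivative of
  \<open>c n \<bullet> c (n + e)\<close> is the amplitude times a constant times the difference of
  the quantities in question at \<open>n + e\<close> and at \<open>n\<close>. The product itself is
  bounded by the energy, so after division by a large amplitude only small differences remain, and
  no spectral theory enters. The amplitude has to be fixed before \<open>f\<close>; therefore each
  smallness statement has constants that depend on the mode, the accuracy and the phase, but never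
  on the solution. The theorem speaks of all solutions. An arbitrary energy solution is first known
  to have bounded coefficients only, while the decay argument needs a square-summable bound that is
  uniform in time, to exchange sums over modes with time integrals. Picard iteration supplies such a
  bound for one solution, and uniqueness carries the result over to the others. In the same way the
  Euler velocity has to be identified before anything can be said about it; as its time derivative
  is merely integrable, product rules in time and space are derived from Fourier
  coefficients.\<close>

definition wave :: "int^2 \<Rightarrow> real^2 \<Rightarrow> complex" where
  "wave n x = cis (\<Sum>j\<in>UNIV. of_int (n $ j) * x $ j)"

definition mean :: "(real^2 \<Rightarrow> complex) \<Rightarrow> complex" where
  "mean f = (\<integral>x. f x \<partial>torus) / of_real ((2 * pi)\<^sup>2)"

definition cfc :: "(real^2 \<Rightarrow> complex) \<Rightarrow> int^2 \<Rightarrow> complex" where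
  "cfc f n = mean (\<lambda>x. f x * wave (- n) x)"

text \<open>Periodicity is left out: integrals see one cell only, and the real class
  \<open>torus_L2\<close> adds it back through \<open>torus_L2_iff\<close>.\<close>

definition cL2 :: "(real^2 \<Rightarrow> complex) set" where
  "cL2 = {f \<in> borel_measurable torus. integrable torus (\<lambda>x. (cmod (f x))\<^sup>2)}"

text \<open>Dividing by the area of the cell makes the characters orthonormal, so Parseval's
  identity carries no constant.\<close>

definition msq :: "(real^2 \<Rightarrow> complex) \<Rightarrow> real" where
  "msq f = (\<integral>x. (cmod (f x))\<^sup>2 \<partial>torus) / (2 * pi)\<^sup>2"

lemma wave_0 [simp]: "wave 0 x = 1"
  by (simp add: wave_def)

lemma wave_add: "wave (m + n) x = wave m x * wave n x"
  by (simp add: wave_def cis_mult sum.distrib algebra_simps)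

lemma wave_minus: "wave (- n) x = cnj (wave n x)"
  by (simp add: wave_def sum_negf cis_cnj)

lemma norm_wave [simp]: "cmod (wave n x) = 1"
  by (simp add: wave_def)

lemma cnj_wave_mult [simp]: "cnj (wave n x) * wave n x = 1"
  by (simp add: wave_def cis_cnj cis_mult)

lemma continuous_wave: "continuous_on S (wave n)"
  unfolding wave_def cis_conv_exp by (intro continuous_intros)

lemma periodic_wave: "wave n (x + axis j (2 * pi)) = wave n x"
proof -
  have "(\<Sum>i\<in>UNIV. of_int (n $ i) * (x + axis j (2 * pi)) $ i)
      = (\<Sum>i\<in>UNIV. of_int (n $ i) * x $ i) + (2 * pi) * real_of_int (n $ j)"
    using exhaust_2[of j] by (auto simp: algebra_simps UNIV_2 axis_def)
  then show ?thesis unfolding wave_def by (simp flip: cis_mult)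
qed

lemma fourier_coeff_cfc: "fourier_coeff f n = cfc (\<lambda>x. of_real (f x)) n"
  by (simp add: fourier_coeff_def cfc_def mean_def wave_def sum_negf)

section \<open>The torus as a finite measure space; orthogonality of the characters\<close>

lemma space_torus [simp]: "space torus = cbox 0 (\<chi> j. 2 * pi)"
  by (simp add: torus_def)

lemma finite_measure_torus: "finite_measure torus"
  unfolding torus_def by (rule finite_measure_lebesgue_on) simp

interpretation T: finite_measure torus by (rule finite_measure_torus)

lemma measurable_torus_continuous:
  "continuous_on UNIV f \<Longrightarrow> (f :: real^2 \<Rightarrow> 'b::euclidean_space) \<in> borel_measurable torus"
  unfolding torus_def
  by (metis continuous_imp_measurable_on_sets_lebesgue continuous_on_subset lmeasurable_cbox fmeasurableD subset_UNIV)

lemma measurable_wave [measurable]: "wave n \<in> borel_measurable torus"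
  by (rule measurable_torus_continuous[OF continuous_wave])

text \<open>Product functions integrate factorwise because \<open>lborel\<close> on the plane is the
  image of a product of one-dimensional measures indexed by \<open>Basis\<close>;
  \<open>axis_index\<close> translates basis vectors back into coordinates. Continuity of the
  factors takes care of measurability and integrability.\<close>

lemma integral_torus_prod:
  fixes h :: "2 \<Rightarrow> real \<Rightarrow> complex"
  assumes h: "\<And>j. continuous_on UNIV (h j)"
  shows "(\<integral>x. (\<Prod>j\<in>UNIV. h j (x $ j)) \<partial>torus) = (\<Prod>j\<in>UNIV. \<integral>s. indicator {0..2*pi} s *\<^sub>R h j s \<partial>lborel)"
proof -
  let ?H = "\<lambda>x::real^2. (\<Prod>j\<in>UNIV. h j (x $ j))"
  let ?k = "\<lambda>j s. indicator {0..2*pi} s *\<^sub>R h j s :: complex"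
  let ?j = "axis_index :: real^2 \<Rightarrow> 2"
  have mb: "h j \<in> borel_measurable borel" for j
    using h borel_measurable_continuous_onI by blast
  have mH: "?H \<in> borel_measurable borel"
    by (intro borel_measurable_continuous_onI continuous_intros continuous_on_prod
          continuous_on_compose2[OF h]) auto
  have ij: "integrable lborel (?k j)" for j
    using borel_integrable_atLeastAtMost'[OF continuous_on_subset[OF h[of j] subset_UNIV], of 0 "2*pi"]
    by (simp add: set_integrable_def)
  have bij: "bij_betw (\<lambda>j::2. axis j (1::real)) UNIV Basis"
    by (auto simp: bij_betw_def inj_on_def axis_eq_axis Basis_vec_def)
  have ai: "?j (axis j 1) = j" for j
    by (metis axis_eq_axis axis_in_Basis_iff axis_index one_neq_zero Basis_real_def singletonI)
  have "(\<integral>x. ?H x \<partial>torus) = (\<integral>x. indicator (cbox 0 (\<chi> j. 2 * pi)) x *\<^sub>R ?H x \<partial>lborel)"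
    unfolding torus_def
    by (subst integral_restrict_space)
       (auto intro!: integral_completion borel_measurable_scaleR borel_measurable_indicator mH)
  also have "\<dots> = (\<integral>x. (\<Prod>b\<in>Basis. ?k (?j b) (x \<bullet> b)) \<partial>lborel)"
  proof (rule Bochner_Integration.integral_cong)
    fix x :: "real^2"
    have "(\<Prod>b\<in>Basis. ?k (?j b) (x \<bullet> b)) = (\<Prod>j\<in>UNIV. ?k j (x $ j))"
      by (subst prod.reindex_bij_betw[OF bij, symmetric]) (simp add: ai cart_eq_inner_axis)
    also have "\<dots> = indicator (cbox 0 (\<chi> j. 2 * pi)) x *\<^sub>R ?H x"
      by (auto simp: mem_box_cart UNIV_2 indicator_def forall_2)
    finally show "indicator (cbox 0 (\<chi> j. 2 * pi)) x *\<^sub>R ?H x = (\<Prod>b\<in>Basis. ?k (?j b) (x \<bullet> b))" ..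
  qed simp
  also have "\<dots> = (\<integral>f. (\<Prod>b\<in>Basis. ?k (?j b) (f b)) \<partial>(\<Pi>\<^sub>M b\<in>(Basis::(real^2) set). lborel))"
  proof (subst lborel_eq, subst integral_distr)
    show "(\<lambda>f. \<Sum>b\<in>Basis. f b *\<^sub>R b) \<in> (\<Pi>\<^sub>M b\<in>(Basis::(real^2) set). lborel) \<rightarrow>\<^sub>M borel"
      by simp
    show "(\<lambda>x. \<Prod>b\<in>Basis. ?k (?j b) (x \<bullet> b)) \<in> borel_measurable (borel :: (real^2) measure)"
      using mb by measurable
  qed (auto intro!: Bochner_Integration.integral_cong prod.cong simp: inner_sum_left inner_Basis if_distrib cong: if_cong)
  also have "\<dots> = (\<Prod>b\<in>Basis. \<integral>s. ?k (?j b) s \<partial>lborel)"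
  proof -
    interpret product_sigma_finite "\<lambda>b::real^2. lborel :: real measure" by standard
    show ?thesis by (rule product_integral_prod) (auto simp: ij)
  qed
  also have "\<dots> = (\<Prod>j\<in>UNIV. \<integral>s. ?k j s \<partial>lborel)"
    by (subst prod.reindex_bij_betw[OF bij, symmetric]) (simp add: ai)
  finally show ?thesis .
qed

lemma integral_cis_period:
  "(\<integral>s. indicator {0..2*pi} s *\<^sub>R cis (of_int k * s) \<partial>lborel) = (if k = 0 then of_real (2*pi) else 0)"
proof (cases "k = 0")
  case True
  then show ?thesis by (simp add: scaleR_conv_of_real)
next
  case False
  define F where "F s = cis (of_int k * s) / (\<i> * of_int k)" for s
  have "has_bochner_integral lborel (\<lambda>s. indicator {0..2*pi} s *\<^sub>R cis (of_int k * s)) (F (2*pi) - F 0)"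
  proof (rule has_bochner_integral_FTC_Icc)
    show "(F has_vector_derivative cis (of_int k * s)) (at s within {0..2*pi})" for s
    proof -
      have "((\<lambda>z. exp (\<i> * (of_int k * z)) / (\<i> * of_int k)) has_field_derivative exp (\<i> * (of_int k * of_real s))) (at (of_real s))"
        using False by (auto intro!: derivative_eq_intros) (simp add: complex_eq_iff)
      from has_vector_derivative_real_field[OF this] show ?thesis
        unfolding F_def cis_conv_exp by simp
    qed
  qed (auto simp: cis_conv_exp intro!: continuous_intros)
  then show ?thesis using False
    by (simp add: has_bochner_integral_integral_eq F_def mult.commute[of "of_int k"] cis_multiple_2pi)
qed

lemma integral_wave: "(\<integral>x. wave n x \<partial>torus) = (if n = 0 then of_real ((2*pi)\<^sup>2) else 0)"
proof -
  have "wave n x = (\<Prod>j\<in>UNIV. cis (of_int (n $ j) * x $ j))" for x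
    by (simp add: wave_def UNIV_2 cis_mult)
  then have "(\<integral>x. wave n x \<partial>torus) = (\<Prod>j\<in>UNIV. if n $ j = 0 then of_real (2*pi) else 0)"
    using integral_torus_prod[of "\<lambda>j s. cis (of_int (n $ j) * s)"]
    by (simp add: integral_cis_period continuous_on_cis continuous_intros del: of_real_mult)
  also have "\<dots> = (if n = 0 then of_real ((2*pi)\<^sup>2) else 0)"
    using exhaust_2 by (auto simp: UNIV_2 vec_eq_iff power2_eq_square) metis
  finally show ?thesis .
qed

lemma mean_wave: "mean (wave n) = (if n = 0 then 1 else 0)"
  by (simp add: mean_def integral_wave del: of_real_power)

lemma measure_torus: "measure torus (cbox 0 (\<chi> j. 2 * pi)) = (2*pi)\<^sup>2"
proof -
  have "(\<integral>x. (1::complex) \<partial>torus) = of_real ((2*pi)\<^sup>2)"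
    using integral_wave[of 0] by simp
  then have "complex_of_real (measure torus (space torus)) = of_real ((2*pi)\<^sup>2)"
    by (simp add: scaleR_conv_of_real)
  then show ?thesis by (simp only: of_real_eq_iff space_torus)
qed

section \<open>Square-integrable functions, their coefficients and Bessel's inequality\<close>

lemma cL2_measurable: "f \<in> cL2 \<Longrightarrow> f \<in> borel_measurable torus"
  by (simp add: cL2_def)

lemma cL2_square: "f \<in> cL2 \<Longrightarrow> integrable torus (\<lambda>x. (cmod (f x))\<^sup>2)"
  by (simp add: cL2_def)

lemma cL2_bound:
  assumes "g \<in> cL2" "f \<in> borel_measurable torus" "\<And>x. cmod (f x) \<le> C * cmod (g x)"
  shows "f \<in> cL2"
proof -
  have "integrable torus (\<lambda>x. (cmod (f x))\<^sup>2)"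
  proof (rule Bochner_Integration.integrable_bound)
    show "integrable torus (\<lambda>x. C\<^sup>2 * (cmod (g x))\<^sup>2)" using cL2_square[OF assms(1)] by simp
    have "(cmod (f x))\<^sup>2 \<le> C\<^sup>2 * (cmod (g x))\<^sup>2" for x
      using power_mono[OF assms(3)[of x] norm_ge_zero, of 2] by (simp add: power_mult_distrib)
    then show "AE x in torus. norm ((cmod (f x))\<^sup>2) \<le> norm (C\<^sup>2 * (cmod (g x))\<^sup>2)" by simp
  qed (use assms(2) in measurable)
  then show ?thesis using assms by (simp add: cL2_def)
qed

lemma cL2_cmult [intro]: "f \<in> cL2 \<Longrightarrow> (\<lambda>x. c * f x) \<in> cL2"
  by (rule cL2_bound[of f _ "cmod c"]) (auto simp: norm_mult dest: cL2_measurable)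

lemma cL2_cnj [intro]: "f \<in> cL2 \<Longrightarrow> (\<lambda>x. cnj (f x)) \<in> cL2"
  by (rule cL2_bound[of f _ 1])
     (auto dest!: cL2_measurable intro: borel_measurable_continuous_on[of cnj] continuous_intros)

lemma cL2_mult_wave [intro]: "f \<in> cL2 \<Longrightarrow> (\<lambda>x. f x * wave n x) \<in> cL2"
  by (rule cL2_bound[of f _ 1]) (auto simp: norm_mult dest: cL2_measurable)

lemma cL2_add [intro]:
  assumes "f \<in> cL2" "g \<in> cL2" shows "(\<lambda>x. f x + g x) \<in> cL2"
proof -
  have "integrable torus (\<lambda>x. (cmod (f x + g x))\<^sup>2)"
  proof (rule Bochner_Integration.integrable_bound)
    show "integrable torus (\<lambda>x. 2 * (cmod (f x))\<^sup>2 + 2 * (cmod (g x))\<^sup>2)"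
      using assms[THEN cL2_square] by simp
    have "(cmod (f x + g x))\<^sup>2 \<le> 2 * (cmod (f x))\<^sup>2 + 2 * (cmod (g x))\<^sup>2" for x
    proof -
      have "(cmod (f x + g x))\<^sup>2 \<le> (cmod (f x) + cmod (g x))\<^sup>2"
        by (rule power_mono[OF norm_triangle_ineq norm_ge_zero])
      also have "\<dots> \<le> 2 * (cmod (f x))\<^sup>2 + 2 * (cmod (g x))\<^sup>2"
        using zero_le_power2[of "cmod (f x) - cmod (g x)"] by (simp add: power2_eq_square algebra_simps)
      finally show ?thesis .
    qed
    then show "AE x in torus. norm ((cmod (f x + g x))\<^sup>2) \<le> norm (2 * (cmod (f x))\<^sup>2 + 2 * (cmod (g x))\<^sup>2)"
      by simp
  qed (use assms[THEN cL2_measurable] in measurable)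
  then show ?thesis using assms by (auto simp: cL2_def)
qed

lemma cL2_diff [intro]: "f \<in> cL2 \<Longrightarrow> g \<in> cL2 \<Longrightarrow> (\<lambda>x. f x - g x) \<in> cL2"
  using cL2_add[of f "\<lambda>x. -1 * g x"] cL2_cmult[of g "-1"] by simp

lemma cL2_const [intro, simp]: "(\<lambda>x. c) \<in> cL2"
  by (simp add: cL2_def)

lemma cL2_wave [intro, simp]: "wave n \<in> cL2"
  using cL2_mult_wave[OF cL2_const[of 1], of n] by simp

lemma cL2_sum [intro]: "(\<And>i. i \<in> F \<Longrightarrow> f i \<in> cL2) \<Longrightarrow> (\<lambda>x. \<Sum>i\<in>F. f i x) \<in> cL2"
  by (induction F rule: infinite_finite_induct) auto

lemma integrable_cL2_mult:
  assumes "f \<in> cL2" "g \<in> cL2" shows "integrable torus (\<lambda>x. f x * g x)"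
proof (rule Bochner_Integration.integrable_bound)
  show "integrable torus (\<lambda>x. (cmod (f x))\<^sup>2 + (cmod (g x))\<^sup>2)"
    using assms[THEN cL2_square] by simp
  have "cmod (f x) * cmod (g x) \<le> (cmod (f x))\<^sup>2 + (cmod (g x))\<^sup>2" for x
    using sum_squares_bound[of "cmod (f x)" "cmod (g x)"]
      mult_nonneg_nonneg[OF norm_ge_zero norm_ge_zero, of "f x" "g x"] by linarith
  then show "AE x in torus. norm (f x * g x) \<le> norm ((cmod (f x))\<^sup>2 + (cmod (g x))\<^sup>2)"
    by (auto simp: norm_mult)
qed (use assms[THEN cL2_measurable] in measurable)

lemma integrable_cL2: "f \<in> cL2 \<Longrightarrow> integrable torus f"
  using integrable_cL2_mult[of f "\<lambda>x. 1"] by simp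

lemma mean_add: "integrable torus f \<Longrightarrow> integrable torus g \<Longrightarrow> mean (\<lambda>x. f x + g x) = mean f + mean g"
  by (simp add: mean_def add_divide_distrib)

lemma mean_diff: "integrable torus f \<Longrightarrow> integrable torus g \<Longrightarrow> mean (\<lambda>x. f x - g x) = mean f - mean g"
  by (simp add: mean_def diff_divide_distrib)

lemma mean_cmult: "mean (\<lambda>x. c * f x) = c * mean f"
  by (simp add: mean_def)

lemma mean_sum: "(\<And>i. i \<in> F \<Longrightarrow> integrable torus (f i)) \<Longrightarrow> mean (\<lambda>x. \<Sum>i\<in>F. f i x) = (\<Sum>i\<in>F. mean (f i))"
  by (simp add: mean_def sum_divide_distrib)

lemma mean_cnj: "mean (\<lambda>x. cnj (f x)) = cnj (mean f)"
  by (simp add: mean_def)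

lemma cfc_add: "f \<in> cL2 \<Longrightarrow> g \<in> cL2 \<Longrightarrow> cfc (\<lambda>x. f x + g x) n = cfc f n + cfc g n"
  by (simp add: cfc_def distrib_right mean_add integrable_cL2_mult)

lemma cfc_diff: "f \<in> cL2 \<Longrightarrow> g \<in> cL2 \<Longrightarrow> cfc (\<lambda>x. f x - g x) n = cfc f n - cfc g n"
  by (simp add: cfc_def left_diff_distrib mean_diff integrable_cL2_mult)

lemma cfc_cmult: "cfc (\<lambda>x. c * f x) n = c * cfc f n"
  by (simp add: cfc_def mean_cmult mult.assoc)

lemma cfc_sum: "(\<And>i. i \<in> F \<Longrightarrow> f i \<in> cL2) \<Longrightarrow> cfc (\<lambda>x. \<Sum>i\<in>F. f i x) n = (\<Sum>i\<in>F. cfc (f i) n)"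
  unfolding cfc_def sum_distrib_right by (intro mean_sum integrable_cL2_mult) auto

lemma cfc_mult_wave: "cfc (\<lambda>x. f x * wave m x) n = cfc f (n - m)"
  by (simp add: cfc_def mult.assoc flip: wave_add)

lemma cfc_cnj: "cfc (\<lambda>x. cnj (f x)) n = cnj (cfc f (- n))"
  by (simp add: cfc_def wave_minus flip: mean_cnj)

lemma cfc_wave: "cfc (wave m) n = (if n = m then 1 else 0)"
  unfolding cfc_def by (simp add: mean_wave flip: wave_add)

lemma cfc_AE_cong:
  assumes "AE x in torus. f x = g x" "f \<in> borel_measurable torus" "g \<in> borel_measurable torus"
  shows "cfc f n = cfc g n"
proof -
  have "(\<integral>x. f x * wave (-n) x \<partial>torus) = (\<integral>x. g x * wave (-n) x \<partial>torus)"
    by (rule integral_cong_AE) (use assms in auto)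
  then show ?thesis by (simp add: cfc_def mean_def)
qed

lemma msq_nonneg [simp]: "msq f \<ge> 0"
  by (simp add: msq_def)

lemma msq_mean: "of_real (msq f) = mean (\<lambda>x. f x * cnj (f x))"
proof -
  have "(\<integral>x. f x * cnj (f x) \<partial>torus) = (\<integral>x. complex_of_real ((cmod (f x))\<^sup>2) \<partial>torus)"
    by (simp add: complex_norm_square del: of_real_power)
  then show ?thesis by (simp add: msq_def mean_def del: of_real_power)
qed

text \<open>Pythagoras in a single identity: with \<open>a\<close> the Fourier coefficients it
  yields Bessel's inequality, with \<open>f = 0\<close> the norm of a trigonometric polynomial, and
  for partial sums the remainder in Riesz-Fischer.\<close>

lemma msq_diff_waves:
  assumes f: "f \<in> cL2" and F: "finite F"
  shows "msq (\<lambda>x. f x - (\<Sum>n\<in>F. a n * wave n x))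
       = msq f - (\<Sum>n\<in>F. 2 * Re (cnj (a n) * cfc f n)) + (\<Sum>n\<in>F. (cmod (a n))\<^sup>2)"
proof -
  let ?S = "\<lambda>x. \<Sum>n\<in>F. a n * wave n x"
  have S: "?S \<in> cL2" by (intro cL2_sum cL2_cmult cL2_wave)
  have i: "integrable torus (\<lambda>x. u x * cnj (v x))" if "u \<in> cL2" "v \<in> cL2" for u v
    using integrable_cL2_mult[OF that(1) cL2_cnj[OF that(2)]] .
  have fS: "mean (\<lambda>x. f x * cnj (?S x)) = (\<Sum>n\<in>F. cnj (a n) * cfc f n)"
  proof -
    have "mean (\<lambda>x. f x * cnj (?S x)) = mean (\<lambda>x. \<Sum>n\<in>F. cnj (a n) * (f x * wave (- n) x))"
      by (simp add: sum_distrib_left wave_minus algebra_simps)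
    also have "\<dots> = (\<Sum>n\<in>F. mean (\<lambda>x. cnj (a n) * (f x * wave (- n) x)))"
      by (rule mean_sum) (use f in \<open>auto intro: integrable_cL2 intro!: integrable_mult_right\<close>)
    finally show ?thesis by (simp add: mean_cmult cfc_def)
  qed
  have Sg: "cfc ?S n = (if n \<in> F then a n else 0)" for n
    using F by (simp add: cfc_sum cL2_cmult cfc_cmult cfc_wave if_distrib cong: if_cong)
  have SS: "mean (\<lambda>x. ?S x * cnj (?S x)) = (\<Sum>n\<in>F. a n * cnj (a n))"
  proof -
    have "mean (\<lambda>x. ?S x * cnj (?S x)) = mean (\<lambda>x. \<Sum>n\<in>F. cnj (a n) * (?S x * wave (- n) x))"
      by (simp add: sum_distrib_left[of "?S _"] wave_minus algebra_simps)
    also have "\<dots> = (\<Sum>n\<in>F. mean (\<lambda>x. cnj (a n) * (?S x * wave (- n) x)))"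
      by (rule mean_sum) (use S in \<open>auto intro!: integrable_mult_right integrable_cL2 cL2_mult_wave\<close>)
    also have "\<dots> = (\<Sum>n\<in>F. cnj (a n) * cfc ?S n)" by (simp add: mean_cmult cfc_def)
    finally show ?thesis by (simp add: Sg mult.commute)
  qed
  have Sf: "mean (\<lambda>x. ?S x * cnj (f x)) = cnj (\<Sum>n\<in>F. cnj (a n) * cfc f n)"
    unfolding fS[symmetric] mean_cnj[symmetric] by (simp add: mult.commute)
  have "of_real (msq (\<lambda>x. f x - ?S x))
      = mean (\<lambda>x. f x * cnj (f x) - f x * cnj (?S x) - (?S x * cnj (f x) - ?S x * cnj (?S x)))"
    unfolding msq_mean by (simp add: algebra_simps)
  also have "\<dots> = mean (\<lambda>x. f x * cnj (f x)) - mean (\<lambda>x. f x * cnj (?S x))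
      - (mean (\<lambda>x. ?S x * cnj (f x)) - mean (\<lambda>x. ?S x * cnj (?S x)))"
    using f S by (simp add: mean_diff i Bochner_Integration.integrable_diff del: cnj_sum)
  also have "\<dots> = of_real (msq f) - (\<Sum>n\<in>F. cnj (a n) * cfc f n) - cnj (\<Sum>n\<in>F. cnj (a n) * cfc f n)
      + (\<Sum>n\<in>F. a n * cnj (a n))"
    unfolding fS Sf SS msq_mean by simp
  finally have "msq (\<lambda>x. f x - ?S x) = Re (of_real (msq f) - (\<Sum>n\<in>F. cnj (a n) * cfc f n)
      - cnj (\<Sum>n\<in>F. cnj (a n) * cfc f n) + (\<Sum>n\<in>F. a n * cnj (a n)))"
    by (metis Re_complex_of_real)
  also have "\<dots> = msq f - (\<Sum>n\<in>F. 2 * Re (cnj (a n) * cfc f n)) + (\<Sum>n\<in>F. (cmod (a n))\<^sup>2)"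
    unfolding cmod_power2
    by (simp add: sum_distrib_left power2_eq_square sum.distrib[symmetric] sum_subtractf[symmetric] algebra_simps)
  finally show ?thesis .
qed

lemma Bessel_torus:
  assumes "f \<in> cL2" "finite F" shows "(\<Sum>n\<in>F. (cmod (cfc f n))\<^sup>2) \<le> msq f"
proof -
  have "0 \<le> msq f - (\<Sum>n\<in>F. 2 * Re (cnj (cfc f n) * cfc f n)) + (\<Sum>n\<in>F. (cmod (cfc f n))\<^sup>2)"
    using msq_diff_waves[OF assms, of "cfc f"] msq_nonneg by metis
  also have "\<dots> = msq f - (\<Sum>n\<in>F. (cmod (cfc f n))\<^sup>2)"
  proof -
    have "2 * Re (cnj (cfc f n) * cfc f n) = 2 * (cmod (cfc f n))\<^sup>2" for n
      unfolding cmod_power2 by (simp add: power2_eq_square)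
    then show ?thesis by (simp add: sum_distrib_left[symmetric])
  qed
  finally show ?thesis by simp
qed

lemma msq_waves:
  assumes "finite F" shows "msq (\<lambda>x. \<Sum>n\<in>F. a n * wave n x) = (\<Sum>n\<in>F. (cmod (a n))\<^sup>2)"
  using msq_diff_waves[OF _ assms, of "\<lambda>x. 0" "\<lambda>n. - a n"] assms
  by (simp add: sum_negf cfc_def mean_def msq_def)

section \<open>Uniqueness of Fourier coefficients through Stone-Weierstrass\<close>

inductive trig_poly :: "(real^2 \<Rightarrow> complex) \<Rightarrow> bool" where
  wave: "trig_poly (\<lambda>x. c * wave n x)"
| add: "trig_poly f \<Longrightarrow> trig_poly g \<Longrightarrow> trig_poly (\<lambda>x. f x + g x)"

lemma trig_poly_const: "trig_poly (\<lambda>x. c)"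
  using trig_poly.wave[of c 0] by simp

lemma trig_poly_mult:
  assumes "trig_poly f" "trig_poly g" shows "trig_poly (\<lambda>x. f x * g x)"
  using assms(1)
proof induction
  case (wave c n)
  show ?case using assms(2)
  proof induction
    case (wave d m)
    show ?case using trig_poly.wave[of "c * d" "n + m"] by (simp add: wave_add mult.assoc mult.left_commute)
  next
    case (add f g)
    then show ?case using trig_poly.add by (auto simp: distrib_left)
  qed
next
  case (add f g)
  then show ?case using trig_poly.add by (auto simp: distrib_right)
qed

abbreviation circle_map :: "real^2 \<Rightarrow> complex \<times> complex" where
  "circle_map x \<equiv> (cis (x $ 1), cis (x $ 2))"

text \<open>A real-linear functional on pairs of complex numbers is a combination of four real
  coordinates; on the product of circles these are cosines and sines, hence combinations of a
  character and its conjugate. Products and sums stay within the class.\<close>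

lemma trig_poly_real_polynomial:
  assumes "real_polynomial_function p"
  shows "trig_poly (\<lambda>x. of_real (p (circle_map x)))"
  using assms
proof induction
  case (linear l)
  interpret bounded_linear l by fact
  have half: "trig_poly (\<lambda>x. of_real (a * Re (cis (x $ j)) + b * Im (cis (x $ j))))" for a b and j :: 2
  proof -
    let ?m = "axis j 1 :: int^2"
    have w: "wave ?m x = cis (x $ j)" for x
      by (simp add: wave_def axis_def if_distrib if_distribR cong: if_cong)
    have e: "of_real (a * Re (cis (x $ j)) + b * Im (cis (x $ j)))
      = (of_real a - \<i> * of_real b) / 2 * wave ?m x + (of_real a + \<i> * of_real b) / 2 * wave (- ?m) x" for x
      by (simp add: wave_minus w complex_eq_iff) (simp add: field_simps)
    show ?thesis unfolding e by (intro trig_poly.add trig_poly.wave)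
  qed
  have lzw: "l (z, w) = (Re z * l (1, 0) + Im z * l (\<i>, 0)) + (Re w * l (0, 1) + Im w * l (0, \<i>))" for z w
  proof -
    have "(z, w) = (Re z *\<^sub>R (1, 0) + Im z *\<^sub>R (\<i>, 0)) + (Re w *\<^sub>R (0, 1) + Im w *\<^sub>R (0, \<i>))"
      by (simp add: complex_eq_iff)
    then show ?thesis by (metis add scaleR real_scaleR_def)
  qed
  have e: "complex_of_real (l (circle_map x))
     = of_real (l (1, 0) * Re (cis (x $ 1)) + l (\<i>, 0) * Im (cis (x $ 1)))
     + of_real (l (0, 1) * Re (cis (x $ 2)) + l (0, \<i>) * Im (cis (x $ 2)))" for x
    unfolding lzw[of "cis (x $ 1)" "cis (x $ 2)"] by (simp add: mult.commute)
  show ?case unfolding e by (intro trig_poly.add half)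
qed (auto simp: trig_poly_const intro: trig_poly.add trig_poly_mult)

lemma trig_poly_orthogonal:
  assumes "trig_poly g" and f: "integrable torus f" and 0: "\<And>n. cfc f n = 0"
  shows "integrable torus (\<lambda>x. f x * g x) \<and> (\<integral>x. f x * g x \<partial>torus) = 0"
  using assms(1)
proof induction
  case (wave c n)
  have i: "integrable torus (\<lambda>x. f x * wave n x)"
    by (rule Bochner_Integration.integrable_bound[OF f]) (use f in \<open>auto simp: norm_mult\<close>)
  have e: "(\<lambda>x. f x * (c * wave n x)) = (\<lambda>x. c * (f x * wave n x))" by (auto simp: fun_eq_iff)
  have "(\<integral>x. f x * wave n x \<partial>torus) = 0"
    using 0[of "- n"] by (simp add: cfc_def mean_def)
  then show ?case unfolding e using i by simp
qed (auto simp: distrib_left)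

text \<open>By Stone-Weierstrass a continuous function on the product of two circles is uniformly
  close to a real polynomial, which pulls back to a trigonometric polynomial; the error is at most
  \<open>e\<close> times the L1 norm of \<open>f\<close>.\<close>

lemma continuous_orthogonal:
  assumes f: "integrable torus f" and 0: "\<And>n. cfc f n = 0"
    and G: "continuous_on (sphere 0 1 \<times> sphere 0 1) (G :: complex \<times> complex \<Rightarrow> real)"
  shows "(\<integral>x. f x * of_real (G (circle_map x)) \<partial>torus) = 0"
proof -
  let ?D = "sphere 0 1 \<times> sphere 0 1 :: (complex \<times> complex) set"
  let ?g = "\<lambda>x. complex_of_real (G (circle_map x))"
  have cD: "compact ?D" by (intro compact_Times compact_sphere)
  have mG: "?g \<in> borel_measurable torus"
    by (intro measurable_torus_continuous continuous_intros continuous_on_compose2[OF G])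
       (auto simp: cis_conv_exp intro!: continuous_intros)
  obtain B where B: "\<And>z. z \<in> ?D \<Longrightarrow> \<bar>G z\<bar> \<le> B"
    using compact_imp_bounded[OF compact_continuous_image[OF G cD]] by (auto simp: bounded_iff)
  have D: "circle_map x \<in> ?D" for x by auto
  have ig: "integrable torus (\<lambda>x. f x * ?g x)"
  proof (rule Bochner_Integration.integrable_bound)
    show "integrable torus (\<lambda>x. B * cmod (f x))" using f by simp
    show "AE x in torus. norm (f x * ?g x) \<le> norm (B * cmod (f x))"
    proof (rule AE_I2)
      fix x
      have "\<bar>G (circle_map x)\<bar> \<le> \<bar>B\<bar>" using B[OF D[of x]] by linarith
      then show "norm (f x * ?g x) \<le> norm (B * cmod (f x))"
        by (simp add: norm_mult abs_mult mult.commute[of "\<bar>B\<bar>"] mult_left_mono)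
    qed
  qed (use f mG in measurable)
  have est: "cmod (\<integral>x. f x * ?g x \<partial>torus) \<le> e * (\<integral>x. cmod (f x) \<partial>torus)" if e: "e > 0" for e
  proof -
    obtain p where p: "real_polynomial_function p" "\<And>z. z \<in> ?D \<Longrightarrow> \<bar>G z - p z\<bar> < e"
      by (rule Stone_Weierstrass_real_polynomial_function[OF cD G e]) blast
    let ?p = "\<lambda>x. complex_of_real (p (circle_map x))"
    have ip: "integrable torus (\<lambda>x. f x * ?p x)" "(\<integral>x. f x * ?p x \<partial>torus) = 0"
      using trig_poly_orthogonal[OF trig_poly_real_polynomial[OF p(1)] f 0] by auto
    have "(\<integral>x. f x * ?g x \<partial>torus) = (\<integral>x. f x * ?g x - f x * ?p x \<partial>torus)"
      using ig ip by simp
    also have "cmod \<dots> \<le> (\<integral>x. cmod (f x * ?g x - f x * ?p x) \<partial>torus)"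
      by (rule integral_norm_bound)
    also have "\<dots> \<le> (\<integral>x. e * cmod (f x) \<partial>torus)"
    proof (rule integral_mono)
      show "cmod (f x * ?g x - f x * ?p x) \<le> e * cmod (f x)" for x
        using p(2)[OF D[of x]] by (simp add: mult.commute[of e] mult_left_mono norm_mult flip: right_diff_distrib of_real_diff)
    qed (use ig ip f in auto)
    finally show ?thesis by simp
  qed
  have "cmod (\<integral>x. f x * ?g x \<partial>torus) \<le> 0"
  proof (rule field_le_epsilon)
    fix e :: real assume "e > 0"
    define c where "c = (\<integral>x. cmod (f x) \<partial>torus)"
    have c: "c \<ge> 0" unfolding c_def by simp
    have "cmod (\<integral>x. f x * ?g x \<partial>torus) \<le> e / (c + 1) * c"
      unfolding c_def by (rule est) (use c \<open>e > 0\<close> in \<open>simp add: c_def add_nonneg_pos\<close>)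
    also have "\<dots> \<le> e" using c \<open>e > 0\<close> by (simp add: field_simps)
    finally show "cmod (\<integral>x. f x * ?g x \<partial>torus) \<le> 0 + e" by simp
  qed
  then show ?thesis by simp
qed

lemma Arg2pi_cis: "0 \<le> s \<Longrightarrow> s < 2 * pi \<Longrightarrow> Arg2pi (cis s) = s"
  by (rule Arg2pi_unique[of 1]) (auto simp: cis_conv_exp)

definition cutoff :: "complex \<times> complex \<Rightarrow> real" where
  "cutoff z = (1 - Re (fst z)) * (1 - Re (snd z))"

lemma cutoff_circle_nonneg: "cutoff (circle_map x) \<ge> 0"
  by (simp add: cutoff_def)

text \<open>The cutoff vanishes where the torus is cut open, so it turns an arbitrary continuous function
  on the plane into a continuous function on the torus.\<close>

definition cut_extend :: "(real^2 \<Rightarrow> real) \<Rightarrow> complex \<times> complex \<Rightarrow> real" where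
  "cut_extend g z = cutoff z * g (\<chi> j. if j = 1 then Arg2pi (fst z) else Arg2pi (snd z))"

text \<open>Where the argument jumps the cutoff vanishes and \<open>g\<close> is bounded, so the
  product tends to zero; elsewhere both factors are continuous. On the far edges of the cell, where
  \<open>Arg2pi\<close> returns 0 instead of \<open>2 * pi\<close>, both sides of the second claim
  are zero.\<close>

lemma continuous_cut_extend:
  fixes g :: "real^2 \<Rightarrow> real"
  assumes g: "continuous_on UNIV g" and B: "\<And>x. \<bar>g x\<bar> \<le> 1"
  shows "continuous_on (sphere 0 1 \<times> sphere 0 1) (cut_extend g)"
    and "x \<in> cbox 0 (\<chi> j. 2 * pi) \<Longrightarrow> cut_extend g (circle_map x) = cutoff (circle_map x) * g x"
proof -
  let ?G = "cut_extend g"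
  have G_def: "?G = (\<lambda>z. cutoff z * g (\<chi> j. if j = 1 then Arg2pi (fst z) else Arg2pi (snd z)))"
    by (simp add: cut_extend_def fun_eq_iff)
  let ?D = "sphere 0 1 \<times> sphere 0 1 :: (complex \<times> complex) set"
  let ?A = "\<lambda>z. (\<chi> j. if j = 1 then Arg2pi (fst z) else Arg2pi (snd z)) :: real^2"
  have isC: "isCont cutoff z" for z
    unfolding cutoff_def isCont_def by (intro tendsto_intros)
  show "continuous_on ?D ?G"
    unfolding continuous_on_eq_continuous_within
  proof
    fix z assume z: "z \<in> ?D"
    have pos: "u = 1" if "u \<in> \<real>\<^sub>\<ge>\<^sub>0" "cmod u = 1" for u
      using that by (auto elim!: nonneg_Reals_cases)
    show "continuous (at z within ?D) ?G"
    proof (cases "fst z \<in> \<real>\<^sub>\<ge>\<^sub>0 \<or> snd z \<in> \<real>\<^sub>\<ge>\<^sub>0")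
      case True
      with z pos[of "fst z"] pos[of "snd z"] have "fst z = 1 \<or> snd z = 1" by (auto simp: mem_Times_iff)
      then have c0: "cutoff z = 0" by (auto simp: cutoff_def)
      have "(?G \<longlongrightarrow> 0) (at z within ?D)"
      proof (rule Lim_null_comparison)
        show "\<forall>\<^sub>F w in at z within ?D. norm (?G w) \<le> \<bar>cutoff w\<bar>"
          unfolding G_def using B by (intro always_eventually) (auto simp: abs_mult mult_left_le)
        show "((\<lambda>w. \<bar>cutoff w\<bar>) \<longlongrightarrow> 0) (at z within ?D)"
          using isC[of z] c0 by (intro tendsto_rabs_zero) (auto simp: isCont_def intro: tendsto_within_subset)
      qed
      then show ?thesis using c0 by (simp add: continuous_within G_def)
    next
      case False
      have a: "isCont (\<lambda>z. Arg2pi (fst z)) z" "isCont (\<lambda>z. Arg2pi (snd z)) z"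
        using False by (auto intro!: isCont_o2[of z fst Arg2pi] isCont_o2[of z snd Arg2pi] continuous_at_Arg2pi)
      have "isCont ?A z"
        unfolding isCont_def by (intro tendsto_vec_lambda) (use a in \<open>auto simp: isCont_def\<close>)
      moreover have "isCont g (?A z)" using g by (simp add: continuous_on_eq_continuous_at)
      ultimately have "isCont (\<lambda>z. g (?A z)) z" by (rule isCont_o2)
      then have "isCont ?G z" unfolding G_def using isC by (intro continuous_mult)
      then show ?thesis by (rule continuous_at_imp_continuous_at_within)
    qed
  qed
  assume x: "x \<in> cbox 0 (\<chi> j. 2 * pi)"
  then have b: "0 \<le> x $ j" "x $ j \<le> 2 * pi" for j by (auto simp: mem_box_cart)
  show "?G (circle_map x) = cutoff (circle_map x) * g x"
  proof (cases "x $ 1 = 2 * pi \<or> x $ 2 = 2 * pi")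
    case True
    then show ?thesis by (auto simp: G_def cutoff_def)
  next
    case False
    then have "x $ 1 < 2 * pi" "x $ 2 < 2 * pi" using b[of 1] b[of 2] by auto
    then have "?A (circle_map x) = x"
      using exhaust_2 b by (auto simp: vec_eq_iff Arg2pi_cis)
    then show ?thesis by (simp add: G_def)
  qed
qed

lemma AE_torus_negligible:
  assumes "negligible N" shows "AE x in torus. x \<notin> N \<and> x \<in> cbox 0 (\<chi> j. 2 * pi)"
proof -
  have "AE x in lebesgue. x \<notin> N"
    using assms by (intro AE_not_in) (simp add: negligible_iff_null_sets)
  then have "AE x in torus. x \<notin> N"
    unfolding torus_def by (subst AE_restrict_space_iff) auto
  moreover have "AE x in torus. x \<in> cbox 0 (\<chi> j. 2 * pi)"
    by (rule AE_I2) simp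
  ultimately show ?thesis by eventually_elim simp
qed

text \<open>Inside the cell a cosine equals 1 only on the edges, which are pieces of four lines. So
  the cutoff may be divided out of an integrand that vanishes almost everywhere.\<close>

lemma negligible_cutoff_zero: "AE x in torus. cutoff (circle_map x) \<noteq> 0"
proof -
  have "negligible {x::real^2. x $ j = c}" for j c
    using negligible_hyperplane[of "axis j (1::real) :: real^2" c] by (simp add: inner_axis' axis_eq_axis)
  then have n: "negligible (\<Union>j. {x::real^2. x $ j = 0} \<union> {x. x $ j = 2 * pi})"
    by (intro negligible_Union) auto
  have "cutoff (circle_map x) \<noteq> 0"
    if "x \<in> cbox 0 (\<chi> j. 2 * pi)" "x \<notin> (\<Union>j. {x::real^2. x $ j = 0} \<union> {x. x $ j = 2 * pi})" for x
  proof -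
    have "0 < x $ j" "x $ j < 2 * pi" for j
      using that by (auto simp: mem_box_cart less_le)
    then have "cos (x $ j) \<noteq> 1" for j
    proof -
      have False if c: "cos (x $ j) = 1" and c0: "0 < x $ j" and c2: "x $ j < 2 * pi"
      proof -
        obtain i :: int where i: "x $ j = of_int i * 2 * pi"
          using c unfolding cos_one_2pi_int by blast
        have "0 < i"
        proof (rule ccontr)
          assume "\<not> 0 < i"
          then have "of_int i * (2 * pi) \<le> 0" by (intro mult_nonpos_nonneg) auto
          then show False using c0 i by linarith
        qed
        then have "1 * 2 * pi \<le> of_int i * 2 * pi" by (intro mult_right_mono) auto
        then show False using c2 i by linarith
      qed
      then show ?thesis using \<open>\<And>j. 0 < x $ j\<close> \<open>\<And>j. x $ j < 2 * pi\<close> by blast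
    qed
    then show ?thesis by (simp add: cutoff_def)
  qed
  then show ?thesis by (intro eventually_mono[OF AE_torus_negligible[OF n]]) blast
qed

text \<open>Testing with continuous approximations of \<open>sgn r\<close> gives, by dominated
  convergence, that the cutoff times \<open>\<bar>r\<bar>\<close> has integral zero; the cutoff is
  positive off a null set.\<close>

lemma real_zero_if_continuous_orthogonal:
  fixes r :: "real^2 \<Rightarrow> real"
  assumes r: "integrable torus r"
    and 0: "\<And>g. continuous_on UNIV g \<Longrightarrow> (\<And>x. \<bar>g x\<bar> \<le> 1) \<Longrightarrow> (\<integral>x. r x * (cutoff (circle_map x) * g x) \<partial>torus) = 0"
  shows "AE x in torus. r x = 0"
proof -
  let ?c = "\<lambda>x. cutoff (circle_map x)"
  let ?S = "cbox 0 (\<chi> j. 2 * pi) :: (real^2) set"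
  have mr: "r \<in> borel_measurable (lebesgue_on ?S)" using r by (simp add: torus_def)
  then have "(\<lambda>x. sgn (r x)) measurable_on ?S"
    by (subst measurable_on_iff_borel_measurable) auto
  then obtain N h where N: "negligible N" and h: "\<And>n. continuous_on UNIV (h n)"
    and lim: "\<And>x. x \<notin> N \<Longrightarrow> (\<lambda>n. h n x) \<longlonglongrightarrow> (if x \<in> ?S then sgn (r x) else 0)"
    unfolding measurable_on_def by blast
  \<comment> \<open>Clamping respects the bound that the hypothesis asks of test functions and does
    not disturb a limit in [-1, 1].\<close>
  define g where "g n x = max (-1) (min 1 (h n x))" for n x
  have g: "continuous_on UNIV (g n)" "\<bar>g n x\<bar> \<le> 1" for n x
    unfolding g_def by (auto intro!: continuous_intros h)
  have limg: "(\<lambda>n. g n x) \<longlonglongrightarrow> sgn (r x)" if "x \<notin> N" "x \<in> ?S" for x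
  proof -
    have "(\<lambda>n. g n x) \<longlonglongrightarrow> max (-1) (min 1 (sgn (r x)))"
      unfolding g_def using lim[OF that(1)] that(2) by (intro tendsto_intros) simp
    then show ?thesis by (simp add: sgn_if split: if_splits)
  qed
  have cc: "continuous_on UNIV ?c"
    unfolding cutoff_def by (simp add: cis_conv_exp) (intro continuous_intros)
  have c4: "\<bar>?c x\<bar> \<le> 4" for x
  proof -
    have "?c x \<le> 2 * 2" unfolding cutoff_def by (intro mult_mono) (auto simp: cos_ge_minus_one)
    then show ?thesis using cutoff_circle_nonneg[of x] by simp
  qed
  have AEN: "AE x in torus. x \<notin> N \<and> x \<in> ?S"
    by (rule AE_torus_negligible[OF N])
  have "(\<lambda>n. \<integral>x. r x * (?c x * g n x) \<partial>torus) \<longlonglongrightarrow> (\<integral>x. r x * (?c x * sgn (r x)) \<partial>torus)"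
  proof (rule integral_dominated_convergence)
    show "integrable torus (\<lambda>x. 4 * \<bar>r x\<bar>)" using r by simp
    show "AE x in torus. (\<lambda>n. r x * (?c x * g n x)) \<longlonglongrightarrow> r x * (?c x * sgn (r x))"
      using AEN by eventually_elim (auto intro!: tendsto_intros limg)
    show "AE x in torus. norm (r x * (?c x * g n x)) \<le> 4 * \<bar>r x\<bar>" for n
    proof (rule AE_I2)
      fix x
      have "\<bar>?c x\<bar> * \<bar>g n x\<bar> \<le> 4 * 1" using c4 g(2) by (intro mult_mono) auto
      then show "norm (r x * (?c x * g n x)) \<le> 4 * \<bar>r x\<bar>"
        by (simp add: abs_mult mult.commute mult_left_mono)
    qed
  qed (use r measurable_torus_continuous[OF cc] measurable_torus_continuous[OF g(1)] in measurable)
  then have "(\<integral>x. r x * (?c x * sgn (r x)) \<partial>torus) = 0"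
    using 0[OF g(1) g(2)] by (simp add: LIMSEQ_const_iff)
  moreover have "r x * (?c x * sgn (r x)) = ?c x * \<bar>r x\<bar>" for x
    by (simp add: sgn_if)
  ultimately have "(\<integral>x. ?c x * \<bar>r x\<bar> \<partial>torus) = 0" by (simp only:)
  moreover have "integrable torus (\<lambda>x. ?c x * \<bar>r x\<bar>)"
  proof (rule Bochner_Integration.integrable_bound)
    show "integrable torus (\<lambda>x. 4 * r x)" using r by simp
    show "AE x in torus. norm (?c x * \<bar>r x\<bar>) \<le> norm (4 * r x)"
      using c4 by (auto simp: abs_mult intro!: mult_right_mono)
  qed (use r measurable_torus_continuous[OF cc] in measurable)
  ultimately have "AE x in torus. ?c x * \<bar>r x\<bar> = 0"
    using cutoff_circle_nonneg by (subst (asm) integral_nonneg_eq_0_iff_AE) auto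
  with negligible_cutoff_zero show ?thesis by eventually_elim auto
qed

theorem fourier_uniqueness:
  assumes f: "integrable torus f" and 0: "\<And>n. cfc f n = 0"
  shows "AE x in torus. f x = 0"
proof -
  have *: "(\<integral>x. f x * of_real (cutoff (circle_map x) * g x) \<partial>torus) = 0"
      "integrable torus (\<lambda>x. f x * of_real (cutoff (circle_map x) * g x))"
    if g: "continuous_on UNIV g" "\<And>x. \<bar>g x\<bar> \<le> 1" for g :: "real^2 \<Rightarrow> real"
  proof -
    note G = continuous_cut_extend[OF g]
    show "(\<integral>x. f x * of_real (cutoff (circle_map x) * g x) \<partial>torus) = 0"
    proof -
      have "(\<integral>x. f x * of_real (cutoff (circle_map x) * g x) \<partial>torus)
          = (\<integral>x. f x * of_real (cut_extend g (circle_map x)) \<partial>torus)"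
      proof (rule Bochner_Integration.integral_cong[OF refl])
        fix x assume "x \<in> space torus"
        then show "f x * of_real (cutoff (circle_map x) * g x) = f x * of_real (cut_extend g (circle_map x))"
          using G(2)[of x] by (simp only: space_torus)
      qed
      also have "\<dots> = 0" by (rule continuous_orthogonal[OF f 0 G(1)])
      finally show ?thesis .
    qed
    have cc: "continuous_on UNIV (\<lambda>x. complex_of_real (cutoff (circle_map x) * g x))"
      unfolding cutoff_def by (simp add: cis_conv_exp) (intro continuous_intros g)
    show "integrable torus (\<lambda>x. f x * of_real (cutoff (circle_map x) * g x))"
    proof (rule Bochner_Integration.integrable_bound)
      show "integrable torus (\<lambda>x. 4 * f x)" using f by simp
      have "\<bar>cutoff (circle_map x)\<bar> * \<bar>g x\<bar> \<le> 4 * 1" for x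
      proof (intro mult_mono)
        have "cutoff (circle_map x) \<le> 2 * 2" unfolding cutoff_def by (intro mult_mono) (auto simp: cos_ge_minus_one)
        then show "\<bar>cutoff (circle_map x)\<bar> \<le> 4" using cutoff_circle_nonneg[of x] by simp
      qed (use g in auto)
      then show "AE x in torus. norm (f x * of_real (cutoff (circle_map x) * g x)) \<le> norm (4 * f x)"
      proof (intro AE_I2)
        fix x assume *: "\<And>x. \<bar>cutoff (circle_map x)\<bar> * \<bar>g x\<bar> \<le> 4 * 1"
        show "norm (f x * of_real (cutoff (circle_map x) * g x)) \<le> norm (4 * f x)"
          using mult_left_mono[OF *[of x] norm_ge_zero[of "f x"]] by (simp add: norm_mult abs_mult mult.commute)
      qed
    qed (intro borel_measurable_times measurable_torus_continuous[OF cc] borel_measurable_integrable[OF f])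
  qed
  \<comment> \<open>The test functions are real, so the vanishing integrals split into real and
    imaginary part.\<close>
  have "AE x in torus. Re (f x) = 0"
  proof (rule real_zero_if_continuous_orthogonal)
    fix g :: "real^2 \<Rightarrow> real" assume g: "continuous_on UNIV g" "\<And>x. \<bar>g x\<bar> \<le> 1"
    show "(\<integral>x. Re (f x) * (cutoff (circle_map x) * g x) \<partial>torus) = 0"
      using integral_Re[OF *(2)[OF g]] *(1)[OF g] by simp
  qed (use f in auto)
  moreover have "AE x in torus. Im (f x) = 0"
  proof (rule real_zero_if_continuous_orthogonal)
    fix g :: "real^2 \<Rightarrow> real" assume g: "continuous_on UNIV g" "\<And>x. \<bar>g x\<bar> \<le> 1"
    show "(\<integral>x. Im (f x) * (cutoff (circle_map x) * g x) \<partial>torus) = 0"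
      using integral_Im[OF *(2)[OF g]] *(1)[OF g] by simp
  qed (use f in auto)
  ultimately show ?thesis by eventually_elim (auto simp: complex_eq_iff)
qed

section \<open>Enumerating the lattice in order to integrate lattice sums term by term\<close>

definition grid :: "nat \<Rightarrow> int^2" where "grid = from_nat_into UNIV"

lemma infinite_grid: "infinite (UNIV :: (int^2) set)"
proof
  assume "finite (UNIV :: (int^2) set)"
  then have "finite (range (\<lambda>k::int. axis 1 k :: int^2))" by (rule finite_subset[OF subset_UNIV])
  then have "finite (UNIV :: int set)" by (rule finite_imageD) (auto simp: inj_on_def axis_eq_axis)
  then show False by simp
qed

lemma bij_grid: "bij_betw grid UNIV UNIV"
  unfolding grid_def by (rule bij_betw_from_nat_into) (auto simp: infinite_grid)

lemma has_sum_grid: "((\<lambda>i. f (grid i)) has_sum S) UNIV \<longleftrightarrow> (f has_sum S) UNIV"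
  by (rule has_sum_reindex_bij_betw[OF bij_grid])

lemma summable_on_grid: "(\<lambda>i. f (grid i)) summable_on UNIV \<longleftrightarrow> f summable_on UNIV"
  by (rule summable_on_reindex_bij_betw[OF bij_grid])

lemma summable_grid:
  "f summable_on (UNIV :: (int^2) set) \<Longrightarrow> summable (\<lambda>i. f (grid i))"
  using summable_on_grid summable_on_imp_summable by blast

lemma inj_grid: "inj grid"
  using bij_grid by (rule bij_betw_imp_inj_on)

lemma AE_summable_norm:
  fixes f :: "nat \<Rightarrow> 'a \<Rightarrow> 'b::{banach, second_countable_topology}"
  assumes i: "\<And>n. integrable M (f n)" and s: "summable (\<lambda>i. \<integral>x. norm (f i x) \<partial>M)"
  shows "AE x in M. summable (\<lambda>i. norm (f i x))"
proof -
  have m: "f i \<in> borel_measurable M" for i using i by auto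
  have "(\<integral>\<^sup>+x. (\<Sum>i. ennreal (norm (f i x))) \<partial>M) = (\<Sum>i. \<integral>\<^sup>+x. ennreal (norm (f i x)) \<partial>M)"
    by (rule nn_integral_suminf) (use m in measurable)
  also have "\<dots> = (\<Sum>i. ennreal (\<integral>x. norm (f i x) \<partial>M))"
    by (subst nn_integral_eq_integral) (auto simp: i)
  also have "\<dots> = ennreal (\<Sum>i. \<integral>x. norm (f i x) \<partial>M)"
    by (rule suminf_ennreal2) (use s in auto)
  finally have "(\<integral>\<^sup>+x. (\<Sum>i. ennreal (norm (f i x))) \<partial>M) \<noteq> \<infinity>" by simp
  then have "AE x in M. (\<Sum>i. ennreal (norm (f i x))) \<noteq> \<infinity>"
    by (intro nn_integral_PInf_AE) (use m in measurable)
  then show ?thesis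
    by eventually_elim (rule summable_suminf_not_top, auto)
qed

text \<open>Lebesgue measure is complete, so a change on a null set keeps measurability. Many
  functions below are known only up to null sets: sums that converge almost everywhere, or
  expressions in a velocity that equals the shear flow almost everywhere.\<close>

lemma borel_measurable_lebesgue_on_AE:
  fixes f :: "'a::euclidean_space \<Rightarrow> 'b::euclidean_space"
  assumes f: "f \<in> borel_measurable (lebesgue_on S)" and S: "S \<in> sets lebesgue"
    and eq: "AE x in lebesgue_on S. f x = g x"
  shows "g \<in> borel_measurable (lebesgue_on S)"
proof -
  have "(\<lambda>x. if x \<in> S then f x else 0) \<in> borel_measurable lebesgue"
    using f S by (simp add: borel_measurable_if)
  moreover have "AE x in lebesgue. (if x \<in> S then f x else 0) = (if x \<in> S then g x else 0)"
    using eq S by (subst (asm) AE_restrict_space_iff) (auto elim!: eventually_mono)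
  ultimately have "(\<lambda>x. if x \<in> S then g x else 0) \<in> borel_measurable lebesgue"
    by (rule borel_measurable_AE)
  then show ?thesis using S by (simp add: borel_measurable_if)
qed

lemma has_sum_diff:
  fixes f g :: "'i \<Rightarrow> 'b::real_normed_vector"
  assumes "(f has_sum a) A" "(g has_sum b) A" shows "((\<lambda>x. f x - g x) has_sum (a - b)) A"
  using has_sum_add[OF assms(1) has_sum_bounded_linear[OF bounded_linear_minus[OF bounded_linear_ident] assms(2)]]
  by simp

text \<open>The convergence theorems concern sequences, so the sum is enumerated by
  \<open>grid\<close>; \<open>infsum\<close> agrees with the enumerated series wherever that
  converges absolutely, which is almost everywhere.\<close>

lemma has_sum_integral:
  fixes f :: "int^2 \<Rightarrow> 'a::euclidean_space \<Rightarrow> 'b::euclidean_space"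
  assumes S: "S \<in> sets lebesgue" and i: "\<And>n. integrable (lebesgue_on S) (f n)"
    and s: "(\<lambda>n. \<integral>x. norm (f n x) \<partial>lebesgue_on S) summable_on UNIV"
  shows "AE x in lebesgue_on S. (\<lambda>n. norm (f n x)) summable_on UNIV"
    and "integrable (lebesgue_on S) (\<lambda>x. \<Sum>\<^sub>\<infinity>n. f n x)"
    and "((\<lambda>n. \<integral>x. f n x \<partial>lebesgue_on S) has_sum (\<integral>x. (\<Sum>\<^sub>\<infinity>n. f n x) \<partial>lebesgue_on S)) UNIV"
proof -
  let ?M = "lebesgue_on S"
  let ?f = "\<lambda>i x. f (grid i) x"
  have s': "summable (\<lambda>i. \<integral>x. norm (?f i x) \<partial>?M)" using summable_grid[OF s] .
  have AE: "AE x in ?M. summable (\<lambda>i. norm (?f i x))" by (rule AE_summable_norm[OF i s'])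
  have hs: "((\<lambda>n. f n x) has_sum (\<Sum>i. ?f i x)) UNIV \<and> (\<lambda>n. norm (f n x)) summable_on UNIV"
    if "summable (\<lambda>i. norm (?f i x))" for x
    using norm_summable_imp_has_sum[OF that summable_sums[OF summable_norm_cancel[OF that]]]
      summable_nonneg_imp_summable_on[OF that]
    by (simp add: has_sum_grid[of "\<lambda>n. f n x"] summable_on_grid[of "\<lambda>n. norm (f n x)"])
  show "AE x in ?M. (\<lambda>n. norm (f n x)) summable_on UNIV"
    using AE by eventually_elim (simp add: hs)
  have AEeq: "AE x in ?M. (\<Sum>i. ?f i x) = (\<Sum>\<^sub>\<infinity>n. f n x)"
    using AE by eventually_elim (use hs infsumI in fastforce)
  note int = integrable_suminf[OF i AE s'] and su = sums_integral[OF i AE s']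
  have m: "(\<lambda>x. \<Sum>\<^sub>\<infinity>n. f n x) \<in> borel_measurable ?M"
    by (rule borel_measurable_lebesgue_on_AE[OF borel_measurable_integrable[OF int] S AEeq])
  show "integrable ?M (\<lambda>x. \<Sum>\<^sub>\<infinity>n. f n x)"
    by (rule integrable_cong_AE_imp[OF int m]) (use AEeq in eventually_elim, simp)
  have "(\<integral>x. (\<Sum>i. ?f i x) \<partial>?M) = (\<integral>x. (\<Sum>\<^sub>\<infinity>n. f n x) \<partial>?M)"
    by (rule integral_cong_AE[OF borel_measurable_integrable[OF int] m AEeq])
  moreover have "summable (\<lambda>i. norm (\<integral>x. ?f i x \<partial>?M))"
    by (rule summable_comparison_test'[OF s']) simp
  ultimately have "((\<lambda>i. \<integral>x. ?f i x \<partial>?M) has_sum (\<integral>x. (\<Sum>\<^sub>\<infinity>n. f n x) \<partial>?M)) UNIV"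
    using norm_summable_imp_has_sum su by metis
  then show "((\<lambda>n. \<integral>x. f n x \<partial>?M) has_sum (\<integral>x. (\<Sum>\<^sub>\<infinity>n. f n x) \<partial>?M)) UNIV"
    using has_sum_grid[of "\<lambda>n. \<integral>x. f n x \<partial>?M"] by simp
qed

section \<open>Riesz-Fischer and Parseval\<close>

lemma fast_subsequence:
  fixes q :: "nat \<Rightarrow> real"
  assumes q: "summable q" "\<And>i. q i \<ge> 0"
  obtains r where "\<And>k. r k < r (Suc k)" "\<And>k m. r k \<le> m \<Longrightarrow> sum q {r k..<m} \<le> (1/4) ^ k"
proof -
  have "\<exists>N. \<forall>m. N \<le> m \<longrightarrow> sum q {N..<m} \<le> (1/4) ^ k" for k
  proof -
    obtain N where N: "\<And>m n. m \<ge> N \<Longrightarrow> norm (sum q {m..<n}) < (1/4) ^ k"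
      using q(1) unfolding summable_Cauchy by (metis zero_less_power zero_less_divide_1_iff zero_less_numeral)
    then show ?thesis using abs_ge_self order_trans less_imp_le by (metis order_refl real_norm_def)
  qed
  then obtain N where N: "\<And>k m. N k \<le> m \<Longrightarrow> sum q {N k..<m} \<le> (1/4) ^ k" by metis
  \<comment> \<open>Summing makes the indices strictly increasing while \<open>r k\<close> still
    dominates \<open>N k\<close>.\<close>
  define r where "r k = (\<Sum>j\<le>k. Suc (N j))" for k
  have Nr: "N k \<le> r k" for k
    using member_le_sum[of k "{..k}" "\<lambda>j. Suc (N j)"] by (simp add: r_def)
  show thesis
  proof
    show "r k < r (Suc k)" for k by (simp add: r_def)
    show "sum q {r k..<m} \<le> (1/4) ^ k" if "r k \<le> m" for k m
    proof -
      have "sum q {r k..<m} \<le> sum q {N k..<m}" using Nr q(2) by (intro sum_mono2) auto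
      also have "\<dots> \<le> (1/4) ^ k" using N[of k m] Nr[of k] that by simp
      finally show ?thesis .
    qed
  qed
qed

text \<open>Young's inequality with a free parameter in place of Cauchy-Schwarz; for a mean square
  of \<open>(1/4) ^ k\<close> the choice \<open>s = 2 ^ k\<close> balances the two terms.\<close>

lemma integral_norm_le_msq:
  assumes "h \<in> cL2" "s > 0"
  shows "(\<integral>x. cmod (h x) \<partial>torus) \<le> (2*pi)\<^sup>2 * (s * msq h + 1 / s)"
proof -
  have "(\<integral>x. cmod (h x) \<partial>torus) \<le> (\<integral>x. s * (cmod (h x))\<^sup>2 + 1 / s \<partial>torus)"
  proof (rule integral_mono)
    show "cmod (h x) \<le> s * (cmod (h x))\<^sup>2 + 1 / s" for x
    proof -
      have "0 \<le> (s * cmod (h x) - 1)\<^sup>2 + s * cmod (h x)" using assms by simp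
      then have "s * cmod (h x) \<le> (s * cmod (h x))\<^sup>2 + 1"
        by (simp add: power2_eq_square algebra_simps)
      then show ?thesis using assms(2) by (simp add: field_simps power2_eq_square)
    qed
  qed (use assms cL2_square[OF assms(1)] integrable_cL2[OF assms(1)] in simp_all)
  also have "\<dots> = (2*pi)\<^sup>2 * (s * msq h + 1 / s)"
    using cL2_square[OF assms(1)] by (simp add: msq_def measure_torus distrib_left)
  finally show ?thesis .
qed

lemma Re_cnj_mult: "Re (cnj z * z) = (cmod z)\<^sup>2"
  unfolding cmod_power2 by (simp add: power2_eq_square)

theorem riesz_fischer:
  assumes c: "(\<lambda>n. (cmod (c n))\<^sup>2) summable_on UNIV"
  obtains f where "f \<in> cL2" "\<And>n. cfc f n = c n" "\<And>x j. f (x + axis j (2 * pi)) = f x"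
    "((\<lambda>n. (cmod (c n))\<^sup>2) has_sum msq f) UNIV"
proof -
  define q where "q i = (cmod (c (grid i)))\<^sup>2" for i
  have q: "summable q" "\<And>i. q i \<ge> 0" using summable_grid[OF c] unfolding q_def by auto
  \<comment> \<open>Tails of size \<open>(1/4) ^ k\<close> have square roots that sum geometrically;
    this turns mean-square convergence into convergence almost everywhere.\<close>
  obtain r where r: "\<And>k. r k < r (Suc k)" and tail: "\<And>k m. r k \<le> m \<Longrightarrow> sum q {r k..<m} \<le> (1/4) ^ k"
    using fast_subsequence[OF q] by metis
  have sm: "strict_mono r" using r by (simp add: strict_mono_Suc_iff)
  define s where "s k x = (\<Sum>n\<in>grid ` {..<r k}. c n * wave n x)" for k x
  have s_cL2: "s k \<in> cL2" for k unfolding s_def by (intro cL2_sum cL2_cmult cL2_wave)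
  have s_diff: "s m x - s k x = (\<Sum>n\<in>grid ` {r k..<r m}. c n * wave n x)" if "k \<le> m" for k m x
  proof -
    have "r k \<le> r m" using that sm by (simp add: strict_mono_less_eq)
    then have "grid ` {..<r m} - grid ` {..<r k} = grid ` {r k..<r m}" "grid ` {..<r k} \<subseteq> grid ` {..<r m}"
      by (auto simp flip: image_set_diff[OF inj_grid] lessThan_minus_lessThan)
    then show ?thesis unfolding s_def
      by (metis (no_types, lifting) sum_diff finite_imageI finite_lessThan)
  qed
  have msq_s: "msq (\<lambda>x. s m x - s k x) \<le> (1/4) ^ k" if "k \<le> m" for k m
  proof -
    have "msq (\<lambda>x. s m x - s k x) = (\<Sum>n\<in>grid ` {r k..<r m}. (cmod (c n))\<^sup>2)"
      using that by (simp add: s_diff msq_waves)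
    also have "\<dots> = sum q {r k..<r m}"
      by (subst sum.reindex) (auto simp: q_def intro: inj_on_subset[OF inj_grid])
    also have "\<dots> \<le> (1/4) ^ k" using tail sm that by (simp add: strict_mono_less_eq)
    finally show ?thesis .
  qed
  define h where "h k x = s (Suc k) x - s k x" for k x
  have h_cL2: "h k \<in> cL2" for k unfolding h_def using s_cL2 by auto
  have "summable (\<lambda>k. \<integral>x. cmod (h k x) \<partial>torus)"
  proof (rule summable_comparison_test')
    show "summable (\<lambda>k. (2*pi)\<^sup>2 * (2 * (1/2::real) ^ k))" by (intro summable_mult summable_geometric) auto
    fix k
    have "(\<integral>x. cmod (h k x) \<partial>torus) \<le> (2*pi)\<^sup>2 * (2 ^ k * msq (h k) + 1 / 2 ^ k)"
      by (rule integral_norm_le_msq[OF h_cL2]) simp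
    also have "\<dots> \<le> (2*pi)\<^sup>2 * (2 ^ k * (1/4) ^ k + 1 / 2 ^ k)"
      unfolding h_def by (intro mult_left_mono add_mono msq_s) auto
    also have "\<dots> = (2*pi)\<^sup>2 * (2 * (1/2) ^ k)"
      by (simp add: power_divide flip: power_mult_distrib) (simp add: field_simps flip: power_mult_distrib)
    finally show "norm (\<integral>x. cmod (h k x) \<partial>torus) \<le> (2*pi)\<^sup>2 * (2 * (1/2) ^ k)" by simp
  qed
  then have "AE x in torus. summable (\<lambda>k. cmod (h k x))"
    by (rule AE_summable_norm[OF integrable_cL2[OF h_cL2]])
  then have conv: "AE x in torus. convergent (\<lambda>k. s k x)"
  proof eventually_elim
    case (elim x)
    have "(\<Sum>i<k. h i x) = s k x - s 0 x" for k by (induction k) (auto simp: h_def)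
    then have "(\<lambda>k. s k x - s 0 x) \<longlonglongrightarrow> (\<Sum>i. h i x)"
      using summable_LIMSEQ[OF summable_norm_cancel[OF elim]] by simp
    then have "(\<lambda>k. s k x - s 0 x + s 0 x) \<longlonglongrightarrow> (\<Sum>i. h i x) + s 0 x" by (intro tendsto_intros)
    then show "convergent (\<lambda>k. s k x)" by (auto simp: convergent_def)
  qed
  \<comment> \<open>Using \<open>lim\<close> everywhere, also where the sums diverge, makes
    \<open>f\<close> exactly periodic: the sequences at a point and at its translate by a period
    coincide.\<close>
  define f where "f x = lim (\<lambda>k. s k x)" for x
  have f_lim: "AE x in torus. (\<lambda>k. s k x) \<longlonglongrightarrow> f x"
    using conv by eventually_elim (simp add: f_def convergent_LIMSEQ_iff)
  have ms: "s k \<in> borel_measurable torus" for k using s_cL2 cL2_measurable by blast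
  have mf: "f \<in> borel_measurable torus" unfolding f_def by (rule borel_measurable_lim_metric[OF ms])
  \<comment> \<open>Fatou's lemma, letting \<open>m\<close> tend to infinity in the bound for
    \<open>s m - s k\<close>.\<close>
  have fs: "(\<lambda>x. f x - s k x) \<in> cL2 \<and> msq (\<lambda>x. f x - s k x) \<le> (1/4) ^ k" for k
  proof -
    have i: "integrable torus (\<lambda>x. (cmod (s m x - s k x))\<^sup>2)" for m
      using s_cL2 by (intro cL2_square cL2_diff)
    have "(\<integral>\<^sup>+x. ennreal ((cmod (f x - s k x))\<^sup>2) \<partial>torus)
        = (\<integral>\<^sup>+x. liminf (\<lambda>m. ennreal ((cmod (s m x - s k x))\<^sup>2)) \<partial>torus)"
    proof (rule nn_integral_cong_AE, use f_lim in eventually_elim)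
      fix x assume "(\<lambda>k. s k x) \<longlonglongrightarrow> f x"
      then have l: "(\<lambda>m. ennreal ((cmod (s m x - s k x))\<^sup>2)) \<longlonglongrightarrow> ennreal ((cmod (f x - s k x))\<^sup>2)"
        by (intro tendsto_ennrealI tendsto_intros)
      show "ennreal ((cmod (f x - s k x))\<^sup>2) = liminf (\<lambda>m. ennreal ((cmod (s m x - s k x))\<^sup>2))"
        by (rule sym, rule lim_imp_Liminf[OF _ l]) simp
    qed
    also have "\<dots> \<le> liminf (\<lambda>m. \<integral>\<^sup>+x. ennreal ((cmod (s m x - s k x))\<^sup>2) \<partial>torus)"
      by (rule nn_integral_liminf) (use ms in measurable)
    also have "\<dots> = liminf (\<lambda>m. ennreal ((2*pi)\<^sup>2 * msq (\<lambda>x. s m x - s k x)))"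
      using i by (subst nn_integral_eq_integral) (auto simp: msq_def)
    also have "\<dots> \<le> liminf (\<lambda>m. ennreal ((2*pi)\<^sup>2 * (1/4) ^ k))"
      by (intro Liminf_mono eventually_mono[OF eventually_ge_at_top[of k]] ennreal_leI mult_left_mono msq_s) auto
    also have "\<dots> = ennreal ((2*pi)\<^sup>2 * (1/4) ^ k)" by (simp add: Liminf_const)
    finally have le: "(\<integral>\<^sup>+x. ennreal ((cmod (f x - s k x))\<^sup>2) \<partial>torus) \<le> ennreal ((2*pi)\<^sup>2 * (1/4) ^ k)" .
    have int: "integrable torus (\<lambda>x. (cmod (f x - s k x))\<^sup>2)"
    proof (rule integrableI_bounded)
      show "(\<integral>\<^sup>+x. ennreal (norm ((cmod (f x - s k x))\<^sup>2)) \<partial>torus) < \<infinity>"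
        using le by (simp add: order_le_less_trans[OF le])
    qed (use mf ms in measurable)
    then have "ennreal (\<integral>x. (cmod (f x - s k x))\<^sup>2 \<partial>torus) \<le> ennreal ((2*pi)\<^sup>2 * (1/4) ^ k)"
      using le by (subst (asm) nn_integral_eq_integral) auto
    then have "(\<integral>x. (cmod (f x - s k x))\<^sup>2 \<partial>torus) \<le> (2*pi)\<^sup>2 * (1/4) ^ k"
      by (subst (asm) ennreal_le_iff) auto
    then show ?thesis using int mf ms by (simp add: cL2_def msq_def field_simps)
  qed
  have f: "f \<in> cL2" using cL2_add[OF conjunct1[OF fs[of 0]] s_cL2[of 0]] by simp
  have lim0: "(\<lambda>k. (1/4::real) ^ k) \<longlonglongrightarrow> 0" by (rule LIMSEQ_power_zero) simp
  have cf: "cfc f n = c n" for n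
  proof -
    obtain i where i: "grid i = n" using bij_grid by (metis bij_betw_def rangeE UNIV_I)
    have "(cmod (cfc f n - c n))\<^sup>2 \<le> (1/4) ^ k" if "k > i" for k
    proof -
      have "i < r k" using strict_mono_imp_increasing[OF sm, of k] that by simp
      then have "n \<in> grid ` {..<r k}" using i by auto
      then have "cfc (s k) n = c n"
        unfolding s_def by (simp add: cfc_sum cL2_cmult cfc_cmult cfc_wave if_distrib cong: if_cong)
      then have "(cmod (cfc f n - c n))\<^sup>2 = (\<Sum>n\<in>{n}. (cmod (cfc (\<lambda>x. f x - s k x) n))\<^sup>2)"
        using f s_cL2 by (simp add: cfc_diff)
      also have "\<dots> \<le> msq (\<lambda>x. f x - s k x)" using fs by (intro Bessel_torus) auto
      also have "\<dots> \<le> (1/4) ^ k" using fs by simp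
      finally show ?thesis .
    qed
    then have "(cmod (cfc f n - c n))\<^sup>2 \<le> 0"
      by (intro tendsto_lowerbound[OF lim0] eventually_mono[OF eventually_gt_at_top[of i]]) auto
    then show ?thesis by simp
  qed
  \<comment> \<open>By Pythagoras the remainder is \<open>msq f\<close> minus the partial sum of
    squares, so the full series sums to \<open>msq f\<close>.\<close>
  have "(\<lambda>k. msq f - (\<Sum>i<r k. q i)) \<longlonglongrightarrow> 0"
  proof (rule Lim_null_comparison[OF _ lim0], intro always_eventually allI)
    fix k
    have "msq (\<lambda>x. f x - s k x) = msq f - (\<Sum>n\<in>grid ` {..<r k}. (cmod (c n))\<^sup>2)"
      unfolding s_def by (subst msq_diff_waves[OF f])
        (simp_all only: cf Re_cnj_mult sum_distrib_left[symmetric] finite_imageI finite_lessThan)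
    also have "(\<Sum>n\<in>grid ` {..<r k}. (cmod (c n))\<^sup>2) = (\<Sum>i<r k. q i)"
      by (subst sum.reindex) (auto simp: q_def intro: inj_on_subset[OF inj_grid])
    finally show "norm (msq f - (\<Sum>i<r k. q i)) \<le> (1/4) ^ k"
      using fs[of k] msq_nonneg[of "\<lambda>x. f x - s k x"] by simp
  qed
  then have "(\<lambda>k. msq f - (msq f - (\<Sum>i<r k. q i))) \<longlonglongrightarrow> msq f - 0" by (intro tendsto_intros)
  then have "(\<lambda>k. (\<Sum>i<r k. q i)) \<longlonglongrightarrow> msq f" by simp
  moreover have "(\<lambda>k. (\<Sum>i<r k. q i)) \<longlonglongrightarrow> suminf q"
    using LIMSEQ_subseq_LIMSEQ[OF summable_LIMSEQ[OF q(1)] sm] by (simp add: o_def)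
  ultimately have "q sums msq f" using q(1) LIMSEQ_unique summable_sums by metis
  then have "((\<lambda>i. (cmod (c (grid i)))\<^sup>2) has_sum msq f) UNIV"
    using sums_nonneg_imp_has_sum q(2) unfolding q_def by blast
  then have hs: "((\<lambda>n. (cmod (c n))\<^sup>2) has_sum msq f) UNIV"
    using has_sum_grid[of "\<lambda>n. (cmod (c n))\<^sup>2"] by simp
  have "f (x + axis j (2 * pi)) = f x" for x j
    unfolding f_def s_def by (simp add: periodic_wave)
  then show thesis using that f cf hs by blast
qed

text \<open>Riesz-Fischer produces a function with the same coefficients for which the identity is
  known, and uniqueness identifies it with \<open>f\<close> almost everywhere.\<close>

theorem Parseval:
  assumes f: "f \<in> cL2" shows "((\<lambda>n. (cmod (cfc f n))\<^sup>2) has_sum msq f) UNIV"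
proof -
  have "(\<lambda>n. (cmod (cfc f n))\<^sup>2) summable_on UNIV"
    by (rule nonneg_bdd_above_summable_on) (auto intro!: bdd_aboveI2 Bessel_torus[OF f])
  then obtain g where g: "g \<in> cL2" "\<And>n. cfc g n = cfc f n"
    "((\<lambda>n. (cmod (cfc f n))\<^sup>2) has_sum msq g) UNIV"
    using riesz_fischer by metis
  have "AE x in torus. f x - g x = 0"
    by (rule fourier_uniqueness) (use f g in \<open>auto simp: cfc_diff intro: integrable_cL2\<close>)
  then have "AE x in torus. (cmod (f x))\<^sup>2 = (cmod (g x))\<^sup>2" by eventually_elim simp
  then have "(\<integral>x. (cmod (f x))\<^sup>2 \<partial>torus) = (\<integral>x. (cmod (g x))\<^sup>2 \<partial>torus)"
    by (intro integral_cong_AE) (use f[THEN cL2_measurable] g(1)[THEN cL2_measurable] in auto)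
  then show ?thesis using g(3) by (simp add: msq_def)
qed

lemma polarization:
  fixes a b :: complex
  shows "a * cnj b = (of_real ((cmod (a + b))\<^sup>2) - of_real ((cmod (a - b))\<^sup>2)
     + \<i> * (of_real ((cmod (a + \<i> * b))\<^sup>2) - of_real ((cmod (a - \<i> * b))\<^sup>2))) / 4"
  by (simp add: cmod_power2 complex_eq_iff) (simp add: power2_eq_square algebra_simps)

theorem Parseval_inner:
  assumes f: "f \<in> cL2" and g: "g \<in> cL2"
  shows "((\<lambda>n. cfc f n * cnj (cfc g n)) has_sum mean (\<lambda>x. f x * cnj (g x))) UNIV"
proof -
  let ?m = "\<lambda>u. complex_of_real (msq u)"
  have cg: "(\<lambda>x. \<i> * g x) \<in> cL2" using g by (rule cL2_cmult)
  have P: "((\<lambda>n. complex_of_real ((cmod (cfc u n))\<^sup>2)) has_sum ?m u) UNIV" if "u \<in> cL2" for u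
    using Parseval[OF that] by (rule has_sum_of_real)
  have "((\<lambda>n. (of_real ((cmod (cfc (\<lambda>x. f x + g x) n))\<^sup>2) - of_real ((cmod (cfc (\<lambda>x. f x - g x) n))\<^sup>2)
     + \<i> * (of_real ((cmod (cfc (\<lambda>x. f x + \<i> * g x) n))\<^sup>2) - of_real ((cmod (cfc (\<lambda>x. f x - \<i> * g x) n))\<^sup>2))) * (1/4))
     has_sum ((?m (\<lambda>x. f x + g x) - ?m (\<lambda>x. f x - g x)
       + \<i> * (?m (\<lambda>x. f x + \<i> * g x) - ?m (\<lambda>x. f x - \<i> * g x))) * (1/4))) UNIV"
    using f g cg by (intro has_sum_cmult_left has_sum_add has_sum_diff has_sum_cmult_right P cL2_add cL2_diff)
  moreover have "(of_real ((cmod (cfc (\<lambda>x. f x + g x) n))\<^sup>2) - of_real ((cmod (cfc (\<lambda>x. f x - g x) n))\<^sup>2)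
     + \<i> * (of_real ((cmod (cfc (\<lambda>x. f x + \<i> * g x) n))\<^sup>2) - of_real ((cmod (cfc (\<lambda>x. f x - \<i> * g x) n))\<^sup>2))) * (1/4)
     = cfc f n * cnj (cfc g n)" for n
    unfolding polarization[of "cfc f n"] cfc_add[OF f g] cfc_diff[OF f g] cfc_add[OF f cg] cfc_diff[OF f cg] cfc_cmult
    by simp
  moreover have "mean (\<lambda>x. f x * cnj (g x)) = (?m (\<lambda>x. f x + g x) - ?m (\<lambda>x. f x - g x)
       + \<i> * (?m (\<lambda>x. f x + \<i> * g x) - ?m (\<lambda>x. f x - \<i> * g x))) * (1/4)"
  proof -
    let ?s = "\<lambda>u x. complex_of_real ((cmod (u x))\<^sup>2)"
    have ms: "?m u = mean (?s u)" for u
      by (simp add: msq_def mean_def del: of_real_power)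
    have i: "integrable torus (?s u)" if "u \<in> cL2" for u
      using cL2_square[OF that] by (simp del: of_real_power)
    note ii = i[OF cL2_add[OF f g]] i[OF cL2_diff[OF f g]] i[OF cL2_add[OF f cg]] i[OF cL2_diff[OF f cg]]
    have "mean (\<lambda>x. f x * cnj (g x)) = mean (\<lambda>x. (1/4) * ((?s (\<lambda>x. f x + g x) x - ?s (\<lambda>x. f x - g x) x)
       + \<i> * (?s (\<lambda>x. f x + \<i> * g x) x - ?s (\<lambda>x. f x - \<i> * g x) x)))"
      unfolding polarization[of "f _"] by simp
    also have "\<dots> = (1/4) * ((mean (?s (\<lambda>x. f x + g x)) - mean (?s (\<lambda>x. f x - g x)))
       + \<i> * (mean (?s (\<lambda>x. f x + \<i> * g x)) - mean (?s (\<lambda>x. f x - \<i> * g x))))"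
      unfolding mean_cmult using ii
      by (simp only: mean_add mean_diff mean_cmult Bochner_Integration.integrable_diff integrable_mult_right)
    finally show ?thesis by (simp add: ms)
  qed
  ultimately show ?thesis by (simp only:)
qed

lemma cL2_eq_AE:
  assumes "f \<in> cL2" "g \<in> cL2" "\<And>n. cfc f n = cfc g n" shows "AE x in torus. f x = g x"
proof -
  have "AE x in torus. f x - g x = 0"
    by (rule fourier_uniqueness) (use assms in \<open>auto simp: cfc_diff intro: integrable_cL2\<close>)
  then show ?thesis by eventually_elim simp
qed

section \<open>The Fourier system of the advection-diffusion equation\<close>

text \<open>\<open>shift 1 \<bullet> x\<close> and \<open>shift 2 \<bullet> x\<close> are the phases of \<open>\<theta>\<^sub>1\<close> and \<open>\<theta>\<^sub>3\<close>; \<open>cross i n\<close> is the inner product of \<open>n\<close> with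
  the direction of the shear.\<close>

definition shift :: "2 \<Rightarrow> int^2" where
  "shift i = (\<chi> j. if j = 1 then 1 else if i = 1 then 0 else - 1)"

definition cross :: "2 \<Rightarrow> int^2 \<Rightarrow> int" where
  "cross i n = shift i $ 1 * n $ 2 - shift i $ 2 * n $ 1"

definition lap :: "int^2 \<Rightarrow> real" where
  "lap n = (\<Sum>j\<in>UNIV. (real_of_int (n $ j))\<^sup>2)"

text \<open>The Fourier coefficients of \<open>v \<bullet> \<nabla>\<phi>\<close> for the shear flow
  with amplitudes \<open>a\<close>, as \<open>flow_gradient\<close> shows: multiplication by a sine
  moves a frequency by \<open>shift i\<close> both ways, and the derivative along the shear
  contributes \<open>cross i n\<close>.\<close>

definition transport ::
    "(2 \<Rightarrow> real \<Rightarrow> real) \<Rightarrow> (int^2 \<Rightarrow> real \<Rightarrow> complex) \<Rightarrow> int^2 \<Rightarrow> real \<Rightarrow> complex" where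
  "transport a c n t = (\<Sum>i\<in>UNIV. of_real (a i t * of_int (cross i n) / 2) *
     (c (n - shift i) t - c (n + shift i) t))"

definition mode_solution ::
    "real \<Rightarrow> (2 \<Rightarrow> real \<Rightarrow> real) \<Rightarrow> (int^2 \<Rightarrow> real \<Rightarrow> complex) \<Rightarrow> bool" where
  "mode_solution \<tau> a c \<longleftrightarrow> (\<forall>n. \<forall>t\<in>{0..\<tau>}.
     (c n has_vector_derivative (- of_real (lap n) * c n t - transport a c n t)) (at t within {0..\<tau>}))"

definition nbr_sum :: "(int^2 \<Rightarrow> real) \<Rightarrow> int^2 \<Rightarrow> real" where
  "nbr_sum S n = (\<Sum>i\<in>UNIV. S (n - shift i) + S (n + shift i))"

lemma lap_nonneg [simp]: "lap n \<ge> 0"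
  by (simp add: lap_def sum_nonneg)

text \<open>\<open>cross i n\<close> is the inner product of \<open>n\<close> with a vector of
  squared length at most 2. Hence transport costs one square root of the diffusion symbol, which
  diffusion can absorb.\<close>

lemma cross_square: "(real_of_int (cross i n))\<^sup>2 \<le> 2 * lap n"
proof -
  have "(x + y)\<^sup>2 \<le> 2 * (x\<^sup>2 + y\<^sup>2)" for x y :: real
    using zero_le_power2[of "x - y"] by (simp add: power2_eq_square algebra_simps)
  moreover have "y\<^sup>2 \<le> 2 * (x\<^sup>2 + y\<^sup>2)" for x y :: real by simp
  ultimately show ?thesis
    by (auto simp: cross_def shift_def lap_def UNIV_2 add.commute)
qed

lemma cross_shift [simp]: "cross i (n + shift i) = cross i n" "cross i (n - shift i) = cross i n"
  by (auto simp: cross_def algebra_simps)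

lemma nbr_sum_nonneg: "(\<And>n. S n \<ge> 0) \<Longrightarrow> nbr_sum S n \<ge> 0"
  by (simp add: nbr_sum_def sum_nonneg)

lemma nbr_sum_mono: "(\<And>n. S n \<le> S' n) \<Longrightarrow> nbr_sum S n \<le> nbr_sum S' n"
  unfolding nbr_sum_def by (intro sum_mono add_mono)

lemma has_sum_translate: "((\<lambda>n. f (n + s)) has_sum S) UNIV \<longleftrightarrow> (f has_sum S) (UNIV :: (int^2) set)"
  by (rule has_sum_reindex_bij_betw) (rule bij_betwI[where g = "\<lambda>n. n - s"], auto)

lemma has_sum_nbr_sum:
  assumes "(S has_sum s) UNIV" shows "(nbr_sum S has_sum 4 * s) UNIV"
proof -
  have "((\<lambda>n. S (n - shift i) + S (n + shift i)) has_sum s + s) UNIV" for i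
    using assms has_sum_translate[of S "- shift i"] by (intro has_sum_add) (simp_all add: has_sum_translate)
  from has_sum_add[OF this[of 1] this[of 2]] show ?thesis
    by (simp add: nbr_sum_def[abs_def] UNIV_2)
qed

lemma nbr_sum_square: "(nbr_sum S n)\<^sup>2 \<le> 4 * nbr_sum (\<lambda>n. (S n)\<^sup>2) n"
proof -
  have "(a + b + (c + d))\<^sup>2 \<le> 4 * (a\<^sup>2 + b\<^sup>2 + (c\<^sup>2 + d\<^sup>2))" for a b c d :: real
    using zero_le_power2[of "a - b"] zero_le_power2[of "a - c"] zero_le_power2[of "a - d"]
      zero_le_power2[of "b - c"] zero_le_power2[of "b - d"] zero_le_power2[of "c - d"]
    by (simp add: power2_eq_square algebra_simps)
  then show ?thesis by (simp add: nbr_sum_def UNIV_2)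
qed

lemma transport_bound:
  assumes a: "\<And>i. \<bar>a i t\<bar> \<le> A" and S: "\<And>n. cmod (c n t) \<le> S n * E"
  shows "cmod (transport a c n t) \<le> A / 2 * sqrt (2 * lap n) * nbr_sum S n * E"
proof -
  have A0: "A \<ge> 0" using a[of 1] by simp
  have "cmod (transport a c n t) \<le> (\<Sum>i\<in>UNIV. (A / 2 * sqrt (2 * lap n)) * (S (n - shift i) * E + S (n + shift i) * E))"
    unfolding transport_def
  proof (rule sum_norm_le)
    fix i :: 2
    have x: "\<bar>real_of_int (cross i n)\<bar> \<le> sqrt (2 * lap n)"
      using cross_square[of i n] by (simp add: real_le_rsqrt)
    have "cmod (of_real (a i t * of_int (cross i n) / 2) * (c (n - shift i) t - c (n + shift i) t))
        = (\<bar>a i t\<bar> / 2 * \<bar>real_of_int (cross i n)\<bar>) * cmod (c (n - shift i) t - c (n + shift i) t)"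
      by (simp add: norm_mult abs_mult norm_divide)
    also have "\<dots> \<le> (A / 2 * sqrt (2 * lap n)) * (S (n - shift i) * E + S (n + shift i) * E)"
      using a A0 x S norm_triangle_ineq4 by (intro mult_mono order.trans[OF norm_triangle_ineq4] add_mono) auto
    finally show "cmod (of_real (a i t * of_int (cross i n) / 2) * (c (n - shift i) t - c (n + shift i) t))
        \<le> (A / 2 * sqrt (2 * lap n)) * (S (n - shift i) * E + S (n + shift i) * E)" .
  qed
  also have "\<dots> = A / 2 * sqrt (2 * lap n) * nbr_sum S n * E"
    by (simp add: nbr_sum_def UNIV_2 algebra_simps)
  finally show ?thesis .
qed

lemma transport_diff: "transport a (\<lambda>n t. c n t - d n t) n t = transport a c n t - transport a d n t"
  by (simp add: transport_def UNIV_2 algebra_simps diff_divide_distrib add_divide_distrib)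

lemma continuous_transport:
  assumes "\<And>i. continuous_on X (a i)" "\<And>n. continuous_on X (c n)"
  shows "continuous_on X (transport a c n)"
  unfolding transport_def by (intro continuous_intros assms) auto

section \<open>Variation of constants in an exponentially weighted norm\<close>

definition duhamel :: "real \<Rightarrow> (real \<Rightarrow> complex) \<Rightarrow> real \<Rightarrow> complex" where
  "duhamel l F t = exp (- l * t) *\<^sub>R integral {0..t} (\<lambda>s. exp (l * s) *\<^sub>R F s)"

lemma duhamel_0 [simp]: "duhamel l F 0 = 0"
  by (simp add: duhamel_def)

lemma duhamel_has_derivative:
  assumes F: "continuous_on {0..\<tau>} F" and t: "t \<in> {0..\<tau>}"
  shows "(duhamel l F has_vector_derivative (F t - of_real l * duhamel l F t)) (at t within {0..\<tau>})"
proof -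
  have "((\<lambda>u. integral {0..u} (\<lambda>s. exp (l * s) *\<^sub>R F s)) has_vector_derivative exp (l * t) *\<^sub>R F t) (at t within {0..\<tau>})"
    by (rule integral_has_vector_derivative[OF _ t]) (intro continuous_intros F)
  moreover have "((\<lambda>t. exp (- l * t)) has_real_derivative (- l * exp (- l * t))) (at t within {0..\<tau>})"
    by (auto intro!: derivative_eq_intros)
  ultimately have "((\<lambda>u. exp (- l * u) *\<^sub>R integral {0..u} (\<lambda>s. exp (l * s) *\<^sub>R F s)) has_vector_derivative
     (exp (- l * t) *\<^sub>R (exp (l * t) *\<^sub>R F t) + (- l * exp (- l * t)) *\<^sub>R integral {0..t} (\<lambda>s. exp (l * s) *\<^sub>R F s)))
     (at t within {0..\<tau>})"
    by (intro has_vector_derivative_scaleR)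
  moreover have "exp (- l * t) *\<^sub>R (exp (l * t) *\<^sub>R F t) + (- l * exp (- l * t)) *\<^sub>R integral {0..t} (\<lambda>s. exp (l * s) *\<^sub>R F s)
      = F t - of_real l * duhamel l F t"
  proof -
    have "exp (- l * t) *\<^sub>R (exp (l * t) *\<^sub>R F t) = F t" by (simp flip: exp_add)
    then show ?thesis by (simp add: duhamel_def scaleR_conv_of_real)
  qed
  ultimately show ?thesis
    by (simp only: duhamel_def[abs_def])
qed

lemma duhamel_continuous:
  assumes F: "continuous_on {0..\<tau>} F" shows "continuous_on {0..\<tau>} (duhamel l F)"
  using duhamel_has_derivative[OF F] has_vector_derivative_continuous continuous_on_eq_continuous_within by blast

text \<open>Against a source that grows like \<open>exp (M * t)\<close> the damped integral gains
  \<open>l + M\<close> and not merely \<open>l\<close>, so there is a gain even for the zero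
  mode.\<close>

lemma duhamel_bound:
  assumes F: "continuous_on {0..\<tau>} F" and t: "t \<in> {0..\<tau>}" and l: "l \<ge> 0" and M: "M > 0"
    and P: "\<And>s. s \<in> {0..\<tau>} \<Longrightarrow> cmod (F s) \<le> P * exp (M * s)"
  shows "cmod (duhamel l F t) \<le> P / (l + M) * exp (M * t)"
proof -
  have P0: "P \<ge> 0" using P[of 0] t order_trans[OF norm_ge_zero[of "F 0"]] by simp
  have lM: "l + M > 0" using l M by simp
  have "((\<lambda>s. P * exp (k * s)) has_integral (P / k * exp (k * t) - P / k * exp (k * 0))) {0..t}"
    if "k > 0" for k
    by (rule fundamental_theorem_of_calculus)
       (use t that in \<open>auto intro!: derivative_eq_intros simp flip: has_real_derivative_iff_has_vector_derivative\<close>)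
  from this[OF lM] have I: "((\<lambda>s. P * exp ((l + M) * s)) has_integral (P / (l + M) * (exp ((l + M) * t) - 1))) {0..t}"
    by (simp add: right_diff_distrib)
  have "norm (integral {0..t} (\<lambda>s. exp (l * s) *\<^sub>R F s)) \<le> integral {0..t} (\<lambda>s. P * exp ((l + M) * s))"
  proof (rule Henstock_Kurzweil_Integration.integral_norm_bound_integral)
    show "(\<lambda>s. exp (l * s) *\<^sub>R F s) integrable_on {0..t}"
      using t by (intro integrable_continuous_real continuous_intros continuous_on_subset[OF F]) auto
    show "(\<lambda>s. P * exp ((l + M) * s)) integrable_on {0..t}" using I by blast
    fix s assume "s \<in> {0..t}"
    then have "cmod (F s) \<le> P * exp (M * s)" using P t by auto
    then have "exp (l * s) * cmod (F s) \<le> exp (l * s) * (P * exp (M * s))" by (rule mult_left_mono) simp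
    then show "norm (exp (l * s) *\<^sub>R F s) \<le> P * exp ((l + M) * s)"
      by (simp add: exp_add distrib_right mult.left_commute)
  qed
  also have "\<dots> \<le> P / (l + M) * exp ((l + M) * t)"
    unfolding integral_unique[OF I] using P0 lM by (intro mult_left_mono) auto
  finally have "exp (- l * t) * norm (integral {0..t} (\<lambda>s. exp (l * s) *\<^sub>R F s))
     \<le> exp (- l * t) * (P / (l + M) * exp ((l + M) * t))" by (rule mult_left_mono) simp
  also have "\<dots> = P / (l + M) * exp (M * t)"
    by (simp add: distrib_right exp_add exp_minus)
  finally show ?thesis by (simp add: duhamel_def)
qed

lemma duhamel_diff:
  assumes F: "continuous_on {0..\<tau>} F" and G: "continuous_on {0..\<tau>} G" and t: "t \<in> {0..\<tau>}"
  shows "duhamel l (\<lambda>s. F s - G s) t = duhamel l F t - duhamel l G t"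
proof -
  have i: "(\<lambda>s. exp (l * s) *\<^sub>R H s) integrable_on {0..t}" if "continuous_on {0..\<tau>} H" for H :: "real \<Rightarrow> complex"
    using t by (intro integrable_continuous_real continuous_intros continuous_on_subset[OF that]) auto
  show ?thesis unfolding duhamel_def
    by (simp only: scaleR_right_diff_distrib Henstock_Kurzweil_Integration.integral_diff[OF i[OF F] i[OF G]])
qed

text \<open>The integrating factor \<open>exp (l * t)\<close> turns the difference to the Duhamel
  term into a constant.\<close>

lemma duhamel_unique:
  assumes F: "continuous_on {0..\<tau>} F" and t: "t \<in> {0..\<tau>}"
    and w: "\<And>t. t \<in> {0..\<tau>} \<Longrightarrow> (w has_vector_derivative (F t - of_real l * w t)) (at t within {0..\<tau>})"
  shows "w t = exp (- l * t) *\<^sub>R w 0 + duhamel l F t"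
proof -
  define y where "y t = exp (l * t) *\<^sub>R (w t - duhamel l F t)" for t
  have "y t = y 0"
  proof (rule has_derivative_zero_unique[of "{0..\<tau>}" y])
    fix t assume t: "t \<in> {0..\<tau>}"
    have "((\<lambda>t. w t - duhamel l F t) has_vector_derivative
        (F t - of_real l * w t) - (F t - of_real l * duhamel l F t)) (at t within {0..\<tau>})"
      by (rule has_vector_derivative_diff[OF w[OF t] duhamel_has_derivative[OF F t]])
    moreover have "((\<lambda>t. exp (l * t)) has_real_derivative (l * exp (l * t))) (at t within {0..\<tau>})"
      by (auto intro!: derivative_eq_intros)
    ultimately have "(y has_vector_derivative
       (exp (l * t) *\<^sub>R ((F t - of_real l * w t) - (F t - of_real l * duhamel l F t))
         + (l * exp (l * t)) *\<^sub>R (w t - duhamel l F t))) (at t within {0..\<tau>})"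
      unfolding y_def by (rule has_vector_derivative_scaleR[rotated])
    then show "(y has_derivative (\<lambda>h. 0)) (at t within {0..\<tau>})"
      by (simp add: has_vector_derivative_def scaleR_conv_of_real algebra_simps)
  qed (use t in auto)
  then have "exp (- l * t) *\<^sub>R (exp (l * t) *\<^sub>R (w t - duhamel l F t)) = exp (- l * t) *\<^sub>R w 0"
    by (simp add: y_def)
  then show ?thesis by (simp add: algebra_simps flip: exp_add)
qed

text \<open>The arithmetic-geometric mean inequality for \<open>lap n\<close> and
  \<open>8 * A\<^sup>2\<close>. This is the origin of the exponent \<open>8 * A\<^sup>2 + 1\<close>
  in the time weight; the summand 1 keeps the denominator positive.\<close>

lemma gain_le:
  assumes "A \<ge> 0" shows "A / 2 * sqrt (2 * lap n) / (lap n + (8 * A\<^sup>2 + 1)) \<le> 1 / 8"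
proof -
  have "0 \<le> (sqrt (2 * lap n) - 4 * A)\<^sup>2" by simp
  also have "\<dots> = 2 * lap n - 2 * sqrt (2 * lap n) * (4 * A) + 16 * A\<^sup>2"
    by (simp add: power2_diff power_mult_distrib)
  finally have "4 * A * sqrt (2 * lap n) \<le> lap n + 8 * A\<^sup>2" by (simp add: algebra_simps)
  moreover have "lap n + (8 * A\<^sup>2 + 1) > 0" by (simp add: add_nonneg_pos)
  ultimately show ?thesis by (simp add: divide_le_eq)
qed

text \<open>In the exponentially weighted supremum norm the transport term is a contraction, because it gains
  a factor \<open>1/8\<close> against the heat semigroup and couples each mode to four neighbours.\<close>

lemma duhamel_transport_bound:
  assumes a: "\<And>i. continuous_on {0..\<tau>} (a i)" "\<And>i t. t \<in> {0..\<tau>} \<Longrightarrow> \<bar>a i t\<bar> \<le> A" and A: "A \<ge> 0"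
    and c: "\<And>n. continuous_on {0..\<tau>} (c n)"
    and S: "\<And>n t. t \<in> {0..\<tau>} \<Longrightarrow> cmod (c n t) \<le> S n * exp ((8 * A\<^sup>2 + 1) * t)"
    and t: "t \<in> {0..\<tau>}"
  shows "cmod (duhamel (lap n) (transport a c n) t) \<le> nbr_sum S n / 8 * exp ((8 * A\<^sup>2 + 1) * t)"
proof -
  let ?M = "8 * A\<^sup>2 + 1"
  have S0: "S n \<ge> 0" for n using S[of 0 n] t order_trans[OF norm_ge_zero[of "c n 0"]] by simp
  have "cmod (duhamel (lap n) (transport a c n) t)
      \<le> (A / 2 * sqrt (2 * lap n) * nbr_sum S n) / (lap n + ?M) * exp (?M * t)"
  proof (rule duhamel_bound[OF continuous_transport t lap_nonneg])
    show "?M > 0" by (simp add: add_nonneg_pos)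
    show "cmod (transport a c n s) \<le> (A / 2 * sqrt (2 * lap n) * nbr_sum S n) * exp (?M * s)"
      if "s \<in> {0..\<tau>}" for s using a(2) S that by (intro transport_bound) auto
  qed (use a c in auto)
  also have "\<dots> = (A / 2 * sqrt (2 * lap n) / (lap n + ?M)) * (nbr_sum S n * exp (?M * t))" by simp
  also have "\<dots> \<le> (1 / 8) * (nbr_sum S n * exp (?M * t))"
    using gain_le[OF A] nbr_sum_nonneg[OF S0] by (intro mult_right_mono) auto
  finally show ?thesis by simp
qed

lemma mode_solution_duhamel:
  assumes c: "mode_solution \<tau> a c" and a: "\<And>i. continuous_on {0..\<tau>} (a i)" and t: "t \<in> {0..\<tau>}"
  shows "c n t = exp (- lap n * t) *\<^sub>R c n 0 - duhamel (lap n) (transport a c n) t"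
    and "continuous_on {0..\<tau>} (c n)"
proof -
  show cc: "continuous_on {0..\<tau>} (c n)" for n
    using c has_vector_derivative_continuous unfolding mode_solution_def continuous_on_eq_continuous_within by blast
  have F: "continuous_on {0..\<tau>} (transport a c n)" by (intro continuous_transport a cc)
  have "c n t = exp (- lap n * t) *\<^sub>R c n 0 + duhamel (lap n) (\<lambda>t. 0 - transport a c n t) t"
  proof (rule duhamel_unique[OF _ t])
    show "continuous_on {0..\<tau>} (\<lambda>t. 0 - transport a c n t)" by (intro continuous_intros F)
    show "(c n has_vector_derivative (0 - transport a c n t - of_real (lap n) * c n t)) (at t within {0..\<tau>})"
      if "t \<in> {0..\<tau>}" for t
    proof -
      have "0 - transport a c n t - of_real (lap n) * c n t = - of_real (lap n) * c n t - transport a c n t" by simp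
      then show ?thesis using c that unfolding mode_solution_def by (simp only:)
    qed
  qed
  also have "duhamel (lap n) (\<lambda>t. 0 - transport a c n t) t = - duhamel (lap n) (transport a c n) t"
    using duhamel_diff[OF continuous_on_const F t, of "lap n" 0] by (simp add: duhamel_def)
  finally show "c n t = exp (- lap n * t) *\<^sub>R c n 0 - duhamel (lap n) (transport a c n) t" by simp
qed

text \<open>The difference of two solutions is a fixed point of the contraction, so each application
  halves its bound. A bound uniform in \<open>n\<close> suffices to start, and Bessel's inequality
  provides one for any energy solution.\<close>

lemma mode_solution_unique:
  assumes c: "mode_solution \<tau> a c" and d: "mode_solution \<tau> a d" and a: "\<And>i. continuous_on {0..\<tau>} (a i)"
    and init: "\<And>n. c n 0 = d n 0"
    and B: "\<And>n t. t \<in> {0..\<tau>} \<Longrightarrow> cmod (c n t) \<le> B" "\<And>n t. t \<in> {0..\<tau>} \<Longrightarrow> cmod (d n t) \<le> B"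
    and t: "t \<in> {0..\<tau>}"
  shows "c n t = d n t"
proof -
  have "\<exists>A. \<forall>t\<in>{0..\<tau>}. \<bar>a i t\<bar> \<le> A" for i
    using compact_imp_bounded[OF compact_continuous_image[OF a compact_Icc]] by (auto simp: bounded_iff)
  then obtain Ai where Ai: "\<And>i t. t \<in> {0..\<tau>} \<Longrightarrow> \<bar>a i t\<bar> \<le> Ai i" by metis
  define A where "A = (\<Sum>i\<in>UNIV. Ai i)"
  have Ai0: "Ai i \<ge> 0" for i using Ai[of t i] t by simp
  have A: "\<bar>a i t\<bar> \<le> A" if "t \<in> {0..\<tau>}" for i t
    using Ai[OF that, of i] member_le_sum[of i UNIV Ai] Ai0 by (simp add: A_def)
  have A0: "A \<ge> 0" using A[OF t, of 1] by simp
  let ?M = "8 * A\<^sup>2 + 1"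
  let ?w = "\<lambda>n t. c n t - d n t"
  have wc: "continuous_on {0..\<tau>} (?w n)" for n
    using mode_solution_duhamel(2)[OF _ a t] c d by (intro continuous_intros) auto
  have w: "?w n t = - duhamel (lap n) (transport a ?w n) t" if t: "t \<in> {0..\<tau>}" for n t
  proof -
    have "transport a ?w n = (\<lambda>s. transport a c n s - transport a d n s)"
      using transport_diff by (auto simp: fun_eq_iff)
    moreover have "duhamel (lap n) (\<lambda>s. transport a c n s - transport a d n s) t
        = duhamel (lap n) (transport a c n) t - duhamel (lap n) (transport a d n) t"
      using c d a by (intro duhamel_diff[OF _ _ t] continuous_transport a mode_solution_duhamel(2)[OF _ _ t]) auto
    ultimately show ?thesis
      using mode_solution_duhamel(1)[OF c a t, of n] mode_solution_duhamel(1)[OF d a t, of n] init by simp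
  qed
  have "cmod (?w n t) \<le> (2 * B) * (1/2) ^ k * exp (?M * t)" if "t \<in> {0..\<tau>}" for k n t
    using that
  proof (induction k arbitrary: n t)
    case 0
    have "cmod (?w n t) \<le> 2 * B" using norm_triangle_ineq4[of "c n t" "d n t"] B[OF 0, of n] by simp
    moreover have "2 * B * 1 \<le> 2 * B * exp (?M * t)"
      using 0 order_trans[OF norm_ge_zero B(1)[OF 0, of n]] by (intro mult_left_mono) auto
    ultimately show ?case by simp
  next
    case (Suc k)
    \<comment> \<open>Four neighbours with the same bound, divided by 8: a factor 1/2.\<close>
    have "cmod (?w n t) \<le> nbr_sum (\<lambda>n. (2 * B) * (1/2) ^ k) n / 8 * exp (?M * t)"
      unfolding w[OF Suc.prems] norm_minus_cancel
      by (rule duhamel_transport_bound[OF a A A0 wc Suc.IH Suc.prems])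
    then show ?case by (simp add: nbr_sum_def)
  qed
  note est = this[OF t, of n]
  have "(\<lambda>k. (2 * B) * (1/2) ^ k * exp (?M * t)) \<longlonglongrightarrow> (2 * B) * 0 * exp (?M * t)"
    by (intro tendsto_intros LIMSEQ_power_zero) simp
  then have "cmod (?w n t) \<le> (2 * B) * 0 * exp (?M * t)"
    by (rule LIMSEQ_le_const) (use est in blast)
  then show ?thesis by simp
qed

section \<open>Existence of mode solutions by Picard iteration\<close>

lemma bounded_on_Icc:
  fixes a :: "2 \<Rightarrow> real \<Rightarrow> real"
  assumes a: "\<And>i. continuous_on {0..\<tau>} (a i)"
  obtains A where "A \<ge> 0" "\<And>i t. t \<in> {0..\<tau>} \<Longrightarrow> \<bar>a i t\<bar> \<le> A"
proof -
  have "\<exists>A. \<forall>t\<in>{0..\<tau>}. \<bar>a i t\<bar> \<le> A" for i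
    using compact_imp_bounded[OF compact_continuous_image[OF a compact_Icc]] by (auto simp: bounded_iff)
  then obtain Ai where Ai: "\<And>i t. t \<in> {0..\<tau>} \<Longrightarrow> \<bar>a i t\<bar> \<le> Ai i" by metis
  show thesis
  proof
    show "(\<Sum>i\<in>UNIV. \<bar>Ai i\<bar>) \<ge> 0" by (simp add: sum_nonneg)
    show "\<bar>a i t\<bar> \<le> (\<Sum>i\<in>UNIV. \<bar>Ai i\<bar>)" if "t \<in> {0..\<tau>}" for i t
      using Ai[OF that, of i] member_le_sum[of i UNIV "\<lambda>i. \<bar>Ai i\<bar>"] by simp
  qed
qed

text \<open>Iterating \<open>(a + b)\<^sup>2 \<le> 2 * a\<^sup>2 + 2 * b\<^sup>2\<close> costs a
  factor 2 per term, which is affordable for terms whose squares decay like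
  \<open>(1/4) ^ k\<close>.\<close>

lemma square_sum_le_weighted: "(\<Sum>k<K. x k)\<^sup>2 \<le> (\<Sum>k<K. 2 ^ Suc k * (x k)\<^sup>2)" for x :: "nat \<Rightarrow> real"
proof (induction K arbitrary: x)
  case (Suc K)
  have "(a + b)\<^sup>2 \<le> 2 * a\<^sup>2 + 2 * b\<^sup>2" for a b :: real
    using zero_le_power2[of "a - b"] by (simp add: power2_eq_square algebra_simps)
  then have "(\<Sum>k<Suc K. x k)\<^sup>2 \<le> 2 * (x 0)\<^sup>2 + 2 * (\<Sum>k<K. x (Suc k))\<^sup>2"
    unfolding sum.lessThan_Suc_shift by blast
  also have "\<dots> \<le> 2 * (x 0)\<^sup>2 + 2 * (\<Sum>k<K. 2 ^ Suc k * (x (Suc k))\<^sup>2)"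
    using Suc.IH[of "\<lambda>k. x (Suc k)"] by simp
  also have "\<dots> = (\<Sum>k<Suc K. 2 ^ Suc k * (x k)\<^sup>2)"
    unfolding sum.lessThan_Suc_shift by (simp add: sum_distrib_left mult.assoc)
  finally show ?case .
qed simp

text \<open>Picard iteration: \<open>majorant d k\<close> bounds the \<open>k\<close>-th increment in the weighted supremum norm.\<close>

primrec majorant :: "(int^2 \<Rightarrow> real) \<Rightarrow> nat \<Rightarrow> int^2 \<Rightarrow> real" where
  "majorant d 0 = d"
| "majorant d (Suc k) = (\<lambda>n. nbr_sum (majorant d k) n / 8)"

lemma majorant_nonneg: "(\<And>n. d n \<ge> 0) \<Longrightarrow> majorant d k n \<ge> 0"
  by (induction k arbitrary: n) (auto simp: nbr_sum_nonneg)

lemma majorant_bound: "(\<And>n. d n \<le> B) \<Longrightarrow> majorant d k n \<le> B * (1/2) ^ k"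
proof (induction k arbitrary: n)
  case (Suc k)
  have "nbr_sum (majorant d k) n \<le> nbr_sum (\<lambda>n. B * (1/2) ^ k) n"
    by (intro nbr_sum_mono Suc)
  then show ?case by (simp add: nbr_sum_def)
qed simp

text \<open>Cauchy-Schwarz over four neighbours and the fourfold count of every mode give
  \<open>4 * 4 / 64 = 1/4\<close> per step.\<close>

lemma majorant_square_summable:
  assumes "((\<lambda>n. (d n)\<^sup>2) has_sum Q) UNIV"
  shows "\<exists>q. ((\<lambda>n. (majorant d k n)\<^sup>2) has_sum q) UNIV \<and> q \<le> (1/4) ^ k * Q"
proof (induction k)
  case 0
  show ?case using assms by auto
next
  case (Suc k)
  then obtain q where q: "((\<lambda>n. (majorant d k n)\<^sup>2) has_sum q) UNIV" "q \<le> (1/4) ^ k * Q" by blast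
  have h: "((\<lambda>n. (1/16) * nbr_sum (\<lambda>n. (majorant d k n)\<^sup>2) n) has_sum (1/16) * (4 * q)) UNIV"
    by (intro has_sum_cmult_right has_sum_nbr_sum q)
  have le: "(majorant d (Suc k) n)\<^sup>2 \<le> (1/16) * nbr_sum (\<lambda>n. (majorant d k n)\<^sup>2) n" for n
    using nbr_sum_square[of "majorant d k" n] by (simp add: power_divide)
  have s: "(\<lambda>n. (majorant d (Suc k) n)\<^sup>2) summable_on UNIV"
    by (rule summable_on_comparison_test[OF has_sum_imp_summable[OF h]]) (use le in auto)
  have "infsum (\<lambda>n. (majorant d (Suc k) n)\<^sup>2) UNIV \<le> (1/16) * (4 * q)"
    by (rule has_sum_mono[OF has_sum_infsum[OF s] h]) (rule le)
  also have "\<dots> \<le> (1/4) ^ Suc k * Q" using q(2) by simp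
  finally show ?case using has_sum_infsum[OF s] by blast
qed

text \<open>The sum of the majorants will bound the modes at all times at once; it is
  square-summable because the decay \<open>(1/4) ^ k\<close> outweighs the factors
  \<open>2 ^ Suc k\<close> of \<open>square_sum_le_weighted\<close>.\<close>

lemma majorant_sum_square_summable:
  assumes d: "((\<lambda>n. (d n)\<^sup>2) has_sum Q) UNIV" and d0: "\<And>n. d n \<ge> 0"
  shows "summable (\<lambda>k. majorant d k n)" "(\<lambda>n. (\<Sum>k. majorant d k n)\<^sup>2) summable_on UNIV"
proof -
  have dB: "d n \<le> sqrt Q" for n
    using finite_sum_le_has_sum[OF d, of "{n}"] by (simp add: real_le_rsqrt)
  show s: "summable (\<lambda>k. majorant d k n)" for n
  proof (rule summable_comparison_test')
    show "summable (\<lambda>k. sqrt Q * (1/2) ^ k)" by (intro summable_mult summable_geometric) auto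
    show "norm (majorant d k n) \<le> sqrt Q * (1/2) ^ k" for k
      using majorant_bound[OF dB] majorant_nonneg[OF d0] by simp
  qed
  have Q0: "Q \<ge> 0" using has_sum_nonneg[OF d] by simp
  have fin: "(\<Sum>n\<in>F. (\<Sum>k<K. majorant d k n)\<^sup>2) \<le> 4 * Q" if F: "finite F" for F K
  proof -
    have "(\<Sum>n\<in>F. (\<Sum>k<K. majorant d k n)\<^sup>2) \<le> (\<Sum>n\<in>F. \<Sum>k<K. 2 ^ Suc k * (majorant d k n)\<^sup>2)"
      by (intro sum_mono square_sum_le_weighted)
    also have "\<dots> = (\<Sum>k<K. 2 ^ Suc k * (\<Sum>n\<in>F. (majorant d k n)\<^sup>2))"
      by (subst sum.swap) (simp add: sum_distrib_left)
    also have "\<dots> \<le> (\<Sum>k<K. 2 * Q * (1/2) ^ k)"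
    proof (rule sum_mono)
      fix k
      obtain q where q: "((\<lambda>n. (majorant d k n)\<^sup>2) has_sum q) UNIV" "q \<le> (1/4) ^ k * Q"
        using majorant_square_summable[OF d] by blast
      have "(\<Sum>n\<in>F. (majorant d k n)\<^sup>2) \<le> (1/4) ^ k * Q"
        using finite_sum_le_has_sum[OF q(1) F] q(2) by simp
      then have "2 ^ Suc k * (\<Sum>n\<in>F. (majorant d k n)\<^sup>2) \<le> 2 ^ Suc k * ((1/4) ^ k * Q)"
        by (rule mult_left_mono) simp
      also have "\<dots> = 2 * Q * (2 * (1/4)) ^ k" unfolding power_mult_distrib by simp
      finally show "2 ^ Suc k * (\<Sum>n\<in>F. (majorant d k n)\<^sup>2) \<le> 2 * Q * (1/2) ^ k" by simp
    qed
    also have "\<dots> = 2 * Q * (\<Sum>k<K. (1/2) ^ k)" by (simp add: sum_distrib_left)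
    also have "\<dots> \<le> 2 * Q * 2"
      using Q0 by (intro mult_left_mono) (auto simp: sum_gp_strict)
    finally show ?thesis by simp
  qed
  show "(\<lambda>n. (\<Sum>k. majorant d k n)\<^sup>2) summable_on UNIV"
  proof (rule nonneg_bdd_above_summable_on)
    show "bdd_above (sum (\<lambda>n. (\<Sum>k. majorant d k n)\<^sup>2) ` {F. F \<subseteq> UNIV \<and> finite F})"
    proof (rule bdd_aboveI2)
      fix F :: "(int^2) set" assume "F \<in> {F. F \<subseteq> UNIV \<and> finite F}"
      then have F: "finite F" by simp
      have "(\<lambda>K. \<Sum>n\<in>F. (\<Sum>k<K. majorant d k n)\<^sup>2) \<longlonglongrightarrow> (\<Sum>n\<in>F. (\<Sum>k. majorant d k n)\<^sup>2)"
        by (intro tendsto_intros summable_LIMSEQ s)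
      then show "(\<Sum>n\<in>F. (\<Sum>k. majorant d k n)\<^sup>2) \<le> 4 * Q"
        by (rule tendsto_upperbound) (use fin[OF F] in auto)
    qed
  qed simp
qed

text \<open>Increments rather than iterates: the first is the heat flow of the data, and the partial
  sums satisfy the integral equation with a lag of one.\<close>

primrec picard :: "(2 \<Rightarrow> real \<Rightarrow> real) \<Rightarrow> (int^2 \<Rightarrow> complex) \<Rightarrow> nat \<Rightarrow> int^2 \<Rightarrow> real \<Rightarrow> complex" where
  "picard a c0 0 n t = exp (- lap n * t) *\<^sub>R c0 n"
| "picard a c0 (Suc k) n t = - duhamel (lap n) (transport a (picard a c0 k) n) t"

text \<open>Besides a solution this delivers the time-independent square-summable bound
  \<open>g\<close>, on which the later exchanges of sums over modes with integrals rest.\<close>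

theorem mode_solution_exists:
  assumes \<tau>: "0 \<le> \<tau>" and a: "\<And>i. continuous_on {0..\<tau>} (a i)" and c0: "(\<lambda>n. (cmod (c0 n))\<^sup>2) summable_on UNIV"
  obtains c g where "mode_solution \<tau> a c" "\<And>n. c n 0 = c0 n"
    "\<And>n t. t \<in> {0..\<tau>} \<Longrightarrow> cmod (c n t) \<le> g n" "(\<lambda>n. (g n)\<^sup>2) summable_on UNIV"
proof -
  obtain A where A0: "A \<ge> 0" and A: "\<And>i t. t \<in> {0..\<tau>} \<Longrightarrow> \<bar>a i t\<bar> \<le> A" using bounded_on_Icc[of \<tau> a, OF a] by metis
  define M where "M = 8 * A\<^sup>2 + 1"
  have M: "M > 0" by (simp add: M_def add_nonneg_pos)
  let ?d = "\<lambda>n. cmod (c0 n)"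
  obtain Q where Q: "((\<lambda>n. (?d n)\<^sup>2) has_sum Q) UNIV" using c0 by (auto simp: summable_on_def)
  note ms = majorant_sum_square_summable[OF Q norm_ge_zero]
  let ?m = "majorant ?d"
  let ?p = "picard a c0"
  have cp: "continuous_on {0..\<tau>} (?p k n)" for k n
  proof (induction k arbitrary: n)
    case 0
    show ?case by (simp add: continuous_intros)
  next
    case (Suc k)
    show ?case by (simp, intro continuous_intros duhamel_continuous continuous_transport a Suc)
  qed
  have bp: "cmod (?p k n t) \<le> ?m k n * exp (M * t)" if "t \<in> {0..\<tau>}" for k n t
    using that
  proof (induction k arbitrary: n t)
    case 0
    have "exp (- lap n * t) \<le> exp (M * t)" using 0 M by (auto intro: order_trans[of _ 0])
    then show ?case by (simp add: mult.commute mult_left_mono)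
  next
    case (Suc k)
    show ?case
      using duhamel_transport_bound[OF a A A0 cp _ Suc.prems, where S = "?m k" and n = n] Suc.IH by (simp add: M_def)
  qed
  define E where "E = exp (M * \<bar>\<tau>\<bar>)"
  have E: "exp (M * t) \<le> E" if "t \<in> {0..\<tau>}" for t using that M by (simp add: E_def)
  define g where "g n = (\<Sum>k. ?m k n) * E" for n
  have bp': "norm (?p k n t) \<le> ?m k n * E" if "t \<in> {0..\<tau>}" for k n t
    using order_trans[OF bp[OF that] mult_left_mono[OF E[OF that] majorant_nonneg]] by simp
  have sE: "summable (\<lambda>k. ?m k n * E)" for n by (intro summable_mult2 ms)
  have sp: "summable (\<lambda>k. norm (?p k n t))" if "t \<in> {0..\<tau>}" for n t
    by (rule summable_comparison_test'[OF sE[of n]]) (use bp'[OF that] in simp)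
  define c where "c n t = (\<Sum>k. ?p k n t)" for n t
  have cg: "cmod (c n t) \<le> g n" if "t \<in> {0..\<tau>}" for n t
  proof -
    have "cmod (c n t) \<le> (\<Sum>k. norm (?p k n t))" unfolding c_def by (rule summable_norm[OF sp[OF that]])
    also have "\<dots> \<le> (\<Sum>k. ?m k n * E)" by (rule suminf_le[OF bp'[OF that] sp[OF that] sE])
    also have "\<dots> = g n" unfolding g_def by (rule suminf_mult2[symmetric, OF ms(1)])
    finally show ?thesis .
  qed
  have cc: "continuous_on {0..\<tau>} (c n)" for n
  proof (rule uniform_limit_theorem)
    show "uniform_limit {0..\<tau>} (\<lambda>K t. \<Sum>k<K. ?p k n t) (c n) sequentially"
      unfolding c_def by (rule Weierstrass_m_test[OF bp' sE])
    show "\<forall>\<^sub>F K in sequentially. continuous_on {0..\<tau>} (\<lambda>t. \<Sum>k<K. ?p k n t)"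
      by (intro always_eventually allI continuous_intros cp)
  qed simp
  \<comment> \<open>The tail of the majorants measures the distance to the \<open>K\<close>-th
    partial sum in the weighted norm, so the limit may be taken inside
    \<open>duhamel\<close>.\<close>
  define tl where "tl K n = (\<Sum>k. ?m (k + K) n)" for K n
  have tl: "cmod (c n t - (\<Sum>k<K. ?p k n t)) \<le> tl K n * exp (M * t)" if t: "t \<in> {0..\<tau>}" for K n t
  proof -
    have s1: "summable (\<lambda>k. norm (?p (k + K) n t))" using summable_ignore_initial_segment[OF sp[OF t]] .
    have s2: "summable (\<lambda>k. ?m (k + K) n)" using summable_ignore_initial_segment[OF ms(1)] .
    have "c n t - (\<Sum>k<K. ?p k n t) = (\<Sum>k. ?p (k + K) n t)"
      unfolding c_def by (simp add: suminf_minus_initial_segment[OF summable_norm_cancel[OF sp[OF t]]])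
    also have "cmod \<dots> \<le> (\<Sum>k. norm (?p (k + K) n t))" by (rule summable_norm[OF s1])
    also have "\<dots> \<le> (\<Sum>k. ?m (k + K) n * exp (M * t))"
      by (rule suminf_le[OF bp[OF t] s1 summable_mult2[OF s2]])
    also have "\<dots> = tl K n * exp (M * t)" unfolding tl_def by (rule suminf_mult2[symmetric, OF s2])
    finally show ?thesis .
  qed
  have tl0: "(\<lambda>K. tl K n) \<longlonglongrightarrow> 0" for n
    unfolding tl_def using suminf_exist_split2[OF ms(1)] by (simp add: add.commute)
  \<comment> \<open>Telescoping by linearity: transporting the first \<open>K\<close> increments
    produces the increments 1 to \<open>K\<close>.\<close>
  have part: "(\<Sum>k<Suc K. ?p k n t) = exp (- lap n * t) *\<^sub>R c0 n
      - duhamel (lap n) (transport a (\<lambda>n t. \<Sum>k<K. ?p k n t) n) t" if t: "t \<in> {0..\<tau>}" for K n t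
  proof (induction K)
    case 0
    show ?case by (simp add: transport_def duhamel_def)
  next
    case (Suc K)
    let ?s = "\<lambda>n t. \<Sum>k<K. ?p k n t"
    have "duhamel (lap n) (transport a (\<lambda>n t. \<Sum>k<Suc K. ?p k n t) n) t - duhamel (lap n) (transport a ?s n) t
        = duhamel (lap n) (\<lambda>s. transport a (\<lambda>n t. \<Sum>k<Suc K. ?p k n t) n s - transport a ?s n s) t"
      by (rule duhamel_diff[symmetric, OF _ _ t]) (intro continuous_transport a continuous_intros cp)+
    also have "(\<lambda>s. transport a (\<lambda>n t. \<Sum>k<Suc K. ?p k n t) n s - transport a ?s n s) = transport a (?p K) n"
      by (simp flip: transport_diff)
    finally show ?case using Suc by (simp add: algebra_simps)
  qed
  have fix_eq: "c n t = exp (- lap n * t) *\<^sub>R c0 n - duhamel (lap n) (transport a c n) t" if t: "t \<in> {0..\<tau>}" for n t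
  proof -
    let ?s = "\<lambda>K n t. \<Sum>k<K. ?p k n t"
    have cs: "continuous_on {0..\<tau>} (?s K n)" for K n by (intro continuous_intros cp)
    have est: "cmod (duhamel (lap n) (transport a c n) t - duhamel (lap n) (transport a (?s K) n) t)
        \<le> nbr_sum (tl K) n / 8 * exp (M * t)" for K
    proof -
      have "duhamel (lap n) (transport a c n) t - duhamel (lap n) (transport a (?s K) n) t
        = duhamel (lap n) (transport a (\<lambda>n t. c n t - ?s K n t) n) t"
        unfolding transport_diff[abs_def]
        by (rule duhamel_diff[symmetric, OF _ _ t]) (intro continuous_transport a cc cs)+
      also have "cmod \<dots> \<le> nbr_sum (tl K) n / 8 * exp (M * t)"
        unfolding M_def
        by (rule duhamel_transport_bound[OF a A A0 _ _ t])
           (use tl[unfolded M_def] in \<open>auto intro!: continuous_intros cc cp\<close>)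
      finally show ?thesis .
    qed
    have l: "(\<lambda>K. nbr_sum (tl K) n / 8 * exp (M * t)) \<longlonglongrightarrow> 0"
      unfolding nbr_sum_def by (auto intro!: tendsto_eq_intros tl0)
    have "(\<lambda>K. duhamel (lap n) (transport a c n) t - duhamel (lap n) (transport a (?s K) n) t) \<longlonglongrightarrow> 0"
      by (rule Lim_null_comparison[OF always_eventually[OF allI[OF est]] l])
    then have "(\<lambda>K. exp (- lap n * t) *\<^sub>R c0 n - duhamel (lap n) (transport a c n) t
        + (duhamel (lap n) (transport a c n) t - duhamel (lap n) (transport a (?s K) n) t))
        \<longlonglongrightarrow> exp (- lap n * t) *\<^sub>R c0 n - duhamel (lap n) (transport a c n) t + 0"
      by (intro tendsto_add tendsto_const)
    then have "(\<lambda>K. ?s (Suc K) n t) \<longlonglongrightarrow> exp (- lap n * t) *\<^sub>R c0 n - duhamel (lap n) (transport a c n) t"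
      unfolding part[OF t] by simp
    moreover have "(\<lambda>K. ?s (Suc K) n t) \<longlonglongrightarrow> c n t"
      unfolding c_def by (rule LIMSEQ_Suc[OF summable_LIMSEQ[OF summable_norm_cancel[OF sp[OF t]]]])
    ultimately show ?thesis by (rule LIMSEQ_unique[symmetric])
  qed
  \<comment> \<open>Differentiating the integral equation avoids differentiating the series.\<close>
  have "mode_solution \<tau> a c"
    unfolding mode_solution_def
  proof (intro allI ballI)
    fix n t assume t: "t \<in> {0..\<tau>}"
    have "((\<lambda>t. exp (- lap n * t) *\<^sub>R c0 n - duhamel (lap n) (transport a c n) t) has_vector_derivative
       (- lap n * exp (- lap n * t)) *\<^sub>R c0 n
        - (transport a c n t - of_real (lap n) * duhamel (lap n) (transport a c n) t)) (at t within {0..\<tau>})"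
    proof (rule has_vector_derivative_diff[OF _ duhamel_has_derivative[OF _ t]])
      have "((\<lambda>t. exp (- lap n * t)) has_real_derivative (- lap n * exp (- lap n * t))) (at t within {0..\<tau>})"
        by (auto intro!: derivative_eq_intros)
      from has_vector_derivative_scaleR[OF this has_vector_derivative_const[of "c0 n"]]
      show "((\<lambda>t. exp (- lap n * t) *\<^sub>R c0 n) has_vector_derivative (- lap n * exp (- lap n * t)) *\<^sub>R c0 n) (at t within {0..\<tau>})"
        by simp
      show "continuous_on {0..\<tau>} (transport a c n)" by (intro continuous_transport a cc)
    qed
    moreover have "(- lap n * exp (- lap n * t)) *\<^sub>R c0 n
        - (transport a c n t - of_real (lap n) * duhamel (lap n) (transport a c n) t)
        = - of_real (lap n) * c n t - transport a c n t"
      by (subst fix_eq[OF t]) (simp add: scaleR_conv_of_real algebra_simps)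
    ultimately have "((\<lambda>t. exp (- lap n * t) *\<^sub>R c0 n - duhamel (lap n) (transport a c n) t) has_vector_derivative
       (- of_real (lap n) * c n t - transport a c n t)) (at t within {0..\<tau>})" by (simp only:)
    then show "(c n has_vector_derivative - of_real (lap n) * c n t - transport a c n t) (at t within {0..\<tau>})"
      by (rule has_vector_derivative_transform[OF t, rotated]) (rule fix_eq)
  qed
  moreover have "c n 0 = c0 n" for n
    using fix_eq[of 0 n] \<tau> by simp
  moreover have "(\<lambda>n. (g n)\<^sup>2) summable_on UNIV"
    unfolding g_def power_mult_distrib by (intro summable_on_cmult_left ms)
  ultimately show thesis using that cg by blast
qed

section \<open>Enhanced dissipation along a line of modes\<close>

lemma telescope_bound:
  fixes \<rho> :: "int \<Rightarrow> real"
  assumes "\<And>j. a \<le> j \<Longrightarrow> j < a + int k \<Longrightarrow> \<bar>\<rho> (j + 1) - \<rho> j\<bar> \<le> z"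
  shows "\<bar>\<rho> (a + int k) - \<rho> a\<bar> \<le> real k * z"
  using assms
proof (induction k)
  case (Suc k)
  have "\<bar>\<rho> (a + int k + 1) - \<rho> (a + int k)\<bar> \<le> z" using Suc.prems[of "a + int k"] by simp
  moreover have "\<bar>\<rho> (a + int k) - \<rho> a\<bar> \<le> real k * z" using Suc by simp
  moreover have "a + int (Suc k) = a + int k + 1" by simp
  ultimately show ?case by (simp add: algebra_simps)
qed simp

text \<open>If \<open>\<rho>\<close> is almost constant on a long stretch then it is small there, since it is summable;
  then \<open>X j + \<eta> j\<^sup>2\<close> is convex, and a summable sequence with this property is small.\<close>

lemma convex_sequence_small:
  fixes X \<rho> :: "int \<Rightarrow> real" and J L :: nat
  assumes X0: "\<And>j. X j \<ge> 0" and D: "\<And>F. finite F \<Longrightarrow> sum X F \<le> D" and J: "0 < J" "J \<le> L"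
    and up: "\<And>j. \<bar>\<rho> j\<bar> \<le> X j + (X (j - 1) + X (j + 1)) / 2"
    and lo: "\<And>j. X j \<le> \<bar>\<rho> j\<bar> + (X (j - 1) + X (j + 1)) / 2"
    and \<zeta>: "\<And>j. \<bar>j\<bar> \<le> int L \<Longrightarrow> \<bar>\<rho> (j + 1) - \<rho> j\<bar> \<le> \<zeta>" and \<zeta>0: "\<zeta> \<ge> 0"
  shows "X 0 \<le> D / real J + (2 * D / real L + 2 * real L * \<zeta>) * (real J)\<^sup>2"
proof -
  define \<eta> where "\<eta> = 2 * D / real L + 2 * real L * \<zeta>"
  have L: "L > 0" using J by simp
  have D0: "D \<ge> 0" using D[of "{}"] by simp
  have \<eta>0: "\<eta> \<ge> 0" using D0 \<zeta>0 by (simp add: \<eta>_def)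
  have shift_sum: "(\<Sum>j\<in>{1..int L}. X (j + s)) \<le> D" for s
  proof -
    have "(\<Sum>j\<in>{1..int L}. X (j + s)) = sum X ((\<lambda>j. j + s) ` {1..int L})"
      by (subst sum.reindex) (auto simp: inj_on_def)
    then show ?thesis using D by simp
  qed
  \<comment> \<open>Pigeonhole: the sum of \<open>\<bar>\<rho> j\<bar>\<close> over \<open>L\<close>
    points is at most \<open>2 * D\<close>, so some value does not exceed the average.\<close>
  have "\<exists>j0\<in>{1..int L}. \<bar>\<rho> j0\<bar> \<le> 2 * D / real L"
  proof (rule ccontr)
    assume "\<not> ?thesis"
    then have "(\<Sum>j\<in>{1..int L}. 2 * D / real L) < (\<Sum>j\<in>{1..int L}. \<bar>\<rho> j\<bar>)"
      using L by (intro sum_strict_mono) (auto simp: not_le)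
    also have "\<dots> \<le> (\<Sum>j\<in>{1..int L}. X (j + 0) + (X (j + - 1) + X (j + 1)) / 2)"
      using up by (intro sum_mono) simp
    also have "\<dots> = (\<Sum>j\<in>{1..int L}. X (j + 0)) + ((\<Sum>j\<in>{1..int L}. X (j + - 1)) + (\<Sum>j\<in>{1..int L}. X (j + 1))) / 2"
      by (simp add: sum.distrib flip: sum_divide_distrib)
    also have "\<dots> \<le> 2 * D" using shift_sum[of 0] shift_sum[of "- 1"] shift_sum[of 1] by argo
    finally show False using L by simp
  qed
  then obtain j0 where j0: "1 \<le> j0" "j0 \<le> int L" "\<bar>\<rho> j0\<bar> \<le> 2 * D / real L" by auto
  \<comment> \<open>From \<open>j0\<close> any point of the range is reached in at most
    \<open>2 * L\<close> steps, each changing \<rho> by at most \<zeta>.\<close>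
  have \<rho>: "\<bar>\<rho> j\<bar> \<le> \<eta>" if j: "\<bar>j\<bar> \<le> int L" for j
  proof -
    have "\<bar>\<rho> (max j j0) - \<rho> (min j j0)\<bar> \<le> real (nat (max j j0 - min j j0)) * \<zeta>"
      using telescope_bound[of "min j j0" "nat (max j j0 - min j j0)" \<rho> \<zeta>] j j0 \<zeta>
      by (auto simp: max_def min_def split: if_splits)
    also have "\<dots> \<le> (2 * real L) * \<zeta>"
      using j j0 \<zeta>0 by (intro mult_right_mono) (auto simp: max_def min_def)
    finally have "\<bar>\<rho> j - \<rho> j0\<bar> \<le> 2 * real L * \<zeta>" by (auto simp: max_def min_def split: if_splits)
    then show ?thesis using j0(3) by (simp add: \<eta>_def)
  qed
  \<comment> \<open>Symmetrising about 0 removes the unknown slope: the inequality at 0 already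
    bounds \<open>Y 1 - Y 0\<close> from below.\<close>
  define Y where "Y k = X (int k) + X (- int k)" for k
  have conv: "2 * Y (Suc k) \<le> Y k + Y (Suc (Suc k)) + 4 * \<eta>" if "Suc k \<le> L" for k
  proof -
    have "X (int k + 1) \<le> \<bar>\<rho> (int k + 1)\<bar> + (X (int k) + X (int k + 2)) / 2"
      using lo[of "int k + 1"] by (simp add: add.commute)
    moreover have "X (- int k - 1) \<le> \<bar>\<rho> (- int k - 1)\<bar> + (X (- int k - 2) + X (- int k)) / 2"
    proof -
      have e: "- int k - 1 - 1 = - int k - 2" "- int k - 1 + 1 = - int k" by simp_all
      show ?thesis using lo[of "- int k - 1"] unfolding e .
    qed
    moreover have "Y k = X (int k) + X (- int k)" by (simp add: Y_def)
    moreover have "Y (Suc k) = X (int k + 1) + X (- int k - 1)"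
      unfolding Y_def by (intro arg_cong2[where f = "(+)"] arg_cong[where f = X]) simp_all
    moreover have "Y (Suc (Suc k)) = X (int k + 2) + X (- int k - 2)"
      unfolding Y_def by (intro arg_cong2[where f = "(+)"] arg_cong[where f = X]) simp_all
    moreover have "\<bar>\<rho> (int k + 1)\<bar> \<le> \<eta>" "\<bar>\<rho> (- int k - 1)\<bar> \<le> \<eta>" using that by (auto intro!: \<rho>)
    moreover have "2 * (p + p') \<le> q + q' + (u + u') + 4 * \<eta>"
      if "p \<le> r + (q + u) / 2" "p' \<le> r' + (u' + q') / 2" "r \<le> \<eta>" "r' \<le> \<eta>" for p p' q q' u u' r r' :: real
      using that by argo
    ultimately show ?thesis by simp
  qed
  have inc: "Y (Suc k) \<ge> Y k - 2 * \<eta> * (2 * real k + 1)" if "k \<le> L" for k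
    using that
  proof (induction k)
    case 0
    have "X 0 \<le> \<bar>\<rho> 0\<bar> + (X (- 1) + X 1) / 2" "\<bar>\<rho> 0\<bar> \<le> \<eta>" using lo[of 0] \<rho>[of 0] by simp_all
    then have "2 * X 0 - 2 * \<eta> \<le> X 1 + X (- 1)" by argo
    then show ?case by (simp add: Y_def)
  next
    case (Suc k)
    then show ?case using conv[of k] by (simp add: algebra_simps)
  qed
  \<comment> \<open>The losses add up as \<open>1 + 3 + ... + (2 * k - 1) = k\<^sup>2\<close>. A
    large \<open>X 0\<close> would thus force \<open>J\<close> large values of \<open>Y\<close>,
    whose sum is at most \<open>D\<close>.\<close>
  have Yj: "Y k \<ge> 2 * X 0 - 2 * \<eta> * (real k)\<^sup>2" if "k \<le> L" for k
    using that
  proof (induction k)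
    case 0
    then show ?case by (simp add: Y_def)
  next
    case (Suc k)
    then show ?case using inc[of k] by (simp add: power2_eq_square algebra_simps)
  qed
  have "real J * (2 * X 0 - 2 * \<eta> * (real J)\<^sup>2) = (\<Sum>k\<in>{1..J}. 2 * X 0 - 2 * \<eta> * (real J)\<^sup>2)" by simp
  also have "\<dots> \<le> (\<Sum>k\<in>{1..J}. Y k)"
  proof (rule sum_mono)
    fix k assume k: "k \<in> {1..J}"
    have "\<eta> * (real k)\<^sup>2 \<le> \<eta> * (real J)\<^sup>2" using k \<eta>0 by (intro mult_left_mono power_mono) auto
    then show "2 * X 0 - 2 * \<eta> * (real J)\<^sup>2 \<le> Y k" using Yj[of k] k J by simp
  qed
  also have "\<dots> = sum X (int ` {1..J}) + sum X ((\<lambda>k. - int k) ` {1..J})"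
    unfolding Y_def sum.distrib by (simp add: sum.reindex inj_on_def)
  also have "\<dots> = sum X (int ` {1..J} \<union> (\<lambda>k. - int k) ` {1..J})"
    by (rule sum.union_disjoint[symmetric]) auto
  also have "\<dots> \<le> D" by (rule D) simp
  finally have "2 * X 0 - 2 * \<eta> * (real J)\<^sup>2 \<le> D / real J" using J by (simp add: field_simps)
  moreover have "D / real J \<ge> 0" using D0 by simp
  ultimately show ?thesis using X0[of 0] unfolding \<eta>_def[symmetric] by simp
qed

text \<open>The constants are chosen in the order \<open>J\<close>, \<open>L\<close>,
  \<open>\<zeta>\<close>: \<open>J\<close> makes the first term of the previous bound at most
  \<open>\<epsilon> / 2\<close>, then \<open>L\<close> and \<open>\<zeta>\<close> make each of the
  other two at most \<open>\<epsilon> / 4\<close>. They depend on \<open>D\<close> and \<epsilon>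
  alone, which is the source of uniformity over all solutions.\<close>

lemma tridiagonal_decay:
  fixes D \<epsilon> :: real
  assumes D: "D \<ge> 0" and \<epsilon>: "\<epsilon> > 0"
  obtains L :: nat and \<zeta> where "\<zeta> > 0"
    "\<And>X \<rho>. (\<And>j. X j \<ge> 0) \<Longrightarrow> (\<And>F. finite F \<Longrightarrow> sum X F \<le> D) \<Longrightarrow>
       (\<And>j. \<bar>\<rho> j\<bar> \<le> X j + (X (j - 1) + X (j + 1)) / 2) \<Longrightarrow>
       (\<And>j. X j \<le> \<bar>\<rho> j\<bar> + (X (j - 1) + X (j + 1)) / 2) \<Longrightarrow>
       (\<And>j. \<bar>j\<bar> \<le> int L \<Longrightarrow> \<bar>\<rho> (j + 1) - \<rho> j\<bar> \<le> \<zeta>) \<Longrightarrow> X 0 \<le> \<epsilon>"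
proof -
  obtain J :: nat where J: "real J > 2 * D / \<epsilon>" using reals_Archimedean2 by blast
  have "2 * D / \<epsilon> \<ge> 0" using D \<epsilon> by simp
  then have J0: "J > 0" using J by (cases J) auto
  obtain L0 :: nat where L0: "real L0 > 8 * D * (real J)\<^sup>2 / \<epsilon>" using reals_Archimedean2 by blast
  define L where "L = max J L0"
  have L: "L \<ge> J" "real L > 8 * D * (real J)\<^sup>2 / \<epsilon>" using L0 by (auto simp: L_def)
  have L1: "L > 0" using L(1) J0 by simp
  define \<zeta> where "\<zeta> = \<epsilon> / (8 * real L * (real J)\<^sup>2)"
  show thesis
  proof
    show "\<zeta> > 0" using \<epsilon> L1 J0 by (simp add: \<zeta>_def)
    fix X \<rho> :: "int \<Rightarrow> real"
    assume *: "\<And>j. X j \<ge> 0" "\<And>F. finite F \<Longrightarrow> sum X F \<le> D"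
       "\<And>j. \<bar>\<rho> j\<bar> \<le> X j + (X (j - 1) + X (j + 1)) / 2"
       "\<And>j. X j \<le> \<bar>\<rho> j\<bar> + (X (j - 1) + X (j + 1)) / 2"
       "\<And>j. \<bar>j\<bar> \<le> int L \<Longrightarrow> \<bar>\<rho> (j + 1) - \<rho> j\<bar> \<le> \<zeta>"
    have "X 0 \<le> D / real J + (2 * D / real L + 2 * real L * \<zeta>) * (real J)\<^sup>2"
      by (rule convex_sequence_small[where \<rho> = \<rho>]) (use * J0 L(1) \<open>\<zeta> > 0\<close> in auto)
    moreover have "D / real J \<le> \<epsilon> / 2" using J J0 \<epsilon> by (simp add: field_simps)
    moreover have "2 * D / real L * (real J)\<^sup>2 \<le> \<epsilon> / 4" using L(2) L1 \<epsilon> by (simp add: field_simps)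
    moreover have "2 * real L * \<zeta> * (real J)\<^sup>2 = \<epsilon> / 4" using L1 J0 by (simp add: \<zeta>_def field_simps)
    ultimately show "X 0 \<le> \<epsilon>" by (simp add: distrib_right)
  qed
qed

section \<open>Energy balance of the modes\<close>

lemma FTC_lebesgue:
  fixes F :: "real \<Rightarrow> real"
  assumes "s \<le> t" "\<And>r. r \<in> {s..t} \<Longrightarrow> (F has_real_derivative f r) (at r within {s..t})" "continuous_on {s..t} f"
  shows "(\<integral>r. f r \<partial>lebesgue_on {s..t}) = F t - F s"
proof -
  have "(f has_integral (F t - F s)) {s..t}"
    using assms by (intro fundamental_theorem_of_calculus) (auto simp: has_real_derivative_iff_has_vector_derivative)
  then show ?thesis
    using assms(3) by (simp add: lebesgue_integral_eq_integral continuous_imp_integrable_real integral_unique)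
qed

lemma measure_lebesgue_on_Icc [simp]: "s \<le> t \<Longrightarrow> measure (lebesgue_on {s..t}) {s..t} = t - s" for s t :: real
  by (simp add: measure_restrict_space)

lemma inner_damped:
  "u \<bullet> (- of_real l * u - T) + (- of_real l * u - T) \<bullet> u = - 2 * l * (u \<bullet> u) - 2 * (u \<bullet> T)" for u T :: complex
  by (simp add: inner_complex_def algebra_simps)

locale mode_flow =
  fixes \<tau> :: real and a :: "2 \<Rightarrow> real \<Rightarrow> real" and c :: "int^2 \<Rightarrow> real \<Rightarrow> complex" and g :: "int^2 \<Rightarrow> real"
    and A :: real
  assumes sol: "mode_solution \<tau> a c"
    and a_cont: "\<And>i. continuous_on {0..\<tau>} (a i)" and a_bound: "\<And>i t. t \<in> {0..\<tau>} \<Longrightarrow> \<bar>a i t\<bar> \<le> A"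
    and c_bound: "\<And>n t. t \<in> {0..\<tau>} \<Longrightarrow> cmod (c n t) \<le> g n" and g_sum: "(\<lambda>n. (g n)\<^sup>2) summable_on UNIV"
    and \<tau>_nonneg: "0 \<le> \<tau>"
begin

definition energy :: "(int^2) set \<Rightarrow> real \<Rightarrow> real" where
  "energy K t = (\<Sum>\<^sub>\<infinity>n\<in>K. (cmod (c n t))\<^sup>2)"

definition mass :: "real \<Rightarrow> real \<Rightarrow> int^2 \<Rightarrow> real" where
  "mass s t n = (\<integral>r. (cmod (c n r))\<^sup>2 \<partial>lebesgue_on {s..t})"

text \<open>The energy handed from \<open>n + shift i\<close> to \<open>n\<close> during the
  interval. It enters the balance of the two modes with opposite signs, because
  \<open>cross i\<close> takes the same value on both.\<close>

definition flux :: "2 \<Rightarrow> real \<Rightarrow> real \<Rightarrow> int^2 \<Rightarrow> real" where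
  "flux i s t n = (\<integral>r. a i r * of_int (cross i n) * (c n r \<bullet> c (n + shift i) r) \<partial>lebesgue_on {s..t})"

lemma A_nonneg: "A \<ge> 0"
  using a_bound[of 0 1] \<tau>_nonneg by simp

lemma g_nonneg: "g n \<ge> 0"
  using c_bound[of 0 n] \<tau>_nonneg order_trans[OF norm_ge_zero] by simp

lemma c_deriv:
  "t \<in> {0..\<tau>} \<Longrightarrow> (c n has_vector_derivative (- of_real (lap n) * c n t - transport a c n t)) (at t within {0..\<tau>})"
  using sol by (simp add: mode_solution_def)

lemma c_cont: "continuous_on {0..\<tau>} (c n)"
  using c_deriv has_vector_derivative_continuous unfolding continuous_on_eq_continuous_within by blast

lemma c_square_le: "t \<in> {0..\<tau>} \<Longrightarrow> (cmod (c n t))\<^sup>2 \<le> (g n)\<^sup>2"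
  by (rule power_mono[OF c_bound norm_ge_zero])

lemma c_square_summable: "t \<in> {0..\<tau>} \<Longrightarrow> (\<lambda>n. (cmod (c n t))\<^sup>2) summable_on K"
proof -
  assume t: "t \<in> {0..\<tau>}"
  have "(\<lambda>n. (cmod (c n t))\<^sup>2) summable_on UNIV"
    by (rule summable_on_comparison_test[OF g_sum]) (use c_square_le[OF t] in auto)
  then show ?thesis by (rule summable_on_subset_banach) simp
qed

lemma inner_deriv:
  assumes "t \<in> {0..\<tau>}"
  shows "((\<lambda>r. c n r \<bullet> c m r) has_real_derivative
     (c n t \<bullet> (- of_real (lap m) * c m t - transport a c m t)
       + (- of_real (lap n) * c n t - transport a c n t) \<bullet> c m t)) (at t within {0..\<tau>})"
  using bounded_bilinear.has_vector_derivative[OF bounded_bilinear_inner c_deriv[OF assms] c_deriv[OF assms]]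
  by (simp add: has_real_derivative_iff_has_vector_derivative)

lemma inner_integral:
  assumes "0 \<le> s" "s \<le> t" "t \<le> \<tau>"
  shows "c n t \<bullet> c m t - c n s \<bullet> c m s = (\<integral>r. (c n r \<bullet> (- of_real (lap m) * c m r - transport a c m r)
       + (- of_real (lap n) * c n r - transport a c n r) \<bullet> c m r) \<partial>lebesgue_on {s..t})"
proof (rule FTC_lebesgue[symmetric])
  fix r assume "r \<in> {s..t}"
  then show "((\<lambda>r. c n r \<bullet> c m r) has_real_derivative
     (c n r \<bullet> (- of_real (lap m) * c m r - transport a c m r)
       + (- of_real (lap n) * c n r - transport a c n r) \<bullet> c m r)) (at r within {s..t})"
    using assms by (intro DERIV_subset[OF inner_deriv]) auto
next
  have "continuous_on {0..\<tau>} (\<lambda>r. c n r \<bullet> (- of_real (lap m) * c m r - transport a c m r)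
       + (- of_real (lap n) * c n r - transport a c n r) \<bullet> c m r)"
    by (intro continuous_intros continuous_transport a_cont c_cont)
  then show "continuous_on {s..t} (\<lambda>r. c n r \<bullet> (- of_real (lap m) * c m r - transport a c m r)
       + (- of_real (lap n) * c n r - transport a c n r) \<bullet> c m r)"
    by (rule continuous_on_subset) (use assms in auto)
qed (use assms in simp)

lemma integrable_on_sub:
  fixes h :: "real \<Rightarrow> 'b::euclidean_space"
  assumes "0 \<le> s" "t \<le> \<tau>" "continuous_on {0..\<tau>} h"
  shows "integrable (lebesgue_on {s..t}) h"
  by (rule continuous_imp_integrable_real, rule continuous_on_subset[OF assms(3)]) (use assms in auto)

lemma inner_transport:
  "c n r \<bullet> transport a c n r = (\<Sum>i\<in>UNIV. a i r * of_int (cross i n) / 2 * (c n r \<bullet> c (n - shift i) r - c n r \<bullet> c (n + shift i) r))"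
  unfolding transport_def inner_sum_right
  by (simp only: scaleR_conv_of_real[symmetric] inner_scaleR_right inner_diff_right)

lemma mode_energy:
  assumes st: "0 \<le> s" "s \<le> t" "t \<le> \<tau>"
  shows "(cmod (c n t))\<^sup>2 + 2 * (lap n * mass s t n) + (\<Sum>i\<in>UNIV. flux i s t (n - shift i) - flux i s t n) = (cmod (c n s))\<^sup>2"
proof -
  let ?M = "lebesgue_on {s..t}"
  have im: "integrable ?M (\<lambda>r. (cmod (c n r))\<^sup>2)"
    using st by (intro integrable_on_sub continuous_intros c_cont) auto
  have ifl: "integrable ?M (\<lambda>r. a i r * of_int (cross i n) * (c n r \<bullet> c (n + shift i) r))" for i n
    using st by (intro integrable_on_sub continuous_intros c_cont a_cont) auto
  have fl': "flux i s t (n - shift i) = (\<integral>r. a i r * of_int (cross i n) * (c n r \<bullet> c (n - shift i) r) \<partial>?M)" for i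
    by (simp add: flux_def inner_commute)
  have ifl': "integrable ?M (\<lambda>r. a i r * of_int (cross i n) * (c n r \<bullet> c (n - shift i) r))" for i
    using st by (intro integrable_on_sub continuous_intros c_cont a_cont) auto
  have "(cmod (c n t))\<^sup>2 - (cmod (c n s))\<^sup>2 = (\<integral>r. - 2 * lap n * (cmod (c n r))\<^sup>2
     - (\<Sum>i\<in>UNIV. a i r * of_int (cross i n) * (c n r \<bullet> c (n - shift i) r) - a i r * of_int (cross i n) * (c n r \<bullet> c (n + shift i) r)) \<partial>?M)"
    unfolding power2_norm_eq_inner inner_integral[OF st]
  proof (rule Bochner_Integration.integral_cong[OF refl])
    fix r
    have "c n r \<bullet> (- of_real (lap n) * c n r - transport a c n r) + (- of_real (lap n) * c n r - transport a c n r) \<bullet> c n r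
       = - 2 * lap n * (c n r \<bullet> c n r) - 2 * (c n r \<bullet> transport a c n r)"
      by (rule inner_damped)
    then show "c n r \<bullet> (- of_real (lap n) * c n r - transport a c n r) + (- of_real (lap n) * c n r - transport a c n r) \<bullet> c n r
       = - 2 * lap n * (c n r \<bullet> c n r)
     - (\<Sum>i\<in>UNIV. a i r * of_int (cross i n) * (c n r \<bullet> c (n - shift i) r) - a i r * of_int (cross i n) * (c n r \<bullet> c (n + shift i) r))"
      unfolding inner_transport sum_distrib_left by (simp add: right_diff_distrib)
  qed
  also have "\<dots> = - 2 * lap n * mass s t n - (\<Sum>i\<in>UNIV. flux i s t (n - shift i) - flux i s t n)"
    unfolding fl' using im ifl ifl' by (simp add: mass_def flux_def)
  finally show ?thesis by simp
qed

text \<open>Young's inequality absorbs the transport of a mode into half of its dissipation and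
  leaves neighbours that are bounded by \<open>g\<close>. This is done mode by mode because the
  cancellation of fluxes is not yet available: their sum is shown to converge by means of this
  bound.\<close>

lemma lap_mass_summable: "(\<lambda>n. lap n * mass 0 \<tau> n) summable_on UNIV"
proof -
  let ?h = "\<lambda>n. (g n)\<^sup>2 + (A\<^sup>2 / 2 * 4 * \<tau>) * nbr_sum (\<lambda>n. (g n)\<^sup>2) n"
  obtain S where S: "((\<lambda>n. (g n)\<^sup>2) has_sum S) UNIV" using g_sum by (auto simp: summable_on_def)
  have h: "?h summable_on UNIV"
    using has_sum_add[OF S has_sum_cmult_right[OF has_sum_nbr_sum[OF S]]] by (auto simp: summable_on_def)
  have "lap n * mass 0 \<tau> n \<le> ?h n" for n
  proof -
    let ?M = "lebesgue_on {0..\<tau>}"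
    let ?P = "A\<^sup>2 / 2 * (nbr_sum g n)\<^sup>2"
    have im: "integrable ?M (\<lambda>r. (cmod (c n r))\<^sup>2)"
      by (intro integrable_on_sub continuous_intros c_cont) auto
    have "(cmod (c n \<tau>))\<^sup>2 - (cmod (c n 0))\<^sup>2 \<le> (\<integral>r. ?P - lap n * (cmod (c n r))\<^sup>2 \<partial>?M)"
      unfolding power2_norm_eq_inner inner_integral[OF order_refl \<tau>_nonneg order_refl]
    proof (rule integral_mono)
      fix r assume "r \<in> space ?M"
      then have r: "r \<in> {0..\<tau>}" by simp
      have T: "cmod (transport a c n r) \<le> A / 2 * sqrt (2 * lap n) * nbr_sum g n * 1"
        using a_bound[OF r] c_bound[OF r] by (intro transport_bound) auto
      have "- 2 * (c n r \<bullet> transport a c n r) \<le> 2 * (cmod (c n r) * cmod (transport a c n r))"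
        using Cauchy_Schwarz_ineq2[of "c n r" "transport a c n r"] by (simp add: abs_le_iff)
      also have "\<dots> \<le> 2 * (cmod (c n r) * (A / 2 * sqrt (2 * lap n) * nbr_sum g n * 1))"
        using T by (intro mult_left_mono) auto
      also have "\<dots> = 2 * (sqrt (lap n) * cmod (c n r)) * (A / sqrt 2 * nbr_sum g n)"
        by (simp add: real_sqrt_mult) (simp add: field_simps)
      also have "\<dots> \<le> (sqrt (lap n) * cmod (c n r))\<^sup>2 + (A / sqrt 2 * nbr_sum g n)\<^sup>2"
        by (rule sum_squares_bound)
      also have "\<dots> = lap n * (c n r \<bullet> c n r) + ?P"
        by (simp add: power_mult_distrib power_divide power2_norm_eq_inner)
      finally have "- 2 * (c n r \<bullet> transport a c n r) \<le> lap n * (c n r \<bullet> c n r) + ?P" .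
      then show "c n r \<bullet> (- of_real (lap n) * c n r - transport a c n r) + (- of_real (lap n) * c n r - transport a c n r) \<bullet> c n r
         \<le> ?P - lap n * (c n r \<bullet> c n r)"
        unfolding inner_damped by simp
    next
      show "integrable ?M (\<lambda>r. c n r \<bullet> (- of_real (lap n) * c n r - transport a c n r) + (- of_real (lap n) * c n r - transport a c n r) \<bullet> c n r)"
        by (intro integrable_on_sub continuous_intros continuous_transport a_cont c_cont) auto
      show "integrable ?M (\<lambda>r. ?P - lap n * (c n r \<bullet> c n r))"
        by (intro integrable_on_sub continuous_intros c_cont) auto
    qed
    also have "\<dots> = ?P * \<tau> - lap n * mass 0 \<tau> n"
      using im \<tau>_nonneg by (simp add: mass_def)
    finally have "lap n * mass 0 \<tau> n \<le> (cmod (c n 0))\<^sup>2 + ?P * \<tau>" using zero_le_power2[of "cmod (c n \<tau>)"] by linarith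
    also have "\<dots> \<le> ?h n"
    proof (rule add_mono)
      show "(cmod (c n 0))\<^sup>2 \<le> (g n)\<^sup>2" using \<tau>_nonneg by (intro c_square_le) auto
      have "?P * \<tau> \<le> A\<^sup>2 / 2 * (4 * nbr_sum (\<lambda>n. (g n)\<^sup>2) n) * \<tau>"
        using nbr_sum_square[of g n] \<tau>_nonneg by (intro mult_right_mono mult_left_mono) auto
      then show "?P * \<tau> \<le> (A\<^sup>2 / 2 * 4 * \<tau>) * nbr_sum (\<lambda>n. (g n)\<^sup>2) n" by (simp add: mult_ac)
    qed
    finally show ?thesis .
  qed
  then show ?thesis
    by (intro summable_on_comparison_test[OF h]) (auto simp: mass_def)
qed

lemma mass_mono:
  assumes "0 \<le> s" "s \<le> t" "t \<le> \<tau>" shows "mass s t n \<le> mass 0 \<tau> n" "mass s t n \<ge> 0"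
proof -
  have i: "(\<lambda>r. (cmod (c n r))\<^sup>2) integrable_on {u..v}" if "0 \<le> u" "v \<le> \<tau>" for u v
    by (rule integrable_continuous_real, rule continuous_on_subset[of "{0..\<tau>}"], intro continuous_intros c_cont)
      (use that in auto)
  have e: "mass u v n = integral {u..v} (\<lambda>r. (cmod (c n r))\<^sup>2)" if "0 \<le> u" "v \<le> \<tau>" for u v
    unfolding mass_def by (rule lebesgue_integral_eq_integral)
      (use that in \<open>auto intro!: integrable_on_sub continuous_intros c_cont\<close>)
  show "mass s t n \<le> mass 0 \<tau> n"
    using assms i e by (auto intro!: Henstock_Kurzweil_Integration.integral_subset_le)
  show "mass s t n \<ge> 0" by (simp add: mass_def)
qed

lemma lap_mass_sub_summable:
  assumes "0 \<le> s" "s \<le> t" "t \<le> \<tau>" shows "(\<lambda>n. lap n * mass s t n) summable_on K"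
proof -
  have "(\<lambda>n. lap n * mass s t n) summable_on UNIV"
    by (rule summable_on_comparison_test[OF lap_mass_summable])
      (use mass_mono[OF assms] in \<open>auto intro: mult_left_mono\<close>)
  then show ?thesis by (rule summable_on_subset_banach) simp
qed

text \<open>The factor \<open>cross i n\<close> goes to \<open>c n\<close>, where the dissipation
  pays for it, and the neighbour is bounded by \<open>g\<close>. With a convergent sum the fluxes
  may be translated and cancelled.\<close>

lemma flux_abs_summable:
  assumes st: "0 \<le> s" "s \<le> t" "t \<le> \<tau>" shows "flux i s t summable_on K"
proof -
  let ?h = "\<lambda>n. 2 * A * (lap n * mass s t n) + A * (t - s) * (g (n + shift i))\<^sup>2"
  have h: "?h summable_on UNIV"
    using g_sum has_sum_translate[of "\<lambda>n. (g n)\<^sup>2" "shift i"]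
    by (intro summable_on_add summable_on_cmult_right lap_mass_sub_summable[OF st]) (auto simp: summable_on_def)
  have "\<bar>flux i s t n\<bar> \<le> ?h n" for n
  proof -
    let ?M = "lebesgue_on {s..t}"
    have im: "integrable ?M (\<lambda>r. (cmod (c n r))\<^sup>2)"
      using st by (intro integrable_on_sub continuous_intros c_cont) auto
    have "norm (flux i s t n) \<le> (\<integral>r. 2 * A * lap n * (cmod (c n r))\<^sup>2 + A * (g (n + shift i))\<^sup>2 \<partial>?M)"
      unfolding flux_def
    proof (rule Bochner_Integration.integral_norm_bound_integral)
      fix r assume "r \<in> space ?M"
      then have r: "r \<in> {0..\<tau>}" using st by auto
      have "norm (a i r * of_int (cross i n) * (c n r \<bullet> c (n + shift i) r))
          \<le> A * (\<bar>of_int (cross i n)\<bar> * (cmod (c n r) * cmod (c (n + shift i) r)))"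
        unfolding real_norm_def abs_mult mult.assoc
        using a_bound[OF r] A_nonneg Cauchy_Schwarz_ineq2[of "c n r" "c (n + shift i) r"] by (intro mult_mono) auto
      also have "\<dots> \<le> A * ((\<bar>of_int (cross i n)\<bar> * cmod (c n r))\<^sup>2 + (cmod (c (n + shift i) r))\<^sup>2)"
      proof (rule mult_left_mono[OF _ A_nonneg])
        have "2 * (u * v) \<le> u\<^sup>2 + v\<^sup>2" for u v :: real using sum_squares_bound[of u v] by simp
        moreover have "u * v \<le> 2 * (u * v)" if "u \<ge> 0" "v \<ge> 0" for u v :: real using that by simp
        ultimately show "\<bar>of_int (cross i n)\<bar> * (cmod (c n r) * cmod (c (n + shift i) r))
            \<le> (\<bar>of_int (cross i n)\<bar> * cmod (c n r))\<^sup>2 + (cmod (c (n + shift i) r))\<^sup>2"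
          unfolding mult.assoc[symmetric] by (meson mult_nonneg_nonneg abs_ge_zero norm_ge_zero order_trans)
      qed
      also have "\<dots> \<le> A * (2 * lap n * (cmod (c n r))\<^sup>2 + (g (n + shift i))\<^sup>2)"
        using A_nonneg cross_square[of i n] c_square_le[OF r, of "n + shift i"]
        by (intro mult_left_mono add_mono) (auto simp: power_mult_distrib intro!: mult_right_mono)
      finally show "norm (a i r * of_int (cross i n) * (c n r \<bullet> c (n + shift i) r))
          \<le> 2 * A * lap n * (cmod (c n r))\<^sup>2 + A * (g (n + shift i))\<^sup>2" by (simp add: algebra_simps)
    next
      show "integrable ?M (\<lambda>r. a i r * of_int (cross i n) * (c n r \<bullet> c (n + shift i) r))"
        using st by (intro integrable_on_sub continuous_intros c_cont a_cont) auto
      show "integrable ?M (\<lambda>r. 2 * A * lap n * (cmod (c n r))\<^sup>2 + A * (g (n + shift i))\<^sup>2)"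
        using st by (intro integrable_on_sub continuous_intros c_cont) auto
    qed
    also have "\<dots> = ?h n" using im st by (simp add: mass_def algebra_simps)
    finally show ?thesis by simp
  qed
  then have "(\<lambda>n. norm (flux i s t n)) summable_on UNIV"
    by (intro summable_on_comparison_test[OF h]) auto
  then have "flux i s t summable_on UNIV" by (rule abs_summable_summable)
  then show ?thesis by (rule summable_on_subset_banach) simp
qed

text \<open>Over a set invariant under \<open>shift i\<close> the fluxes cancel after a translation,
  and a shear that is switched off has none. So the balance holds for any union of lines of the
  active shear and not just for all modes together.\<close>

theorem energy_identity:
  assumes st: "0 \<le> s" "s \<le> t" "t \<le> \<tau>"
    and K: "\<And>i. (\<forall>n. n + shift i \<in> K \<longleftrightarrow> n \<in> K) \<or> (\<forall>r\<in>{s..t}. a i r = 0)"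
  shows "energy K t + 2 * (\<Sum>\<^sub>\<infinity>n\<in>K. lap n * mass s t n) = energy K s"
proof -
  have fl: "((\<lambda>n. flux i s t (n - shift i) - flux i s t n) has_sum 0) K" for i
  proof (cases "\<forall>r\<in>{s..t}. a i r = 0")
    case True
    then have "flux i s t n = (\<integral>r. 0 \<partial>lebesgue_on {s..t})" for n
      unfolding flux_def by (intro Bochner_Integration.integral_cong) auto
    then show ?thesis by (simp add: has_sum_0)
  next
    case False
    then have inv: "n + shift i \<in> K \<longleftrightarrow> n \<in> K" for n using K by blast
    have inv': "n - shift i \<in> K \<longleftrightarrow> n \<in> K" for n using inv[of "n - shift i"] by simp
    obtain S where S: "(flux i s t has_sum S) K" using flux_abs_summable[OF st] by (auto simp: summable_on_def)
    have "bij_betw (\<lambda>n. n - shift i) K K"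
      by (rule bij_betwI[where g = "\<lambda>n. n + shift i"]) (auto simp: inv inv')
    from has_sum_reindex_bij_betw[OF this, of "flux i s t" S] S
    have "((\<lambda>n. flux i s t (n - shift i)) has_sum S) K" by simp
    from has_sum_diff[OF this S] show ?thesis by simp
  qed
  have "((\<lambda>n. (cmod (c n t))\<^sup>2 + 2 * (lap n * mass s t n) + (\<Sum>i\<in>UNIV. flux i s t (n - shift i) - flux i s t n))
     has_sum (energy K t + 2 * (\<Sum>\<^sub>\<infinity>n\<in>K. lap n * mass s t n) + (0 + 0))) K"
  proof -
    have "((\<lambda>n. (cmod (c n t))\<^sup>2 + 2 * (lap n * mass s t n)) has_sum (energy K t + 2 * (\<Sum>\<^sub>\<infinity>n\<in>K. lap n * mass s t n))) K"
      unfolding energy_def using st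
      by (intro has_sum_add has_sum_cmult_right has_sum_infsum c_square_summable lap_mass_sub_summable) auto
    from has_sum_add[OF this has_sum_add[OF fl[of 1] fl[of 2]]] show ?thesis by (simp add: UNIV_2)
  qed
  then have "((\<lambda>n. (cmod (c n s))\<^sup>2) has_sum (energy K t + 2 * (\<Sum>\<^sub>\<infinity>n\<in>K. lap n * mass s t n))) K"
    unfolding mode_energy[OF st] by simp
  then show ?thesis by (simp add: energy_def infsumI)
qed

lemma energy_decreasing:
  assumes st: "0 \<le> s" "s \<le> t" "t \<le> \<tau>"
    and K: "\<And>i. (\<forall>n. n + shift i \<in> K \<longleftrightarrow> n \<in> K) \<or> (\<forall>r\<in>{s..t}. a i r = 0)"
  shows "energy K t \<le> energy K s"
proof -
  have "(\<Sum>\<^sub>\<infinity>n\<in>K. lap n * mass s t n) \<ge> 0"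
    by (rule infsum_nonneg) (simp add: mass_def)
  then show ?thesis using energy_identity[OF assms] by simp
qed

lemma energy_mono:
  assumes "t \<in> {0..\<tau>}" "K \<subseteq> K'" shows "energy K t \<le> energy K' t"
  unfolding energy_def by (rule infsum_mono2) (use c_square_summable assms in auto)

lemma energy_nonneg: "energy K t \<ge> 0"
  unfolding energy_def by (rule infsum_nonneg) simp

end

section \<open>A phase with a single active shear\<close>

lemma abs_inner_le_squares: "\<bar>u \<bullet> v\<bar> \<le> ((cmod u)\<^sup>2 + (cmod v)\<^sup>2) / 2" for u v :: complex
  using Cauchy_Schwarz_ineq2[of u v] sum_squares_bound[of "cmod u" "cmod v"] by simp

lemma integral_linear_combination:
  fixes f g h :: "'a \<Rightarrow> real"
  assumes "integrable M f" "integrable M g" "integrable M h"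
  shows "(\<integral>x. k * f x + l * (g x - h x) \<partial>M) = k * (\<integral>x. f x \<partial>M) + l * ((\<integral>x. g x \<partial>M) - (\<integral>x. h x \<partial>M))"
  using assms by simp

text \<open>The time profile \<open>w\<close> is kept apart from the amplitude \<open>B\<close>, so
  that a threshold for \<open>B\<close> can be found that depends on \<open>w\<close> only through
  its integral.\<close>

locale flow_phase = mode_flow +
  fixes i :: 2 and s t :: real and w :: "real \<Rightarrow> real" and B :: real
  assumes st: "0 \<le> s" "s \<le> t" "t \<le> \<tau>"
    and off: "\<And>j r. j \<noteq> i \<Longrightarrow> r \<in> {s..t} \<Longrightarrow> a j r = 0" and on: "\<And>r. r \<in> {s..t} \<Longrightarrow> a i r = B * w r"
    and B_pos: "B > 0" and w_cont: "continuous_on {0..\<tau>} w" and w_01: "\<And>r. 0 \<le> w r" "\<And>r. w r \<le> 1"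
    and energy_le_1: "energy UNIV s \<le> 1"
begin

lemma energy_phase_decreasing:
  assumes "r \<in> {s..t}" "r' \<in> {s..t}" "r \<le> r'" "\<And>n. n + shift i \<in> K \<longleftrightarrow> n \<in> K"
  shows "energy K r' \<le> energy K r"
proof (rule energy_decreasing)
  show "(\<forall>n. n + shift j \<in> K \<longleftrightarrow> n \<in> K) \<or> (\<forall>q\<in>{r..r'}. a j q = 0)" for j
    using assms off[of j] by (cases "j = i") auto
qed (use assms st in auto)

lemma energy_phase_le_1: "r \<in> {s..t} \<Longrightarrow> energy UNIV r \<le> 1"
  using energy_phase_decreasing[of s r UNIV] energy_le_1 by auto

lemma sum_square_le_1: "r \<in> {s..t} \<Longrightarrow> finite F \<Longrightarrow> (\<Sum>n\<in>F. (cmod (c n r))\<^sup>2) \<le> 1"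
  using energy_phase_le_1[of r] st unfolding energy_def
  by (intro order_trans[OF finite_sum_le_infsum[of _ UNIV]] c_square_summable) auto

lemma c_square_le_1: "r \<in> {s..t} \<Longrightarrow> (cmod (c n r))\<^sup>2 \<le> 1"
  using sum_square_le_1[of r "{n}"] by simp

text \<open>\<open>weight\<close> and \<open>corr\<close> below take the parts of \<open>X\<close>
  and \<open>\<rho>\<close> in \<open>convex_sequence_small\<close>. The profile sits inside both
  averages since it multiplies the transport term in the time derivative.\<close>

definition weight :: "int^2 \<Rightarrow> real" where
  "weight n = (\<integral>r. w r * (cmod (c n r))\<^sup>2 \<partial>lebesgue_on {s..t})"

definition corr :: "int^2 \<Rightarrow> real" where
  "corr n = (\<integral>r. w r * ((cmod (c n r))\<^sup>2 + c (n - shift i) r \<bullet> c (n + shift i) r) \<partial>lebesgue_on {s..t})"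

lemma integrable_phase:
  "continuous_on {0..\<tau>} h \<Longrightarrow> integrable (lebesgue_on {s..t}) (h :: real \<Rightarrow> real)"
  using st by (intro integrable_on_sub) auto

lemma transport_phase:
  "r \<in> {s..t} \<Longrightarrow> transport a c n r = (B * w r * of_int (cross i n) / 2) *\<^sub>R (c (n - shift i) r - c (n + shift i) r)"
proof -
  assume r: "r \<in> {s..t}"
  have "transport a c n r = (\<Sum>j\<in>{i}. of_real (a j r * of_int (cross j n) / 2) * (c (n - shift j) r - c (n + shift j) r))"
    unfolding transport_def by (rule sum.mono_neutral_right) (use off[OF _ r] in auto)
  then show ?thesis by (simp add: on[OF r] scaleR_conv_of_real)
qed

text \<open>Up to the diffusion, \<open>corr (n + shift i) - corr n\<close> is the integral of a multiple of the time derivative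
  of \<open>c n \<bullet> c (n + shift i)\<close>.\<close>

lemma corr_step:
  assumes "cross i n \<noteq> 0"
  shows "\<bar>corr (n + shift i) - corr n\<bar> \<le> 2 * (2 + (lap n + lap (n + shift i)) * (t - s)) / B"
proof -
  let ?e = "shift i" and ?M = "lebesgue_on {s..t}"
  let ?\<kappa> = "real_of_int (cross i n)"
  let ?P = "\<lambda>r. c n r \<bullet> c (n + ?e) r"
  let ?R = "\<lambda>n r. w r * ((cmod (c n r))\<^sup>2 + c (n - ?e) r \<bullet> c (n + ?e) r)"
  have iP: "integrable ?M ?P" by (intro integrable_phase continuous_intros c_cont)
  have iR: "integrable ?M (?R n)" for n by (intro integrable_phase continuous_intros c_cont w_cont)
  have "?P t - ?P s = (\<integral>r. - (lap n + lap (n + ?e)) * ?P r + B * ?\<kappa> / 2 * (?R (n + ?e) r - ?R n r) \<partial>?M)"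
    unfolding inner_integral[OF st]
  proof (rule Bochner_Integration.integral_cong[OF refl])
    fix r assume "r \<in> space ?M"
    then have r: "r \<in> {s..t}" by simp
    show "c n r \<bullet> (- of_real (lap (n + ?e)) * c (n + ?e) r - transport a c (n + ?e) r)
        + (- of_real (lap n) * c n r - transport a c n r) \<bullet> c (n + ?e) r
      = - (lap n + lap (n + ?e)) * ?P r + B * ?\<kappa> / 2 * (?R (n + ?e) r - ?R n r)"
      unfolding transport_phase[OF r] power2_norm_eq_inner
      by (simp add: inner_complex_def algebra_simps add_divide_distrib diff_divide_distrib)
  qed
  also have "\<dots> = - (lap n + lap (n + ?e)) * (\<integral>r. ?P r \<partial>?M) + B * ?\<kappa> / 2 * (corr (n + ?e) - corr n)"
    unfolding corr_def by (rule integral_linear_combination[OF iP iR iR])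
  finally have eq: "B * ?\<kappa> / 2 * (corr (n + ?e) - corr n) = ?P t - ?P s + (lap n + lap (n + ?e)) * (\<integral>r. ?P r \<partial>?M)"
    by (simp add: algebra_simps)
  have P1: "\<bar>?P r\<bar> \<le> 1" if "r \<in> {s..t}" for r
    using abs_inner_le_squares[of "c n r" "c (n + ?e) r"] c_square_le_1[OF that, of n] c_square_le_1[OF that, of "n + ?e"] by simp
  have "norm (\<integral>r. ?P r \<partial>?M) \<le> (\<integral>r. 1 \<partial>?M)"
    by (rule Bochner_Integration.integral_norm_bound_integral) (use iP P1 in auto)
  then have IP: "\<bar>\<integral>r. ?P r \<partial>?M\<bar> \<le> t - s" using st by simp
  \<comment> \<open>\<open>cross i n\<close> is a nonzero integer, hence at least 1 in modulus, so
    the bound does not depend on its value.\<close>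
  have "B * 1 / 2 * \<bar>corr (n + ?e) - corr n\<bar> \<le> B * \<bar>?\<kappa>\<bar> / 2 * \<bar>corr (n + ?e) - corr n\<bar>"
    using assms B_pos by (intro mult_right_mono divide_right_mono mult_left_mono) auto
  also have "\<dots> = \<bar>?P t - ?P s + (lap n + lap (n + ?e)) * (\<integral>r. ?P r \<partial>?M)\<bar>"
    unfolding eq[symmetric] using B_pos by (simp add: abs_mult)
  also have "\<dots> \<le> \<bar>?P t\<bar> + \<bar>?P s\<bar> + (lap n + lap (n + ?e)) * \<bar>\<integral>r. ?P r \<partial>?M\<bar>"
    by (intro order_trans[OF abs_triangle_ineq] add_mono abs_triangle_ineq4) (simp add: abs_mult)
  also have "\<dots> \<le> 1 + 1 + (lap n + lap (n + ?e)) * (t - s)"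
    using st P1 IP by (intro add_mono mult_left_mono) auto
  finally show ?thesis using B_pos by (simp add: field_simps)
qed

text \<open>\<open>corr n\<close> is \<open>weight n\<close> plus the averaged correlation of the
  two neighbours, which Cauchy-Schwarz bounds by half the sum of their weights.\<close>

lemma corr_weight:
  "\<bar>corr n\<bar> \<le> weight n + (weight (n - shift i) + weight (n + shift i)) / 2"
  "weight n \<le> \<bar>corr n\<bar> + (weight (n - shift i) + weight (n + shift i)) / 2"
proof -
  let ?M = "lebesgue_on {s..t}"
  let ?q = "\<integral>r. w r * (c (n - shift i) r \<bullet> c (n + shift i) r) \<partial>?M"
  have i1: "integrable ?M (\<lambda>r. w r * (cmod (c n r))\<^sup>2)" for n
    by (intro integrable_phase continuous_intros c_cont w_cont)
  have i2: "integrable ?M (\<lambda>r. w r * (c (n - shift i) r \<bullet> c (n + shift i) r))"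
    by (intro integrable_phase continuous_intros c_cont w_cont)
  have "norm ?q \<le> (\<integral>r. (w r * (cmod (c (n - shift i) r))\<^sup>2 + w r * (cmod (c (n + shift i) r))\<^sup>2) / 2 \<partial>?M)"
  proof (rule Bochner_Integration.integral_norm_bound_integral)
    show "integrable ?M (\<lambda>r. (w r * (cmod (c (n - shift i) r))\<^sup>2 + w r * (cmod (c (n + shift i) r))\<^sup>2) / 2)"
      using i1 by auto
    show "norm (w r * (c (n - shift i) r \<bullet> c (n + shift i) r))
        \<le> (w r * (cmod (c (n - shift i) r))\<^sup>2 + w r * (cmod (c (n + shift i) r))\<^sup>2) / 2" for r
      using mult_left_mono[OF abs_inner_le_squares w_01(1)[of r], of "c (n - shift i) r" "c (n + shift i) r"] w_01(1)[of r]
      by (simp add: abs_mult distrib_left)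
  qed (rule i2)
  also have "\<dots> = (weight (n - shift i) + weight (n + shift i)) / 2" using i1 by (simp add: weight_def)
  finally have q: "\<bar>?q\<bar> \<le> (weight (n - shift i) + weight (n + shift i)) / 2" by simp
  have w0: "weight n \<ge> 0" unfolding weight_def using w_01 by (intro Bochner_Integration.integral_nonneg) auto
  have "corr n = weight n + ?q"
    using i1 i2 by (simp add: corr_def weight_def distrib_left)
  then show "\<bar>corr n\<bar> \<le> weight n + (weight (n - shift i) + weight (n + shift i)) / 2"
    "weight n \<le> \<bar>corr n\<bar> + (weight (n - shift i) + weight (n + shift i)) / 2"
    using q w0 by linarith+
qed

lemma weight_nonneg: "weight n \<ge> 0"
  unfolding weight_def using w_01 by (intro Bochner_Integration.integral_nonneg) auto

lemma sum_weight_le: "finite F \<Longrightarrow> sum weight F \<le> t - s"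
proof -
  let ?M = "lebesgue_on {s..t}"
  assume F: "finite F"
  have i1: "integrable ?M (\<lambda>r. w r * (cmod (c n r))\<^sup>2)" for n
    by (intro integrable_phase continuous_intros c_cont w_cont)
  have "sum weight F = (\<integral>r. (\<Sum>n\<in>F. w r * (cmod (c n r))\<^sup>2) \<partial>?M)"
    unfolding weight_def using i1 by simp
  also have "\<dots> \<le> (\<integral>r. 1 \<partial>?M)"
  proof (rule integral_mono)
    fix r assume "r \<in> space ?M"
    then have "w r * (\<Sum>n\<in>F. (cmod (c n r))\<^sup>2) \<le> 1 * 1"
      using w_01[of r] sum_square_le_1[of r F] F by (intro mult_mono) (auto simp: sum_nonneg)
    then show "(\<Sum>n\<in>F. w r * (cmod (c n r))\<^sup>2) \<le> 1" by (simp add: sum_distrib_left)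
  qed (use i1 in auto)
  finally show ?thesis using st by simp
qed

lemma weight_le_mass: "weight n \<le> mass s t n"
  unfolding weight_def mass_def
proof (rule integral_mono)
  show "integrable (lebesgue_on {s..t}) (\<lambda>r. w r * (cmod (c n r))\<^sup>2)"
    by (intro integrable_phase continuous_intros c_cont w_cont)
  show "integrable (lebesgue_on {s..t}) (\<lambda>r. (cmod (c n r))\<^sup>2)"
    by (intro integrable_phase continuous_intros c_cont)
  show "w r * (cmod (c n r))\<^sup>2 \<le> (cmod (c n r))\<^sup>2" for r
    using w_01[of r] by (simp add: mult_left_le_one_le)
qed

text \<open>The energy on \<open>K\<close> decreases, so its final value times the integral of the
  profile is at most the averaged energy, the sum of the weights. In this way bounds on time
  averages reach the end of the phase.\<close>

lemma weighted_energy: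
  assumes K: "\<And>n. n + shift i \<in> K \<longleftrightarrow> n \<in> K"
  shows "\<exists>S. (weight has_sum S) K \<and> energy K t * (\<integral>r. w r \<partial>lebesgue_on {s..t}) \<le> S"
proof -
  let ?M = "lebesgue_on {s..t}"
  \<comment> \<open>Extending by zero off \<open>K\<close> makes the termwise integration over the
    full lattice applicable.\<close>
  let ?f = "\<lambda>n r. if n \<in> K then w r * (cmod (c n r))\<^sup>2 else 0"
  have i1: "integrable ?M (\<lambda>r. w r * (cmod (c n r))\<^sup>2)" for n
    by (intro integrable_phase continuous_intros c_cont w_cont)
  have if': "integrable ?M (?f n)" for n using i1[of n] by (cases "n \<in> K") auto
  have S: "{s..t} \<in> sets lebesgue" by simp
  have "(\<lambda>n. \<integral>r. norm (?f n r) \<partial>?M) summable_on UNIV"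
  proof (rule summable_on_comparison_test)
    show "(\<lambda>n. (t - s) * (g n)\<^sup>2) summable_on UNIV" by (intro summable_on_cmult_right g_sum)
    fix n
    have "(\<integral>r. norm (?f n r) \<partial>?M) \<le> (\<integral>r. (g n)\<^sup>2 \<partial>?M)"
    proof (rule integral_mono)
      fix r assume "r \<in> space ?M"
      then have "w r * (cmod (c n r))\<^sup>2 \<le> 1 * (g n)\<^sup>2"
        using w_01[of r] c_square_le[of r n] st by (intro mult_mono) auto
      then show "norm (?f n r) \<le> (g n)\<^sup>2" using w_01(1)[of r] by simp
    qed (use if' in auto)
    then show "(\<integral>r. norm (?f n r) \<partial>?M) \<le> (t - s) * (g n)\<^sup>2" using st by (simp add: mult.commute)
  qed auto
  note hs = has_sum_integral[OF S if' this]
  have "((\<lambda>n. if n \<in> K then weight n else 0) has_sum (\<integral>r. (\<Sum>\<^sub>\<infinity>n. ?f n r) \<partial>?M)) UNIV"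
  proof -
    have "(\<integral>r. ?f n r \<partial>?M) = (if n \<in> K then weight n else 0)" for n by (simp add: weight_def)
    then show ?thesis using hs(3) by (simp only:)
  qed
  moreover have "(weight has_sum x) K \<longleftrightarrow> ((\<lambda>n. if n \<in> K then weight n else 0) has_sum x) UNIV" for x
    by (rule has_sum_cong_neutral) auto
  ultimately have 1: "(weight has_sum (\<integral>r. (\<Sum>\<^sub>\<infinity>n. ?f n r) \<partial>?M)) K" by blast
  have "(\<integral>r. energy K t * w r \<partial>?M) \<le> (\<integral>r. (\<Sum>\<^sub>\<infinity>n. ?f n r) \<partial>?M)"
  proof (rule integral_mono)
    show "integrable ?M (\<lambda>r. energy K t * w r)" by (intro integrable_phase continuous_intros w_cont)
    fix r assume "r \<in> space ?M"
    then have r: "r \<in> {s..t}" by simp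
    have "(\<Sum>\<^sub>\<infinity>n. ?f n r) = (\<Sum>\<^sub>\<infinity>n\<in>K. w r * (cmod (c n r))\<^sup>2)"
      by (rule infsum_cong_neutral) auto
    also have "\<dots> = w r * energy K r" unfolding energy_def by (rule infsum_cmult_right')
    finally show "energy K t * w r \<le> (\<Sum>\<^sub>\<infinity>n. ?f n r)"
      using energy_phase_decreasing[OF r _ _ K, of t] r w_01(1)[of r] by (simp add: mult.commute mult_left_mono)
  qed (rule hs(2))
  then have "energy K t * (\<integral>r. w r \<partial>?M) \<le> (\<integral>r. (\<Sum>\<^sub>\<infinity>n. ?f n r) \<partial>?M)" by simp
  with 1 show ?thesis by blast
qed

lemma lap_mass_le: "(\<Sum>\<^sub>\<infinity>n. lap n * mass s t n) \<le> 1 / 2"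
  using energy_identity[OF st, of UNIV] energy_nonneg[of UNIV t] energy_le_1 by simp

end

section \<open>Decay over one phase, uniform in the solution\<close>

definition line :: "2 \<Rightarrow> int^2 \<Rightarrow> int \<Rightarrow> int^2" where
  "line i n j = n + (\<chi> k. j * shift i $ k)"

lemma line_0 [simp]: "line i n 0 = n"
  by (simp add: line_def vec_eq_iff)

lemma line_step: "line i n (j + 1) = line i n j + shift i" "line i n (j - 1) = line i n j - shift i"
  by (simp_all add: line_def vec_eq_iff algebra_simps)

lemma cross_line [simp]: "cross i (line i n j) = cross i n"
  by (simp add: cross_def line_def algebra_simps)

lemma inj_line: "inj (line i n)"
proof (rule injI)
  fix j j' assume "line i n j = line i n j'"
  then have "line i n j $ 1 = line i n j' $ 1" by simp
  then show "j = j'" by (simp add: line_def shift_def)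
qed

text \<open>Only the steps with \<open>\<bar>j\<bar> \<le> L\<close> along the line of
  \<open>n\<close> matter, so the diffusion terms in \<open>corr_step\<close> have a common bound
  and a large amplitude makes all these steps small. The threshold must precede the solution, which
  is why the locale parameters are quantified after it.\<close>

lemma mode_decay:
  assumes \<epsilon>: "\<epsilon> > 0" and T: "T \<ge> 0" and n: "cross i n \<noteq> 0"
  obtains B0 where "B0 > 0"
    "\<And>\<tau> a c g A s t w B. flow_phase \<tau> a c g A i s t w B \<Longrightarrow> t - s \<le> T \<Longrightarrow> B0 \<le> B \<Longrightarrow> flow_phase.weight c s t w n \<le> \<epsilon>"
proof -
  obtain L :: nat and \<zeta> where \<zeta>: "\<zeta> > 0" and L: "\<And>X \<rho>. (\<And>j. X j \<ge> 0) \<Longrightarrow> (\<And>F. finite F \<Longrightarrow> sum X F \<le> T) \<Longrightarrow>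
       (\<And>j. \<bar>\<rho> j\<bar> \<le> X j + (X (j - 1) + X (j + 1)) / 2) \<Longrightarrow>
       (\<And>j. X j \<le> \<bar>\<rho> j\<bar> + (X (j - 1) + X (j + 1)) / 2) \<Longrightarrow>
       (\<And>j. \<bar>j\<bar> \<le> int L \<Longrightarrow> \<bar>\<rho> (j + 1) - \<rho> j\<bar> \<le> \<zeta>) \<Longrightarrow> X 0 \<le> \<epsilon>"
    using tridiagonal_decay[OF T \<epsilon>] by metis
  define h where "h j = 2 * (2 + (lap (line i n j) + lap (line i n j + shift i)) * T)" for j
  have h0: "h j \<ge> 0" for j using T by (simp add: h_def)
  \<comment> \<open>Dominates \<open>h j / \<zeta>\<close> for every relevant \<open>j\<close>; the
    summand 1 makes it positive.\<close>
  define B0 where "B0 = (\<Sum>j\<in>{- int L..int L}. h j) / \<zeta> + 1"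
  have B0: "B0 > 0" using h0 \<zeta> by (simp add: B0_def add_nonneg_pos sum_nonneg)
  show thesis
  proof
    show "B0 > 0" by fact
    fix \<tau> a c g A s t w B
    assume "flow_phase \<tau> a c g A i s t w B" and ts: "t - s \<le> T" and B: "B0 \<le> B"
    then interpret flow_phase \<tau> a c g A i s t w B by simp
    have "weight (line i n 0) \<le> \<epsilon>"
    proof (rule L[of "\<lambda>j. weight (line i n j)" "\<lambda>j. corr (line i n j)"])
      show "sum (\<lambda>j. weight (line i n j)) F \<le> T" if "finite F" for F
      proof -
        have "sum (\<lambda>j. weight (line i n j)) F = sum weight (line i n ` F)"
          by (subst sum.reindex) (auto intro: inj_on_subset[OF inj_line])
        also have "\<dots> \<le> t - s" using that by (intro sum_weight_le) auto
        finally show ?thesis using ts by simp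
      qed
      fix j
      show "\<bar>corr (line i n j)\<bar> \<le> weight (line i n j) + (weight (line i n (j - 1)) + weight (line i n (j + 1))) / 2"
        "weight (line i n j) \<le> \<bar>corr (line i n j)\<bar> + (weight (line i n (j - 1)) + weight (line i n (j + 1))) / 2"
        unfolding line_step by (rule corr_weight)+
      assume j: "\<bar>j\<bar> \<le> int L"
      have "\<bar>corr (line i n (j + 1)) - corr (line i n j)\<bar> \<le> 2 * (2 + (lap (line i n j) + lap (line i n j + shift i)) * (t - s)) / B"
        unfolding line_step by (rule corr_step) (use n in simp)
      also have "\<dots> \<le> h j / B"
        unfolding h_def using ts B_pos by (intro divide_right_mono mult_left_mono add_mono) auto
      also have "\<dots> \<le> \<zeta>"
      proof -
        have "h j \<le> (\<Sum>j\<in>{- int L..int L}. h j)" using j h0 by (intro member_le_sum) auto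
        also have "\<dots> \<le> \<zeta> * B0" using \<zeta> by (simp add: B0_def field_simps)
        also have "\<dots> \<le> \<zeta> * B" using B \<zeta> by simp
        finally show ?thesis using B_pos by (simp add: divide_le_eq)
      qed
      finally show "\<bar>corr (line i n (j + 1)) - corr (line i n j)\<bar> \<le> \<zeta>" .
    qed (rule weight_nonneg)
    then show "weight n \<le> \<epsilon>" by simp
  qed
qed

lemma finite_lap_le: "finite {n. lap n \<le> R}"
proof -
  let ?I = "{- \<lceil>\<bar>R\<bar>\<rceil>..\<lceil>\<bar>R\<bar>\<rceil>}"
  have "{n. lap n \<le> R} \<subseteq> (\<lambda>(p, q). \<chi> j. if j = 1 then p else q) ` (?I \<times> ?I)"
  proof
    fix n :: "int^2" assume "n \<in> {n. lap n \<le> R}"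
    then have R: "lap n \<le> R" by simp
    have "n $ j \<in> ?I" for j
    proof -
      have "\<bar>n $ j\<bar> \<le> \<bar>n $ j\<bar> * \<bar>n $ j\<bar>"
        using mult_left_mono[of 1 "\<bar>n $ j\<bar>" "\<bar>n $ j\<bar>"] by (cases "n $ j = 0") auto
      then have "real_of_int \<bar>n $ j\<bar> \<le> real_of_int (\<bar>n $ j\<bar> * \<bar>n $ j\<bar>)" by (rule of_int_le_iff[THEN iffD2])
      also have "\<dots> = (real_of_int (n $ j))\<^sup>2" by (simp add: power2_eq_square)
      also have "\<dots> \<le> lap n" unfolding lap_def by (rule member_le_sum) auto
      also have "\<dots> \<le> \<bar>R\<bar>" using R by simp
      finally show ?thesis by (auto simp: abs_le_iff le_ceiling_iff) linarith+
    qed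
    then have m: "(n $ 1, n $ 2) \<in> ?I \<times> ?I" by blast
    have "n = (\<lambda>(p, q). \<chi> j. if j = 1 then p else q) (n $ 1, n $ 2)"
      using exhaust_2 by (auto simp: vec_eq_iff)
    then show "n \<in> (\<lambda>(p, q). \<chi> j. if j = 1 then p else q) ` (?I \<times> ?I)" using m by (rule image_eqI)
  qed
  then show ?thesis by (rule finite_subset) auto
qed

text \<open>Modes of high frequency are damped by the diffusion, the finitely many others by
  lemma \<open>mode_decay\<close>.\<close>

lemma phase_decay:
  fixes W :: real
  assumes \<epsilon>: "\<epsilon> > 0" and T: "T \<ge> 0" and W: "W > 0"
  obtains B0 where "B0 > 0"
    "\<And>\<tau> a c g A s t w B. flow_phase \<tau> a c g A i s t w B \<Longrightarrow> t - s \<le> T \<Longrightarrow> (\<integral>r. w r \<partial>lebesgue_on {s..t}) = W \<Longrightarrow>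
       B0 \<le> B \<Longrightarrow> mode_flow.energy c {n. cross i n \<noteq> 0} t \<le> \<epsilon>"
proof -
  \<comment> \<open>Modes with \<open>lap n\<close> above \<open>N\<close> carry at most
    \<open>1 / (2 * N)\<close>, since the total dissipation is at most 1/2; this choice turns that
    into half of \<open>\<epsilon> * W\<close>.\<close>
  define N where "N = 1 / (\<epsilon> * W)"
  have N: "N > 0" using \<epsilon> W by (simp add: N_def)
  let ?K = "{n. cross i n \<noteq> 0}"
  define F where "F = {n \<in> ?K. lap n \<le> N}"
  have F: "finite F" unfolding F_def by (rule finite_subset[OF _ finite_lap_le[of N]]) auto
  \<comment> \<open>The other half of \<open>\<epsilon> * W\<close> is shared among the modes of
    \<open>F\<close>; the summand 1 covers an empty \<open>F\<close>.\<close>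
  define \<eta> where "\<eta> = \<epsilon> * W / (2 * (real (card F) + 1))"
  have \<eta>: "\<eta> > 0" using \<epsilon> W by (simp add: \<eta>_def add_nonneg_pos)
  have "\<exists>B0>0. \<forall>\<tau> a c g A s t w B. flow_phase \<tau> a c g A i s t w B \<longrightarrow> t - s \<le> T \<longrightarrow> B0 \<le> B \<longrightarrow> flow_phase.weight c s t w n \<le> \<eta>"
    if "n \<in> F" for n
  proof -
    have "cross i n \<noteq> 0" using that by (simp add: F_def)
    from mode_decay[OF \<eta> T this] show ?thesis by metis
  qed
  then obtain b where b: "\<And>n. n \<in> F \<Longrightarrow> b n > 0"
    "\<And>n \<tau> a c g A s t w B. n \<in> F \<Longrightarrow> flow_phase \<tau> a c g A i s t w B \<Longrightarrow> t - s \<le> T \<Longrightarrow> b n \<le> B \<Longrightarrow> flow_phase.weight c s t w n \<le> \<eta>"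
    by metis
  define B0 where "B0 = (\<Sum>n\<in>F. b n) + 1"
  have bB: "b n \<le> B0" if "n \<in> F" for n
    using member_le_sum[of n F b] b(1) F that by (auto simp: B0_def less_imp_le intro: order_trans)
  show thesis
  proof
    show "B0 > 0" unfolding B0_def using b(1) by (intro add_nonneg_pos sum_nonneg) (auto simp: less_imp_le)
    fix \<tau> a c g A s t w B
    assume fp: "flow_phase \<tau> a c g A i s t w B" and ts: "t - s \<le> T" and Wi: "(\<integral>r. w r \<partial>lebesgue_on {s..t}) = W" and B: "B0 \<le> B"
    then interpret flow_phase \<tau> a c g A i s t w B by simp
    obtain S where S: "(weight has_sum S) ?K" "energy ?K t * W \<le> S"
      using weighted_energy[of ?K] Wi by auto
    let ?l = "\<lambda>n. lap n * mass s t n"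
    have 1: "((\<lambda>n. if n \<in> F then \<eta> else 0) has_sum (real (card F) * \<eta>)) ?K"
      by (rule has_sum_finite_neutralI[OF F]) (auto simp: F_def)
    have 2: "((\<lambda>n. (1 / N) * ?l n) has_sum (1 / N) * (\<Sum>\<^sub>\<infinity>n\<in>?K. ?l n)) ?K"
      by (intro has_sum_cmult_right has_sum_infsum lap_mass_sub_summable st)
    have "S \<le> real (card F) * \<eta> + (1 / N) * (\<Sum>\<^sub>\<infinity>n\<in>?K. ?l n)"
    proof (rule has_sum_mono[OF S(1) has_sum_add[OF 1 2]])
      fix n assume n: "n \<in> ?K"
      have m0: "mass s t n \<ge> 0" by (rule mass_mono(2)[OF st])
      show "weight n \<le> (if n \<in> F then \<eta> else 0) + (1 / N) * ?l n"
      proof (cases "n \<in> F")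
        case True
        have "0 \<le> (1 / N) * ?l n" using N m0 by simp
        then show ?thesis using True b(2)[OF True fp ts] bB[OF True] B by simp
      next
        case False
        then have "N \<le> lap n" using n by (auto simp: F_def)
        then have "N * mass s t n \<le> ?l n" using m0 by (rule mult_right_mono)
        moreover have "N * weight n \<le> N * mass s t n" using weight_le_mass[of n] N by (intro mult_left_mono) auto
        ultimately have "N * weight n \<le> ?l n" by linarith
        then show ?thesis using False N by (simp add: field_simps)
      qed
    qed
    also have "(\<Sum>\<^sub>\<infinity>n\<in>?K. ?l n) \<le> (\<Sum>\<^sub>\<infinity>n. ?l n)"
      by (rule infsum_mono2) (use lap_mass_sub_summable[OF st] mass_mono(2)[OF st] in auto)
    also have "\<dots> \<le> 1 / 2" by (rule lap_mass_le)
    finally have "S \<le> real (card F) * \<eta> + (1 / N) * (1 / 2)" using N by (simp add: mult_left_mono divide_right_mono)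
    moreover have "real (card F) * \<eta> \<le> \<epsilon> * W / 2"
    proof -
      have "real (card F) * \<eta> \<le> (real (card F) + 1) * \<eta>" using \<eta> by simp
      also have "\<dots> = \<epsilon> * W / 2"
      proof -
        have "q * (x / (2 * q)) = x / 2" if "q \<noteq> 0" for q x :: real using that by simp
        then show ?thesis unfolding \<eta>_def by (metis add_nonneg_pos less_irrefl of_nat_0_le_iff zero_less_one)
      qed
      finally show ?thesis .
    qed
    moreover have "(1 / N) * (1 / 2) = \<epsilon> * W / 2" by (simp add: N_def)
    ultimately have "energy ?K t * W \<le> \<epsilon> * W" using S(2) by linarith
    then show "energy ?K t \<le> \<epsilon>" using W by simp
  qed
qed

section \<open>The two-phase shear flow\<close>

text \<open>Squaring the positive part makes the amplitudes continuously differentiable and keeps their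
  supports disjoint.\<close>

definition pulse :: "real \<Rightarrow> 2 \<Rightarrow> real \<Rightarrow> real" where
  "pulse \<tau> i r = (max 0 ((if i = 1 then 1 else - 1) * sin (2 * pi / \<tau> * r)))\<^sup>2"

definition pulse_deriv :: "real \<Rightarrow> 2 \<Rightarrow> real \<Rightarrow> real" where
  "pulse_deriv \<tau> i r = 2 * max 0 ((if i = 1 then 1 else - 1) * sin (2 * pi / \<tau> * r))
     * ((if i = 1 then 1 else - 1) * (2 * pi / \<tau> * cos (2 * pi / \<tau> * r)))"

lemma pulse_cont: "continuous_on S (pulse \<tau> i)"
  unfolding pulse_def by (intro continuous_intros)

lemma pulse_deriv_cont: "continuous_on S (pulse_deriv \<tau> i)"
  unfolding pulse_deriv_def by (intro continuous_intros)

lemma pulse_0 [simp]: "pulse \<tau> i 0 = 0"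
  by (simp add: pulse_def)

lemma pulse_nonneg: "0 \<le> pulse \<tau> i r"
  by (simp add: pulse_def)

lemma pulse_le_1: "pulse \<tau> i r \<le> 1"
proof -
  have "max 0 ((if i = 1 then 1 else - 1) * sin (2 * pi / \<tau> * r)) \<le> 1"
    using abs_sin_le_one[of "2 * pi / \<tau> * r"] by (auto simp: abs_le_iff)
  from power_mono[OF this, of 2] show ?thesis by (simp add: pulse_def)
qed

lemma square_pos_part_deriv: "((\<lambda>x::real. (max 0 x)\<^sup>2) has_real_derivative 2 * max 0 x) (at x)"
proof (cases x "0 :: real" rule: linorder_cases)
  case less
  have "((\<lambda>x::real. 0) has_real_derivative 0) (at x)" by simp
  then have "((\<lambda>x::real. (max 0 x)\<^sup>2) has_real_derivative 0) (at x)"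
    by (rule has_field_derivative_transform_within_open[where S = "{..<0}"]) (use less in auto)
  then show ?thesis using less by simp
next
  case greater
  have "((\<lambda>x::real. x\<^sup>2) has_real_derivative 2 * x) (at x)" by (auto intro!: derivative_eq_intros)
  then have "((\<lambda>x::real. (max 0 x)\<^sup>2) has_real_derivative 2 * x) (at x)"
    by (rule has_field_derivative_transform_within_open[where S = "{0<..}"]) (use greater in auto)
  then show ?thesis using greater by simp
next
  case equal
  have "((\<lambda>h::real. ((max 0 (0 + h))\<^sup>2 - (max 0 0)\<^sup>2) / h) \<longlongrightarrow> 0) (at 0)"
  proof (rule Lim_null_comparison)
    show "\<forall>\<^sub>F h::real in at 0. norm (((max 0 (0 + h))\<^sup>2 - (max 0 0)\<^sup>2) / h) \<le> \<bar>h\<bar>"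
      by (intro always_eventually) (auto simp: max_def power2_eq_square)
    show "((\<lambda>h::real. \<bar>h\<bar>) \<longlongrightarrow> 0) (at 0)" by (auto intro!: tendsto_eq_intros)
  qed
  then show ?thesis using equal by (simp add: DERIV_def)
qed

lemma pulse_has_deriv: "(pulse \<tau> i has_real_derivative pulse_deriv \<tau> i r) (at r within S)"
proof -
  have "((\<lambda>r. k * sin (q * r)) has_real_derivative k * (q * cos (q * r))) (at r within S)" for k q :: real
    by (auto intro!: derivative_eq_intros)
  from DERIV_chain2[OF square_pos_part_deriv this] show ?thesis
    unfolding pulse_def[abs_def] pulse_deriv_def .
qed

lemma pulse_product: "pulse \<tau> 1 r * pulse \<tau> 2 r = 0"
  by (auto simp: pulse_def max_def)

context
  fixes \<tau> :: real assumes \<tau>: "\<tau> > 0"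
begin

lemma sin_first: "r \<in> {0..\<tau>/2} \<Longrightarrow> sin (2 * pi / \<tau> * r) \<ge> 0"
  using \<tau> by (intro sin_ge_zero) (auto simp: field_simps)

lemma sin_second: "r \<in> {\<tau>/2..\<tau>} \<Longrightarrow> sin (2 * pi / \<tau> * r) \<le> 0"
proof -
  assume r: "r \<in> {\<tau>/2..\<tau>}"
  have "sin (2 * pi / \<tau> * (r - \<tau>/2)) \<ge> 0" using r \<tau> by (intro sin_first) auto
  moreover have "2 * pi / \<tau> * (r - \<tau>/2) = 2 * pi / \<tau> * r - pi" using \<tau> by (simp add: field_simps)
  ultimately show ?thesis by (simp add: sin_diff)
qed

lemma pulse_off: "r \<in> {0..\<tau>/2} \<Longrightarrow> pulse \<tau> 2 r = 0" "r \<in> {\<tau>/2..\<tau>} \<Longrightarrow> pulse \<tau> 1 r = 0"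
  using sin_first[of r] sin_second[of r] by (auto simp: pulse_def)

text \<open>The common value for both halves serves as the constant \<open>W\<close> of
  \<open>phase_decay\<close>.\<close>

lemma integral_pulse:
  "(\<integral>r. pulse \<tau> 1 r \<partial>lebesgue_on {0..\<tau>/2}) = \<tau> / 4" "(\<integral>r. pulse \<tau> 2 r \<partial>lebesgue_on {\<tau>/2..\<tau>}) = \<tau> / 4"
proof -
  define F where "F r = r / 2 - sin (2 * (2 * pi / \<tau> * r)) / (8 * pi / \<tau>)" for r
  have F: "(F has_real_derivative (sin (2 * pi / \<tau> * r))\<^sup>2) (at r within S)" for r S
  proof -
    have "(F has_real_derivative (1 / 2 - cos (2 * (2 * pi / \<tau> * r)) * (2 * (2 * pi / \<tau>)) / (8 * pi / \<tau>))) (at r within S)"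
      unfolding F_def by (auto intro!: derivative_eq_intros)
    moreover have "1 / 2 - cos (2 * (2 * pi / \<tau> * r)) * (2 * (2 * pi / \<tau>)) / (8 * pi / \<tau>) = (sin (2 * pi / \<tau> * r))\<^sup>2"
      unfolding cos_double cos_squared_eq using \<tau> by (simp add: field_simps)
    ultimately show ?thesis by simp
  qed
  have 1: "2 * (2 * pi / \<tau> * 0) = 0" "2 * (2 * pi / \<tau> * (\<tau> / 2)) = 2 * pi" "2 * (2 * pi / \<tau> * \<tau>) = 4 * pi"
    using \<tau> by auto
  have s4: "sin (4 * pi) = 0" using sin_npi[of 4] by simp
  have "(\<integral>r. pulse \<tau> 1 r \<partial>lebesgue_on {0..\<tau>/2}) = F (\<tau>/2) - F 0"
  proof (rule FTC_lebesgue)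
    show "(F has_real_derivative pulse \<tau> 1 r) (at r within {0..\<tau>/2})" if "r \<in> {0..\<tau>/2}" for r
      using F[of r] sin_first[OF that] by (simp add: pulse_def)
  qed (use \<tau> pulse_cont in auto)
  then show "(\<integral>r. pulse \<tau> 1 r \<partial>lebesgue_on {0..\<tau>/2}) = \<tau> / 4" unfolding F_def 1 by simp
  have "(\<integral>r. pulse \<tau> 2 r \<partial>lebesgue_on {\<tau>/2..\<tau>}) = F \<tau> - F (\<tau>/2)"
  proof (rule FTC_lebesgue)
    show "(F has_real_derivative pulse \<tau> 2 r) (at r within {\<tau>/2..\<tau>})" if "r \<in> {\<tau>/2..\<tau>}" for r
      using F[of r] sin_second[OF that] by (simp add: pulse_def)
  qed (use \<tau> pulse_cont in auto)
  then show "(\<integral>r. pulse \<tau> 2 r \<partial>lebesgue_on {\<tau>/2..\<tau>}) = \<tau> / 4" unfolding F_def 1 using s4 by simp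
qed

text \<open>It is convenient to argue from the end: the second phase damps every mode with
  \<open>cross 2 n \<noteq> 0\<close>, whatever its history. The remaining modes other than the mean
  have \<open>cross 1 n \<noteq> 0\<close>, hence are small at half time, and their energy cannot
  grow afterwards because they form a union of lines of the second shear.\<close>

theorem two_phase_decay:
  assumes \<epsilon>: "\<epsilon> > 0"
  obtains B where "B > 0"
    "\<And>c g A. mode_flow \<tau> (\<lambda>i r. B * pulse \<tau> i r) c g A \<Longrightarrow> mode_flow.energy c UNIV 0 \<le> 1 \<Longrightarrow> c 0 0 = 0 \<Longrightarrow>
       mode_flow.energy c UNIV \<tau> \<le> \<epsilon>"
proof -
  have p: "\<epsilon> / 2 > 0" "\<tau> / 2 \<ge> 0" "\<tau> / 4 > 0" using \<epsilon> \<tau> by auto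
  obtain B1 where B1: "B1 > 0"
    "\<And>T a c g A s t w B. flow_phase T a c g A 1 s t w B \<Longrightarrow> t - s \<le> \<tau> / 2 \<Longrightarrow> (\<integral>r. w r \<partial>lebesgue_on {s..t}) = \<tau> / 4 \<Longrightarrow>
       B1 \<le> B \<Longrightarrow> mode_flow.energy c {n. cross 1 n \<noteq> 0} t \<le> \<epsilon> / 2"
    using phase_decay[OF p, of 1] by metis
  obtain B2 where B2: "B2 > 0"
    "\<And>T a c g A s t w B. flow_phase T a c g A 2 s t w B \<Longrightarrow> t - s \<le> \<tau> / 2 \<Longrightarrow> (\<integral>r. w r \<partial>lebesgue_on {s..t}) = \<tau> / 4 \<Longrightarrow>
       B2 \<le> B \<Longrightarrow> mode_flow.energy c {n. cross 2 n \<noteq> 0} t \<le> \<epsilon> / 2"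
    using phase_decay[OF p, of 2] by metis
  show thesis
  proof
    let ?B = "B1 + B2"
    show "?B > 0" using B1(1) B2(1) by simp
    fix c g A
    assume mf: "mode_flow \<tau> (\<lambda>i r. ?B * pulse \<tau> i r) c g A" and E1: "mode_flow.energy c UNIV 0 \<le> 1" and c00: "c 0 0 = 0"
    interpret mode_flow \<tau> "\<lambda>i r. ?B * pulse \<tau> i r" c g A by (rule mf)
    have ne: "j = 2" if "j \<noteq> 1" for j :: 2 using that exhaust_2 by blast
    have Eh: "energy UNIV (\<tau>/2) \<le> 1"
      using energy_decreasing[of 0 "\<tau>/2" UNIV] \<tau> E1 by auto
    have "flow_phase \<tau> (\<lambda>i r. ?B * pulse \<tau> i r) c g A 1 0 (\<tau>/2) (pulse \<tau> 1) ?B"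
    proof unfold_locales
      show "?B * pulse \<tau> j r = 0" if "j \<noteq> 1" "r \<in> {0..\<tau>/2}" for j r
        using ne[OF that(1)] pulse_off(1)[OF that(2)] by simp
    qed (use \<tau> B1(1) B2(1) E1 pulse_cont pulse_nonneg pulse_le_1 in auto)
    from B1(2)[OF this] have P1: "energy {n. cross 1 n \<noteq> 0} (\<tau>/2) \<le> \<epsilon> / 2"
      using integral_pulse B2(1) by simp
    have "flow_phase \<tau> (\<lambda>i r. ?B * pulse \<tau> i r) c g A 2 (\<tau>/2) \<tau> (pulse \<tau> 2) ?B"
    proof unfold_locales
      show "?B * pulse \<tau> j r = 0" if "j \<noteq> 2" "r \<in> {\<tau>/2..\<tau>}" for j r
        using that(1) exhaust_2[of j] pulse_off(2)[OF that(2)] by auto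
    qed (use \<tau> B1(1) B2(1) Eh pulse_cont pulse_nonneg pulse_le_1 in auto)
    from B2(2)[OF this] have P2: "energy {n. cross 2 n \<noteq> 0} \<tau> \<le> \<epsilon> / 2"
      using integral_pulse B1(1) by simp
    have fl0: "flux i 0 t (0 - shift i) = 0" "flux i 0 t 0 = 0" for i t
      by (simp_all add: flux_def cross_def)
    \<comment> \<open>The mean has neither diffusion nor flux, so it keeps its initial value
      0.\<close>
    have c0: "c 0 (\<tau>/2) = 0"
      using mode_energy[of 0 "\<tau>/2" 0] \<tau> c00 fl0 by (simp add: lap_def)
    \<comment> \<open>\<open>cross 1 n\<close> is \<open>n $ 2\<close> and \<open>cross 2 n\<close>
      is \<open>n $ 1 + n $ 2\<close>; both vanish only at 0.\<close>
    have split: "{n. cross 2 n = 0} \<subseteq> insert 0 {n. cross 1 n \<noteq> 0}"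
    proof
      fix n assume "n \<in> {n. cross 2 n = 0}"
      then have "n $ 1 + n $ 2 = 0" by (simp add: cross_def shift_def)
      then have "n = 0" if "n $ 2 = 0" using that exhaust_2 by (auto simp: vec_eq_iff) (metis add.right_neutral exhaust_2)
      then show "n \<in> insert 0 {n. cross 1 n \<noteq> 0}" by (auto simp: cross_def shift_def)
    qed
    have "energy {n. cross 2 n = 0} \<tau> \<le> energy {n. cross 2 n = 0} (\<tau>/2)"
    proof (rule energy_decreasing)
      show "(\<forall>n. n + shift j \<in> {n. cross 2 n = 0} \<longleftrightarrow> n \<in> {n. cross 2 n = 0}) \<or> (\<forall>r\<in>{\<tau>/2..\<tau>}. ?B * pulse \<tau> j r = 0)" for j
        using exhaust_2[of j] pulse_off(2) by auto
    qed (use \<tau> in auto)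
    also have "\<dots> \<le> energy (insert 0 {n. cross 1 n \<noteq> 0}) (\<tau>/2)"
      using split \<tau> by (intro energy_mono) auto
    also have "\<dots> = energy {n. cross 1 n \<noteq> 0} (\<tau>/2)"
      unfolding energy_def by (rule infsum_cong_neutral) (auto simp: c0)
    finally have P3: "energy {n. cross 2 n = 0} \<tau> \<le> \<epsilon> / 2" using P1 by simp
    have "energy UNIV \<tau> = energy ({n. cross 2 n = 0} \<union> {n. cross 2 n \<noteq> 0}) \<tau>"
      by (rule arg_cong[where f = "\<lambda>K. energy K \<tau>"]) auto
    also have "\<dots> = energy {n. cross 2 n = 0} \<tau> + energy {n. cross 2 n \<noteq> 0} \<tau>"
      unfolding energy_def using \<tau> by (intro infsum_Un_disjoint c_square_summable) auto
    finally show "energy UNIV \<tau> \<le> \<epsilon>" using P2 P3 by simp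
  qed
qed

end

section \<open>Weak solutions and their Fourier coefficients\<close>

abbreviation cx :: "(real^2 \<Rightarrow> real) \<Rightarrow> real^2 \<Rightarrow> complex" where
  "cx f \<equiv> \<lambda>x. complex_of_real (f x)"

lemma torus_L2_iff: "f \<in> torus_L2 \<longleftrightarrow> torus_periodic f \<and> cx f \<in> cL2"
proof -
  have re: "(\<lambda>x. Re (cx f x)) \<in> borel_measurable torus" if "cx f \<in> borel_measurable torus"
    using that by measurable
  have 1: "cx f \<in> borel_measurable torus \<longleftrightarrow> f \<in> borel_measurable torus"
  proof
    assume "f \<in> borel_measurable torus"
    then show "cx f \<in> borel_measurable torus" by measurable
  qed (use re in \<open>simp only: Re_complex_of_real\<close>)
  have 2: "(\<lambda>x. (cmod (cx f x))\<^sup>2) = (\<lambda>x. (f x)\<^sup>2)" by simp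
  show ?thesis unfolding torus_L2_def cL2_def mem_Collect_eq 1 2 ..
qed

lemma torus_L2_cx: "f \<in> torus_L2 \<Longrightarrow> cx f \<in> cL2"
  by (simp add: torus_L2_iff)

lemma torus_L2_measurable: "f \<in> torus_L2 \<Longrightarrow> f \<in> borel_measurable torus"
  by (simp add: torus_L2_def)

lemma torus_L2_diff: "f \<in> torus_L2 \<Longrightarrow> g \<in> torus_L2 \<Longrightarrow> (\<lambda>x. f x - g x) \<in> torus_L2"
  by (auto simp: torus_L2_iff torus_periodic_def)

lemma torus_L2_add: "f \<in> torus_L2 \<Longrightarrow> g \<in> torus_L2 \<Longrightarrow> (\<lambda>x. f x + g x) \<in> torus_L2"
  by (auto simp: torus_L2_iff torus_periodic_def)

lemma torus_L2_cmult: "f \<in> torus_L2 \<Longrightarrow> (\<lambda>x. k * f x) \<in> torus_L2"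
  by (auto simp: torus_L2_iff torus_periodic_def)

lemma fourier_coeff_diff:
  "f \<in> torus_L2 \<Longrightarrow> g \<in> torus_L2 \<Longrightarrow> fourier_coeff (\<lambda>x. f x - g x) n = fourier_coeff f n - fourier_coeff g n"
  by (simp add: fourier_coeff_cfc cfc_diff torus_L2_cx)

lemma fourier_coeff_add:
  "f \<in> torus_L2 \<Longrightarrow> g \<in> torus_L2 \<Longrightarrow> fourier_coeff (\<lambda>x. f x + g x) n = fourier_coeff f n + fourier_coeff g n"
  by (simp add: fourier_coeff_cfc cfc_add torus_L2_cx)

lemma fourier_coeff_cmult: "fourier_coeff (\<lambda>x. k * f x) n = of_real k * fourier_coeff f n"
  by (simp add: fourier_coeff_cfc cfc_cmult)

lemma fourier_coeff_minus: "fourier_coeff f (- n) = cnj (fourier_coeff f n)"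
  using cfc_cnj[of "cx f" "- n"] by (simp add: fourier_coeff_cfc)

lemma L2_norm_msq: "L2_norm_torus f = 2 * pi * sqrt (msq (cx f))"
proof -
  have "sqrt ((2 * pi)\<^sup>2) = 2 * pi" by (simp only: real_sqrt_abs) simp
  then show ?thesis
    by (simp only: L2_norm_torus_def msq_def real_sqrt_divide norm_of_real power2_abs) simp
qed

lemma Parseval_real:
  "f \<in> torus_L2 \<Longrightarrow> ((\<lambda>n. (cmod (fourier_coeff f n))\<^sup>2) has_sum msq (cx f)) UNIV"
  using Parseval[OF torus_L2_cx] by (simp add: fourier_coeff_cfc)

lemma fourier_coeff_le_msq: "f \<in> torus_L2 \<Longrightarrow> (cmod (fourier_coeff f n))\<^sup>2 \<le> msq (cx f)"
  using Bessel_torus[OF torus_L2_cx, of f "{n}"] by (simp add: fourier_coeff_cfc)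

lemma torus_L2_eq_AE:
  "f \<in> torus_L2 \<Longrightarrow> g \<in> torus_L2 \<Longrightarrow> (\<And>n. fourier_coeff f n = fourier_coeff g n) \<Longrightarrow> AE x in torus. f x = g x"
  using cL2_eq_AE[of "cx f" "cx g"] by (simp add: torus_L2_cx fourier_coeff_cfc)

lemma torus_L2_Re:
  assumes "F \<in> cL2" "\<And>x j. F (x + axis j (2 * pi)) = F x"
  shows "(\<lambda>x. Re (F x)) \<in> torus_L2"
    "fourier_coeff (\<lambda>x. Re (F x)) n = (cfc F n + cnj (cfc F (- n))) / 2"
proof -
  have e: "cx (\<lambda>x. Re (F x)) = (\<lambda>x. (1/2) * (F x + cnj (F x)))" by (auto simp: fun_eq_iff complex_eq_iff)
  show "(\<lambda>x. Re (F x)) \<in> torus_L2"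
    unfolding torus_L2_iff e torus_periodic_def
    by (intro conjI cL2_cmult cL2_add cL2_cnj assms(1)) (simp add: assms(2))
  show "fourier_coeff (\<lambda>x. Re (F x)) n = (cfc F n + cnj (cfc F (- n))) / 2"
    unfolding fourier_coeff_cfc e cfc_cmult using assms(1) by (subst cfc_add) (auto simp: cfc_cnj)
qed

text \<open>Taking the real part of the complex Riesz-Fischer function keeps the coefficients,
  because they are Hermitian symmetric.\<close>

lemma riesz_fischer_real:
  assumes "(\<lambda>n. (cmod (c n))\<^sup>2) summable_on UNIV" "\<And>n. c (- n) = cnj (c n)"
  obtains f where "f \<in> torus_L2" "\<And>n. fourier_coeff f n = c n"
proof -
  obtain F where F: "F \<in> cL2" "\<And>n. cfc F n = c n" "\<And>x j. F (x + axis j (2 * pi)) = F x"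
    using riesz_fischer[OF assms(1)] by metis
  have "fourier_coeff (\<lambda>x. Re (F x)) n = c n" for n
    using assms(2)[of n] by (simp add: torus_L2_Re(2)[OF F(1,3)] F(2))
  then show thesis using that torus_L2_Re(1)[OF F(1,3)] by blast
qed

lemma integral_Re_wave:
  assumes F: "F \<in> torus_L2"
  shows "(\<integral>x. F x * Re (u * wave (- n) x) \<partial>torus) = (2 * pi)\<^sup>2 * Re (u * fourier_coeff F n)"
    "integrable torus (\<lambda>x. F x * Re (u * wave (- n) x))"
proof -
  have i: "integrable torus (\<lambda>x. cx F x * (u * wave (- n) x))"
    by (intro integrable_cL2_mult torus_L2_cx F cL2_cmult cL2_wave)
  have "(\<integral>x. F x * Re (u * wave (- n) x) \<partial>torus) = (\<integral>x. Re (cx F x * (u * wave (- n) x)) \<partial>torus)" by simp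
  also have "\<dots> = Re (\<integral>x. u * (cx F x * wave (- n) x) \<partial>torus)"
    using integral_Re[OF i] by (simp only: mult.left_commute)
  also have "\<dots> = (2 * pi)\<^sup>2 * Re (u * fourier_coeff F n)"
    by (simp add: fourier_coeff_cfc cfc_def mean_def power2_eq_square)
  finally show "(\<integral>x. F x * Re (u * wave (- n) x) \<partial>torus) = (2 * pi)\<^sup>2 * Re (u * fourier_coeff F n)" .
  show "integrable torus (\<lambda>x. F x * Re (u * wave (- n) x))" using integrable_Re[OF i] by simp
qed

text \<open>The weak formulation admits real test functions; the complex factor \<open>u\<close>
  lets them recover a complex coefficient \<open>z\<close> through the values
  \<open>Re (u * z)\<close>.\<close>

definition test_fun :: "complex \<Rightarrow> int^2 \<Rightarrow> real^2 \<Rightarrow> real" where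
  "test_fun u n x = Re (u * wave (- n) x)"

definition test_grad :: "complex \<Rightarrow> int^2 \<Rightarrow> real^2 \<Rightarrow> real^2" where
  "test_grad u n x = (\<chi> j. Re ((- \<i> * of_int (n $ j) * u) * wave (- n) x))"

lemma Re_wave_L2:
  "(\<lambda>x. Re (u * wave (- n) x)) \<in> torus_L2"
  "fourier_coeff (\<lambda>x. Re (u * wave (- n) x)) m = (u * (if m = - n then 1 else 0) + cnj u * (if m = n then 1 else 0)) / 2"
proof -
  have F: "(\<lambda>x. u * wave (- n) x) \<in> cL2" "u * wave (- n) (x + axis j (2 * pi)) = u * wave (- n) x" for x j
    by (auto simp: periodic_wave)
  show "(\<lambda>x. Re (u * wave (- n) x)) \<in> torus_L2" by (rule torus_L2_Re(1)[OF F])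
  show "fourier_coeff (\<lambda>x. Re (u * wave (- n) x)) m = (u * (if m = - n then 1 else 0) + cnj u * (if m = n then 1 else 0)) / 2"
    unfolding torus_L2_Re(2)[OF F] cfc_cmult cfc_wave by auto
qed

lemma weak_gradient_test: "weak_gradient (test_fun u n) (test_grad u n)"
  unfolding weak_gradient_def
proof (intro conjI allI)
  show "test_fun u n \<in> torus_L2" unfolding test_fun_def[abs_def] by (rule Re_wave_L2(1))
  fix j
  have e: "(\<lambda>x. test_grad u n x $ j) = (\<lambda>x. Re ((- \<i> * of_int (n $ j) * u) * wave (- n) x))"
    by (simp add: test_grad_def)
  show "(\<lambda>x. test_grad u n x $ j) \<in> torus_L2" unfolding e by (rule Re_wave_L2(1))
  show "fourier_coeff (\<lambda>x. test_grad u n x $ j) m = \<i> * of_int (m $ j) * fourier_coeff (test_fun u n) m" for m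
  proof (cases "n = 0")
    case False
    then have "- n \<noteq> n" by (auto simp: vec_eq_iff)
    then show ?thesis unfolding e test_fun_def[abs_def] Re_wave_L2(2) by (auto simp: field_simps)
  qed (unfold e test_fun_def[abs_def] Re_wave_L2(2), auto)
qed

definition phase :: "2 \<Rightarrow> real^2 \<Rightarrow> real" where
  "phase i x = (\<Sum>j\<in>UNIV. of_int (shift i $ j) * x $ j)"

text \<open>\<open>shift i\<close> turned by a right angle, that is (0, 1) and (1, 1): the direction
  of the shear. Being orthogonal to the frequency, it makes the flow divergence-free.\<close>

definition perp :: "2 \<Rightarrow> 2 \<Rightarrow> int" where
  "perp i k = (if k = 1 then - shift i $ 2 else shift i $ 1)"

definition flow :: "(2 \<Rightarrow> real \<Rightarrow> real) \<Rightarrow> real \<Rightarrow> real^2 \<Rightarrow> real^2" where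
  "flow a t x = (\<chi> k. \<Sum>i\<in>UNIV. a i t * of_int (perp i k) * sin (phase i x))"

lemma sin_phase: "complex_of_real (sin (phase i x)) = (wave (shift i) x - wave (- shift i) x) / (2 * \<i>)"
  unfolding wave_minus by (simp add: wave_def phase_def complex_eq_iff)

lemma cos_phase: "complex_of_real (cos (phase i x)) = (wave (shift i) x + wave (- shift i) x) / 2"
  unfolding wave_minus by (simp add: wave_def phase_def complex_eq_iff)

lemma cL2_sin_mult:
  assumes "F \<in> cL2" shows "(\<lambda>x. of_real (sin (phase i x)) * F x) \<in> cL2"
    "cfc (\<lambda>x. of_real (sin (phase i x)) * F x) n = (cfc F (n - shift i) - cfc F (n + shift i)) / (2 * \<i>)"
proof -
  have e: "(\<lambda>x. of_real (sin (phase i x)) * F x) = (\<lambda>x. (1 / (2 * \<i>)) * (F x * wave (shift i) x - F x * wave (- shift i) x))"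
    by (auto simp: fun_eq_iff sin_phase algebra_simps diff_divide_distrib)
  show "(\<lambda>x. of_real (sin (phase i x)) * F x) \<in> cL2"
    unfolding e by (intro cL2_cmult cL2_diff cL2_mult_wave assms)
  have "cfc (\<lambda>x. F x * wave (shift i) x - F x * wave (- shift i) x) n = cfc F (n - shift i) - cfc F (n + shift i)"
    by (subst cfc_diff) (auto simp: cfc_mult_wave assms)
  then show "cfc (\<lambda>x. of_real (sin (phase i x)) * F x) n = (cfc F (n - shift i) - cfc F (n + shift i)) / (2 * \<i>)"
    unfolding e cfc_cmult by simp
qed

lemma weak_gradient_coeff:
  "weak_gradient \<phi> G \<Longrightarrow> cx (\<lambda>x. G x $ k) \<in> cL2"
  "weak_gradient \<phi> G \<Longrightarrow> cfc (cx (\<lambda>x. G x $ k)) n = \<i> * of_int (n $ k) * fourier_coeff \<phi> n"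
  by (simp_all add: weak_gradient_def torus_L2_cx flip: fourier_coeff_cfc)

text \<open>A sine factor shifts frequencies by \<open>shift i\<close> both ways, and the derivative
  contributes the inner product of \<open>perp i\<close> with the frequency. This is
  \<open>cross i n\<close>, unchanged by the shift, and the two imaginary units cancel.\<close>

lemma flow_gradient:
  assumes G: "weak_gradient \<phi> G"
  shows "cx (\<lambda>x. flow a t x \<bullet> G x) \<in> cL2"
    "cfc (cx (\<lambda>x. flow a t x \<bullet> G x)) n = transport a (\<lambda>n t. fourier_coeff \<phi> n) n t"
proof -
  let ?s = "\<lambda>i k x. of_real (sin (phase i x)) * cx (\<lambda>x. G x $ k) x"
  have e: "cx (\<lambda>x. flow a t x \<bullet> G x) = (\<lambda>x. \<Sum>i\<in>UNIV. \<Sum>k\<in>UNIV. of_real (a i t * of_int (perp i k)) * ?s i k x)"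
    by (simp add: fun_eq_iff flow_def inner_vec_def UNIV_2 algebra_simps)
  note s = cL2_sin_mult[OF weak_gradient_coeff(1)[OF G]]
  show "cx (\<lambda>x. flow a t x \<bullet> G x) \<in> cL2"
    unfolding e by (intro cL2_sum cL2_cmult s)
  have "cfc (cx (\<lambda>x. flow a t x \<bullet> G x)) n = (\<Sum>i\<in>UNIV. \<Sum>k\<in>UNIV. of_real (a i t * of_int (perp i k)) *
     ((\<i> * of_int ((n - shift i) $ k) * fourier_coeff \<phi> (n - shift i) - \<i> * of_int ((n + shift i) $ k) * fourier_coeff \<phi> (n + shift i)) / (2 * \<i>)))"
    unfolding e
    by (simp only: cfc_sum cL2_sum cL2_cmult s cfc_cmult weak_gradient_coeff(2)[OF G])
  also have "\<dots> = transport a (\<lambda>n t. fourier_coeff \<phi> n) n t"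
    unfolding transport_def
  proof (rule sum.cong[OF refl])
    fix i :: 2
    have x: "complex_of_int (cross i n) = (\<Sum>k\<in>UNIV. of_int (perp i k) * of_int (n $ k))" for n
      by (simp add: cross_def perp_def UNIV_2)
    have "(\<Sum>k\<in>UNIV. of_real (a i t * of_int (perp i k)) *
     ((\<i> * of_int ((n - shift i) $ k) * fourier_coeff \<phi> (n - shift i) - \<i> * of_int ((n + shift i) $ k) * fourier_coeff \<phi> (n + shift i)) / (2 * \<i>)))
     = of_real (a i t) / 2 * (of_int (cross i (n - shift i)) * fourier_coeff \<phi> (n - shift i) - of_int (cross i (n + shift i)) * fourier_coeff \<phi> (n + shift i))"
      unfolding x by (simp add: UNIV_2 field_simps)
    then show "(\<Sum>k\<in>UNIV. of_real (a i t * of_int (perp i k)) *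
     ((\<i> * of_int ((n - shift i) $ k) * fourier_coeff \<phi> (n - shift i) - \<i> * of_int ((n + shift i) $ k) * fourier_coeff \<phi> (n + shift i)) / (2 * \<i>)))
     = of_real (a i t * of_int (cross i n) / 2) * (fourier_coeff \<phi> (n - shift i) - fourier_coeff \<phi> (n + shift i))"
      by (simp add: field_simps)
  qed
  finally show "cfc (cx (\<lambda>x. flow a t x \<bullet> G x)) n = transport a (\<lambda>n t. fourier_coeff \<phi> n) n t" .
qed

lemma AE_torus_measurable:
  fixes f g :: "real^2 \<Rightarrow> 'b::euclidean_space"
  assumes "f \<in> borel_measurable torus" "AE x in torus. f x = g x" shows "g \<in> borel_measurable torus"
  using assms unfolding torus_def by (intro borel_measurable_lebesgue_on_AE[OF assms(1)[unfolded torus_def]]) auto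

lemma continuous_into_L2_coeff:
  assumes \<phi>: "continuous_into_L2 \<tau> \<phi>"
  shows "continuous_on {0..\<tau>} (\<lambda>t. fourier_coeff (\<phi> t) n)"
  unfolding continuous_on_def
proof
  fix t assume t: "t \<in> {0..\<tau>}"
  have L: "\<phi> r \<in> torus_L2" if "r \<in> {0..\<tau>}" for r using \<phi> that by (simp add: continuous_into_L2_def)
  have "((\<lambda>r. fourier_coeff (\<phi> r) n - fourier_coeff (\<phi> t) n) \<longlongrightarrow> 0) (at t within {0..\<tau>})"
  proof (rule Lim_null_comparison)
    show "((\<lambda>r. L2_norm_torus (\<lambda>x. \<phi> r x - \<phi> t x)) \<longlongrightarrow> 0) (at t within {0..\<tau>})"
      using \<phi> t by (simp add: continuous_into_L2_def)
    show "\<forall>\<^sub>F r in at t within {0..\<tau>}. norm (fourier_coeff (\<phi> r) n - fourier_coeff (\<phi> t) n) \<le> L2_norm_torus (\<lambda>x. \<phi> r x - \<phi> t x)"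
      unfolding eventually_at_filter
    proof (intro always_eventually allI impI)
      fix r assume r: "r \<in> {0..\<tau>}"
      let ?m = "msq (cx (\<lambda>x. \<phi> r x - \<phi> t x))"
      have "cmod (fourier_coeff (\<phi> r) n - fourier_coeff (\<phi> t) n) \<le> sqrt ?m"
        using fourier_coeff_le_msq[OF torus_L2_diff[OF L[OF r] L[OF t]], of n]
        by (intro real_le_rsqrt) (simp add: fourier_coeff_diff[OF L[OF r] L[OF t]])
      also have "1 * sqrt ?m \<le> (2 * pi) * sqrt ?m"
        using pi_ge_two by (intro mult_right_mono) auto
      finally show "norm (fourier_coeff (\<phi> r) n - fourier_coeff (\<phi> t) n) \<le> L2_norm_torus (\<lambda>x. \<phi> r x - \<phi> t x)"
        by (simp add: L2_norm_msq)
    qed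
  qed
  then show "((\<lambda>t. fourier_coeff (\<phi> t) n) \<longlongrightarrow> fourier_coeff (\<phi> t) n) (at t within {0..\<tau>})"
    by (rule Lim_null[THEN iffD2])
qed

text \<open>Sequential compactness: norms exceeding every \<open>k\<close> at times
  \<open>s k\<close> would contradict continuity at a limit point of these times. Continuity is
  given through norms of differences to a base point, hence the detour.\<close>

lemma continuous_into_L2_bounded:
  assumes \<phi>: "continuous_into_L2 \<tau> \<phi>"
  shows "\<exists>B. \<forall>t\<in>{0..\<tau>}. msq (cx (\<phi> t)) \<le> B"
proof (rule ccontr)
  assume neg: "\<not> (\<exists>B. \<forall>t\<in>{0..\<tau>}. msq (cx (\<phi> t)) \<le> B)"
  have "\<forall>k::nat. \<exists>t. t \<in> {0..\<tau>} \<and> real k < msq (cx (\<phi> t))"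
  proof
    fix k :: nat
    have "\<not> (\<forall>t\<in>{0..\<tau>}. msq (cx (\<phi> t)) \<le> real k)" using neg by blast
    then show "\<exists>t. t \<in> {0..\<tau>} \<and> real k < msq (cx (\<phi> t))" unfolding not_le[symmetric] by blast
  qed
  from choice[OF this] obtain s where s: "\<And>k::nat. s k \<in> {0..\<tau>}" "\<And>k. msq (cx (\<phi> (s k))) > real k" by blast
  have L: "\<phi> r \<in> torus_L2" if "r \<in> {0..\<tau>}" for r using \<phi> that by (simp add: continuous_into_L2_def)
  obtain l r where l: "l \<in> {0..\<tau>}" "strict_mono r" "(s \<circ> r) \<longlonglongrightarrow> l"
    using s(1) compact_Icc[of 0 \<tau>] unfolding compact_def by blast
  have "((\<lambda>r. L2_norm_torus (\<lambda>x. \<phi> r x - \<phi> l x)) \<longlongrightarrow> L2_norm_torus (\<lambda>x. \<phi> l x - \<phi> l x)) (at l within {0..\<tau>})"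
    using \<phi> l(1) by (simp add: continuous_into_L2_def L2_norm_torus_def)
  then have "continuous (at l within {0..\<tau>}) (\<lambda>r. L2_norm_torus (\<lambda>x. \<phi> r x - \<phi> l x))"
    by (simp add: continuous_within)
  then have "((\<lambda>r. L2_norm_torus (\<lambda>x. \<phi> r x - \<phi> l x)) \<circ> (s \<circ> r)) \<longlonglongrightarrow> L2_norm_torus (\<lambda>x. \<phi> l x - \<phi> l x)"
    unfolding continuous_within_sequentially using s(1) l(3) by auto
  then have "(\<lambda>k. L2_norm_torus (\<lambda>x. \<phi> (s (r k)) x - \<phi> l x)) \<longlonglongrightarrow> 0"
    by (simp add: o_def L2_norm_torus_def)
  then have "\<forall>\<^sub>F k in sequentially. L2_norm_torus (\<lambda>x. \<phi> (s (r k)) x - \<phi> l x) < 1"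
    by (rule order_tendstoD) simp
  then obtain N where N: "\<And>k. k \<ge> N \<Longrightarrow> L2_norm_torus (\<lambda>x. \<phi> (s (r k)) x - \<phi> l x) < 1"
    by (auto simp: eventually_sequentially)
  \<comment> \<open>Chosen beyond the bound \<open>2 * 1 + 2 * msq (cx (\<phi> l))\<close> that
    closeness to the limit point imposes.\<close>
  obtain K :: nat where K: "real K > 2 + 2 * msq (cx (\<phi> l))" using reals_Archimedean2 by blast
  define k where "k = max N K"
  let ?d = "\<lambda>x. \<phi> (s (r k)) x - \<phi> l x"
  have d: "?d \<in> torus_L2" using L s(1) l(1) by (intro torus_L2_diff) auto
  have "msq (cx ?d) \<le> 1"
  proof -
    have "2 * pi * sqrt (msq (cx ?d)) < 1" using N[of k] by (simp add: k_def L2_norm_msq)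
    moreover have "1 * sqrt (msq (cx ?d)) \<le> 2 * pi * sqrt (msq (cx ?d))"
      using pi_ge_two by (intro mult_right_mono) auto
    ultimately have "sqrt (msq (cx ?d)) \<le> 1" by linarith
    then show ?thesis by (simp only: real_sqrt_le_1_iff)
  qed
  moreover have "msq (cx (\<phi> (s (r k)))) \<le> 2 * msq (cx ?d) + 2 * msq (cx (\<phi> l))"
  proof -
    have le: "(x::real)\<^sup>2 \<le> 2 * (x - y)\<^sup>2 + 2 * y\<^sup>2" for x y
      using zero_le_power2[of "x - 2 * y"] by (simp add: power2_eq_square algebra_simps)
    have i: "integrable torus (\<lambda>x. (f x)\<^sup>2)" if "f \<in> torus_L2" for f using that by (simp add: torus_L2_def)
    have "(\<integral>x. (\<phi> (s (r k)) x)\<^sup>2 \<partial>torus) \<le> (\<integral>x. 2 * (?d x)\<^sup>2 + 2 * (\<phi> l x)\<^sup>2 \<partial>torus)"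
      by (rule integral_mono) (use i[OF L] i[OF d] s(1) l(1) le in auto)
    also have "\<dots> = 2 * (\<integral>x. (?d x)\<^sup>2 \<partial>torus) + 2 * (\<integral>x. (\<phi> l x)\<^sup>2 \<partial>torus)"
      using i[OF L[OF l(1)]] i[OF d] by simp
    finally have "(\<integral>x. (\<phi> (s (r k)) x)\<^sup>2 \<partial>torus) / (2*pi)\<^sup>2
        \<le> (2 * (\<integral>x. (?d x)\<^sup>2 \<partial>torus) + 2 * (\<integral>x. (\<phi> l x)\<^sup>2 \<partial>torus)) / (2*pi)\<^sup>2"
      by (rule divide_right_mono) simp
    moreover have "msq (cx h) = (\<integral>x. (h x)\<^sup>2 \<partial>torus) / (2*pi)\<^sup>2" for h
      by (simp only: msq_def norm_of_real power2_abs)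
    ultimately show ?thesis by (simp only: add_divide_distrib times_divide_eq_right)
  qed
  moreover have "real (r k) \<ge> real K" using seq_suble[OF l(2), of k] by (simp add: k_def)
  ultimately show False using s(2)[of "r k"] K by linarith
qed

lemma transport_local: "(\<And>m. c m t = d m t) \<Longrightarrow> transport a c n t = transport a d n t"
  by (simp add: transport_def)

text \<open>Testing with a character turns the weak formulation into an integral equation for one
  coefficient. Its integrand is continuous although the gradient is known at almost every time only,
  so the equation can be differentiated at every time.\<close>

theorem weak_solution_modes:
  assumes sol: "advection_diffusion_solution \<tau> v f \<phi>" and v: "\<And>t. t \<in> {0..\<tau>} \<Longrightarrow> AE x in torus. v t x = flow a t x"
    and a: "\<And>i. continuous_on {0..\<tau>} (a i)" and f: "f \<in> torus_L2" and \<tau>: "0 \<le> \<tau>"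
  shows "mode_solution \<tau> a (\<lambda>n t. fourier_coeff (\<phi> t) n)" "fourier_coeff (\<phi> 0) n = fourier_coeff f n"
proof -
  let ?c = "\<lambda>n t. fourier_coeff (\<phi> t) n"
  have cont: "continuous_into_L2 \<tau> \<phi>" using sol by (simp add: advection_diffusion_solution_def)
  have L: "\<phi> r \<in> torus_L2" if "r \<in> {0..\<tau>}" for r using cont that by (simp add: continuous_into_L2_def)
  note cc = continuous_into_L2_coeff[OF cont]
  obtain D where D: "AE t in lebesgue_on {0..\<tau>}. weak_gradient (\<phi> t) (D t)"
    and weak: "\<And>\<psi> D\<psi> t. weak_gradient \<psi> D\<psi> \<Longrightarrow> t\<in>{0..\<tau>} \<Longrightarrow>
           (\<integral>x. \<phi> t x * \<psi> x \<partial>torus) +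
           (\<integral>r. (\<integral>x. (v r x \<bullet> D r x) * \<psi> x + D r x \<bullet> D\<psi> x \<partial>torus) \<partial>lebesgue_on {0..t})
           = (\<integral>x. f x * \<psi> x \<partial>torus)"
    using sol unfolding advection_diffusion_solution_def by blast
  let ?I = "\<lambda>n r. of_real (lap n) * ?c n r + transport a ?c n r"
  have Ic: "continuous_on {0..\<tau>} (?I n)" for n by (intro continuous_intros continuous_transport a cc)
  have key: "Re (u * ?c n t) + (\<integral>r. Re (u * ?I n r) \<partial>lebesgue_on {0..t}) = Re (u * fourier_coeff f n)"
    if t: "t \<in> {0..\<tau>}" for u n t
  proof -
    let ?\<psi> = "test_fun u n" and ?D = "test_grad u n"
    let ?J = "\<lambda>r. \<integral>x. (v r x \<bullet> D r x) * ?\<psi> x + D r x \<bullet> ?D x \<partial>torus"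
    have Dt: "AE r in lebesgue_on {0..t}. r \<in> {0..\<tau>} \<and> weak_gradient (\<phi> r) (D r)"
    proof -
      have "AE r in lebesgue. r \<in> {0..\<tau>} \<longrightarrow> weak_gradient (\<phi> r) (D r)"
        using D by (subst (asm) AE_restrict_space_iff) auto
      then show ?thesis using t by (subst AE_restrict_space_iff) (auto elim!: eventually_mono)
    qed
    \<comment> \<open>Where the gradient exists, the spatial integral is expressed by coefficients
      alone, and these are continuous in time.\<close>
    have J: "?J r = (2*pi)\<^sup>2 * Re (u * ?I n r)" if r: "r \<in> {0..\<tau>}" and G: "weak_gradient (\<phi> r) (D r)" for r
    proof -
      let ?H = "\<lambda>x. flow a r x \<bullet> D r x"
      have Hm: "cx ?H \<in> cL2" by (rule flow_gradient(1)[OF G])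
      have Hi: "integrable torus (\<lambda>x. cx ?H x * (u * wave (- n) x))"
        by (intro integrable_cL2_mult Hm cL2_cmult cL2_wave)
      have H1: "integrable torus (\<lambda>x. ?H x * ?\<psi> x)" using integrable_Re[OF Hi] by (simp add: test_fun_def)
      have "(\<integral>x. ?H x * ?\<psi> x \<partial>torus) = (\<integral>x. Re (cx ?H x * (u * wave (- n) x)) \<partial>torus)" by (simp add: test_fun_def)
      also have "\<dots> = Re (\<integral>x. u * (cx ?H x * wave (- n) x) \<partial>torus)"
        using integral_Re[OF Hi] by (simp only: mult.left_commute)
      also have "\<dots> = (2*pi)\<^sup>2 * Re (u * cfc (cx ?H) n)" by (simp add: cfc_def mean_def power2_eq_square)
      finally have H2: "(\<integral>x. ?H x * ?\<psi> x \<partial>torus) = (2*pi)\<^sup>2 * Re (u * transport a ?c n r)"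
        unfolding flow_gradient(2)[OF G] by (simp add: transport_def)
      have Dj: "(\<lambda>x. D r x $ j) \<in> torus_L2" for j using G by (simp add: weak_gradient_def)
      have g1: "integrable torus (\<lambda>x. D r x $ j * ?D x $ j)" for j
        using integral_Re_wave(2)[OF Dj] by (simp only: test_grad_def vec_lambda_beta)
      have g2: "(\<integral>x. D r x $ j * ?D x $ j \<partial>torus) = (2*pi)\<^sup>2 * Re (u * ((real_of_int (n $ j))\<^sup>2 * ?c n r))" for j
      proof -
        have "(\<integral>x. D r x $ j * ?D x $ j \<partial>torus) = (2*pi)\<^sup>2 * Re ((- \<i> * of_int (n $ j) * u) * fourier_coeff (\<lambda>x. D r x $ j) n)"
          using integral_Re_wave(1)[OF Dj] by (simp only: test_grad_def vec_lambda_beta)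
        also have "fourier_coeff (\<lambda>x. D r x $ j) n = \<i> * of_int (n $ j) * ?c n r" using G by (simp add: weak_gradient_def)
        also have "(- \<i> * of_int (n $ j) * u) * (\<i> * of_int (n $ j) * ?c n r) = u * ((real_of_int (n $ j))\<^sup>2 * ?c n r)"
          by (simp add: power2_eq_square algebra_simps)
        finally show ?thesis .
      qed
      have g: "integrable torus (\<lambda>x. D r x \<bullet> ?D x)" "(\<integral>x. D r x \<bullet> ?D x \<partial>torus) = (2*pi)\<^sup>2 * Re (u * (of_real (lap n) * ?c n r))"
      proof -
        show "integrable torus (\<lambda>x. D r x \<bullet> ?D x)" using g1 by (simp add: inner_vec_def)
        have "(\<integral>x. D r x \<bullet> ?D x \<partial>torus) = (\<Sum>j\<in>UNIV. \<integral>x. D r x $ j * ?D x $ j \<partial>torus)"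
          using g1 by (simp add: inner_vec_def)
        also have "\<dots> = (2*pi)\<^sup>2 * Re (u * (of_real (lap n) * ?c n r))"
          unfolding g2 by (simp add: lap_def UNIV_2 algebra_simps)
        finally show "(\<integral>x. D r x \<bullet> ?D x \<partial>torus) = (2*pi)\<^sup>2 * Re (u * (of_real (lap n) * ?c n r))" .
      qed
      have eqAE: "AE x in torus. ?H x * ?\<psi> x + D r x \<bullet> ?D x = (v r x \<bullet> D r x) * ?\<psi> x + D r x \<bullet> ?D x"
        using v[OF r] by eventually_elim simp
      have "?J r = (\<integral>x. ?H x * ?\<psi> x + D r x \<bullet> ?D x \<partial>torus)"
      proof (rule integral_cong_AE)
        show m: "(\<lambda>x. ?H x * ?\<psi> x + D r x \<bullet> ?D x) \<in> borel_measurable torus" using H1 g(1) by auto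
        show "(\<lambda>x. (v r x \<bullet> D r x) * ?\<psi> x + D r x \<bullet> ?D x) \<in> borel_measurable torus"
          by (rule AE_torus_measurable[OF m eqAE])
        show "AE x in torus. (v r x \<bullet> D r x) * ?\<psi> x + D r x \<bullet> ?D x = ?H x * ?\<psi> x + D r x \<bullet> ?D x"
          using eqAE by eventually_elim (erule sym)
      qed
      also have "\<dots> = (2*pi)\<^sup>2 * Re (u * transport a ?c n r) + (2*pi)\<^sup>2 * Re (u * (of_real (lap n) * ?c n r))"
        using H1 g H2 by simp
      finally show ?thesis by (simp add: algebra_simps)
    qed
    have RIc: "continuous_on {0..t} (\<lambda>r. (2*pi)\<^sup>2 * Re (u * ?I n r))"
      by (rule continuous_on_subset[of "{0..\<tau>}"], intro continuous_intros Ic) (use t in auto)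
    have m: "(\<lambda>r. (2*pi)\<^sup>2 * Re (u * ?I n r)) \<in> borel_measurable (lebesgue_on {0..t})"
      using continuous_imp_integrable_real[OF RIc] by auto
    have Jeq: "AE r in lebesgue_on {0..t}. (2*pi)\<^sup>2 * Re (u * ?I n r) = ?J r"
      using Dt by eventually_elim (simp only: J)
    have "(\<integral>r. ?J r \<partial>lebesgue_on {0..t}) = (\<integral>r. (2*pi)\<^sup>2 * Re (u * ?I n r) \<partial>lebesgue_on {0..t})"
    proof (rule integral_cong_AE[OF _ m])
      show "?J \<in> borel_measurable (lebesgue_on {0..t})" by (rule borel_measurable_lebesgue_on_AE[OF m _ Jeq]) simp
      show "AE r in lebesgue_on {0..t}. ?J r = (2*pi)\<^sup>2 * Re (u * ?I n r)" using Jeq by eventually_elim simp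
    qed
    then have "(2*pi)\<^sup>2 * Re (u * ?c n t) + (2*pi)\<^sup>2 * (\<integral>r. Re (u * ?I n r) \<partial>lebesgue_on {0..t}) = (2*pi)\<^sup>2 * Re (u * fourier_coeff f n)"
      using weak[OF weak_gradient_test[of u n] t] integral_Re_wave(1)[OF L[OF t], of u n] integral_Re_wave(1)[OF f, of u n]
      by (simp only: test_fun_def integral_mult_right_zero)
    then have "(2*pi)\<^sup>2 * (Re (u * ?c n t) + (\<integral>r. Re (u * ?I n r) \<partial>lebesgue_on {0..t})) = (2*pi)\<^sup>2 * Re (u * fourier_coeff f n)"
      by (simp only: distrib_left)
    then show ?thesis by simp
  qed
  have int: "?c n t = fourier_coeff f n - integral {0..t} (?I n)" if t: "t \<in> {0..\<tau>}" for n t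
  proof -
    have ii: "integrable (lebesgue_on {0..t}) (?I n)"
      by (rule continuous_imp_integrable_real, rule continuous_on_subset[OF Ic]) (use t in auto)
    have e: "integral {0..t} (?I n) = (\<integral>r. ?I n r \<partial>lebesgue_on {0..t})"
      using ii by (simp add: lebesgue_integral_eq_integral)
    have "Re (u * (?c n t + integral {0..t} (?I n))) = Re (u * fourier_coeff f n)" for u
    proof -
      have "integrable (lebesgue_on {0..t}) (\<lambda>r. u * ?I n r)" using ii by simp
      from integral_Re[OF this] have "(\<integral>r. Re (u * ?I n r) \<partial>lebesgue_on {0..t}) = Re (u * integral {0..t} (?I n))"
        unfolding e by (simp only: integral_mult_right_zero)
      then show ?thesis using key[OF t, of u n] by (simp only: distrib_left plus_complex.sel)
    qed
    \<comment> \<open>The factors 1 and \<open>- \<i>\<close> recover the real and the imaginary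
      part.\<close>
    from this[of 1] this[of "- \<i>"] have "?c n t + integral {0..t} (?I n) = fourier_coeff f n"
      by (simp add: complex_eq_iff)
    then show ?thesis by (simp add: algebra_simps)
  qed
  show "fourier_coeff (\<phi> 0) n = fourier_coeff f n" using int[of 0 n] \<tau> by simp
  show "mode_solution \<tau> a ?c"
    unfolding mode_solution_def
  proof (intro allI ballI)
    fix n t assume t: "t \<in> {0..\<tau>}"
    have "((\<lambda>t. fourier_coeff f n - integral {0..t} (?I n)) has_vector_derivative (0 - ?I n t)) (at t within {0..\<tau>})"
      by (intro has_vector_derivative_diff has_vector_derivative_const integral_has_vector_derivative[OF Ic t])
    moreover have "0 - ?I n t = - of_real (lap n) * ?c n t - transport a ?c n t" by simp
    ultimately have "((\<lambda>t. fourier_coeff f n - integral {0..t} (?I n)) has_vector_derivative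
       (- of_real (lap n) * ?c n t - transport a ?c n t)) (at t within {0..\<tau>})" by (simp only:)
    then show "(?c n has_vector_derivative - of_real (lap n) * ?c n t - transport a ?c n t) (at t within {0..\<tau>})"
      by (rule has_vector_derivative_transform[OF t, rotated]) (rule int)
  qed
qed

section \<open>Measurability in time and construction of energy solutions\<close>

lemma lap_minus [simp]: "lap (- n) = lap n"
  by (simp add: lap_def)

lemma sobolev_weight_lap: "sobolev_weight s n = (1 + lap n) ^ s"
  by (simp add: sobolev_weight_def lap_def)

lemma sobolev_weight_nonneg: "sobolev_weight s n \<ge> 0"
  by (simp add: sobolev_weight_lap)

text \<open>Balls in frequency space are finite and exhaust the lattice, so an unconditional sum is
  the limit of its sums over low modes.\<close>

lemma low_modes_filterlim: "filterlim (\<lambda>m. {n. lap n \<le> real m}) (finite_subsets_at_top UNIV) sequentially"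
  unfolding filterlim_finite_subsets_at_top
proof (intro allI impI)
  fix X :: "(int^2) set" assume X: "finite X \<and> X \<subseteq> UNIV"
  obtain M :: nat where M: "real M > (\<Sum>n\<in>X. lap n)" using reals_Archimedean2 by blast
  have "lap n \<le> real m" if "n \<in> X" "m \<ge> M" for n m
  proof -
    have "lap n \<le> (\<Sum>n\<in>X. lap n)" using X that by (intro member_le_sum) auto
    then show ?thesis using M that(2) by linarith
  qed
  then show "\<forall>\<^sub>F m in sequentially. finite {n. lap n \<le> real m} \<and> X \<subseteq> {n. lap n \<le> real m} \<and> {n. lap n \<le> real m} \<subseteq> UNIV"
    unfolding eventually_sequentially using finite_lap_le by blast
qed

text \<open>Each coefficient is uniformly continuous on the compact interval; for finitely many of
  them the smallest modulus works, whatever the weights.\<close>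

lemma uniform_modulus:
  fixes c :: "int^2 \<Rightarrow> real \<Rightarrow> complex"
  assumes "finite F" "\<And>n. continuous_on {0..\<tau>} (c n)" "e > 0" "\<And>n. W n \<ge> 0"
  shows "\<exists>d>0. \<forall>t\<in>{0..\<tau>}. \<forall>q\<in>{0..\<tau>}. \<bar>t - q\<bar> < d \<longrightarrow> (\<Sum>n\<in>F. W n * (cmod (c n t - c n q))\<^sup>2) \<le> e"
  using assms(1,3)
proof (induction F arbitrary: e)
  case empty
  then show ?case by (auto intro: exI[of _ 1])
next
  case (insert m F)
  define \<eta> where "\<eta> = sqrt (e / 2 / (W m + 1))"
  have Wm: "W m + 1 > 0" using assms(4)[of m] by simp
  have \<eta>: "\<eta> > 0" using insert.prems Wm by (simp add: \<eta>_def)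
  have "uniformly_continuous_on {0..\<tau>} (c m)"
    by (rule compact_uniformly_continuous[OF assms(2) compact_Icc])
  then obtain d1 where d1: "d1 > 0" "\<And>t q. t \<in> {0..\<tau>} \<Longrightarrow> q \<in> {0..\<tau>} \<Longrightarrow> dist t q < d1 \<Longrightarrow> dist (c m t) (c m q) < \<eta>"
    unfolding uniformly_continuous_on_def using \<eta> by metis
  obtain d2 where d2: "d2 > 0" "\<forall>t\<in>{0..\<tau>}. \<forall>q\<in>{0..\<tau>}. \<bar>t - q\<bar> < d2 \<longrightarrow> (\<Sum>n\<in>F. W n * (cmod (c n t - c n q))\<^sup>2) \<le> e / 2"
    using insert.IH[of "e / 2"] insert.prems by auto
  have "(\<Sum>n\<in>insert m F. W n * (cmod (c n t - c n q))\<^sup>2) \<le> e"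
    if "t \<in> {0..\<tau>}" "q \<in> {0..\<tau>}" "\<bar>t - q\<bar> < min d1 d2" for t q
  proof -
    have "(cmod (c m t - c m q))\<^sup>2 \<le> \<eta>\<^sup>2"
      using d1(2)[OF that(1,2)] that(3) by (intro power_mono) (auto simp: dist_norm)
    also have "\<eta>\<^sup>2 = e / 2 / (W m + 1)" using insert.prems Wm by (simp add: \<eta>_def)
    finally have "W m * (cmod (c m t - c m q))\<^sup>2 \<le> (W m + 1) * (e / 2 / (W m + 1))"
      using assms(4)[of m] insert.prems by (intro mult_mono) auto
    also have "\<dots> = e / 2"
    proof -
      have "k * (x / k) = x" if "k > 0" for k x :: real using that by simp
      then show ?thesis using Wm by blast
    qed
    finally have 1: "W m * (cmod (c m t - c m q))\<^sup>2 \<le> e / 2" .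
    have "(\<Sum>n\<in>F. W n * (cmod (c n t - c n q))\<^sup>2) \<le> e / 2"
      by (rule d2(2)[rule_format]) (use that in auto)
    with 1 show ?thesis using insert.hyps by simp
  qed
  then show ?case using d1(1) d2(1) by (intro exI[of _ "min d1 d2"]) auto
qed

text \<open>Step functions in time arise by cutting off the frequencies at
  \<open>lap n \<le> m\<close> and freezing the time on a grid. The squared error splits exactly
  into the tail of the convergent sum and a finite sum that uniform continuity makes small.\<close>

lemma strongly_measurable_modes:
  fixes c :: "int^2 \<Rightarrow> real \<Rightarrow> complex"
  assumes \<tau>: "\<tau> > 0" and cont: "\<And>n. continuous_on {0..\<tau>} (c n)"
    and sym: "\<And>n t. t \<in> {0..\<tau>} \<Longrightarrow> c (- n) t = cnj (c n t)"
    and g: "\<And>t. t \<in> {0..\<tau>} \<Longrightarrow> g t \<in> torus_L2" and coeff: "\<And>t n. t \<in> {0..\<tau>} \<Longrightarrow> fourier_coeff (g t) n = c n t"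
    and ae: "AE t in lebesgue_on {0..\<tau>}. (\<lambda>n. sobolev_weight s n * (cmod (c n t))\<^sup>2) summable_on UNIV"
  shows "strongly_measurable_sobolev s \<tau> g"
proof -
  let ?W = "sobolev_weight s"
  let ?F = "\<lambda>m::nat. {n. lap n \<le> real m}"
  have F: "finite (?F m)" for m by (rule finite_lap_le)
  have "\<forall>m. \<exists>d. d > 0 \<and> (\<forall>t\<in>{0..\<tau>}. \<forall>q\<in>{0..\<tau>}. \<bar>t - q\<bar> < d \<longrightarrow>
      (\<Sum>n\<in>?F m. ?W n * (cmod (c n t - c n q))\<^sup>2) \<le> 1 / real (Suc m))"
  proof
    fix m
    show "\<exists>d>0. \<forall>t\<in>{0..\<tau>}. \<forall>q\<in>{0..\<tau>}. \<bar>t - q\<bar> < d \<longrightarrow> (\<Sum>n\<in>?F m. ?W n * (cmod (c n t - c n q))\<^sup>2) \<le> 1 / real (Suc m)"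
      by (rule uniform_modulus[OF F cont]) (auto simp: sobolev_weight_nonneg)
  qed
  from choice[OF this] obtain d where d: "\<And>m. d m > 0" "\<And>m t q. t \<in> {0..\<tau>} \<Longrightarrow> q\<in>{0..\<tau>} \<Longrightarrow> \<bar>t - q\<bar> < d m \<Longrightarrow>
      (\<Sum>n\<in>?F m. ?W n * (cmod (c n t - c n q))\<^sup>2) \<le> 1 / real (Suc m)" by blast
  have "\<forall>m. \<exists>N::nat. real N > 1 / d m \<and> N > 0"
  proof
    fix m
    obtain N :: nat where N: "real N > 1 / d m" using reals_Archimedean2 by blast
    moreover have "1 / d m > 0" using d(1) by simp
    ultimately have "real N > 0" by linarith
    then show "\<exists>N::nat. real N > 1 / d m \<and> N > 0" using N by auto
  qed
  from choice[OF this] obtain N where N: "\<And>m. real (N m) > 1 / d m" "\<And>m. N m > 0" by blast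
  \<comment> \<open>Rounding down keeps the sampled time in the interval and leaves finitely many
    values.\<close>
  define q where "q m t = real_of_int \<lfloor>real (N m) * t\<rfloor> / real (N m)" for m t
  have q: "q m t \<in> {0..\<tau>}" "\<bar>t - q m t\<bar> < d m" if "t \<in> {0..\<tau>}" for m t
  proof -
    have Nm: "real (N m) > 0" using N(2)[of m] by simp
    have fl: "real_of_int \<lfloor>real (N m) * t\<rfloor> \<le> real (N m) * t" "real (N m) * t < real_of_int \<lfloor>real (N m) * t\<rfloor> + 1" by linarith+
    have "q m t \<le> t" using fl(1) Nm by (simp add: q_def field_simps)
    moreover have "0 \<le> q m t" using that Nm by (simp add: q_def)
    ultimately show "q m t \<in> {0..\<tau>}" using that by simp
    have "t < (real_of_int \<lfloor>real (N m) * t\<rfloor> + 1) / real (N m)"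
      using fl(2) Nm by (simp add: pos_less_divide_eq mult.commute)
    then have "t - q m t < 1 / real (N m)" by (simp add: q_def add_divide_distrib)
    also have "\<dots> < d m" using N(1)[of m] d(1)[of m] Nm by (simp add: field_simps)
    finally show "\<bar>t - q m t\<bar> < d m" using \<open>q m t \<le> t\<close> by simp
  qed
  define P where "P m r x = Re (\<Sum>n\<in>?F m. c n r * wave n x)" for m r x
  have PL: "P m r \<in> torus_L2" "fourier_coeff (P m r) n = (if n \<in> ?F m then c n r else 0)" if "r \<in> {0..\<tau>}" for m r n
  proof -
    let ?Q = "\<lambda>x. \<Sum>n\<in>?F m. c n r * wave n x"
    have Q: "?Q \<in> cL2" "?Q (x + axis j (2 * pi)) = ?Q x" for x j
      by (intro cL2_sum cL2_cmult cL2_wave) (simp add: periodic_wave)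
    have cf: "cfc ?Q n = (if n \<in> ?F m then c n r else 0)" for n
      using F by (simp add: cfc_sum cL2_cmult cfc_cmult cfc_wave if_distrib cong: if_cong)
    show "P m r \<in> torus_L2" unfolding P_def by (rule torus_L2_Re(1)[OF Q])
    show "fourier_coeff (P m r) n = (if n \<in> ?F m then c n r else 0)"
      unfolding P_def torus_L2_Re(2)[OF Q] cf using sym[OF that, of n] by simp
  qed
  define S where "S m t = P m (q m t)" for m t
  have PS: "P m r \<in> sobolev s" if "r \<in> {0..\<tau>}" for m r
    unfolding sobolev_def mem_Collect_eq
  proof (intro conjI PL(1)[OF that])
    show "(\<lambda>n. ?W n * (cmod (fourier_coeff (P m r) n))\<^sup>2) summable_on UNIV"
      unfolding PL(2)[OF that]
      by (rule summable_on_cong_neutral[THEN iffD1, OF _ _ _ summable_on_finite[OF F[of m]]]) auto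
  qed
  have S1: "finite (S m ` {0..\<tau>}) \<and> S m ` {0..\<tau>} \<subseteq> sobolev s \<and> (\<forall>h. {t \<in> {0..\<tau>}. S m t = h} \<in> sets lebesgue)" for m
  proof (intro conjI allI)
    let ?G = "\<lambda>k::int. P m (real_of_int k / real (N m))"
    have SG: "S m t = ?G \<lfloor>real (N m) * t\<rfloor>" for t by (simp add: S_def q_def)
    have "S m ` {0..\<tau>} \<subseteq> ?G ` {0..\<lfloor>real (N m) * \<tau>\<rfloor>}"
      unfolding SG by (auto intro!: imageI floor_mono mult_left_mono)
    then show "finite (S m ` {0..\<tau>})" by (rule finite_subset) simp
    show "S m ` {0..\<tau>} \<subseteq> sobolev s" unfolding S_def using PS q(1) by blast
    fix h
    have "(\<lambda>t. \<lfloor>real (N m) * t\<rfloor>) -` {k. ?G k = h} \<inter> space lborel \<in> sets lborel"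
      by (rule measurable_sets[of _ _ "count_space UNIV"]) auto
    then have "(\<lambda>t. \<lfloor>real (N m) * t\<rfloor>) -` {k. ?G k = h} \<in> sets lebesgue" by auto
    moreover have "{t \<in> {0..\<tau>}. S m t = h} = {0..\<tau>} \<inter> (\<lambda>t. \<lfloor>real (N m) * t\<rfloor>) -` {k. ?G k = h}"
      unfolding SG by auto
    ultimately show "{t \<in> {0..\<tau>}. S m t = h} \<in> sets lebesgue" by auto
  qed
  have S2: "g t \<in> sobolev s \<and> (\<lambda>m. sobolev_norm s (\<lambda>x. g t x - S m t x)) \<longlonglongrightarrow> 0"
    if t: "t \<in> {0..\<tau>}" and sm: "(\<lambda>n. ?W n * (cmod (c n t))\<^sup>2) summable_on UNIV" for t
  proof
    show "g t \<in> sobolev s" using g[OF t] sm by (simp add: sobolev_def coeff[OF t])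
    define Tot where "Tot = (\<Sum>\<^sub>\<infinity>n. ?W n * (cmod (c n t))\<^sup>2)"
    define tl where "tl m = Tot - (\<Sum>n\<in>?F m. ?W n * (cmod (c n t))\<^sup>2)" for m
    have hs: "((\<lambda>n. ?W n * (cmod (c n t))\<^sup>2) has_sum Tot) UNIV"
      unfolding Tot_def using sm by (rule has_sum_infsum)
    have "(\<lambda>m. \<Sum>n\<in>?F m. ?W n * (cmod (c n t))\<^sup>2) \<longlonglongrightarrow> Tot"
      using hs filterlim_compose[OF _ low_modes_filterlim] unfolding has_sum_def by blast
    then have "(\<lambda>m. sqrt (Tot - (\<Sum>n\<in>?F m. ?W n * (cmod (c n t))\<^sup>2) + 1 / real (Suc m))) \<longlonglongrightarrow> sqrt (Tot - Tot + 0)"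
      by (intro tendsto_intros LIMSEQ_Suc[OF lim_1_over_n]) 
    then have lim: "(\<lambda>m. sqrt (tl m + 1 / real (Suc m))) \<longlonglongrightarrow> 0" by (simp add: tl_def)
    have "norm (sobolev_norm s (\<lambda>x. g t x - S m t x)) \<le> sqrt (tl m + 1 / real (Suc m))" for m
    proof -
      let ?h = "\<lambda>n. ?W n * (cmod (fourier_coeff (\<lambda>x. g t x - S m t x) n))\<^sup>2"
      let ?E = "\<Sum>n\<in>?F m. ?W n * (cmod (c n t - c n (q m t)))\<^sup>2"
      have fc: "fourier_coeff (\<lambda>x. g t x - S m t x) n = c n t - (if n \<in> ?F m then c n (q m t) else 0)" for n
        unfolding S_def by (subst fourier_coeff_diff[OF g[OF t] PL(1)[OF q(1)[OF t]]])
          (simp only: coeff[OF t] PL(2)[OF q(1)[OF t]])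
      \<comment> \<open>Corrects the full sum on the low modes; off \<open>?F m\<close> the
        approximation has coefficient 0 and the error is \<open>c n t\<close> itself.\<close>
      have "((\<lambda>n. if n \<in> ?F m then ?W n * (cmod (c n t - c n (q m t)))\<^sup>2 - ?W n * (cmod (c n t))\<^sup>2 else 0)
          has_sum (\<Sum>n\<in>?F m. ?W n * (cmod (c n t - c n (q m t)))\<^sup>2 - ?W n * (cmod (c n t))\<^sup>2)) UNIV"
        by (rule has_sum_finite_neutralI[OF F[of m]]) auto
      from has_sum_add[OF hs this]
      have "(?h has_sum (Tot + (\<Sum>n\<in>?F m. ?W n * (cmod (c n t - c n (q m t)))\<^sup>2 - ?W n * (cmod (c n t))\<^sup>2))) UNIV"
        by (rule has_sum_cong[THEN iffD1, rotated]) (simp add: fc)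
      then have "infsum ?h UNIV = tl m + ?E"
        by (simp add: infsumI tl_def sum_subtractf)
      moreover have "?E \<le> 1 / real (Suc m)" using d(2)[OF t q(1)[OF t] q(2)[OF t]] .
      ultimately have "infsum ?h UNIV \<le> tl m + 1 / real (Suc m)" by simp
      moreover have "infsum ?h UNIV \<ge> 0" by (rule infsum_nonneg) (simp add: sobolev_weight_nonneg)
      ultimately show ?thesis by (simp add: sobolev_norm_def)
    qed
    then show "(\<lambda>m. sobolev_norm s (\<lambda>x. g t x - S m t x)) \<longlonglongrightarrow> 0"
      by (intro Lim_null_comparison[OF always_eventually[OF allI] lim])
  qed
  show ?thesis
    unfolding strongly_measurable_sobolev_def
  proof (intro exI[of _ S] conjI allI)
    have "AE t in lebesgue_on {0..\<tau>}. t \<in> {0..\<tau>}" by (rule AE_I2) simp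
    with ae show "AE t in lebesgue_on {0..\<tau>}. g t \<in> sobolev s \<and> (\<lambda>m. sobolev_norm s (\<lambda>x. g t x - S m t x)) \<longlonglongrightarrow> 0"
      by eventually_elim (rule S2)
  qed (use S1 in auto)
qed

lemma Parseval_inner_real:
  assumes "cx f \<in> cL2" "cx h \<in> cL2"
  shows "((\<lambda>n. Re (cfc (cx f) n * cnj (cfc (cx h) n))) has_sum (\<integral>x. f x * h x \<partial>torus) / (2*pi)\<^sup>2) UNIV"
    "integrable torus (\<lambda>x. f x * h x)"
proof -
  have "mean (\<lambda>x. cx f x * cnj (cx h x)) = of_real ((\<integral>x. f x * h x \<partial>torus) / (2*pi)\<^sup>2)"
  proof -
    have "(\<integral>x. cx f x * cnj (cx h x) \<partial>torus) = (\<integral>x. complex_of_real (f x * h x) \<partial>torus)" by simp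
    then show ?thesis unfolding mean_def by (simp only: integral_complex_of_real of_real_divide)
  qed
  with has_sum_bounded_linear[OF bounded_linear_Re Parseval_inner[OF assms]]
  show "((\<lambda>n. Re (cfc (cx f) n * cnj (cfc (cx h) n))) has_sum (\<integral>x. f x * h x \<partial>torus) / (2*pi)\<^sup>2) UNIV"
    by (simp only: Re_complex_of_real)
  show "integrable torus (\<lambda>x. f x * h x)"
    using integrable_Re[OF integrable_cL2_mult[OF assms]] by simp
qed

lemma weak_gradient_lap:
  assumes "weak_gradient \<psi> G"
  shows "(\<lambda>n. lap n * (cmod (fourier_coeff \<psi> n))\<^sup>2) summable_on UNIV"
proof -
  have "(\<lambda>n. (cmod (fourier_coeff (\<lambda>x. G x $ j) n))\<^sup>2) summable_on UNIV" for j
    using Parseval_real[of "\<lambda>x. G x $ j"] assms by (auto simp: weak_gradient_def summable_on_def)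
  then have "(\<lambda>n. (cmod (fourier_coeff (\<lambda>x. G x $ 1) n))\<^sup>2 + (cmod (fourier_coeff (\<lambda>x. G x $ 2) n))\<^sup>2) summable_on UNIV"
    by (intro summable_on_add)
  moreover have "(cmod (fourier_coeff (\<lambda>x. G x $ 1) n))\<^sup>2 + (cmod (fourier_coeff (\<lambda>x. G x $ 2) n))\<^sup>2
      = lap n * (cmod (fourier_coeff \<psi> n))\<^sup>2" for n
    using assms by (simp add: weak_gradient_def norm_mult power_mult_distrib lap_def UNIV_2 distrib_right)
  ultimately show ?thesis by simp
qed

text \<open>Riesz-Fischer builds every component from its prescribed coefficients; the odd imaginary
  factor respects Hermitian symmetry.\<close>

lemma weak_gradient_exists:
  assumes f: "f \<in> torus_L2" and s: "(\<lambda>n. lap n * (cmod (fourier_coeff f n))\<^sup>2) summable_on UNIV"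
  shows "\<exists>G. weak_gradient f G"
proof -
  have "\<exists>h. h \<in> torus_L2 \<and> (\<forall>n. fourier_coeff h n = \<i> * of_int (n $ j) * fourier_coeff f n)" for j
  proof -
    have "(\<lambda>n. (cmod (\<i> * of_int (n $ j) * fourier_coeff f n))\<^sup>2) summable_on UNIV"
    proof (rule summable_on_comparison_test[OF s])
      fix n :: "int^2"
      have "(real_of_int (n $ j))\<^sup>2 \<le> lap n" unfolding lap_def by (rule member_le_sum) auto
      then show "(cmod (\<i> * of_int (n $ j) * fourier_coeff f n))\<^sup>2 \<le> lap n * (cmod (fourier_coeff f n))\<^sup>2"
        by (simp add: norm_mult power_mult_distrib mult_right_mono)
    qed simp
    moreover have "\<i> * of_int ((- n) $ j) * fourier_coeff f (- n) = cnj (\<i> * of_int (n $ j) * fourier_coeff f n)" for n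
      by (simp add: fourier_coeff_minus)
    ultimately show ?thesis using riesz_fischer_real[of "\<lambda>n. \<i> * of_int (n $ j) * fourier_coeff f n"] by metis
  qed
  then obtain h where h: "\<And>j. h j \<in> torus_L2" "\<And>j n. fourier_coeff (h j) n = \<i> * of_int (n $ j) * fourier_coeff f n"
    by metis
  show ?thesis
    by (rule exI[of _ "\<lambda>x. \<chi> j. h j x"]) (use f h in \<open>simp add: weak_gradient_def\<close>)
qed

context mode_flow
begin

text \<open>The squared distance of two times is a series dominated by
  \<open>4 * (g n)\<^sup>2\<close>, so the M-test makes it continuous in time.\<close>

lemma coefficients_continuous_into_L2:
  assumes \<phi>: "\<And>t. t \<in> {0..\<tau>} \<Longrightarrow> \<phi> t \<in> torus_L2" "\<And>t n. t \<in> {0..\<tau>} \<Longrightarrow> fourier_coeff (\<phi> t) n = c n t"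
  shows "continuous_into_L2 \<tau> \<phi>"
  unfolding continuous_into_L2_def
proof (intro ballI conjI \<phi>(1))
  fix t assume t: "t \<in> {0..\<tau>}"
  let ?H = "\<lambda>r. \<Sum>\<^sub>\<infinity>n. (cmod (c n r - c n t))\<^sup>2"
  have "continuous_on {0..\<tau>} ?H"
  proof (rule uniform_limit_theorem)
    show "uniform_limit {0..\<tau>} (\<lambda>X r. \<Sum>n\<in>X. (cmod (c n r - c n t))\<^sup>2) ?H (finite_subsets_at_top UNIV)"
    proof (rule Weierstrass_m_test_general)
      show "(\<lambda>n. 4 * (g n)\<^sup>2) summable_on UNIV" by (intro summable_on_cmult_right g_sum)
      fix n r assume r: "r \<in> {0..\<tau>}"
      have "cmod (c n r - c n t) \<le> 2 * g n"
        using norm_triangle_ineq4[of "c n r" "c n t"] c_bound[OF r, of n] c_bound[OF t, of n] by simp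
      from power_mono[OF this norm_ge_zero, of 2]
      show "norm ((cmod (c n r - c n t))\<^sup>2) \<le> 4 * (g n)\<^sup>2" by (simp add: power_mult_distrib)
    qed
    show "\<forall>\<^sub>F X in finite_subsets_at_top UNIV. continuous_on {0..\<tau>} (\<lambda>r. \<Sum>n\<in>X. (cmod (c n r - c n t))\<^sup>2)"
      by (intro always_eventually allI continuous_intros c_cont)
  qed simp
  then have "(?H \<longlongrightarrow> ?H t) (at t within {0..\<tau>})" unfolding continuous_on_def using t by blast
  then have "((\<lambda>r. 2 * pi * sqrt (?H r)) \<longlongrightarrow> 2 * pi * sqrt (?H t)) (at t within {0..\<tau>})" by (intro tendsto_intros)
  then have lim: "((\<lambda>r. 2 * pi * sqrt (?H r)) \<longlongrightarrow> 0) (at t within {0..\<tau>})" by simp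
  have e: "L2_norm_torus (\<lambda>x. \<phi> r x - \<phi> t x) = 2 * pi * sqrt (?H r)" if r: "r \<in> {0..\<tau>}" for r
  proof -
    have "((\<lambda>n. (cmod (c n r - c n t))\<^sup>2) has_sum msq (cx (\<lambda>x. \<phi> r x - \<phi> t x))) UNIV"
      using Parseval_real[OF torus_L2_diff[OF \<phi>(1)[OF r] \<phi>(1)[OF t]]]
      by (simp only: fourier_coeff_diff[OF \<phi>(1)[OF r] \<phi>(1)[OF t]] \<phi>(2)[OF r] \<phi>(2)[OF t])
    then show ?thesis unfolding L2_norm_msq by (simp only: infsumI)
  qed
  show "((\<lambda>r. L2_norm_torus (\<lambda>x. \<phi> r x - \<phi> t x)) \<longlongrightarrow> 0) (at t within {0..\<tau>})"
    by (rule Lim_transform_within[OF lim zero_less_one]) (simp add: e)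
qed

text \<open>The time integrals of the weighted squares are summable by
  \<open>lap_mass_summable\<close>, which gives finiteness at almost every time. At a single time
  nothing is claimed, hence the gradient is taken at almost every time.\<close>

lemma H1_weight_summable:
  assumes \<tau>: "\<tau> > 0"
  shows "AE t in lebesgue_on {0..\<tau>}. (\<lambda>n. sobolev_weight 1 n * (cmod (c n t))\<^sup>2) summable_on UNIV"
    "integrable (lebesgue_on {0..\<tau>}) (\<lambda>t. \<Sum>\<^sub>\<infinity>n. sobolev_weight 1 n * (cmod (c n t))\<^sup>2)"
proof -
  let ?f = "\<lambda>n t. sobolev_weight 1 n * (cmod (c n t))\<^sup>2"
  have i: "integrable (lebesgue_on {0..\<tau>}) (?f n)" for n
    by (intro integrable_on_sub continuous_intros c_cont) auto
  have "(\<integral>t. norm (?f n t) \<partial>lebesgue_on {0..\<tau>}) = mass 0 \<tau> n + lap n * mass 0 \<tau> n" for n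
    using sobolev_weight_nonneg[of 1 n] by (simp add: abs_mult) (simp add: sobolev_weight_lap mass_def distrib_right)
  moreover have "(\<lambda>n. mass 0 \<tau> n) summable_on UNIV"
  proof (rule summable_on_comparison_test)
    show "(\<lambda>n. \<tau> * (g n)\<^sup>2) summable_on UNIV" by (intro summable_on_cmult_right g_sum)
    fix n
    have "mass 0 \<tau> n \<le> (\<integral>t. (g n)\<^sup>2 \<partial>lebesgue_on {0..\<tau>})"
      unfolding mass_def
      by (rule integral_mono) (auto intro!: integrable_on_sub continuous_intros c_cont c_square_le)
    then show "mass 0 \<tau> n \<le> \<tau> * (g n)\<^sup>2" using \<tau> by simp
  qed (use mass_mono(2)[of 0 \<tau>] \<tau> in auto)
  ultimately have s: "(\<lambda>n. \<integral>t. norm (?f n t) \<partial>lebesgue_on {0..\<tau>}) summable_on UNIV"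
    using lap_mass_summable by (simp add: summable_on_add)
  have S: "{0..\<tau>} \<in> sets lebesgue" by simp
  have e: "norm (?f n t) = ?f n t" for n t using sobolev_weight_nonneg[of 1 n] by (simp add: abs_mult)
  show "AE t in lebesgue_on {0..\<tau>}. (\<lambda>n. ?f n t) summable_on UNIV"
    using has_sum_integral(1)[OF S i s] unfolding e .
  show "integrable (lebesgue_on {0..\<tau>}) (\<lambda>t. \<Sum>\<^sub>\<infinity>n. ?f n t)"
    by (rule has_sum_integral(2)[OF S i s])
qed

text \<open>Young's inequality against an arbitrary coefficient \<open>p\<close>; if
  \<open>p\<close> comes from a test function in \<open>H^1\<close>, both terms are summable over
  \<open>n\<close>.\<close>

lemma transport_pairing_bound:
  assumes "r \<in> {0..\<tau>}"
  shows "cmod (p :: complex) * cmod (transport a c n r) \<le> lap n * (cmod p)\<^sup>2 + 2 * A\<^sup>2 * nbr_sum (\<lambda>n. (g n)\<^sup>2) n"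
proof -
  have "cmod (transport a c n r) \<le> A / 2 * sqrt (2 * lap n) * nbr_sum g n * 1"
    using a_bound[OF assms] c_bound[OF assms] by (intro transport_bound) auto
  then have "cmod p * cmod (transport a c n r) \<le> cmod p * (A / 2 * sqrt (2 * lap n) * nbr_sum g n * 1)"
    by (rule mult_left_mono) simp
  also have "\<dots> = (sqrt (lap n) * cmod p) * (A / sqrt 2 * nbr_sum g n)"
    by (simp add: real_sqrt_mult) (simp add: field_simps)
  also have "\<dots> \<le> (sqrt (lap n) * cmod p)\<^sup>2 + (A / sqrt 2 * nbr_sum g n)\<^sup>2"
  proof -
    have "0 \<le> (sqrt (lap n) * cmod p) * (A / sqrt 2 * nbr_sum g n)"
      using A_nonneg nbr_sum_nonneg[where S = g and n = n, OF g_nonneg] by simp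
    moreover have "x * y \<le> x\<^sup>2 + y\<^sup>2" if "0 \<le> x * y" for x y :: real
      using sum_squares_bound[of x y] that by (simp add: mult.assoc)
    ultimately show ?thesis by blast
  qed
  also have "\<dots> = lap n * (cmod p)\<^sup>2 + A\<^sup>2 / 2 * (nbr_sum g n)\<^sup>2"
    by (simp add: power_mult_distrib power_divide)
  also have "\<dots> \<le> lap n * (cmod p)\<^sup>2 + A\<^sup>2 / 2 * (4 * nbr_sum (\<lambda>n. (g n)\<^sup>2) n)"
    by (intro add_left_mono mult_left_mono nbr_sum_square) auto
  finally show ?thesis by simp
qed

text \<open>By Parseval the spatial integrals become sums over modes, and each mode satisfies its
  equation by the fundamental theorem of calculus. The substance is the exchange of the sum over
  modes with the time integral.\<close>

theorem weak_solution_exists: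
  assumes \<tau>: "\<tau> > 0" and sym: "\<And>n t. t \<in> {0..\<tau>} \<Longrightarrow> c (- n) t = cnj (c n t)"
    and f: "f \<in> torus_L2" "\<And>n. fourier_coeff f n = c n 0"
    and v: "\<And>t. t \<in> {0..\<tau>} \<Longrightarrow> AE x in torus. v t x = flow a t x"
  shows "\<exists>\<phi>. advection_diffusion_solution \<tau> v f \<phi>"
proof -
  have "\<forall>t\<in>{0..\<tau>}. \<exists>h. h \<in> torus_L2 \<and> (\<forall>n. fourier_coeff h n = c n t)"
  proof
    fix t assume t: "t \<in> {0..\<tau>}"
    show "\<exists>h. h \<in> torus_L2 \<and> (\<forall>n. fourier_coeff h n = c n t)"
      using riesz_fischer_real[OF c_square_summable[OF t] sym[OF t]] by metis
  qed
  from bchoice[OF this] obtain \<phi> where \<phi>: "\<And>t. t \<in> {0..\<tau>} \<Longrightarrow> \<phi> t \<in> torus_L2"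
    "\<And>t n. t \<in> {0..\<tau>} \<Longrightarrow> fourier_coeff (\<phi> t) n = c n t" by blast
  let ?S = "\<lambda>t. (\<lambda>n. sobolev_weight 1 n * (cmod (c n t))\<^sup>2) summable_on UNIV"
  have "\<exists>G. weak_gradient (\<phi> t) G" if t: "t \<in> {0..\<tau>}" and s: "?S t" for t
  proof (rule weak_gradient_exists[OF \<phi>(1)[OF t]])
    show "(\<lambda>n. lap n * (cmod (fourier_coeff (\<phi> t) n))\<^sup>2) summable_on UNIV"
      by (rule summable_on_comparison_test[OF s])
        (auto simp: \<phi>(2)[OF t] sobolev_weight_lap intro!: mult_right_mono)
  qed
  then obtain D where D: "\<And>t. t \<in> {0..\<tau>} \<Longrightarrow> ?S t \<Longrightarrow> weak_gradient (\<phi> t) (D t)" by metis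
  have AED: "AE t in lebesgue_on {0..\<tau>}. t \<in> {0..\<tau>} \<and> weak_gradient (\<phi> t) (D t)"
  proof -
    have "AE t in lebesgue_on {0..\<tau>}. t \<in> {0..\<tau>}" by (rule AE_I2) simp
    with H1_weight_summable(1)[OF \<tau>] show ?thesis by eventually_elim (use D in blast)
  qed
  have weak: "(\<integral>x. \<phi> t x * \<psi> x \<partial>torus) +
           (\<integral>r. (\<integral>x. (v r x \<bullet> D r x) * \<psi> x + D r x \<bullet> D\<psi> x \<partial>torus) \<partial>lebesgue_on {0..t})
           = (\<integral>x. f x * \<psi> x \<partial>torus)"
    if \<psi>: "weak_gradient \<psi> D\<psi>" and t: "t \<in> {0..\<tau>}" for \<psi> D\<psi> t
  proof -
    let ?M = "lebesgue_on {0..t}"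
    define p where "p n = fourier_coeff \<psi> n" for n
    define I where "I n r = of_real (lap n) * c n r + transport a c n r" for n r
    \<comment> \<open>The time integrand of the weak formulation at mode \<open>n\<close>, equal to
      minus the derivative of \<open>Re (c n r * cnj (p n))\<close>.\<close>
    define F where "F n r = Re (I n r * cnj (p n))" for n r
    let ?J = "\<lambda>r. \<integral>x. (v r x \<bullet> D r x) * \<psi> x + D r x \<bullet> D\<psi> x \<partial>torus"
    have \<psi>L: "\<psi> \<in> torus_L2" using \<psi> by (simp add: weak_gradient_def)
    have Ic: "continuous_on {0..\<tau>} (I n)" for n
      unfolding I_def by (intro continuous_intros continuous_transport a_cont c_cont)
    have Fc: "continuous_on {0..\<tau>} (F n)" for n unfolding F_def by (intro continuous_intros Ic)
    have Fi: "integrable ?M (F n)" for n using t by (intro integrable_on_sub Fc) auto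
    have F_int: "(\<integral>r. F n r \<partial>?M) = Re (c n 0 * cnj (p n)) - Re (c n t * cnj (p n))" for n
    proof -
      have "(\<integral>r. F n r \<partial>?M) = (- Re (c n t * cnj (p n))) - (- Re (c n 0 * cnj (p n)))"
      proof (rule FTC_lebesgue)
        fix r assume r: "r \<in> {0..t}"
        have "(c n has_vector_derivative - of_real (lap n) * c n r - transport a c n r) (at r within {0..t})"
          by (rule has_vector_derivative_within_subset[OF c_deriv]) (use r t in auto)
        then have "((\<lambda>r. - Re (c n r * cnj (p n))) has_vector_derivative
           - Re ((- of_real (lap n) * c n r - transport a c n r) * cnj (p n))) (at r within {0..t})"
          by (intro has_vector_derivative_minus bounded_linear.has_vector_derivative[OF bounded_linear_compose[OF bounded_linear_Re bounded_linear_mult_left]])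
        moreover have "- Re ((- of_real (lap n) * c n r - transport a c n r) * cnj (p n)) = F n r"
          by (simp add: F_def I_def algebra_simps)
        ultimately show "((\<lambda>r. - Re (c n r * cnj (p n))) has_real_derivative F n r) (at r within {0..t})"
          by (simp only: has_real_derivative_iff_has_vector_derivative)
      qed (use t continuous_on_subset[OF Fc] in auto)
      then show ?thesis by simp
    qed
    \<comment> \<open>The test function has one derivative only, so the diffusion symbol is shared
      between \<open>c\<close> and \<open>p\<close>; the part with \<open>c\<close> is summable by
      the dissipation bound, the part with \<open>p\<close> by
      \<open>weak_gradient_lap\<close>.\<close>
    have summ: "(\<lambda>n. \<integral>r. norm (F n r) \<partial>?M) summable_on UNIV"
    proof (rule summable_on_comparison_test)
      obtain Q where Q: "((\<lambda>n. (g n)\<^sup>2) has_sum Q) UNIV" using g_sum by (auto simp: summable_on_def)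
      show "(\<lambda>n. (t * 2) * (lap n * (cmod (p n))\<^sup>2) + (t * 2 * A\<^sup>2) * nbr_sum (\<lambda>n. (g n)\<^sup>2) n + lap n * mass 0 t n) summable_on UNIV"
        using weak_gradient_lap[OF \<psi>] has_sum_nbr_sum[OF Q] t unfolding p_def
        by (intro summable_on_add summable_on_cmult_right lap_mass_sub_summable) (auto simp: summable_on_def)
      fix n
      have im: "integrable ?M (\<lambda>r. (cmod (c n r))\<^sup>2)"
        using t by (intro integrable_on_sub continuous_intros c_cont) auto
      have "(\<integral>r. norm (F n r) \<partial>?M) \<le> (\<integral>r. 2 * (lap n * (cmod (p n))\<^sup>2) + 2 * A\<^sup>2 * nbr_sum (\<lambda>n. (g n)\<^sup>2) n + lap n * (cmod (c n r))\<^sup>2 \<partial>?M)"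
      proof (rule integral_mono)
        fix r assume "r \<in> space ?M"
        then have r: "r \<in> {0..\<tau>}" using t by auto
        have "norm (F n r) \<le> cmod (I n r * cnj (p n))" unfolding F_def by (simp only: real_norm_def abs_Re_le_cmod)
        also have "\<dots> \<le> (lap n * cmod (c n r) + cmod (transport a c n r)) * cmod (p n)"
          unfolding I_def norm_mult complex_mod_cnj
          by (intro mult_right_mono order_trans[OF norm_triangle_ineq]) (auto simp: norm_mult)
        also have "\<dots> = lap n * (cmod (c n r) * cmod (p n)) + cmod (p n) * cmod (transport a c n r)"
          by (simp add: algebra_simps)
        also have "\<dots> \<le> lap n * ((cmod (c n r))\<^sup>2 + (cmod (p n))\<^sup>2) + (lap n * (cmod (p n))\<^sup>2 + 2 * A\<^sup>2 * nbr_sum (\<lambda>n. (g n)\<^sup>2) n)"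
        proof (intro add_mono mult_left_mono transport_pairing_bound[OF r] lap_nonneg)
          have "2 * (cmod (c n r) * cmod (p n)) \<le> (cmod (c n r))\<^sup>2 + (cmod (p n))\<^sup>2"
            using sum_squares_bound[of "cmod (c n r)" "cmod (p n)"] by simp
          moreover have "0 \<le> cmod (c n r) * cmod (p n)" by simp
          ultimately show "cmod (c n r) * cmod (p n) \<le> (cmod (c n r))\<^sup>2 + (cmod (p n))\<^sup>2" by linarith
        qed
        finally show "norm (F n r) \<le> 2 * (lap n * (cmod (p n))\<^sup>2) + 2 * A\<^sup>2 * nbr_sum (\<lambda>n. (g n)\<^sup>2) n + lap n * (cmod (c n r))\<^sup>2"
          by (simp add: algebra_simps)
      next
        show "integrable ?M (\<lambda>r. norm (F n r))" using Fi by simp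
        show "integrable ?M (\<lambda>r. 2 * (lap n * (cmod (p n))\<^sup>2) + 2 * A\<^sup>2 * nbr_sum (\<lambda>n. (g n)\<^sup>2) n + lap n * (cmod (c n r))\<^sup>2)"
          using t by (intro integrable_on_sub continuous_intros c_cont) auto
      qed
      also have "\<dots> = (t * 2) * (lap n * (cmod (p n))\<^sup>2) + (t * 2 * A\<^sup>2) * nbr_sum (\<lambda>n. (g n)\<^sup>2) n + lap n * mass 0 t n"
        using im t by (simp add: mass_def algebra_simps)
      finally show "(\<integral>r. norm (F n r) \<partial>?M) \<le> (t * 2) * (lap n * (cmod (p n))\<^sup>2) + (t * 2 * A\<^sup>2) * nbr_sum (\<lambda>n. (g n)\<^sup>2) n + lap n * mass 0 t n" .
    qed simp
    have S: "{0..t} \<in> sets lebesgue" by simp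
    note hs = has_sum_integral[OF S Fi summ]
    have J: "?J r = (2*pi)\<^sup>2 * (\<Sum>\<^sub>\<infinity>n. F n r)" if r: "r \<in> {0..\<tau>}" and G: "weak_gradient (\<phi> r) (D r)" for r
    proof -
      let ?H = "\<lambda>x. flow a r x \<bullet> D r x"
      note P1 = Parseval_inner_real[OF flow_gradient(1)[OF G, where a = a and t = r] torus_L2_cx[OF \<psi>L]]
      note P2 = Parseval_inner_real[OF weak_gradient_coeff(1)[OF G] weak_gradient_coeff(1)[OF \<psi>]]
      have tr: "transport a (\<lambda>n t. fourier_coeff (\<phi> r) n) n r = transport a c n r" for n
        by (rule transport_local) (rule \<phi>(2)[OF r])
      have in2: "integrable torus (\<lambda>x. D r x \<bullet> D\<psi> x)" unfolding inner_vec_def using P2(2) by simp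
      have "((\<lambda>n. Re (cfc (cx ?H) n * cnj (cfc (cx \<psi>) n))
           + (Re (cfc (cx (\<lambda>x. D r x $ 1)) n * cnj (cfc (cx (\<lambda>x. D\<psi> x $ 1)) n))
             + Re (cfc (cx (\<lambda>x. D r x $ 2)) n * cnj (cfc (cx (\<lambda>x. D\<psi> x $ 2)) n))))
         has_sum ((\<integral>x. ?H x * \<psi> x \<partial>torus) / (2*pi)\<^sup>2 + ((\<integral>x. D r x $ 1 * D\<psi> x $ 1 \<partial>torus) / (2*pi)\<^sup>2
            + (\<integral>x. D r x $ 2 * D\<psi> x $ 2 \<partial>torus) / (2*pi)\<^sup>2))) UNIV"
        by (intro has_sum_add P1(1) P2(1))
      moreover have "Re (cfc (cx ?H) n * cnj (cfc (cx \<psi>) n))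
           + (Re (cfc (cx (\<lambda>x. D r x $ 1)) n * cnj (cfc (cx (\<lambda>x. D\<psi> x $ 1)) n))
             + Re (cfc (cx (\<lambda>x. D r x $ 2)) n * cnj (cfc (cx (\<lambda>x. D\<psi> x $ 2)) n))) = F n r" for n
        unfolding weak_gradient_coeff(2)[OF G] weak_gradient_coeff(2)[OF \<psi>] flow_gradient(2)[OF G]
          F_def I_def p_def
        unfolding fourier_coeff_cfc[symmetric] tr
        unfolding \<phi>(2)[OF r]
        by (simp add: lap_def UNIV_2 power2_eq_square algebra_simps)
      moreover have "(\<integral>x. ?H x * \<psi> x \<partial>torus) / (2*pi)\<^sup>2 + ((\<integral>x. D r x $ 1 * D\<psi> x $ 1 \<partial>torus) / (2*pi)\<^sup>2
            + (\<integral>x. D r x $ 2 * D\<psi> x $ 2 \<partial>torus) / (2*pi)\<^sup>2) = (\<integral>x. ?H x * \<psi> x + D r x \<bullet> D\<psi> x \<partial>torus) / (2*pi)\<^sup>2"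
      proof -
        have "(\<integral>x. D r x \<bullet> D\<psi> x \<partial>torus) = (\<integral>x. D r x $ 1 * D\<psi> x $ 1 \<partial>torus) + (\<integral>x. D r x $ 2 * D\<psi> x $ 2 \<partial>torus)"
          unfolding inner_vec_def using P2(2) by (simp add: UNIV_2)
        then show ?thesis using P1(2) in2 by (simp add: add_divide_distrib)
      qed
      ultimately have "((\<lambda>n. F n r) has_sum (\<integral>x. ?H x * \<psi> x + D r x \<bullet> D\<psi> x \<partial>torus) / (2*pi)\<^sup>2) UNIV" by (simp only:)
      then have 1: "(\<integral>x. ?H x * \<psi> x + D r x \<bullet> D\<psi> x \<partial>torus) = (2*pi)\<^sup>2 * (\<Sum>\<^sub>\<infinity>n. F n r)"
        by (simp add: infsumI)
      have eqAE: "AE x in torus. ?H x * \<psi> x + D r x \<bullet> D\<psi> x = (v r x \<bullet> D r x) * \<psi> x + D r x \<bullet> D\<psi> x"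
        using v[OF r] by eventually_elim simp
      have "?J r = (\<integral>x. ?H x * \<psi> x + D r x \<bullet> D\<psi> x \<partial>torus)"
      proof (rule integral_cong_AE)
        show m: "(\<lambda>x. ?H x * \<psi> x + D r x \<bullet> D\<psi> x) \<in> borel_measurable torus" using P1(2) in2 by auto
        show "(\<lambda>x. (v r x \<bullet> D r x) * \<psi> x + D r x \<bullet> D\<psi> x) \<in> borel_measurable torus"
          by (rule AE_torus_measurable[OF m eqAE])
        show "AE x in torus. (v r x \<bullet> D r x) * \<psi> x + D r x \<bullet> D\<psi> x = ?H x * \<psi> x + D r x \<bullet> D\<psi> x"
          using eqAE by eventually_elim (erule HOL.sym)
      qed
      then show ?thesis using 1 by (simp only:)
    qed
    have AEt: "AE r in ?M. r \<in> {0..\<tau>} \<and> weak_gradient (\<phi> r) (D r)"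
    proof -
      have "AE r in lebesgue. r \<in> {0..\<tau>} \<longrightarrow> r \<in> {0..\<tau>} \<and> weak_gradient (\<phi> r) (D r)"
        using AED by (subst (asm) AE_restrict_space_iff) auto
      then show ?thesis using t by (subst AE_restrict_space_iff) (auto elim!: eventually_mono)
    qed
    have Jeq: "AE r in ?M. (2*pi)\<^sup>2 * (\<Sum>\<^sub>\<infinity>n. F n r) = ?J r"
      using AEt by eventually_elim (simp only: J)
    have m: "(\<lambda>r. (2*pi)\<^sup>2 * (\<Sum>\<^sub>\<infinity>n. F n r)) \<in> borel_measurable ?M" using hs(2) by auto
    have "(\<integral>r. ?J r \<partial>?M) = (\<integral>r. (2*pi)\<^sup>2 * (\<Sum>\<^sub>\<infinity>n. F n r) \<partial>?M)"
    proof (rule integral_cong_AE[OF _ m])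
      show "?J \<in> borel_measurable ?M" by (rule borel_measurable_lebesgue_on_AE[OF m S Jeq])
      show "AE r in ?M. ?J r = (2*pi)\<^sup>2 * (\<Sum>\<^sub>\<infinity>n. F n r)" using Jeq by eventually_elim (erule HOL.sym)
    qed
    also have "\<dots> = (2*pi)\<^sup>2 * (\<integral>r. (\<Sum>\<^sub>\<infinity>n. F n r) \<partial>?M)" by (rule integral_mult_right_zero)
    also have "(\<integral>r. (\<Sum>\<^sub>\<infinity>n. F n r) \<partial>?M) = (\<integral>x. f x * \<psi> x \<partial>torus) / (2*pi)\<^sup>2 - (\<integral>x. \<phi> t x * \<psi> x \<partial>torus) / (2*pi)\<^sup>2"
    proof (rule has_sum_unique[OF hs(3)])
      have "((\<lambda>n. Re (c n 0 * cnj (p n)) - Re (c n t * cnj (p n))) has_sum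
          ((\<integral>x. f x * \<psi> x \<partial>torus) / (2*pi)\<^sup>2 - (\<integral>x. \<phi> t x * \<psi> x \<partial>torus) / (2*pi)\<^sup>2)) UNIV"
        using has_sum_diff[OF Parseval_inner_real(1)[OF torus_L2_cx[OF f(1)] torus_L2_cx[OF \<psi>L]]
            Parseval_inner_real(1)[OF torus_L2_cx[OF \<phi>(1)[OF t]] torus_L2_cx[OF \<psi>L]]]
        by (simp only: fourier_coeff_cfc[symmetric] f(2) \<phi>(2)[OF t] p_def)
      then show "((\<lambda>n. \<integral>r. F n r \<partial>?M) has_sum
          ((\<integral>x. f x * \<psi> x \<partial>torus) / (2*pi)\<^sup>2 - (\<integral>x. \<phi> t x * \<psi> x \<partial>torus) / (2*pi)\<^sup>2)) UNIV"
        by (simp only: F_int)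
    qed
    also have "(2*pi)\<^sup>2 * ((\<integral>x. f x * \<psi> x \<partial>torus) / (2*pi)\<^sup>2 - (\<integral>x. \<phi> t x * \<psi> x \<partial>torus) / (2*pi)\<^sup>2)
        = (\<integral>x. f x * \<psi> x \<partial>torus) - (\<integral>x. \<phi> t x * \<psi> x \<partial>torus)"
    proof -
      have *: "k * (x / k - y / k) = x - y" if "k \<noteq> 0" for k x y :: real using that by (simp add: field_simps)
      show ?thesis by (rule *) simp
    qed
    finally show ?thesis by simp
  qed
  have "bochner_Lp_sobolev 2 1 \<tau> \<phi>"
    unfolding bochner_Lp_sobolev_def
  proof
    show "strongly_measurable_sobolev 1 \<tau> \<phi>"
      by (rule strongly_measurable_modes[OF \<tau> c_cont sym \<phi> H1_weight_summable(1)[OF \<tau>]])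
    have "sobolev_norm 1 (\<phi> t) ^ 2 = (\<Sum>\<^sub>\<infinity>n. sobolev_weight 1 n * (cmod (c n t))\<^sup>2)" if t: "t \<in> {0..\<tau>}" for t
      unfolding sobolev_norm_def \<phi>(2)[OF t]
      by (rule real_sqrt_pow2) (intro infsum_nonneg mult_nonneg_nonneg sobolev_weight_nonneg zero_le_power2)
    then show "integrable (lebesgue_on {0..\<tau>}) (\<lambda>t. sobolev_norm 1 (\<phi> t) ^ 2)"
      using H1_weight_summable(2)[OF \<tau>] by (subst Bochner_Integration.integrable_cong[OF refl]) auto
  qed
  moreover have "AE x in torus. \<phi> 0 x = f x"
    using \<tau> by (intro torus_L2_eq_AE \<phi>(1) f(1)) (auto simp: \<phi>(2) f(2))
  moreover have "AE t in lebesgue_on {0..\<tau>}. weak_gradient (\<phi> t) (D t)"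
    using AED by eventually_elim simp
  ultimately have "advection_diffusion_solution \<tau> v f \<phi>"
    unfolding advection_diffusion_solution_def
    using coefficients_continuous_into_L2[OF \<phi>] weak by (intro conjI exI[of _ D] allI impI ballI) auto
  then show "\<exists>\<phi>. advection_diffusion_solution \<tau> v f \<phi>" by (intro exI)
qed

end

section \<open>Shear flows solve the Euler system\<close>

lemma FTC_lebesgue_vector:
  fixes F :: "real \<Rightarrow> 'b::euclidean_space"
  assumes "s \<le> t" "\<And>r. r \<in> {s..t} \<Longrightarrow> (F has_vector_derivative f r) (at r within {s..t})" "continuous_on {s..t} f"
  shows "(\<integral>r. f r \<partial>lebesgue_on {s..t}) = F t - F s"
proof -
  have "(f has_integral (F t - F s)) {s..t}" by (rule fundamental_theorem_of_calculus[OF assms(1,2)])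
  then show ?thesis
    using assms(3) by (simp add: lebesgue_integral_eq_integral continuous_imp_integrable_real integral_unique)
qed

definition sin_coeff :: "2 \<Rightarrow> int^2 \<Rightarrow> complex" where
  "sin_coeff i n = ((if n = shift i then 1 else 0) - (if n = - shift i then 1 else 0)) / (2 * \<i>)"

definition shear_modes :: "(int^2) set" where
  "shear_modes = shift ` UNIV \<union> (\<lambda>i. - shift i) ` UNIV"

lemma finite_shear_modes: "finite shear_modes"
  by (simp add: shear_modes_def)

definition flow_coeff :: "(2 \<Rightarrow> real \<Rightarrow> real) \<Rightarrow> 2 \<Rightarrow> int^2 \<Rightarrow> real \<Rightarrow> complex" where
  "flow_coeff a k n t = (\<Sum>i\<in>UNIV. of_real (a i t * of_int (perp i k)) * sin_coeff i n)"

lemma flow_coeff_0: "n \<notin> shear_modes \<Longrightarrow> flow_coeff a k n t = 0"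
  by (auto simp: flow_coeff_def sin_coeff_def shear_modes_def intro!: sum.neutral)

lemma periodic_phase: "cx (\<lambda>x. sin (phase i x)) (x + axis j (2 * pi)) = cx (\<lambda>x. sin (phase i x)) x"
    "cx (\<lambda>x. cos (phase i x)) (x + axis j (2 * pi)) = cx (\<lambda>x. cos (phase i x)) x"
  by (simp_all only: sin_phase cos_phase periodic_wave)

lemma sin_phase_L2: "(\<lambda>x. sin (phase i x)) \<in> torus_L2" "fourier_coeff (\<lambda>x. sin (phase i x)) n = sin_coeff i n"
proof -
  have e: "cx (\<lambda>x. sin (phase i x)) = (\<lambda>x. (1 / (2 * \<i>)) * (wave (shift i) x - wave (- shift i) x))"
    by (simp add: fun_eq_iff sin_phase)
  have "torus_periodic (\<lambda>x. sin (phase i x))"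
    using periodic_phase(1)[of i] by (simp add: torus_periodic_def)
  then show "(\<lambda>x. sin (phase i x)) \<in> torus_L2"
    unfolding torus_L2_iff e by (intro conjI cL2_cmult cL2_diff cL2_wave)
  show "fourier_coeff (\<lambda>x. sin (phase i x)) n = sin_coeff i n"
    unfolding fourier_coeff_cfc e cfc_cmult by (subst cfc_diff) (auto simp: cfc_wave sin_coeff_def)
qed

text \<open>The second claim is the derivative of the sine in Fourier terms: both sides are
  supported at \<open>n = \<plusminus> shift i\<close>, where the signs match.\<close>

lemma cos_phase_L2: "(\<lambda>x. cos (phase i x)) \<in> torus_L2"
    "of_int (shift i $ j) * fourier_coeff (\<lambda>x. cos (phase i x)) n = \<i> * of_int (n $ j) * sin_coeff i n"
proof -
  have e: "cx (\<lambda>x. cos (phase i x)) = (\<lambda>x. (1 / 2) * (wave (shift i) x + wave (- shift i) x))"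
    by (simp add: fun_eq_iff cos_phase)
  have "torus_periodic (\<lambda>x. cos (phase i x))"
    using periodic_phase(2)[of i] by (simp add: torus_periodic_def)
  then show "(\<lambda>x. cos (phase i x)) \<in> torus_L2"
    unfolding torus_L2_iff e by (intro conjI cL2_cmult cL2_add cL2_wave)
  have "fourier_coeff (\<lambda>x. cos (phase i x)) n = ((if n = shift i then 1 else 0) + (if n = - shift i then 1 else 0)) / 2"
    unfolding fourier_coeff_cfc e cfc_cmult by (subst cfc_add) (auto simp: cfc_wave)
  moreover have "shift i \<noteq> - shift i"
  proof
    assume "shift i = - shift i"
    then have "shift i $ 1 = - (shift i $ 1)" by (metis vector_uminus_component)
    then show False by (simp add: shift_def)
  qed
  ultimately show "of_int (shift i $ j) * fourier_coeff (\<lambda>x. cos (phase i x)) n = \<i> * of_int (n $ j) * sin_coeff i n"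
    by (auto simp: sin_coeff_def field_simps)
qed

lemma flow_component: "flow a t x $ k = a 1 t * of_int (perp 1 k) * sin (phase 1 x) + a 2 t * of_int (perp 2 k) * sin (phase 2 x)"
  by (simp add: flow_def UNIV_2)

lemma flow_L2: "(\<lambda>x. flow a t x $ k) \<in> torus_L2" "fourier_coeff (\<lambda>x. flow a t x $ k) n = flow_coeff a k n t"
proof -
  note L = torus_L2_cmult[OF sin_phase_L2(1)]
  show "(\<lambda>x. flow a t x $ k) \<in> torus_L2" unfolding flow_component by (intro torus_L2_add L)
  show "fourier_coeff (\<lambda>x. flow a t x $ k) n = flow_coeff a k n t"
    unfolding flow_component fourier_coeff_add[OF L L] fourier_coeff_cmult sin_phase_L2(2)
    by (simp add: flow_coeff_def UNIV_2)
qed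

lemma flow_coeff_minus: "flow_coeff a k (- n) t = cnj (flow_coeff a k n t)"
  using fourier_coeff_minus[of "\<lambda>x. flow a t x $ k" n] by (simp add: flow_L2)

lemma flow_coeff_cont:
  "(\<And>i. continuous_on S (a i)) \<Longrightarrow> continuous_on S (flow_coeff a k n)"
  unfolding flow_coeff_def by (intro continuous_intros) auto

lemma flow_sobolev: "(\<lambda>x. flow a t x $ k) \<in> sobolev s"
    "sobolev_norm s (\<lambda>x. flow a t x $ k) = sqrt (\<Sum>n\<in>shear_modes. sobolev_weight s n * (cmod (flow_coeff a k n t))\<^sup>2)"
    "(\<lambda>n. sobolev_weight s n * (cmod (flow_coeff a k n t))\<^sup>2) summable_on UNIV"
proof -
  have h: "((\<lambda>n. sobolev_weight s n * (cmod (flow_coeff a k n t))\<^sup>2) has_sum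
      (\<Sum>n\<in>shear_modes. sobolev_weight s n * (cmod (flow_coeff a k n t))\<^sup>2)) UNIV"
    by (rule has_sum_finite_neutralI[OF finite_shear_modes]) (auto simp: flow_coeff_0)
  then show s: "(\<lambda>n. sobolev_weight s n * (cmod (flow_coeff a k n t))\<^sup>2) summable_on UNIV"
    by (rule has_sum_imp_summable)
  show "(\<lambda>x. flow a t x $ k) \<in> sobolev s"
    using s by (simp add: sobolev_def flow_L2)
  show "sobolev_norm s (\<lambda>x. flow a t x $ k) = sqrt (\<Sum>n\<in>shear_modes. sobolev_weight s n * (cmod (flow_coeff a k n t))\<^sup>2)"
    unfolding sobolev_norm_def flow_L2 by (simp only: infsumI[OF h])
qed

text \<open>Linearity in the amplitudes reduces continuity in any Sobolev norm to that of finitely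
  many coefficients.\<close>

lemma flow_diff: "flow a r x $ k - flow a t x $ k = flow (\<lambda>i q. a i q - a i t) r x $ k"
  by (simp add: flow_component algebra_simps)

lemma flow_continuous_into_sobolev:
  assumes a: "\<And>i. continuous_on {0..\<tau>} (a i)"
  shows "continuous_into_sobolev s \<tau> (\<lambda>t x. flow a t x $ k)"
  unfolding continuous_into_sobolev_def
proof (intro ballI conjI flow_sobolev(1))
  fix t assume t: "t \<in> {0..\<tau>}"
  have "continuous_on {0..\<tau>} (\<lambda>r. sqrt (\<Sum>n\<in>shear_modes. sobolev_weight s n * (cmod (flow_coeff (\<lambda>i q. a i q - a i t) k n r))\<^sup>2))"
    by (intro continuous_intros flow_coeff_cont a)
  then have "((\<lambda>r. sqrt (\<Sum>n\<in>shear_modes. sobolev_weight s n * (cmod (flow_coeff (\<lambda>i q. a i q - a i t) k n r))\<^sup>2))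
     \<longlongrightarrow> sqrt (\<Sum>n\<in>shear_modes. sobolev_weight s n * (cmod (flow_coeff (\<lambda>i q. a i q - a i t) k n t))\<^sup>2)) (at t within {0..\<tau>})"
    unfolding continuous_on_def using t by blast
  moreover have "flow_coeff (\<lambda>i q. a i q - a i t) k n t = 0" for n by (simp add: flow_coeff_def)
  ultimately show "((\<lambda>r. sobolev_norm s (\<lambda>x. flow a r x $ k - flow a t x $ k)) \<longlongrightarrow> 0) (at t within {0..\<tau>})"
    unfolding flow_diff flow_sobolev(2) by simp
qed

lemma mean_zero_coeff: "f \<in> torus_L2 \<Longrightarrow> (\<integral>x. f x \<partial>torus) = 0 \<longleftrightarrow> fourier_coeff f 0 = 0"
  unfolding fourier_coeff_cfc cfc_def mean_def by simp

lemma flow_W11: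
  assumes \<tau>: "\<tau> > 0" and a: "\<And>i t. (a i has_real_derivative a' i t) (at t)" and a': "\<And>i S. continuous_on S (a' i)"
  shows "has_W11_derivative s \<tau> (\<lambda>t x. flow a t x $ k) (\<lambda>t x. flow a' t x $ k)"
  unfolding has_W11_derivative_def bochner_Lp_sobolev_def
proof (intro conjI ballI allI)
  show "strongly_measurable_sobolev s \<tau> (\<lambda>t x. flow a' t x $ k)"
    by (rule strongly_measurable_modes[OF \<tau>, where c = "flow_coeff a' k"])
       (auto simp: flow_L2 flow_coeff_minus flow_sobolev(3) intro!: flow_coeff_cont a')
  show "integrable (lebesgue_on {0..\<tau>}) (\<lambda>t. sobolev_norm s (\<lambda>x. flow a' t x $ k) ^ 1)"
    unfolding flow_sobolev(2) power_one_right
    by (intro continuous_imp_integrable_real continuous_intros flow_coeff_cont a')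
  fix t n assume t: "t \<in> {0..\<tau>}"
  have "(\<integral>r. flow_coeff a' k n r \<partial>lebesgue_on {0..t}) = flow_coeff a k n t - flow_coeff a k n 0"
  proof (rule FTC_lebesgue_vector)
    fix r assume "r \<in> {0..t}"
    have "((\<lambda>r. of_real (a i r * of_int (perp i k)) * sin_coeff i n) has_vector_derivative
        of_real (a' i r * of_int (perp i k)) * sin_coeff i n) (at r within {0..t})" for i
    proof -
      have "((\<lambda>r. a i r * of_int (perp i k)) has_vector_derivative a' i r * of_int (perp i k)) (at r within {0..t})"
        using DERIV_cmult_right[OF has_field_derivative_at_within[OF a]]
        by (simp add: has_real_derivative_iff_has_vector_derivative)
      from bounded_linear.has_vector_derivative[OF bounded_linear_compose[OF bounded_linear_mult_left bounded_linear_of_real] this]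
      show ?thesis .
    qed
    then show "(flow_coeff a k n has_vector_derivative flow_coeff a' k n r) (at r within {0..t})"
      unfolding flow_coeff_def by (intro has_vector_derivative_sum)
  qed (use t in \<open>auto intro!: flow_coeff_cont a'\<close>)
  then show "fourier_coeff (\<lambda>x. flow a t x $ k) n = fourier_coeff (\<lambda>x. flow a 0 x $ k) n
      + (\<integral>r. fourier_coeff (\<lambda>x. flow a' r x $ k) n \<partial>lebesgue_on {0..t})"
    by (simp add: flow_L2)
qed

definition flow_grad :: "(2 \<Rightarrow> real \<Rightarrow> real) \<Rightarrow> real \<Rightarrow> real^2 \<Rightarrow> real^2^2" where
  "flow_grad a t x = (\<chi> k j. a 1 t * of_int (perp 1 k) * (of_int (shift 1 $ j) * cos (phase 1 x))
     + a 2 t * of_int (perp 2 k) * (of_int (shift 2 $ j) * cos (phase 2 x)))"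

lemma flow_weak_gradient: "weak_gradient (\<lambda>x. flow a t x $ k) (\<lambda>x. flow_grad a t x $ k)"
  unfolding weak_gradient_def
proof (intro conjI allI flow_L2)
  fix j
  have e: "(\<lambda>x. flow_grad a t x $ k $ j) = (\<lambda>x. a 1 t * of_int (perp 1 k) * (of_int (shift 1 $ j) * cos (phase 1 x))
     + a 2 t * of_int (perp 2 k) * (of_int (shift 2 $ j) * cos (phase 2 x)))"
    by (simp add: flow_grad_def)
  note L = torus_L2_cmult[OF torus_L2_cmult[OF cos_phase_L2(1)]]
  show "(\<lambda>x. flow_grad a t x $ k $ j) \<in> torus_L2" unfolding e by (intro torus_L2_add L)
  show "fourier_coeff (\<lambda>x. flow_grad a t x $ k $ j) n = \<i> * of_int (n $ j) * fourier_coeff (\<lambda>x. flow a t x $ k) n" for n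
    unfolding e fourier_coeff_add[OF L L] fourier_coeff_cmult flow_L2(2) of_real_of_int_eq cos_phase_L2(2)
    by (simp add: flow_coeff_def UNIV_2 algebra_simps)
qed

lemma trace_flow_grad: "trace (flow_grad a t x) = 0"
  by (simp add: trace_def flow_grad_def UNIV_2 perp_def)

text \<open>Each shear is constant along its own direction, so only mixed terms remain, and these
  carry the product of the two amplitudes.\<close>

lemma flow_self_advection: "a 1 t * a 2 t = 0 \<Longrightarrow> flow_grad a t x *v flow a t x = 0"
  by (auto simp: vec_eq_iff matrix_vector_mult_def flow_component flow_grad_def UNIV_2 perp_def algebra_simps)

text \<open>Without self-advection the equation reduces to \<open>v' = F\<close>, so the pressure
  can be zero and the force is the flow with the differentiated amplitudes.\<close>

theorem flow_euler_solution:
  assumes \<tau>: "\<tau> > 0" and a: "\<And>i t. (a i has_real_derivative a' i t) (at t)" and a': "\<And>i S. continuous_on S (a' i)"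
    and a0: "\<And>i. a i 0 = 0" and prod: "\<And>t. a 1 t * a 2 t = 0"
  shows "euler_solution k \<tau> (flow a') (flow a)"
proof -
  have ac: "continuous_on S (a i)" for S i
    using a DERIV_isCont continuous_at_imp_continuous_on by blast
  have z: "weak_gradient (\<lambda>x. 0) (\<lambda>x. 0)"
  proof -
    have "(\<lambda>x. 0) \<in> torus_L2" "fourier_coeff (\<lambda>x. 0) n = 0" for n
      by (auto simp: torus_L2_iff torus_periodic_def fourier_coeff_def)
    then show ?thesis by (simp add: weak_gradient_def)
  qed
  show ?thesis
    unfolding euler_solution_def
  proof (intro conjI allI ballI)
    show "continuous_into_sobolev k \<tau> (\<lambda>t x. flow a t x $ i)" for i by (rule flow_continuous_into_sobolev[OF ac])
    show "(\<integral>x. flow a t x $ i \<partial>torus) = 0" for t i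
    proof -
      have "shift i \<noteq> 0" for i by (auto simp: shift_def vec_eq_iff intro!: exI[of _ 1])
      then have "flow_coeff a i 0 t = 0" by (simp add: flow_coeff_def sin_coeff_def)
      then show ?thesis unfolding mean_zero_coeff[OF flow_L2(1)] flow_L2(2) .
    qed
    show "AE x in torus. flow a 0 x = 0" by (rule AE_I2) (simp add: vec_eq_iff flow_component a0)
    show "\<exists>v' Dv p Dp. (\<forall>i. has_W11_derivative (k - 1) \<tau> (\<lambda>t x. flow a t x $ i) (\<lambda>t x. v' t x $ i)) \<and>
        (\<forall>t\<in>{0..\<tau>}. (\<forall>i. weak_gradient (\<lambda>x. flow a t x $ i) (\<lambda>x. Dv t x $ i)) \<and>
                    (AE x in torus. trace (Dv t x) = 0)) \<and>
        (AE t in lebesgue_on {0..\<tau>}. weak_gradient (p t) (Dp t) \<and>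
           (AE x in torus. v' t x + Dv t x *v flow a t x + Dp t x = flow a' t x))"
      by (intro exI[of _ "flow a'"] exI[of _ "flow_grad a"] exI[of _ "\<lambda>t x. 0"] conjI allI ballI AE_I2
            flow_W11[OF \<tau> a a'] flow_weak_gradient trace_flow_grad z)
         (simp add: flow_self_advection prod)
  qed
qed

section \<open>Uniqueness for the Euler system\<close>

lemma cL2_bound_AE:
  assumes g: "g \<in> cL2" and f: "f \<in> borel_measurable torus" and le: "AE x in torus. cmod (f x) \<le> C * cmod (g x)"
  shows "f \<in> cL2"
proof -
  have "integrable torus (\<lambda>x. (cmod (f x))\<^sup>2)"
  proof (rule Bochner_Integration.integrable_bound)
    show "integrable torus (\<lambda>x. C\<^sup>2 * (cmod (g x))\<^sup>2)" using cL2_square[OF g] by simp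
    show "AE x in torus. norm ((cmod (f x))\<^sup>2) \<le> norm (C\<^sup>2 * (cmod (g x))\<^sup>2)"
      using le
    proof eventually_elim
      case (elim x)
      from power_mono[OF elim norm_ge_zero, of 2] show ?case by (simp add: power_mult_distrib)
    qed
  qed (use f in measurable)
  then show ?thesis using f by (simp add: cL2_def)
qed

text \<open>Parseval's identity for \<open>F\<close> against the conjugate of \<open>H\<close> times
  a character; this works although the product of the two is merely integrable.\<close>

lemma fourier_convolution:
  assumes F: "F \<in> cL2" and H: "H \<in> cL2"
  shows "((\<lambda>n. cfc F n * cfc H (m - n)) has_sum cfc (\<lambda>x. F x * H x) m) UNIV"
proof -
  let ?K = "\<lambda>x. cnj (H x * wave (- m) x)"
  have K: "?K \<in> cL2" by (intro cL2_cnj cL2_mult_wave H)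
  have "cnj (cfc ?K n) = cfc H (m - n)" for n
    by (simp only: cfc_cnj cfc_mult_wave complex_cnj_cnj) simp
  moreover have "mean (\<lambda>x. F x * cnj (?K x)) = cfc (\<lambda>x. F x * H x) m"
    by (simp add: cfc_def mult.assoc)
  ultimately show ?thesis using Parseval_inner[OF F K] by (simp only:)
qed

text \<open>The square of \<open>f\<close> is merely integrable, so the product rule is read off the
  convolution: adding the sum to its image under \<open>n \<mapsto> m - n\<close> replaces the
  factor \<open>(m - n) $ j\<close> by \<open>m $ j\<close>.\<close>

lemma fourier_square_derivative:
  assumes G: "weak_gradient f G"
  shows "2 * cfc (\<lambda>x. cx f x * cx (\<lambda>x. G x $ j) x) m = \<i> * of_int (m $ j) * cfc (\<lambda>x. cx f x * cx f x) m"
proof -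
  have f: "cx f \<in> cL2" using G by (simp add: weak_gradient_def torus_L2_cx)
  let ?f = "fourier_coeff f"
  have 1: "((\<lambda>n. ?f n * (\<i> * of_int ((m - n) $ j) * ?f (m - n))) has_sum cfc (\<lambda>x. cx f x * cx (\<lambda>x. G x $ j) x) m) UNIV"
    using fourier_convolution[OF f weak_gradient_coeff(1)[OF G]]
    by (simp only: weak_gradient_coeff(2)[OF G] fourier_coeff_cfc[symmetric])
  have bij: "bij_betw (\<lambda>n. m - n) UNIV (UNIV :: (int^2) set)"
    by (rule bij_betwI[where g = "\<lambda>n. m - n"]) auto
  have 2: "((\<lambda>n. ?f (m - n) * (\<i> * of_int ((m - (m - n)) $ j) * ?f (m - (m - n)))) has_sum cfc (\<lambda>x. cx f x * cx (\<lambda>x. G x $ j) x) m) UNIV"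
    using has_sum_reindex_bij_betw[OF bij, of "\<lambda>n. ?f n * (\<i> * of_int ((m - n) $ j) * ?f (m - n))"] 1 by (simp only:)
  have "((\<lambda>n. \<i> * of_int (m $ j) * (?f n * ?f (m - n))) has_sum \<i> * of_int (m $ j) * cfc (\<lambda>x. cx f x * cx f x) m) UNIV"
    using fourier_convolution[OF f f] by (intro has_sum_cmult_right) (simp only: fourier_coeff_cfc[symmetric])
  moreover have "((\<lambda>n. \<i> * of_int (m $ j) * (?f n * ?f (m - n))) has_sum
      (cfc (\<lambda>x. cx f x * cx (\<lambda>x. G x $ j) x) m + cfc (\<lambda>x. cx f x * cx (\<lambda>x. G x $ j) x) m)) UNIV"
    by (rule has_sum_cong[THEN iffD1, OF _ has_sum_add[OF 1 2]]) (simp add: algebra_simps)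
  ultimately show ?thesis using has_sum_unique by fastforce
qed

text \<open>Half the gradient of \<open>w\<^sup>2\<close> is paired with a divergence-free field.
  Boundedness of \<open>w\<close> places the products with its gradient in L2, where Parseval
  applies.\<close>

lemma trilinear_zero:
  assumes G: "weak_gradient w G" and K: "AE x in torus. \<bar>w x\<bar> \<le> K"
    and v: "\<And>j. (\<lambda>x. v x $ j) \<in> torus_L2"
    and div: "\<And>n. (\<Sum>j\<in>UNIV. of_int (n $ j) * fourier_coeff (\<lambda>x. v x $ j) n) = 0"
  shows "integrable torus (\<lambda>x. w x * G x $ j * v x $ j)"
    "(\<Sum>j\<in>UNIV. \<integral>x. w x * G x $ j * v x $ j \<partial>torus) = 0"
proof -
  have Gm: "(\<lambda>x. G x $ j) \<in> torus_L2" for j using G by (simp add: weak_gradient_def)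
  have wm: "w \<in> torus_L2" using G by (simp add: weak_gradient_def)
  have L: "cx (\<lambda>x. w x * G x $ j) \<in> cL2" for j
  proof (rule cL2_bound_AE[OF torus_L2_cx[OF Gm]])
    show "cx (\<lambda>x. w x * G x $ j) \<in> borel_measurable torus"
      using torus_L2_measurable[OF wm] torus_L2_measurable[OF Gm] by measurable
    show "AE x in torus. cmod (cx (\<lambda>x. w x * G x $ j) x) \<le> K * cmod (cx (\<lambda>x. G x $ j) x)"
      using K by eventually_elim (simp add: abs_mult norm_mult mult_right_mono)
  qed
  note P = Parseval_inner_real[OF L torus_L2_cx[OF v]]
  show "integrable torus (\<lambda>x. w x * G x $ j * v x $ j)" using P(2) .
  let ?q = "\<lambda>n. cfc (\<lambda>x. cx w x * cx w x) n"
  have c: "cfc (cx (\<lambda>x. w x * G x $ j)) n = \<i> * of_int (n $ j) / 2 * ?q n" for j n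
    using fourier_square_derivative[OF G, of j n] by (simp add: field_simps)
  have "((\<lambda>n. Re (cfc (cx (\<lambda>x. w x * G x $ 1)) n * cnj (cfc (cx (\<lambda>x. v x $ 1)) n))
      + Re (cfc (cx (\<lambda>x. w x * G x $ 2)) n * cnj (cfc (cx (\<lambda>x. v x $ 2)) n)))
    has_sum ((\<integral>x. w x * G x $ 1 * v x $ 1 \<partial>torus) / (2*pi)\<^sup>2 + (\<integral>x. w x * G x $ 2 * v x $ 2 \<partial>torus) / (2*pi)\<^sup>2)) UNIV"
    by (intro has_sum_add P(1))
  moreover have "Re (cfc (cx (\<lambda>x. w x * G x $ 1)) n * cnj (cfc (cx (\<lambda>x. v x $ 1)) n))
      + Re (cfc (cx (\<lambda>x. w x * G x $ 2)) n * cnj (cfc (cx (\<lambda>x. v x $ 2)) n)) = 0" for n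
  proof -
    have "cfc (cx (\<lambda>x. w x * G x $ 1)) n * cnj (cfc (cx (\<lambda>x. v x $ 1)) n)
      + cfc (cx (\<lambda>x. w x * G x $ 2)) n * cnj (cfc (cx (\<lambda>x. v x $ 2)) n)
      = \<i> / 2 * ?q n * cnj (\<Sum>j\<in>UNIV. of_int (n $ j) * fourier_coeff (\<lambda>x. v x $ j) n)"
      unfolding c by (simp add: UNIV_2 fourier_coeff_cfc algebra_simps)
    also have "\<dots> = 0" unfolding div by simp
    finally show ?thesis by (simp only: plus_complex.sel[symmetric] zero_complex.sel)
  qed
  ultimately have "((\<lambda>n::int^2. 0) has_sum ((\<integral>x. w x * G x $ 1 * v x $ 1 \<partial>torus) / (2*pi)\<^sup>2 + (\<integral>x. w x * G x $ 2 * v x $ 2 \<partial>torus) / (2*pi)\<^sup>2)) UNIV"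
    by (simp only:)
  then have "(\<integral>x. w x * G x $ 1 * v x $ 1 \<partial>torus) / (2*pi)\<^sup>2 + (\<integral>x. w x * G x $ 2 * v x $ 2 \<partial>torus) / (2*pi)\<^sup>2 = 0"
    using has_sum_unique has_sum_0 by (metis (no_types, lifting))
  then have "((\<integral>x. w x * G x $ 1 * v x $ 1 \<partial>torus) + (\<integral>x. w x * G x $ 2 * v x $ 2 \<partial>torus)) / (2*pi)\<^sup>2 = 0"
    by (simp only: add_divide_distrib)
  then show "(\<Sum>j\<in>UNIV. \<integral>x. w x * G x $ j * v x $ j \<partial>torus) = 0" by (simp add: UNIV_2)
qed

text \<open>The series converges absolutely to a bounded function with the same coefficients, which
  uniqueness identifies with \<open>f\<close>.\<close>

lemma absolutely_convergent_bounded: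
  assumes f: "f \<in> torus_L2" and s: "(\<lambda>n. cmod (fourier_coeff f n)) summable_on UNIV"
  shows "\<exists>K. AE x in torus. \<bar>f x\<bar> \<le> K"
proof -
  let ?f = "fourier_coeff f"
  let ?S = "cbox 0 (\<chi> j. 2 * pi) :: (real^2) set"
  define h where "h x = (\<Sum>\<^sub>\<infinity>n. ?f n * wave n x)" for x
  have S: "?S \<in> sets lebesgue" by simp
  have i: "integrable torus (\<lambda>x. ?f n * wave n x * wave (- m) x)" for n m
    by (intro integrable_cL2_mult cL2_cmult cL2_wave)
  have sm: "(\<lambda>n. \<integral>x. norm (?f n * wave n x * wave (- m) x) \<partial>torus) summable_on UNIV" for m
    using summable_on_cmult_right[OF s, of "(2*pi)\<^sup>2"] by (simp add: norm_mult measure_torus)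
  note hs = has_sum_integral[OF S i[unfolded torus_def] sm[unfolded torus_def], folded torus_def]
  have hw: "(\<Sum>\<^sub>\<infinity>n. ?f n * wave n x * wave (- m) x) = h x * wave (- m) x" for m x
    unfolding h_def by (rule infsum_cmult_left')
  have hi: "integrable torus h"
    using hs(2)[of 0] by (simp add: h_def[abs_def])
  have "cfc h m = ?f m" for m
  proof -
    have "((\<lambda>n. \<integral>x. ?f n * wave n x * wave (- m) x \<partial>torus) has_sum (\<integral>x. h x * wave (- m) x \<partial>torus)) UNIV"
      using hs(3)[of m] unfolding hw .
    moreover have "(\<integral>x. ?f n * wave n x * wave (- m) x \<partial>torus) = (if n = m then ?f m * of_real ((2*pi)\<^sup>2) else 0)" for n
    proof -
      have "(\<integral>x. ?f n * wave n x * wave (- m) x \<partial>torus) = ?f n * (\<integral>x. wave (n + - m) x \<partial>torus)"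
        unfolding wave_add mult.assoc by (rule integral_mult_right_zero)
      then show ?thesis unfolding integral_wave by simp
    qed
    ultimately have "((\<lambda>n. if n = m then ?f m * of_real ((2*pi)\<^sup>2) else 0) has_sum (\<integral>x. h x * wave (- m) x \<partial>torus)) UNIV"
      by (simp only:)
    moreover have "((\<lambda>n. if n = m then ?f m * of_real ((2*pi)\<^sup>2) else 0) has_sum (?f m * of_real ((2*pi)\<^sup>2))) UNIV"
      by (rule has_sum_finite_neutralI[of "{m}"]) auto
    ultimately have "(\<integral>x. h x * wave (- m) x \<partial>torus) = ?f m * of_real ((2*pi)\<^sup>2)" by (rule has_sum_unique)
    then show ?thesis by (simp add: cfc_def mean_def del: of_real_power)
  qed
  moreover have "cfc (\<lambda>x. cx f x - h x) m = cfc (cx f) m - cfc h m" for m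
  proof -
    have hm: "integrable torus (\<lambda>x. h x * wave (- m) x)"
      by (rule Bochner_Integration.integrable_bound[OF hi]) (use hi in \<open>auto simp: norm_mult\<close>)
    show ?thesis unfolding cfc_def left_diff_distrib
      by (rule mean_diff[OF integrable_cL2_mult[OF torus_L2_cx[OF f] cL2_wave] hm])
  qed
  ultimately have "AE x in torus. cx f x - h x = 0"
    using Bochner_Integration.integrable_diff[OF integrable_cL2[OF torus_L2_cx[OF f]] hi]
    by (intro fourier_uniqueness) (simp_all add: fourier_coeff_cfc)
  then have "AE x in torus. \<bar>f x\<bar> \<le> (\<Sum>\<^sub>\<infinity>n. cmod (?f n))"
  proof eventually_elim
    case (elim x)
    have "cmod (h x) \<le> (\<Sum>\<^sub>\<infinity>n. cmod (?f n * wave n x))"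
      unfolding h_def by (rule norm_infsum_bound) (simp add: norm_mult s)
    moreover have "cmod (h x) = \<bar>f x\<bar>" using elim by (metis eq_iff_diff_eq_0 norm_of_real)
    ultimately show ?case by (simp add: norm_mult)
  qed
  then show ?thesis ..
qed

text \<open>The bound is shaped for induction: the two new terms add at most
  \<open>4 / ((N + 1) * (N + 2))\<close>, a difference of consecutive values of
  \<open>4 / (N + 1)\<close>.\<close>

lemma sum_inverse_one_plus_square: "(\<Sum>k\<in>{- int N..int N}. 1 / (1 + (real_of_int k)\<^sup>2)) \<le> 7 - 4 / (real N + 1)"
proof (induction N)
  case (Suc N)
  have "{- int (Suc N)..int (Suc N)} = insert (- int (Suc N)) (insert (int (Suc N)) {- int N..int N})" by auto
  then have "(\<Sum>k\<in>{- int (Suc N)..int (Suc N)}. 1 / (1 + (real_of_int k)\<^sup>2))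
      = 2 / (1 + (real N + 1)\<^sup>2) + (\<Sum>k\<in>{- int N..int N}. 1 / (1 + (real_of_int k)\<^sup>2))"
  proof -
    have "(- 1 - real N)\<^sup>2 = (1 + real N)\<^sup>2" by (simp add: power2_eq_square algebra_simps)
    then show ?thesis using \<open>{- int (Suc N)..int (Suc N)} = _\<close> by (simp add: add.commute)
  qed
  also have "2 / (1 + (real N + 1)\<^sup>2) \<le> 4 / ((real N + 1) * (real N + 2))"
  proof -
    have "2 * ((real N + 1) * (real N + 2)) \<le> 4 * (1 + (real N + 1)\<^sup>2)" by (simp add: power2_eq_square algebra_simps)
    moreover have "0 < 1 + (real N + 1)\<^sup>2" "0 < (real N + 1) * (real N + 2)" by (auto simp: add_pos_nonneg)
    ultimately show ?thesis by (subst frac_le_eq) (auto simp: divide_le_0_iff algebra_simps)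
  qed
  also have "4 / ((real N + 1) * (real N + 2)) = 4 / (real N + 1) - 4 / (real N + 2)" by (simp add: field_simps)
  finally have "(\<Sum>k\<in>{- int (Suc N)..int (Suc N)}. 1 / (1 + (real_of_int k)\<^sup>2))
      \<le> 4 / (real N + 1) - 4 / (real N + 2) + (\<Sum>k\<in>{- int N..int N}. 1 / (1 + (real_of_int k)\<^sup>2))" by simp
  moreover have "4 / (real (Suc N) + 1) = 4 / (real N + 2)" by (simp add: add.commute)
  ultimately show ?case using Suc by linarith
qed simp

text \<open>\<open>(1 + lap n)\<^sup>2\<close> dominates the product of \<open>1 + k\<^sup>2\<close>
  over the two coordinates, so the double sum factorises.\<close>

lemma inverse_weight_summable: "(\<lambda>n. 1 / (1 + lap n)\<^sup>2) summable_on UNIV"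
proof (rule nonneg_bdd_above_summable_on)
  show "bdd_above (sum (\<lambda>n. 1 / (1 + lap n)\<^sup>2) ` {F. F \<subseteq> UNIV \<and> finite F})"
  proof (rule bdd_aboveI2)
    fix F :: "(int^2) set" assume "F \<in> {F. F \<subseteq> UNIV \<and> finite F}"
    then have F: "finite F" by simp
    let ?r = "\<lambda>k::int. 1 / (1 + (real_of_int k)\<^sup>2)"
    have r0: "?r k \<ge> 0" for k by (simp add: add_nonneg_nonneg)
    define N where "N = (\<Sum>n\<in>F. nat \<bar>n $ 1\<bar> + nat \<bar>n $ 2\<bar>)"
    have N: "n $ 1 \<in> {- int N..int N}" "n $ 2 \<in> {- int N..int N}" if "n \<in> F" for n
    proof -
      have "nat \<bar>n $ 1\<bar> + nat \<bar>n $ 2\<bar> \<le> N" unfolding N_def by (rule member_le_sum) (use F that in auto)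
      then show "n $ 1 \<in> {- int N..int N}" "n $ 2 \<in> {- int N..int N}" by auto
    qed
    have inj: "inj_on (\<lambda>n::int^2. (n $ 1, n $ 2)) F" by (rule inj_onI) (simp add: vec_eq_iff forall_2)
    have "(\<Sum>n\<in>F. 1 / (1 + lap n)\<^sup>2) \<le> (\<Sum>n\<in>F. ?r (n $ 1) * ?r (n $ 2))"
    proof (rule sum_mono)
      fix n :: "int^2"
      let ?a = "(real_of_int (n $ 1))\<^sup>2" and ?b = "(real_of_int (n $ 2))\<^sup>2"
      have "(1 + ?a) * (1 + ?b) \<le> (1 + lap n) * (1 + lap n)"
        unfolding lap_def UNIV_2 by (intro mult_mono) auto
      moreover have "0 < (1 + ?a) * (1 + ?b)" by (intro mult_pos_pos) (auto simp: add_pos_nonneg)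
      ultimately have "1 / ((1 + lap n) * (1 + lap n)) \<le> 1 / ((1 + ?a) * (1 + ?b))" by (intro divide_left_mono) auto
      then show "1 / (1 + lap n)\<^sup>2 \<le> ?r (n $ 1) * ?r (n $ 2)" by (simp add: power2_eq_square)
    qed
    also have "\<dots> = (\<Sum>(p, q)\<in>(\<lambda>n. (n $ 1, n $ 2)) ` F. ?r p * ?r q)"
      by (subst sum.reindex[OF inj]) simp
    also have "\<dots> \<le> (\<Sum>(p, q)\<in>{- int N..int N} \<times> {- int N..int N}. ?r p * ?r q)"
      using N r0 by (intro sum_mono2) (auto intro!: mult_nonneg_nonneg)
    also have "\<dots> = (\<Sum>p\<in>{- int N..int N}. ?r p) * (\<Sum>q\<in>{- int N..int N}. ?r q)"
      by (simp add: sum_product sum.cartesian_product)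
    also have "\<dots> \<le> 7 * 7"
    proof -
      have "(\<Sum>p\<in>{- int N..int N}. ?r p) \<le> 7" using sum_inverse_one_plus_square[of N] by (rule order_trans) simp
      moreover have "0 \<le> (\<Sum>p\<in>{- int N..int N}. ?r p)" using r0 by (intro sum_nonneg)
      ultimately show ?thesis by (intro mult_mono) auto
    qed
    finally show "(\<Sum>n\<in>F. 1 / (1 + lap n)\<^sup>2) \<le> 7 * 7" .
  qed
qed simp

text \<open>Young's inequality bounds a coefficient by its weighted square plus the inverse weight,
  and in dimension two both are summable, which gives absolute convergence.\<close>

lemma sobolev_bounded:
  assumes f: "f \<in> sobolev s" and s: "s \<ge> 2"
  shows "\<exists>K. AE x in torus. \<bar>f x\<bar> \<le> K"
proof (rule absolutely_convergent_bounded)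
  show "f \<in> torus_L2" using f by (simp add: sobolev_def)
  show "(\<lambda>n. cmod (fourier_coeff f n)) summable_on UNIV"
  proof (rule summable_on_comparison_test)
    show "(\<lambda>n. sobolev_weight s n * (cmod (fourier_coeff f n))\<^sup>2 + 1 / (1 + lap n)\<^sup>2) summable_on UNIV"
      using f inverse_weight_summable by (intro summable_on_add) (auto simp: sobolev_def)
    fix n
    let ?c = "cmod (fourier_coeff f n)" and ?W = "(1 + lap n)\<^sup>2"
    have "1 + lap n > 0" by (simp add: add_pos_nonneg)
    then have W: "?W > 0" by (rule zero_less_power)
    have "?W \<le> sobolev_weight s n"
      unfolding sobolev_weight_lap using s by (intro power_increasing) auto
    then have 1: "?W * ?c\<^sup>2 \<le> sobolev_weight s n * ?c\<^sup>2" by (rule mult_right_mono) simp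
    have "0 \<le> (?W * ?c - 1)\<^sup>2 + ?W * ?c" using W by simp
    then have "?W * ?c \<le> ?W * (?W * ?c\<^sup>2 + 1 / ?W)" using W by (simp add: power2_eq_square algebra_simps)
    then have "?c \<le> ?W * ?c\<^sup>2 + 1 / ?W" using W by (simp only: mult_le_cancel_left_pos)
    with 1 show "?c \<le> sobolev_weight s n * ?c\<^sup>2 + 1 / ?W" by linarith
  qed simp
qed

lemma sobolev_diff:
  assumes "f \<in> sobolev s" "h \<in> sobolev s" shows "(\<lambda>x. f x - h x) \<in> sobolev s"
proof -
  have L: "f \<in> torus_L2" "h \<in> torus_L2" using assms by (auto simp: sobolev_def)
  have "(\<lambda>n. sobolev_weight s n * (cmod (fourier_coeff (\<lambda>x. f x - h x) n))\<^sup>2) summable_on UNIV"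
  proof (rule summable_on_comparison_test)
    show "(\<lambda>n. 2 * (sobolev_weight s n * (cmod (fourier_coeff f n))\<^sup>2) + 2 * (sobolev_weight s n * (cmod (fourier_coeff h n))\<^sup>2)) summable_on UNIV"
      using assms by (intro summable_on_add summable_on_cmult_right) (auto simp: sobolev_def)
    fix n
    have "(cmod (fourier_coeff f n - fourier_coeff h n))\<^sup>2 \<le> (cmod (fourier_coeff f n) + cmod (fourier_coeff h n))\<^sup>2"
      by (rule power_mono[OF norm_triangle_ineq4 norm_ge_zero])
    also have "\<dots> \<le> 2 * (cmod (fourier_coeff f n))\<^sup>2 + 2 * (cmod (fourier_coeff h n))\<^sup>2"
      using zero_le_power2[of "cmod (fourier_coeff f n) - cmod (fourier_coeff h n)"] by (simp add: power2_eq_square algebra_simps)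
    finally have "sobolev_weight s n * (cmod (fourier_coeff f n - fourier_coeff h n))\<^sup>2
        \<le> sobolev_weight s n * (2 * (cmod (fourier_coeff f n))\<^sup>2 + 2 * (cmod (fourier_coeff h n))\<^sup>2)"
      by (rule mult_left_mono[OF _ sobolev_weight_nonneg])
    then show "sobolev_weight s n * (cmod (fourier_coeff (\<lambda>x. f x - h x) n))\<^sup>2
        \<le> 2 * (sobolev_weight s n * (cmod (fourier_coeff f n))\<^sup>2) + 2 * (sobolev_weight s n * (cmod (fourier_coeff h n))\<^sup>2)"
      unfolding fourier_coeff_diff[OF L] by (simp add: algebra_simps)
  qed (simp add: sobolev_weight_nonneg)
  then show ?thesis using torus_L2_diff[OF L] by (simp add: sobolev_def)
qed

lemma sobolev_norm_bound:
  assumes f: "f \<in> sobolev s" and F: "finite F"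
  shows "L2_set (\<lambda>n. cmod (fourier_coeff f n)) F \<le> sobolev_norm s f"
proof -
  have "(\<Sum>n\<in>F. (cmod (fourier_coeff f n))\<^sup>2) \<le> (\<Sum>n\<in>F. sobolev_weight s n * (cmod (fourier_coeff f n))\<^sup>2)"
  proof (rule sum_mono)
    fix n
    have "1 \<le> sobolev_weight s n" by (simp add: sobolev_weight_lap one_le_power)
    from mult_right_mono[OF this, of "(cmod (fourier_coeff f n))\<^sup>2"]
    show "(cmod (fourier_coeff f n))\<^sup>2 \<le> sobolev_weight s n * (cmod (fourier_coeff f n))\<^sup>2" by simp
  qed
  also have "\<dots> \<le> (\<Sum>\<^sub>\<infinity>n. sobolev_weight s n * (cmod (fourier_coeff f n))\<^sup>2)"
    using f F by (intro finite_sum_le_infsum) (auto simp: sobolev_def sobolev_weight_nonneg)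
  finally show ?thesis unfolding L2_set_def sobolev_norm_def by (rule real_sqrt_le_mono)
qed

lemma sobolev_norm_coeff: "f \<in> sobolev s \<Longrightarrow> cmod (fourier_coeff f n) \<le> sobolev_norm s f"
  using sobolev_norm_bound[of f s "{n}"] by simp

lemma L2_norm_le_sobolev:
  assumes f: "f \<in> sobolev s" shows "L2_norm_torus f \<le> 2 * pi * sobolev_norm s f"
proof -
  have L: "f \<in> torus_L2" using f by (simp add: sobolev_def)
  have "msq (cx f) \<le> (\<Sum>\<^sub>\<infinity>n. sobolev_weight s n * (cmod (fourier_coeff f n))\<^sup>2)"
  proof (rule has_sum_mono[OF Parseval_real[OF L] has_sum_infsum])
    show "(\<lambda>n. sobolev_weight s n * (cmod (fourier_coeff f n))\<^sup>2) summable_on UNIV" using f by (simp add: sobolev_def)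
    fix n
    have "1 \<le> sobolev_weight s n" by (simp add: sobolev_weight_lap one_le_power)
    from mult_right_mono[OF this, of "(cmod (fourier_coeff f n))\<^sup>2"]
    show "(cmod (fourier_coeff f n))\<^sup>2 \<le> sobolev_weight s n * (cmod (fourier_coeff f n))\<^sup>2" by simp
  qed
  then show ?thesis unfolding L2_norm_msq sobolev_norm_def by (intro mult_left_mono real_sqrt_le_mono) auto
qed

lemma continuous_into_sobolev_imp_L2:
  assumes "continuous_into_sobolev s \<tau> h" shows "continuous_into_L2 \<tau> h"
  unfolding continuous_into_L2_def
proof (intro ballI conjI)
  have S: "h r \<in> sobolev s" if "r \<in> {0..\<tau>}" for r using assms that by (simp add: continuous_into_sobolev_def)
  fix t assume t: "t \<in> {0..\<tau>}"
  then show "h t \<in> torus_L2" using S by (simp add: sobolev_def)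
  have "((\<lambda>r. 2 * pi * sobolev_norm s (\<lambda>x. h r x - h t x)) \<longlongrightarrow> 2 * pi * 0) (at t within {0..\<tau>})"
    using assms t by (intro tendsto_intros) (simp add: continuous_into_sobolev_def)
  then have lim: "((\<lambda>r. 2 * pi * sobolev_norm s (\<lambda>x. h r x - h t x)) \<longlongrightarrow> 0) (at t within {0..\<tau>})" by simp
  show "((\<lambda>r. L2_norm_torus (\<lambda>x. h r x - h t x)) \<longlongrightarrow> 0) (at t within {0..\<tau>})"
  proof (rule Lim_null_comparison[OF _ lim])
    show "\<forall>\<^sub>F r in at t within {0..\<tau>}. norm (L2_norm_torus (\<lambda>x. h r x - h t x)) \<le> 2 * pi * sobolev_norm s (\<lambda>x. h r x - h t x)"
      unfolding eventually_at_filter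
    proof (intro always_eventually allI impI)
      fix r assume r: "r \<in> {0..\<tau>}"
      have "L2_norm_torus (\<lambda>x. h r x - h t x) \<ge> 0" by (simp add: L2_norm_msq)
      then show "norm (L2_norm_torus (\<lambda>x. h r x - h t x)) \<le> 2 * pi * sobolev_norm s (\<lambda>x. h r x - h t x)"
        using L2_norm_le_sobolev[OF sobolev_diff[OF S[OF r] S[OF t]]] by simp
    qed
  qed
qed

section \<open>Absolutely continuous functions of time and Gronwall's inequality\<close>

lemma strongly_measurable_coeff:
  assumes "strongly_measurable_sobolev s \<tau> h"
  shows "(\<lambda>r. fourier_coeff (h r) n) \<in> borel_measurable (lebesgue_on {0..\<tau>})"
    "AE r in lebesgue_on {0..\<tau>}. h r \<in> sobolev s"
proof -
  let ?M = "lebesgue_on {0..\<tau>}"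
  obtain S where S: "\<And>m. finite (S m ` {0..\<tau>})" "\<And>m. S m ` {0..\<tau>} \<subseteq> sobolev s"
      "\<And>m u. {t \<in> {0..\<tau>}. S m t = u} \<in> sets lebesgue"
    and AE: "AE t in ?M. h t \<in> sobolev s \<and> (\<lambda>m. sobolev_norm s (\<lambda>x. h t x - S m t x)) \<longlonglongrightarrow> 0"
    using assms unfolding strongly_measurable_sobolev_def by blast
  show "AE r in ?M. h r \<in> sobolev s" using AE by eventually_elim simp
  let ?c = "\<lambda>m r. fourier_coeff (S m r) n"
  have m: "?c m \<in> borel_measurable ?M" for m
  proof (rule measurableI)
    fix U :: "complex set"
    have "?c m -` U \<inter> {0..\<tau>} = (\<Union>u\<in>{u \<in> S m ` {0..\<tau>}. fourier_coeff u n \<in> U}. {t \<in> {0..\<tau>}. S m t = u})" by auto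
    also have "\<dots> \<in> sets lebesgue"
      using S(1)[of m] S(3) by (intro sets.finite_UN) auto
    finally show "?c m -` U \<inter> space ?M \<in> sets ?M" by (simp add: sets_restrict_space_iff)
  qed simp
  have lm: "(\<lambda>r. lim (\<lambda>m. ?c m r)) \<in> borel_measurable ?M" by (rule borel_measurable_lim_metric[OF m])
  have "AE r in ?M. r \<in> {0..\<tau>}" by (rule AE_I2) simp
  with AE have eq: "AE r in ?M. lim (\<lambda>m. ?c m r) = fourier_coeff (h r) n"
  proof eventually_elim
    case (elim r)
    then have hr: "h r \<in> sobolev s" and Sr: "S m r \<in> sobolev s" for m using S(2)[of m] by auto
    have "(\<lambda>m. ?c m r) \<longlonglongrightarrow> fourier_coeff (h r) n"
    proof (rule Lim_null[THEN iffD2], rule Lim_null_comparison)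
      show "(\<lambda>m. sobolev_norm s (\<lambda>x. h r x - S m r x)) \<longlonglongrightarrow> 0" using elim by simp
      show "\<forall>\<^sub>F m in sequentially. norm (?c m r - fourier_coeff (h r) n) \<le> sobolev_norm s (\<lambda>x. h r x - S m r x)"
      proof (intro always_eventually allI)
        fix m
        have "cmod (fourier_coeff (\<lambda>x. h r x - S m r x) n) \<le> sobolev_norm s (\<lambda>x. h r x - S m r x)"
          by (rule sobolev_norm_coeff[OF sobolev_diff[OF hr Sr]])
        then show "norm (?c m r - fourier_coeff (h r) n) \<le> sobolev_norm s (\<lambda>x. h r x - S m r x)"
          using hr Sr[of m] by (subst (asm) fourier_coeff_diff) (auto simp: sobolev_def norm_minus_commute)
      qed
    qed
    then show ?case by (rule limI)
  qed
  show "(\<lambda>r. fourier_coeff (h r) n) \<in> borel_measurable ?M"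
    by (rule borel_measurable_lebesgue_on_AE[OF lm _ eq]) simp
qed

lemma measurable_id_lebesgue_on: "(\<lambda>x::real. x) \<in> borel_measurable (lebesgue_on S)"
  by (intro measurable_restrict_space1 measurable_completion) simp

lemma integral_lebesgue_on_sub:
  fixes z :: "real \<Rightarrow> complex"
  assumes "r \<in> {0..t}"
  shows "(\<integral>s. z s \<partial>lebesgue_on {0..r}) = (\<integral>s. (if s \<le> r then z s else 0) \<partial>lebesgue_on {0..t})"
  by (subst (1 2) integral_restrict_space) (use assms in \<open>auto intro!: Bochner_Integration.integral_cong simp: indicator_def\<close>)

text \<open>The product rule for absolutely continuous functions: the square of the integral is split along
  the diagonal of \<open>[0,t]\<^sup>2\<close>.\<close>

lemma square_integral:
  fixes z :: "real \<Rightarrow> complex"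
  assumes t: "0 \<le> t" and z: "integrable (lebesgue_on {0..t}) z"
  defines "W \<equiv> \<lambda>r. \<integral>s. z s \<partial>lebesgue_on {0..r}"
  shows "integrable (lebesgue_on {0..t}) (\<lambda>r. 2 * Re (cnj (W r) * z r))"
    "(cmod (W t))\<^sup>2 = (\<integral>r. 2 * Re (cnj (W r) * z r) \<partial>lebesgue_on {0..t})"
proof -
  define M where "M = lebesgue_on {0..t}"
  interpret M: finite_measure M unfolding M_def by (rule finite_measure_lebesgue_on) simp
  interpret P: pair_sigma_finite M M by standard
  have spM: "space M = {0..t}" by (simp add: M_def)
  have zM: "integrable M z" using z by (simp add: M_def)
  have zm: "z \<in> borel_measurable M" using zM by auto
  have idm: "(\<lambda>x::real. x) \<in> borel_measurable M" unfolding M_def by (rule measurable_id_lebesgue_on)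
  have m1: "(\<lambda>p. z (fst p)) \<in> borel_measurable (M \<Otimes>\<^sub>M M)" "(\<lambda>p. z (snd p)) \<in> borel_measurable (M \<Otimes>\<^sub>M M)"
    using zm by measurable
  have m2: "(\<lambda>p. fst p) \<in> borel_measurable (M \<Otimes>\<^sub>M M)" "(\<lambda>p. snd p) \<in> borel_measurable (M \<Otimes>\<^sub>M M)"
    using measurable_compose[OF measurable_fst idm] measurable_compose[OF measurable_snd idm] by auto
  have W: "W r = (\<integral>s. (if s \<le> r then z s else 0) \<partial>M)" if "r \<in> {0..t}" for r
    unfolding W_def M_def by (rule integral_lebesgue_on_sub[OF that])
  let ?N = "\<integral>s. cmod (z s) \<partial>M"
  have i1: "integrable M (\<lambda>s. (if s \<le> r then z s else 0))" "integrable M (\<lambda>s. (if r \<le> s then z s else 0))" for r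
    by (rule Bochner_Integration.integrable_bound[OF zM]; use zm idm in measurable; auto)+
  \<comment> \<open>\<open>Q\<close> stands for either triangle; the integrand is dominated by
    \<open>cmod (z r) * cmod (z s)\<close>.\<close>
  have fub: "integrable (M \<Otimes>\<^sub>M M) (\<lambda>p. (if Q (fst p) (snd p) then z (fst p) * cnj (z (snd p)) else 0))"
    if Q: "{p \<in> space (M \<Otimes>\<^sub>M M). Q (fst p) (snd p)} \<in> sets (M \<Otimes>\<^sub>M M)" for Q
  proof (rule P.Fubini_integrable)
    let ?f = "\<lambda>p. (if Q (fst p) (snd p) then z (fst p) * cnj (z (snd p)) else 0)"
    have mf: "(\<lambda>p. z (fst p) * cnj (z (snd p))) \<in> borel_measurable (M \<Otimes>\<^sub>M M)"
      using m1 by (intro borel_measurable_times borel_measurable_continuous_on[of cnj]) (auto intro: continuous_intros)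
    show m: "?f \<in> borel_measurable (M \<Otimes>\<^sub>M M)"
      by (rule measurable_If[OF mf _ Q]) simp
    have mr: "(\<lambda>s. ?f (r, s)) \<in> borel_measurable M" if "r \<in> space M" for r
      using measurable_Pair2[OF m that] by simp
    have b: "norm (?f (r, s)) \<le> cmod (z r) * cmod (z s)" for r s by (simp add: norm_mult)
    have ir: "integrable M (\<lambda>s. ?f (r, s))" if "r \<in> space M" for r
    proof (rule Bochner_Integration.integrable_bound[OF _ mr[OF that]])
      show "integrable M (\<lambda>s. cmod (z r) * cmod (z s))" using zM by simp
      show "AE s in M. norm (?f (r, s)) \<le> norm (cmod (z r) * cmod (z s))" using b by (intro AE_I2) simp
    qed
    then show "AE r in M. integrable M (\<lambda>s. ?f (r, s))" by (rule AE_I2)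
    show "integrable M (\<lambda>r. \<integral>s. norm (?f (r, s)) \<partial>M)"
    proof (rule Bochner_Integration.integrable_bound)
      show "integrable M (\<lambda>r. cmod (z r) * ?N)" using zM by simp
      show "(\<lambda>r. \<integral>s. norm (?f (r, s)) \<partial>M) \<in> borel_measurable M"
        using measurable_compose[OF m borel_measurable_norm] by (intro M.borel_measurable_lebesgue_integral) (simp add: case_prod_beta' cong: if_cong)
      show "AE r in M. norm (\<integral>s. norm (?f (r, s)) \<partial>M) \<le> norm (cmod (z r) * ?N)"
      proof (rule AE_I2)
        fix r assume r: "r \<in> space M"
        have "(\<integral>s. norm (?f (r, s)) \<partial>M) \<le> (\<integral>s. cmod (z r) * cmod (z s) \<partial>M)"
          by (rule integral_mono) (use ir[OF r] zM b in auto)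
        then show "norm (\<integral>s. norm (?f (r, s)) \<partial>M) \<le> norm (cmod (z r) * ?N)" by simp
      qed
    qed
  qed
  have S1: "{p \<in> space (M \<Otimes>\<^sub>M M). snd p \<le> fst p} \<in> sets (M \<Otimes>\<^sub>M M)"
    and S2: "{p \<in> space (M \<Otimes>\<^sub>M M). fst p \<le> snd p} \<in> sets (M \<Otimes>\<^sub>M M)"
    using m2 by (auto intro: borel_measurable_le)
  \<comment> \<open>The triangles on either side of the diagonal. They integrate to the integral of
    \<open>z r * cnj (W r)\<close> and, in the other order of integration, to its conjugate.\<close>
  let ?A = "\<lambda>r s. (if s \<le> r then z r * cnj (z s) else 0)"
  let ?B = "\<lambda>r s. (if r \<le> s then z r * cnj (z s) else 0)"
  have iA: "integrable (M \<Otimes>\<^sub>M M) (\<lambda>(r, s). ?A r s)" and iB: "integrable (M \<Otimes>\<^sub>M M) (\<lambda>(r, s). ?B r s)"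
    using fub[OF S1] fub[OF S2] by (simp_all add: case_prod_beta')
  have inA: "(\<integral>s. ?A r s \<partial>M) = z r * cnj (W r)" if "r \<in> {0..t}" for r
  proof -
    have "(\<integral>s. ?A r s \<partial>M) = (\<integral>s. z r * cnj (if s \<le> r then z s else 0) \<partial>M)"
      by (rule Bochner_Integration.integral_cong) auto
    also have "\<dots> = z r * cnj (\<integral>s. (if s \<le> r then z s else 0) \<partial>M)" by (simp only: integral_mult_right_zero Bochner_Integration.integral_cnj)
    finally show ?thesis unfolding W[OF that] .
  qed
  have inB: "(\<integral>r. ?B r s \<partial>M) = cnj (z s) * W s" if "s \<in> {0..t}" for s
  proof -
    have "(\<integral>r. ?B r s \<partial>M) = (\<integral>r. cnj (z s) * (if r \<le> s then z r else 0) \<partial>M)"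
      by (rule Bochner_Integration.integral_cong) auto
    also have "\<dots> = cnj (z s) * (\<integral>r. (if r \<le> s then z r else 0) \<partial>M)" by (rule integral_mult_right_zero)
    finally show ?thesis unfolding W[OF that] .
  qed
  have iW: "integrable M (\<lambda>r. z r * cnj (W r))"
  proof -
    have "integrable M (\<lambda>r. \<integral>s. ?A r s \<partial>M)" using P.integrable_fst[OF iA] by simp
    moreover have "integrable M (\<lambda>r. \<integral>s. ?A r s \<partial>M) = integrable M (\<lambda>r. z r * cnj (W r))"
      by (rule Bochner_Integration.integrable_cong[OF refl]) (simp add: inA spM)
    ultimately show ?thesis by simp
  qed
  have "integrable M (\<lambda>r. 2 * Re (z r * cnj (W r)))" by (rule integrable_mult_right) (rule integrable_Re[OF iW])
  then show "integrable (lebesgue_on {0..t}) (\<lambda>r. 2 * Re (cnj (W r) * z r))" by (simp only: M_def mult.commute)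
  have A: "(\<integral>r. \<integral>s. ?A r s \<partial>M \<partial>M) = (\<integral>r. z r * cnj (W r) \<partial>M)"
    by (rule Bochner_Integration.integral_cong) (auto simp: inA spM)
  have B: "(\<integral>r. \<integral>s. ?B r s \<partial>M \<partial>M) = cnj (\<integral>r. z r * cnj (W r) \<partial>M)"
  proof -
    have "(\<integral>r. \<integral>s. ?B r s \<partial>M \<partial>M) = (\<integral>s. \<integral>r. ?B r s \<partial>M \<partial>M)"
      by (rule P.Fubini_integral[OF iB, symmetric])
    also have "\<dots> = (\<integral>s. cnj (z s * cnj (W s)) \<partial>M)"
      by (rule Bochner_Integration.integral_cong) (auto simp: inB spM)
    finally show ?thesis by (simp only: Bochner_Integration.integral_cnj)
  qed
  have "(\<integral>r. \<integral>s. ?A r s \<partial>M \<partial>M) + (\<integral>r. \<integral>s. ?B r s \<partial>M \<partial>M) = (\<integral>r. z r * cnj (W t) \<partial>M)"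
  proof -
    have "(\<integral>r. \<integral>s. ?A r s \<partial>M \<partial>M) + (\<integral>r. \<integral>s. ?B r s \<partial>M \<partial>M) = (\<integral>r. (\<integral>s. ?A r s \<partial>M) + (\<integral>s. ?B r s \<partial>M) \<partial>M)"
      using P.integrable_fst[OF iA] P.integrable_fst[OF iB] by simp
    also have "\<dots> = (\<integral>r. z r * cnj (W t) \<partial>M)"
    proof (rule Bochner_Integration.integral_cong[OF refl])
      fix r assume "r \<in> space M"
      then have r: "r \<in> {0..t}" by (simp add: spM)
      have "(\<integral>s. ?A r s \<partial>M) + (\<integral>s. ?B r s \<partial>M) = z r * cnj (\<integral>s. (if s \<le> r then z s else 0) \<partial>M) + z r * cnj (\<integral>s. (if r \<le> s then z s else 0) \<partial>M)"
      proof -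
        have "(\<integral>s. ?B r s \<partial>M) = (\<integral>s. z r * cnj (if r \<le> s then z s else 0) \<partial>M)"
          by (rule Bochner_Integration.integral_cong) auto
        then show ?thesis unfolding inA[OF r] W[OF r] by (simp only: integral_mult_right_zero Bochner_Integration.integral_cnj)
      qed
      also have "\<dots> = z r * cnj ((\<integral>s. (if s \<le> r then z s else 0) \<partial>M) + (\<integral>s. (if r \<le> s then z s else 0) \<partial>M))"
        by (simp add: distrib_left)
      also have "(\<integral>s. (if s \<le> r then z s else 0) \<partial>M) + (\<integral>s. (if r \<le> s then z s else 0) \<partial>M)
          = (\<integral>s. (if s \<le> r then z s else 0) + (if r \<le> s then z s else 0) \<partial>M)" using i1 by simp
      \<comment> \<open>Both triangles contain the diagonal, which meets each section in a single
        point.\<close>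
      also have "\<dots> = (\<integral>s. z s \<partial>M)"
      proof (rule integral_cong_AE)
        have "AE s in lebesgue. s \<notin> {r}" by (intro AE_not_in) (simp add: negligible_iff_null_sets[symmetric])
        then have "AE s in M. s \<noteq> r" unfolding M_def by (subst AE_restrict_space_iff) (auto elim!: eventually_mono)
        then show "AE s in M. (if s \<le> r then z s else 0) + (if r \<le> s then z s else 0) = z s" by eventually_elim auto
      qed (use i1 zm in auto)
      also have "\<dots> = W t" using t by (simp add: W_def M_def)
      finally show "(\<integral>s. ?A r s \<partial>M) + (\<integral>s. ?B r s \<partial>M) = z r * cnj (W t)" .
    qed
    finally show ?thesis .
  qed
  also have "\<dots> = W t * cnj (W t)"
    using t by (simp add: W_def M_def)
  finally have "(\<integral>r. z r * cnj (W r) \<partial>M) + cnj (\<integral>r. z r * cnj (W r) \<partial>M) = W t * cnj (W t)" unfolding A B .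
  then have "Re ((\<integral>r. z r * cnj (W r) \<partial>M) + cnj (\<integral>r. z r * cnj (W r) \<partial>M)) = Re (W t * cnj (W t))" by (rule arg_cong)
  moreover have "Re (W t * cnj (W t)) = (cmod (W t))\<^sup>2" using Re_cnj_mult[of "W t"] by (simp only: mult.commute)
  ultimately have "(cmod (W t))\<^sup>2 = 2 * Re (\<integral>r. z r * cnj (W r) \<partial>M)" by simp
  also have "\<dots> = (\<integral>r. 2 * Re (z r * cnj (W r)) \<partial>M)" by (simp only: integral_mult_right_zero integral_Re[OF iW])
  finally show "(cmod (W t))\<^sup>2 = (\<integral>r. 2 * Re (cnj (W r) * z r) \<partial>lebesgue_on {0..t})" by (simp only: M_def mult.commute)
qed

text \<open>\<open>exp (- C * t)\<close> times the integral of \<open>y\<close> has nonpositive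
  derivative and starts at 0, so the integral is not positive, and the hypothesis then forces
  \<open>y\<close> to vanish.\<close>

lemma gronwall_zero:
  fixes y :: "real \<Rightarrow> real"
  assumes y: "continuous_on {0..\<tau>} y" and y0: "\<And>t. t \<in> {0..\<tau>} \<Longrightarrow> 0 \<le> y t"
    and le: "\<And>t. t \<in> {0..\<tau>} \<Longrightarrow> y t \<le> C * integral {0..t} y" and C: "C \<ge> 0" and t: "t \<in> {0..\<tau>}"
  shows "y t = 0"
proof -
  define E where "E t = exp (- C * t) * integral {0..t} y" for t
  have E: "(E has_real_derivative (exp (- C * s) * y s + (- C * exp (- C * s)) * integral {0..s} y)) (at s within {0..\<tau>})"
    if s: "s \<in> {0..\<tau>}" for s
  proof -
    have 1: "((\<lambda>u. integral {0..u} y) has_real_derivative y s) (at s within {0..\<tau>})"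
      using integral_has_vector_derivative[OF y s] by (simp add: has_real_derivative_iff_has_vector_derivative)
    have 2: "((\<lambda>t. exp (- C * t)) has_real_derivative - C * exp (- C * s)) (at s within {0..\<tau>})"
      by (auto intro!: derivative_eq_intros)
    from DERIV_mult[OF 2 1] show ?thesis unfolding E_def[abs_def] by (simp add: algebra_simps)
  qed
  have "\<exists>s\<in>{0..t}. E t - E 0 = (\<lambda>h. h * (exp (- C * s) * y s + (- C * exp (- C * s)) * integral {0..s} y)) (t - 0)"
  proof (rule mvt_very_simple)
    fix s assume s: "0 \<le> s" "s \<le> t"
    have "(E has_real_derivative (exp (- C * s) * y s + (- C * exp (- C * s)) * integral {0..s} y)) (at s within {0..t})"
      by (rule DERIV_subset[OF E]) (use s t in auto)
    then show "(E has_derivative (\<lambda>h. h * (exp (- C * s) * y s + (- C * exp (- C * s)) * integral {0..s} y))) (at s within {0..t})"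
      by (simp add: has_field_derivative_def mult.commute[of "exp (- C * s) * y s + (- C * exp (- C * s)) * integral {0..s} y"] mult_commute_abs)
  qed (use t in auto)
  then obtain s where s: "s \<in> {0..t}" "E t - E 0 = t * (exp (- C * s) * y s + (- C * exp (- C * s)) * integral {0..s} y)" by auto
  have "exp (- C * s) * y s + (- C * exp (- C * s)) * integral {0..s} y = exp (- C * s) * (y s - C * integral {0..s} y)"
    by (simp add: algebra_simps)
  also have "\<dots> \<le> 0" using le[of s] s(1) t by (intro mult_nonneg_nonpos) auto
  finally have "t * (exp (- C * s) * y s + (- C * exp (- C * s)) * integral {0..s} y) \<le> 0"
    using t by (intro mult_nonneg_nonpos) auto
  then have "E t \<le> E 0" using s(2) by linarith
  then have "exp (- C * t) * integral {0..t} y \<le> 0" by (simp add: E_def)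
  then have "integral {0..t} y \<le> 0" by (simp add: mult_le_0_iff)
  then have "C * integral {0..t} y \<le> 0" using C by (intro mult_nonneg_nonpos)
  then show ?thesis using le[OF t] y0[OF t] by linarith
qed

lemma AE_lebesgue_on_initial:
  assumes "AE r in lebesgue_on {0..\<tau>::real}. P r" "t \<in> {0..\<tau>}" shows "AE r in lebesgue_on {0..t}. P r"
proof -
  have "AE r in lebesgue. r \<in> {0..\<tau>} \<longrightarrow> P r" using assms(1) by (subst (asm) AE_restrict_space_iff) auto
  then show ?thesis using assms(2) by (subst AE_restrict_space_iff) (auto elim!: eventually_mono)
qed

text \<open>The derivative of a squared norm is twice the inner product with the derivative, here
  for a derivative that is merely integrable in time. Mode by mode this is
  \<open>square_integral\<close>, and Cauchy-Schwarz over the modes yields a multiple of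
  \<open>sqrt D * N\<close> as dominating function. The majorant \<open>N\<close> is free so that
  the norms of two functions may be added up to stand for that of their difference.\<close>

lemma msq_absolutely_continuous:
  fixes \<tau> :: real
  assumes \<tau>: "0 \<le> \<tau>" and w: "\<And>t. t \<in> {0..\<tau>} \<Longrightarrow> w t \<in> torus_L2" "\<And>t. t \<in> {0..\<tau>} \<Longrightarrow> msq (cx (w t)) \<le> D"
    and w': "AE r in lebesgue_on {0..\<tau>}. w' r \<in> torus_L2"
    and z: "\<And>n. integrable (lebesgue_on {0..\<tau>}) (\<lambda>r. fourier_coeff (w' r) n)"
    and N: "integrable (lebesgue_on {0..\<tau>}) N"
      "AE r in lebesgue_on {0..\<tau>}. \<forall>F. finite F \<longrightarrow> L2_set (\<lambda>n. cmod (fourier_coeff (w' r) n)) F \<le> N r"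
    and coeff: "\<And>t n. t \<in> {0..\<tau>} \<Longrightarrow> fourier_coeff (w t) n = (\<integral>r. fourier_coeff (w' r) n \<partial>lebesgue_on {0..t})"
  shows "integrable (lebesgue_on {0..\<tau>}) (\<lambda>r. 2 * ((\<integral>x. w r x * w' r x \<partial>torus) / (2*pi)\<^sup>2))"
    and "t \<in> {0..\<tau>} \<Longrightarrow> msq (cx (w t)) = (\<integral>r. 2 * ((\<integral>x. w r x * w' r x \<partial>torus) / (2*pi)\<^sup>2) \<partial>lebesgue_on {0..t})"
proof -
  let ?E = "\<lambda>r. 2 * ((\<integral>x. w r x * w' r x \<partial>torus) / (2*pi)\<^sup>2)"
  define f where "f n r = 2 * Re (cnj (fourier_coeff (w r) n) * fourier_coeff (w' r) n)" for n r
  have main: "integrable (lebesgue_on {0..t}) ?E \<and> msq (cx (w t)) = (\<integral>r. ?E r \<partial>lebesgue_on {0..t})" if t: "t \<in> {0..\<tau>}" for t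
  proof -
    let ?M = "lebesgue_on {0..t}"
    have sub: "integrable ?M h" if "integrable (lebesgue_on {0..\<tau>}) h" for h :: "real \<Rightarrow> 'z::euclidean_space"
      by (rule integrable_subinterval[OF that]) (use t in auto)
    have f: "integrable ?M (f n)" "(cmod (fourier_coeff (w t) n))\<^sup>2 = (\<integral>r. f n r \<partial>?M)" for n
    proof -
      have t0: "0 \<le> t" using t by simp
      note sq = square_integral[OF t0 sub[OF z[of n]]]
      have c: "2 * Re (cnj (\<integral>s. fourier_coeff (w' s) n \<partial>lebesgue_on {0..r}) * fourier_coeff (w' r) n) = f n r" if "r \<in> space ?M" for r
        using coeff[of r n] that t by (simp add: f_def)
      show "integrable ?M (f n)"
        using sq(1) Bochner_Integration.integrable_cong[OF refl c] by (rule iffD1[rotated])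
      show "(cmod (fourier_coeff (w t) n))\<^sup>2 = (\<integral>r. f n r \<partial>?M)"
        using sq(2) Bochner_Integration.integral_cong[OF refl c] unfolding coeff[OF t] by (rule trans)
    qed
    have Ni: "integrable ?M N" by (rule sub[OF N(1)])
    have "(\<Sum>n\<in>F. \<integral>r. norm (f n r) \<partial>?M) \<le> (\<integral>r. 2 * (sqrt D * N r) \<partial>?M)" if F: "finite F" for F
    proof -
      have "(\<Sum>n\<in>F. \<integral>r. norm (f n r) \<partial>?M) = (\<integral>r. (\<Sum>n\<in>F. norm (f n r)) \<partial>?M)"
        by (rule Bochner_Integration.integral_sum[symmetric]) (rule integrable_norm[OF f(1)])
      also have "\<dots> \<le> (\<integral>r. 2 * (sqrt D * N r) \<partial>?M)"
      proof (rule integral_mono_AE)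
        show "integrable ?M (\<lambda>r. \<Sum>n\<in>F. norm (f n r))"
          by (rule Bochner_Integration.integrable_sum) (rule integrable_norm[OF f(1)])
        show "integrable ?M (\<lambda>r. 2 * (sqrt D * N r))" using Ni by simp
        have "AE r in ?M. r \<in> {0..t}" by (rule AE_I2) simp
        with AE_lebesgue_on_initial[OF N(2) t]
        show "AE r in ?M. (\<Sum>n\<in>F. norm (f n r)) \<le> 2 * (sqrt D * N r)"
        proof eventually_elim
          case (elim r)
          then have r: "r \<in> {0..\<tau>}" using t by auto
          have "norm (f n r) \<le> 2 * (\<bar>cmod (fourier_coeff (w r) n)\<bar> * \<bar>cmod (fourier_coeff (w' r) n)\<bar>)" for n
            unfolding f_def using abs_Re_le_cmod[of "cnj (fourier_coeff (w r) n) * fourier_coeff (w' r) n"]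
            by (simp add: norm_mult abs_mult)
          then have "(\<Sum>n\<in>F. norm (f n r)) \<le> 2 * (\<Sum>n\<in>F. \<bar>cmod (fourier_coeff (w r) n)\<bar> * \<bar>cmod (fourier_coeff (w' r) n)\<bar>)"
            unfolding sum_distrib_left by (rule sum_mono)
          also have "\<dots> \<le> 2 * (L2_set (\<lambda>n. cmod (fourier_coeff (w r) n)) F * L2_set (\<lambda>n. cmod (fourier_coeff (w' r) n)) F)"
            by (intro mult_left_mono L2_set_mult_ineq) simp
          also have "\<dots> \<le> 2 * (sqrt D * N r)"
          proof (intro mult_left_mono mult_mono)
            have "(\<Sum>n\<in>F. (cmod (fourier_coeff (w r) n))\<^sup>2) \<le> msq (cx (w r))"
              using Bessel_torus[OF torus_L2_cx[OF w(1)[OF r]] F] by (simp add: fourier_coeff_cfc)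
            also have "\<dots> \<le> D" by (rule w(2)[OF r])
            finally show "L2_set (\<lambda>n. cmod (fourier_coeff (w r) n)) F \<le> sqrt D" by (simp add: L2_set_def)
            have "0 \<le> D" using w(2)[OF r] msq_nonneg[of "cx (w r)"] by linarith
            then show "0 \<le> sqrt D" by simp
            show "L2_set (\<lambda>n. cmod (fourier_coeff (w' r) n)) F \<le> N r" using elim(1) F by blast
          qed (auto simp: L2_set_nonneg)
          finally show ?case .
        qed
      qed
      finally show ?thesis .
    qed
    then have "(\<lambda>n. \<integral>r. norm (f n r) \<partial>?M) summable_on UNIV"
      by (intro nonneg_bdd_above_summable_on) (auto intro!: bdd_aboveI2)
    note hs = has_sum_integral[OF _ f(1) this, simplified]
    have "((\<lambda>n. (cmod (fourier_coeff (w t) n))\<^sup>2) has_sum (\<integral>r. (\<Sum>\<^sub>\<infinity>n. f n r) \<partial>?M)) UNIV"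
      using hs(3) by (simp add: f(2))
    then have y: "msq (cx (w t)) = (\<integral>r. (\<Sum>\<^sub>\<infinity>n. f n r) \<partial>?M)"
      by (rule has_sum_unique[OF Parseval_real[OF w(1)[OF t]]])
    have "AE r in ?M. r \<in> {0..t}" by (rule AE_I2) simp
    with AE_lebesgue_on_initial[OF w' t] have E: "AE r in ?M. (\<Sum>\<^sub>\<infinity>n. f n r) = ?E r"
    proof eventually_elim
      case (elim r)
      then have r: "r \<in> {0..\<tau>}" using t by auto
      have "((\<lambda>n. 2 * Re (cfc (cx (w' r)) n * cnj (cfc (cx (w r)) n))) has_sum 2 * ((\<integral>x. w' r x * w r x \<partial>torus) / (2*pi)\<^sup>2)) UNIV"
        by (intro has_sum_cmult_right Parseval_inner_real torus_L2_cx elim(1) w(1)[OF r])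
      then have "((\<lambda>n. f n r) has_sum ?E r) UNIV"
        by (simp only: f_def fourier_coeff_cfc mult.commute)
      then show ?case by (rule infsumI)
    qed
    have m: "?E \<in> borel_measurable ?M"
      by (rule borel_measurable_lebesgue_on_AE[OF _ _ E]) (use hs(2) in auto)
    show ?thesis
      using hs(2) integrable_cong_AE[OF _ m E] integral_cong_AE[OF _ m E] y by auto
  qed
  show "integrable (lebesgue_on {0..\<tau>}) ?E" using main[of \<tau>] \<tau> by simp
  show "t \<in> {0..\<tau>} \<Longrightarrow> msq (cx (w t)) = (\<integral>r. ?E r \<partial>lebesgue_on {0..t})" using main by simp
qed

section \<open>Energy estimate for the difference to the shear flow\<close>

lemma divergence_coeff:
  assumes v: "\<And>i. weak_gradient (\<lambda>x. v x $ i) (\<lambda>x. Dv x $ i)" and tr: "AE x in torus. trace (Dv x) = 0"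
  shows "(\<Sum>j\<in>UNIV. of_int (n $ j) * fourier_coeff (\<lambda>x. v x $ j) n) = 0"
proof -
  have L: "cx (\<lambda>x. Dv x $ j $ j) \<in> cL2" for j using weak_gradient_coeff(1)[OF v[of j]] .
  have "(\<Sum>j\<in>UNIV. \<i> * of_int (n $ j) * fourier_coeff (\<lambda>x. v x $ j) n) = (\<Sum>j\<in>UNIV. cfc (cx (\<lambda>x. Dv x $ j $ j)) n)"
    by (rule sum.cong[OF refl]) (rule weak_gradient_coeff(2)[OF v, symmetric])
  also have "\<dots> = cfc (\<lambda>x. \<Sum>j\<in>UNIV. cx (\<lambda>x. Dv x $ j $ j) x) n" by (rule cfc_sum[OF L, symmetric])
  also have "\<dots> = cfc (\<lambda>x. 0) n"
  proof (rule cfc_AE_cong)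
    show "AE x in torus. (\<Sum>j\<in>UNIV. cx (\<lambda>x. Dv x $ j $ j) x) = 0"
      using tr by eventually_elim (simp add: trace_def flip: of_real_sum)
    show "(\<lambda>x. \<Sum>j\<in>UNIV. cx (\<lambda>x. Dv x $ j $ j) x) \<in> borel_measurable torus"
      using cL2_measurable[OF L] by (intro borel_measurable_sum)
  qed simp
  also have "\<dots> = 0" by (simp add: cfc_def mean_def)
  finally have "\<i> * (\<Sum>j\<in>UNIV. of_int (n $ j) * fourier_coeff (\<lambda>x. v x $ j) n) = 0"
    by (simp add: sum_distrib_left mult.assoc)
  then show ?thesis by simp
qed

lemma weak_gradient_diff:
  assumes "weak_gradient f F" "weak_gradient g G"
  shows "weak_gradient (\<lambda>x. f x - g x) (\<lambda>x. F x - G x)"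
  using assms unfolding weak_gradient_def
  by (auto simp: torus_L2_diff fourier_coeff_diff algebra_simps)

lemma flow_grad_bound:
  assumes "\<And>i. \<bar>a i t\<bar> \<le> A" shows "\<bar>flow_grad a t x $ k $ j\<bar> \<le> 2 * A"
proof -
  have p: "\<bar>real_of_int (perp i k)\<bar> \<le> 1" "\<bar>real_of_int (shift i $ j)\<bar> \<le> 1" for i by (auto simp: perp_def shift_def)
  have b: "\<bar>a i t * of_int (perp i k) * (of_int (shift i $ j) * cos (phase i x))\<bar> \<le> A" for i
  proof -
    have "\<bar>a i t * of_int (perp i k) * (of_int (shift i $ j) * cos (phase i x))\<bar> 
      = \<bar>a i t\<bar> * (\<bar>real_of_int (perp i k)\<bar> * (\<bar>real_of_int (shift i $ j)\<bar> * \<bar>cos (phase i x)\<bar>))" by (simp add: abs_mult)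
    also have "\<dots> \<le> A * (1 * (1 * 1))"
      using assms p order_trans[OF abs_ge_zero assms] by (intro mult_mono) auto
    finally show ?thesis by simp
  qed
  show ?thesis using b[of 1] b[of 2] by (simp add: flow_grad_def)
qed

text \<open>The nonlinear term of the energy estimate for the difference \<open>w\<close> to the flow \<open>V\<close>: the pressure and
  the transport of \<open>w\<close> drop out, and \<open>V\<close> is not advected by itself.\<close>

lemma euler_difference_estimate:
  assumes v: "\<And>i. weak_gradient (\<lambda>x. v x $ i) (\<lambda>x. Dv x $ i)" "AE x in torus. trace (Dv x) = 0"
    and vs: "\<And>i. (\<lambda>x. v x $ i) \<in> sobolev s" "s \<ge> 2"
    and v': "\<And>i. (\<lambda>x. v' x $ i) \<in> torus_L2" and p: "weak_gradient p Dp"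
    and eq: "AE x in torus. v' x + Dv x *v v x + Dp x = flow a' t x"
    and a: "a 1 t * a 2 t = 0" "\<And>i. \<bar>a i t\<bar> \<le> A"
  shows "(\<Sum>i\<in>UNIV. \<integral>x. (v x $ i - flow a t x $ i) * (v' x $ i - flow a' t x $ i) \<partial>torus)
    \<le> 4 * A * (\<Sum>i\<in>UNIV. \<integral>x. (v x $ i - flow a t x $ i)\<^sup>2 \<partial>torus)"
proof -
  define w where "w i x = v x $ i - flow a t x $ i" for i x
  define W' where "W' i x = v' x $ i - flow a' t x $ i" for i x
  define G where "G i x = Dv x $ i - flow_grad a t x $ i" for i x
  have vL: "(\<lambda>x. v x $ j) \<in> torus_L2" for j using v(1)[of j] by (simp add: weak_gradient_def)
  have wL: "w i \<in> torus_L2" for i unfolding w_def[abs_def] by (rule torus_L2_diff[OF vL flow_L2(1)])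
  have W'L: "W' i \<in> torus_L2" for i unfolding W'_def[abs_def] by (rule torus_L2_diff[OF v' flow_L2(1)])
  have DpL: "(\<lambda>x. Dp x $ i) \<in> torus_L2" for i using p by (simp add: weak_gradient_def)
  have wG: "weak_gradient (w i) (G i)" for i
    unfolding w_def[abs_def] G_def[abs_def] by (rule weak_gradient_diff[OF v(1) flow_weak_gradient])
  have wb: "\<exists>K. AE x in torus. \<bar>w i x\<bar> \<le> K" for i
    unfolding w_def[abs_def] by (rule sobolev_bounded[OF sobolev_diff[OF vs(1) flow_sobolev(1)] vs(2)])
  have div: "(\<Sum>j\<in>UNIV. of_int (n $ j) * fourier_coeff (\<lambda>x. v x $ j) n) = 0" for n
    by (rule divergence_coeff[OF v])
  have divV: "(\<Sum>j\<in>UNIV. of_int (n $ j) * fourier_coeff (\<lambda>x. flow a t x $ j) n) = 0" for n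
    by (rule divergence_coeff[OF flow_weak_gradient]) (simp add: trace_flow_grad)
  have tri: "integrable torus (\<lambda>x. w i x * G i x $ j * v x $ j)"
    "(\<Sum>j\<in>UNIV. \<integral>x. w i x * G i x $ j * v x $ j \<partial>torus) = 0" for i j
  proof -
    obtain K where K: "AE x in torus. \<bar>w i x\<bar> \<le> K" using wb by blast
    show "integrable torus (\<lambda>x. w i x * G i x $ j * v x $ j)"
      "(\<Sum>j\<in>UNIV. \<integral>x. w i x * G i x $ j * v x $ j \<partial>torus) = 0"
      by (rule trilinear_zero[OF wG K vL div])+
  qed
  have iw: "integrable torus (\<lambda>x. w i x * h x)" if "h \<in> torus_L2" for h i
    by (rule Parseval_inner_real(2)[OF torus_L2_cx[OF wL] torus_L2_cx[OF that]])
  \<comment> \<open>Gradients are orthogonal to divergence-free fields, coefficient by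
    coefficient.\<close>
  have press: "(\<Sum>i\<in>UNIV. \<integral>x. w i x * Dp x $ i \<partial>torus) = 0"
  proof -
    have "((\<lambda>n. Re (cfc (cx (w i)) n * cnj (cfc (cx (\<lambda>x. Dp x $ i)) n))) has_sum (\<integral>x. w i x * Dp x $ i \<partial>torus) / (2*pi)\<^sup>2) UNIV" for i
      by (rule Parseval_inner_real(1)[OF torus_L2_cx[OF wL] torus_L2_cx[OF DpL]])
    then have 1: "((\<lambda>n. \<Sum>i\<in>UNIV. Re (cfc (cx (w i)) n * cnj (cfc (cx (\<lambda>x. Dp x $ i)) n))) has_sum
        (\<Sum>i\<in>UNIV. (\<integral>x. w i x * Dp x $ i \<partial>torus) / (2*pi)\<^sup>2)) UNIV"
      unfolding sum_2 by (intro has_sum_add)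
    have 2: "(\<Sum>i\<in>UNIV. Re (cfc (cx (w i)) n * cnj (cfc (cx (\<lambda>x. Dp x $ i)) n))) = 0" for n
    proof -
      have c: "cfc (cx (w i)) n = fourier_coeff (\<lambda>x. v x $ i) n - fourier_coeff (\<lambda>x. flow a t x $ i) n" for i
        unfolding w_def[abs_def] using fourier_coeff_diff[OF vL flow_L2(1)] by (simp only: fourier_coeff_cfc)
      have "(\<Sum>i\<in>UNIV. Re (cfc (cx (w i)) n * cnj (cfc (cx (\<lambda>x. Dp x $ i)) n)))
        = Re (\<Sum>i\<in>UNIV. cfc (cx (w i)) n * cnj (cfc (cx (\<lambda>x. Dp x $ i)) n))" by simp
      also have "(\<Sum>i\<in>UNIV. cfc (cx (w i)) n * cnj (cfc (cx (\<lambda>x. Dp x $ i)) n))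
        = cnj (\<i> * fourier_coeff p n) * ((\<Sum>j\<in>UNIV. of_int (n $ j) * fourier_coeff (\<lambda>x. v x $ j) n)
          - (\<Sum>j\<in>UNIV. of_int (n $ j) * fourier_coeff (\<lambda>x. flow a t x $ j) n))"
        unfolding weak_gradient_coeff(2)[OF p] c
        by (simp add: sum_distrib_left sum_subtractf[symmetric] algebra_simps)
      also have "\<dots> = 0" by (simp only: div divV) simp
      finally show ?thesis by simp
    qed
    have "((\<lambda>n. 0) has_sum (\<Sum>i\<in>UNIV. (\<integral>x. w i x * Dp x $ i \<partial>torus) / (2*pi)\<^sup>2)) (UNIV :: (int^2) set)"
      using 1 unfolding 2 .
    then have "(\<Sum>i\<in>UNIV. (\<integral>x. w i x * Dp x $ i \<partial>torus) / (2*pi)\<^sup>2) = 0"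
      using has_sum_unique[OF _ has_sum_0] by blast
    then show ?thesis by (simp flip: sum_divide_distrib)
  qed
  \<comment> \<open>Two terms of integral zero are added to \<open>w \<bullet> W'\<close>, so that
    the equation collapses pointwise to minus \<open>w\<close> paired with the gradient of the flow
    applied to \<open>w\<close>.\<close>
  define Q where "Q x = (\<Sum>i\<in>UNIV. w i x * W' i x) + (\<Sum>i\<in>UNIV. w i x * Dp x $ i)
    + (\<Sum>i\<in>UNIV. \<Sum>j\<in>UNIV. w i x * G i x $ j * v x $ j)" for x
  have Qi: "integrable torus Q"
    unfolding Q_def[abs_def] by (intro Bochner_Integration.integrable_add Bochner_Integration.integrable_sum iw W'L DpL tri(1))
  have "(\<integral>x. Q x \<partial>torus) = (\<Sum>i\<in>UNIV. \<integral>x. w i x * W' i x \<partial>torus) + (\<Sum>i\<in>UNIV. \<integral>x. w i x * Dp x $ i \<partial>torus)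
    + (\<Sum>i\<in>UNIV. \<Sum>j\<in>UNIV. \<integral>x. w i x * G i x $ j * v x $ j \<partial>torus)"
    unfolding Q_def[abs_def]
    by (simp add: Bochner_Integration.integral_add Bochner_Integration.integral_sum iw W'L DpL tri(1) del: UNIV_2)
  then have Q: "(\<integral>x. Q x \<partial>torus) = (\<Sum>i\<in>UNIV. \<integral>x. w i x * W' i x \<partial>torus)"
    by (simp only: press tri(2)) simp
  have sqi: "integrable torus (\<lambda>x. (w i x)\<^sup>2)" for i using iw[OF wL, of i i] by (simp add: power2_eq_square)
  have "(\<integral>x. Q x \<partial>torus) \<le> (\<integral>x. 4 * A * (\<Sum>i\<in>UNIV. (w i x)\<^sup>2) \<partial>torus)"
  proof (rule integral_mono_AE[OF Qi])
    show "integrable torus (\<lambda>x. 4 * A * (\<Sum>i\<in>UNIV. (w i x)\<^sup>2))"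
      by (intro integrable_mult_right Bochner_Integration.integrable_sum sqi)
    show "AE x in torus. Q x \<le> 4 * A * (\<Sum>i\<in>UNIV. (w i x)\<^sup>2)"
      using eq
    proof eventually_elim
      case (elim x)
      let ?D = "flow_grad a t x"
      have V: "(\<Sum>j\<in>UNIV. ?D $ i $ j * flow a t x $ j) = 0" for i
        using flow_self_advection[of a t x, OF a(1)] by (simp add: matrix_vector_mult_def vec_eq_iff)
      have e: "W' i x = - (\<Sum>j\<in>UNIV. Dv x $ i $ j * v x $ j) - Dp x $ i" for i
      proof -
        have "v' x $ i + (\<Sum>j\<in>UNIV. Dv x $ i $ j * v x $ j) + Dp x $ i = flow a' t x $ i"
          using arg_cong[OF elim, of "\<lambda>y. y $ i"] by (simp add: matrix_vector_mult_def)
        then show ?thesis by (simp add: W'_def)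
      qed
      have k: "w i x * W' i x + w i x * Dp x $ i + (\<Sum>j\<in>UNIV. w i x * G i x $ j * v x $ j)
        = - (\<Sum>j\<in>UNIV. w i x * (?D $ i $ j * w j x))" for i
      proof -
        have "w i x * W' i x + w i x * Dp x $ i + (\<Sum>j\<in>UNIV. w i x * G i x $ j * v x $ j)
          = w i x * (- (\<Sum>j\<in>UNIV. Dv x $ i $ j * v x $ j) + (\<Sum>j\<in>UNIV. G i x $ j * v x $ j))"
          unfolding e by (simp add: algebra_simps sum_distrib_left)
        also have "- (\<Sum>j\<in>UNIV. Dv x $ i $ j * v x $ j) + (\<Sum>j\<in>UNIV. G i x $ j * v x $ j) = - (\<Sum>j\<in>UNIV. ?D $ i $ j * v x $ j)"
          by (simp add: G_def algebra_simps sum_subtractf)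
        also have "\<dots> = - (\<Sum>j\<in>UNIV. ?D $ i $ j * w j x) - (\<Sum>j\<in>UNIV. ?D $ i $ j * flow a t x $ j)"
          by (simp add: w_def algebra_simps sum_subtractf)
        finally show ?thesis by (simp add: V sum_distrib_left del: UNIV_2)
      qed
      have "Q x = - (\<Sum>i\<in>UNIV. \<Sum>j\<in>UNIV. w i x * (?D $ i $ j * w j x))"
        unfolding Q_def sum.distrib[symmetric] k sum_negf ..
      also have "\<dots> \<le> (\<Sum>i\<in>UNIV. \<Sum>j\<in>UNIV. \<bar>w i x * (?D $ i $ j * w j x)\<bar>)"
        unfolding sum_negf[symmetric] by (intro sum_mono) simp
      also have "\<dots> \<le> (\<Sum>i\<in>UNIV. \<Sum>j\<in>UNIV. A * ((w i x)\<^sup>2 + (w j x)\<^sup>2))"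
      proof (intro sum_mono)
        fix i j
        have "A \<ge> 0" using a(2)[of 1] by linarith
        have "\<bar>w i x * (?D $ i $ j * w j x)\<bar> = \<bar>?D $ i $ j\<bar> * (\<bar>w i x\<bar> * \<bar>w j x\<bar>)" by (simp add: abs_mult)
        also have "\<dots> \<le> (2 * A) * (((w i x)\<^sup>2 + (w j x)\<^sup>2) / 2)"
        proof (intro mult_mono flow_grad_bound a(2))
          have "0 \<le> (\<bar>w i x\<bar> - \<bar>w j x\<bar>)\<^sup>2" by simp
          then show "\<bar>w i x\<bar> * \<bar>w j x\<bar> \<le> ((w i x)\<^sup>2 + (w j x)\<^sup>2) / 2" by (simp add: power2_diff)
        qed (use \<open>A \<ge> 0\<close> in auto)
        finally show "\<bar>w i x * (?D $ i $ j * w j x)\<bar> \<le> A * ((w i x)\<^sup>2 + (w j x)\<^sup>2)" by simp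
      qed
      \<comment> \<open>In the sum over four index pairs every \<open>(w i x)\<^sup>2\<close> occurs
        four times.\<close>
      also have "\<dots> = 4 * A * (\<Sum>i\<in>UNIV. (w i x)\<^sup>2)" by (simp add: sum_2 algebra_simps)
      finally show ?case .
    qed
  qed
  also have "\<dots> = 4 * A * (\<Sum>i\<in>UNIV. \<integral>x. (w i x)\<^sup>2 \<partial>torus)"
    by (simp add: Bochner_Integration.integral_sum sqi del: UNIV_2)
  finally show ?thesis unfolding Q w_def W'_def .
qed

lemma msq_diff_le:
  assumes f: "f \<in> cL2" and g: "g \<in> cL2" shows "msq (\<lambda>x. f x - g x) \<le> 2 * msq f + 2 * msq g"
proof -
  have "(\<integral>x. (cmod (f x - g x))\<^sup>2 \<partial>torus) \<le> (\<integral>x. 2 * (cmod (f x))\<^sup>2 + 2 * (cmod (g x))\<^sup>2 \<partial>torus)"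
  proof (rule integral_mono)
    show "integrable torus (\<lambda>x. (cmod (f x - g x))\<^sup>2)" by (rule cL2_square[OF cL2_diff[OF f g]])
    show "integrable torus (\<lambda>x. 2 * (cmod (f x))\<^sup>2 + 2 * (cmod (g x))\<^sup>2)"
      by (intro Bochner_Integration.integrable_add integrable_mult_right cL2_square f g)
    fix x
    have "(cmod (f x - g x))\<^sup>2 \<le> (cmod (f x) + cmod (g x))\<^sup>2" by (intro power_mono norm_triangle_ineq4) simp
    also have "\<dots> \<le> 2 * (cmod (f x))\<^sup>2 + 2 * (cmod (g x))\<^sup>2"
      using zero_le_power2[of "cmod (f x) - cmod (g x)"] by (simp add: power2_sum power2_diff)
    finally show "(cmod (f x - g x))\<^sup>2 \<le> 2 * (cmod (f x))\<^sup>2 + 2 * (cmod (g x))\<^sup>2" .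
  qed
  also have "\<dots> = 2 * (\<integral>x. (cmod (f x))\<^sup>2 \<partial>torus) + 2 * (\<integral>x. (cmod (g x))\<^sup>2 \<partial>torus)"
    using cL2_square[OF f] cL2_square[OF g] by simp
  finally show ?thesis unfolding msq_def by (simp add: field_simps)
qed

lemma bochner_coeff_integrable:
  assumes "bochner_Lp_sobolev 1 s \<tau> h"
  shows "integrable (lebesgue_on {0..\<tau>}) (\<lambda>r. fourier_coeff (h r) n)"
proof (rule Bochner_Integration.integrable_bound)
  have m: "strongly_measurable_sobolev s \<tau> h" and i: "integrable (lebesgue_on {0..\<tau>}) (\<lambda>r. sobolev_norm s (h r))"
    using assms by (simp_all add: bochner_Lp_sobolev_def)
  show "integrable (lebesgue_on {0..\<tau>}) (\<lambda>r. sobolev_norm s (h r))" by (rule i)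
  show "(\<lambda>r. fourier_coeff (h r) n) \<in> borel_measurable (lebesgue_on {0..\<tau>})" by (rule strongly_measurable_coeff(1)[OF m])
  show "AE r in lebesgue_on {0..\<tau>}. norm (fourier_coeff (h r) n) \<le> norm (sobolev_norm s (h r))"
    using strongly_measurable_coeff(2)[OF m]
    by eventually_elim (use sobolev_norm_coeff in \<open>force intro: order_trans[OF _ abs_ge_self]\<close>)
qed

lemma W11_coeff:
  assumes "has_W11_derivative s \<tau> h h'" "t \<in> {0..\<tau>}"
  shows "fourier_coeff (h t) n = fourier_coeff (h 0) n + (\<integral>r. fourier_coeff (h' r) n \<partial>lebesgue_on {0..t})"
  using assms unfolding has_W11_derivative_def by blast

text \<open>The energy method with the explicit flow as reference: its gradient is bounded by the
  amplitudes and gives the Gronwall rate, while transport by the unknown velocity does no work on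
  the difference.\<close>

theorem euler_flow_unique:
  assumes \<tau>: "\<tau> > 0" and a: "\<And>i t. (a i has_real_derivative a' i t) (at t)" and a': "\<And>i S. continuous_on S (a' i)"
    and a0: "\<And>i. a i 0 = 0" and prod: "\<And>t. a 1 t * a 2 t = 0"
    and k: "k \<ge> 3" and sol: "euler_solution k \<tau> (flow a') v" and t: "t \<in> {0..\<tau>}"
  shows "AE x in torus. v t x = flow a t x"
proof -
  let ?M = "lebesgue_on {0..\<tau>}"
  have ac: "continuous_on S (a i)" for S i
    using a DERIV_isCont continuous_at_imp_continuous_on by blast
  obtain A where A: "A \<ge> 0" "\<And>i t. t \<in> {0..\<tau>} \<Longrightarrow> \<bar>a i t\<bar> \<le> A" by (rule bounded_on_Icc[where a = a and \<tau> = \<tau>, OF ac]) (rule that)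
  have csv: "continuous_into_sobolev k \<tau> (\<lambda>t x. v t x $ i)" for i using sol by (simp add: euler_solution_def)
  have v0: "AE x in torus. v 0 x = 0" using sol by (simp add: euler_solution_def)
  obtain v' Dv p Dp where hv: "\<And>i. has_W11_derivative (k - 1) \<tau> (\<lambda>t x. v t x $ i) (\<lambda>t x. v' t x $ i)"
    and grad: "\<And>t i. t \<in> {0..\<tau>} \<Longrightarrow> weak_gradient (\<lambda>x. v t x $ i) (\<lambda>x. Dv t x $ i)"
    and tr: "\<And>t. t \<in> {0..\<tau>} \<Longrightarrow> AE x in torus. trace (Dv t x) = 0"
    and eq: "AE t in ?M. weak_gradient (p t) (Dp t) \<and> (AE x in torus. v' t x + Dv t x *v v t x + Dp t x = flow a' t x)"
    using sol unfolding euler_solution_def by (elim conjE exE) (rule that; simp)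
  have hf: "has_W11_derivative (k - 1) \<tau> (\<lambda>t x. flow a t x $ i) (\<lambda>t x. flow a' t x $ i)" for i
    by (rule flow_W11[OF \<tau> a a'])
  have bv: "bochner_Lp_sobolev 1 (k - 1) \<tau> (\<lambda>t x. v' t x $ i)" and bf: "bochner_Lp_sobolev 1 (k - 1) \<tau> (\<lambda>t x. flow a' t x $ i)" for i
    using hv[of i] hf[of i] by (simp_all add: has_W11_derivative_def)
  have v's: "AE r in ?M. (\<lambda>x. v' r x $ i) \<in> sobolev (k - 1)" for i
    using bv[of i] strongly_measurable_coeff(2) by (simp add: bochner_Lp_sobolev_def)
  have sL: "h \<in> torus_L2" if "h \<in> sobolev s" for h s using that by (simp add: sobolev_def)
  have vs: "(\<lambda>x. v t x $ i) \<in> sobolev k" if "t \<in> {0..\<tau>}" for t i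
    using csv[of i] that by (simp add: continuous_into_sobolev_def)
  define w where "w i t x = v t x $ i - flow a t x $ i" for i t x
  define W where "W i t x = v' t x $ i - flow a' t x $ i" for i t x
  have wL: "w i t \<in> torus_L2" if "t \<in> {0..\<tau>}" for i t
    unfolding w_def[abs_def] by (rule torus_L2_diff[OF sL[OF vs[OF that]] flow_L2(1)])
  have WL: "AE r in ?M. W i r \<in> torus_L2" for i
    using v's[of i] unfolding W_def[abs_def] by eventually_elim (rule torus_L2_diff[OF sL flow_L2(1)])
  have D: "\<exists>D. \<forall>t\<in>{0..\<tau>}. msq (cx (w i t)) \<le> D" for i
  proof -
    obtain D1 where D1: "\<forall>t\<in>{0..\<tau>}. msq (cx (\<lambda>x. v t x $ i)) \<le> D1"
      using continuous_into_L2_bounded[OF continuous_into_sobolev_imp_L2[OF csv[of i]]] by (rule exE)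
    obtain D2 where D2: "\<forall>t\<in>{0..\<tau>}. msq (cx (\<lambda>x. flow a t x $ i)) \<le> D2"
      using continuous_into_L2_bounded[OF continuous_into_sobolev_imp_L2[OF flow_continuous_into_sobolev[of \<tau> a 0 i, OF ac]]] by (rule exE)
    have "msq (cx (w i t)) \<le> 2 * D1 + 2 * D2" if t: "t \<in> {0..\<tau>}" for t
    proof -
      have "msq (cx (w i t)) \<le> 2 * msq (cx (\<lambda>x. v t x $ i)) + 2 * msq (cx (\<lambda>x. flow a t x $ i))"
        using msq_diff_le[OF torus_L2_cx[OF sL[OF vs[OF t]]] torus_L2_cx[OF flow_L2(1)]] by (simp add: w_def)
      then show ?thesis using bspec[OF D1 t] bspec[OF D2 t] by linarith
    qed
    then show ?thesis by blast
  qed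
  have Wc: "AE r in ?M. fourier_coeff (\<lambda>x. v' r x $ i) n - fourier_coeff (\<lambda>x. flow a' r x $ i) n = fourier_coeff (W i r) n" for i n
    using v's[of i] unfolding W_def[abs_def] by eventually_elim (rule fourier_coeff_diff[OF sL flow_L2(1), symmetric])
  have Wd: "integrable ?M (\<lambda>r. fourier_coeff (\<lambda>x. v' r x $ i) n - fourier_coeff (\<lambda>x. flow a' r x $ i) n)" for i n
    by (intro Bochner_Integration.integrable_diff bochner_coeff_integrable[OF bv] bochner_coeff_integrable[OF bf])
  have Wm: "(\<lambda>r. fourier_coeff (W i r) n) \<in> borel_measurable ?M" for i n
    by (rule borel_measurable_lebesgue_on_AE[OF _ _ Wc]) (use Wd in auto)
  have Wi: "integrable ?M (\<lambda>r. fourier_coeff (W i r) n)" for i n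
    using Wd[of i n] integrable_cong_AE[OF borel_measurable_integrable[OF Wd] Wm Wc, of i n] by simp
  \<comment> \<open>Both Sobolev norms are integrable in time, and their sum dominates the partial
    l2 norms of the coefficients of \<open>W\<close>.\<close>
  define N where "N i r = sobolev_norm (k - 1) (\<lambda>x. v' r x $ i) + sobolev_norm (k - 1) (\<lambda>x. flow a' r x $ i)" for i r
  have Ni: "integrable ?M (N i)" for i
    using bv[of i] bf[of i] unfolding N_def[abs_def] by (intro Bochner_Integration.integrable_add) (auto simp: bochner_Lp_sobolev_def)
  have NW: "AE r in ?M. \<forall>F. finite F \<longrightarrow> L2_set (\<lambda>n. cmod (fourier_coeff (W i r) n)) F \<le> N i r" for i
    using v's[of i]
  proof eventually_elim
    case (elim r)
    show ?case
    proof (intro allI impI)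
      fix F :: "(int^2) set" assume F: "finite F"
      have "L2_set (\<lambda>n. cmod (fourier_coeff (W i r) n)) F
        \<le> L2_set (\<lambda>n. cmod (fourier_coeff (\<lambda>x. v' r x $ i) n) + cmod (fourier_coeff (\<lambda>x. flow a' r x $ i) n)) F"
        unfolding W_def[abs_def] fourier_coeff_diff[OF sL[OF elim] flow_L2(1)]
        by (intro L2_set_mono norm_triangle_ineq4) simp
      also have "\<dots> \<le> L2_set (\<lambda>n. cmod (fourier_coeff (\<lambda>x. v' r x $ i) n)) F + L2_set (\<lambda>n. cmod (fourier_coeff (\<lambda>x. flow a' r x $ i) n)) F"
        by (rule L2_set_triangle_ineq)
      also have "\<dots> \<le> N i r"
        unfolding N_def by (intro add_mono sobolev_norm_bound elim flow_sobolev(1) F)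
      finally show "L2_set (\<lambda>n. cmod (fourier_coeff (W i r) n)) F \<le> N i r" .
    qed
  qed
  have coeff: "fourier_coeff (w i t) n = (\<integral>r. fourier_coeff (W i r) n \<partial>lebesgue_on {0..t})" if t: "t \<in> {0..\<tau>}" for i t n
  proof -
    let ?T = "lebesgue_on {0..t}"
    have sub: "integrable ?T h" if "integrable ?M h" for h :: "real \<Rightarrow> complex"
      by (rule integrable_subinterval[OF that]) (use t in auto)
    have z: "fourier_coeff (\<lambda>x. v 0 x $ i) n = 0"
    proof -
      have "cfc (cx (\<lambda>x. v 0 x $ i)) n = cfc (\<lambda>x. 0) n"
      proof (rule cfc_AE_cong)
        show "AE x in torus. cx (\<lambda>x. v 0 x $ i) x = 0" using v0 by eventually_elim simp
        show "cx (\<lambda>x. v 0 x $ i) \<in> borel_measurable torus"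
          using \<tau> by (intro cL2_measurable torus_L2_cx sL[OF vs]) simp
      qed simp
      then show ?thesis by (simp add: fourier_coeff_cfc cfc_def mean_def)
    qed
    have z': "fourier_coeff (\<lambda>x. flow a 0 x $ i) n = 0" by (simp add: flow_L2(2) flow_coeff_def a0)
    have "fourier_coeff (w i t) n = fourier_coeff (\<lambda>x. v t x $ i) n - fourier_coeff (\<lambda>x. flow a t x $ i) n"
      unfolding w_def[abs_def] by (rule fourier_coeff_diff[OF sL[OF vs[OF t]] flow_L2(1)])
    also have "fourier_coeff (\<lambda>x. v t x $ i) n = (\<integral>r. fourier_coeff (\<lambda>x. v' r x $ i) n \<partial>?T)"
      unfolding W11_coeff[OF hv t] z by simp
    also have "fourier_coeff (\<lambda>x. flow a t x $ i) n = (\<integral>r. fourier_coeff (\<lambda>x. flow a' r x $ i) n \<partial>?T)"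
      unfolding W11_coeff[OF hf t] z' by simp
    also have "(\<integral>r. fourier_coeff (\<lambda>x. v' r x $ i) n \<partial>?T) - (\<integral>r. fourier_coeff (\<lambda>x. flow a' r x $ i) n \<partial>?T)
        = (\<integral>r. fourier_coeff (\<lambda>x. v' r x $ i) n - fourier_coeff (\<lambda>x. flow a' r x $ i) n \<partial>?T)"
      by (rule Bochner_Integration.integral_diff[symmetric])
        (rule sub[OF bochner_coeff_integrable[OF bv]] sub[OF bochner_coeff_integrable[OF bf]])+
    also have "\<dots> = (\<integral>r. fourier_coeff (W i r) n \<partial>?T)"
      by (rule integral_cong_AE)
        (use sub[OF Wd[of i n]] sub[OF Wi[of i n]] AE_lebesgue_on_initial[OF Wc[of i n] t] in auto)
    finally show ?thesis .
  qed
  define E where "E i r = 2 * ((\<integral>x. w i r x * W i r x \<partial>torus) / (2*pi)\<^sup>2)" for i r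
  have E: "integrable ?M (E i)" "\<And>t. t \<in> {0..\<tau>} \<Longrightarrow> msq (cx (w i t)) = (\<integral>r. E i r \<partial>lebesgue_on {0..t})" for i
  proof -
    obtain D where D': "\<forall>t\<in>{0..\<tau>}. msq (cx (w i t)) \<le> D" using D by blast
    then have D'': "msq (cx (w i t)) \<le> D" if "t \<in> {0..\<tau>}" for t using that by blast
    have "0 \<le> \<tau>" using \<tau> by simp
    note ac = msq_absolutely_continuous[OF this wL[of _ i] D'' WL[of i] Wi[of i] Ni[of i] NW[of i] coeff[of _ i]]
    show "integrable ?M (E i)" unfolding E_def[abs_def] by (rule ac(1))
    show "msq (cx (w i t)) = (\<integral>r. E i r \<partial>lebesgue_on {0..t})" if "t \<in> {0..\<tau>}" for t
      unfolding E_def[abs_def] by (rule ac(2)[OF _ _ _ that])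
  qed
  define y where "y t = (\<Sum>i\<in>UNIV. msq (cx (w i t)))" for t
  have Es: "integrable ?M (\<lambda>r. \<Sum>i\<in>UNIV. E i r)" by (intro Bochner_Integration.integrable_sum E(1))
  have yE: "y t = (\<integral>r. (\<Sum>i\<in>UNIV. E i r) \<partial>lebesgue_on {0..t})" if t: "t \<in> {0..\<tau>}" for t
  proof -
    have "integrable (lebesgue_on {0..t}) (E i)" for i by (rule integrable_subinterval[OF E(1)]) (use t in auto)
    then show ?thesis unfolding y_def E(2)[OF t] by (rule Bochner_Integration.integral_sum[symmetric])
  qed
  \<comment> \<open>An indefinite integral is continuous; this makes \<open>y\<close> eligible for
    Gronwall.\<close>
  have yc: "continuous_on {0..\<tau>} y"
  proof -
    have "continuous_on {0..\<tau>} (\<lambda>t. integral {0..t} (\<lambda>r. \<Sum>i\<in>UNIV. E i r))"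
      by (rule indefinite_integral_continuous_1[OF integrable_on_lebesgue_on[OF Es]]) simp
    moreover have "integral {0..t} (\<lambda>r. \<Sum>i\<in>UNIV. E i r) = y t" if "t \<in> {0..\<tau>}" for t
      unfolding yE[OF that]
      by (rule lebesgue_integral_eq_integral[symmetric, OF integrable_subinterval[OF Es]]) (use that in auto)
    ultimately show ?thesis by (rule continuous_on_eq)
  qed
  \<comment> \<open>Twice the constant of \<open>euler_difference_estimate\<close>, because of the
    factor 2 in \<open>E\<close>.\<close>
  have Ey: "AE r in ?M. (\<Sum>i\<in>UNIV. E i r) \<le> 8 * A * y r"
  proof -
    have "AE r in ?M. r \<in> {0..\<tau>}" by (rule AE_I2) simp
    with v's[of 1] v's[of 2] eq show ?thesis
    proof eventually_elim
      case (elim r)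
      have v'L: "(\<lambda>x. v' r x $ i) \<in> torus_L2" for i using sL[OF elim(1)] sL[OF elim(2)] exhaust_2[of i] by auto
      have "(\<Sum>i\<in>UNIV. \<integral>x. w i r x * W i r x \<partial>torus) \<le> 4 * A * (\<Sum>i\<in>UNIV. \<integral>x. (w i r x)\<^sup>2 \<partial>torus)"
        unfolding w_def W_def
        by (rule euler_difference_estimate[where v = "v r" and Dv = "Dv r" and v' = "v' r" and p = "p r" and Dp = "Dp r" and s = k])
          (use elim k grad[OF elim(4)] tr vs[OF elim(4)] v'L prod A(2)[OF elim(4)] in auto)
      then have "2 * ((\<Sum>i\<in>UNIV. \<integral>x. w i r x * W i r x \<partial>torus) / (2*pi)\<^sup>2)
        \<le> 2 * (4 * A * (\<Sum>i\<in>UNIV. \<integral>x. (w i r x)\<^sup>2 \<partial>torus) / (2*pi)\<^sup>2)"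
        by (intro mult_left_mono divide_right_mono) auto
      then show ?case
        unfolding E_def y_def msq_def
        by (simp add: sum_distrib_left sum_divide_distrib)
    qed
  qed
  have "y t = 0"
  proof (rule gronwall_zero[OF yc])
    show "0 \<le> y t" for t unfolding y_def by (intro sum_nonneg) simp
    show "0 \<le> 8 * A" using A(1) by simp
    show "y t \<le> 8 * A * integral {0..t} y" if t: "t \<in> {0..\<tau>}" for t
    proof -
      have yi: "integrable (lebesgue_on {0..t}) y"
        by (rule continuous_imp_integrable_real[OF continuous_on_subset[OF yc]]) (use t in auto)
      have "y t \<le> (\<integral>r. 8 * A * y r \<partial>lebesgue_on {0..t})"
        unfolding yE[OF t]
        by (rule integral_mono_AE[OF integrable_subinterval[OF Es] _ AE_lebesgue_on_initial[OF Ey t]])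
          (use t yi in auto)
      also have "\<dots> = 8 * A * integral {0..t} y"
        using lebesgue_integral_eq_integral[OF yi] by simp
      finally show ?thesis .
    qed
  qed (rule t)
  then have m: "msq (cx (w i t)) = 0" for i
    unfolding y_def by (subst (asm) sum_nonneg_eq_0_iff) auto
  have "AE x in torus. v t x $ i = flow a t x $ i" for i
  proof (rule torus_L2_eq_AE[OF sL[OF vs[OF t]] flow_L2(1)])
    fix n
    have "fourier_coeff (w i t) n = 0" using fourier_coeff_le_msq[OF wL[OF t, of i], of n] by (simp add: m)
    then show "fourier_coeff (\<lambda>x. v t x $ i) n = fourier_coeff (\<lambda>x. flow a t x $ i) n"
      unfolding w_def[abs_def] fourier_coeff_diff[OF sL[OF vs[OF t]] flow_L2(1)] by simp
  qed
  from this[of 1] this[of 2] show ?thesis by eventually_elim (simp add: vec_eq_iff forall_2)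
qed

text \<open>Conjugation together with \<open>n \<mapsto> - n\<close> is a symmetry of the system, as
  \<open>cross\<close> is odd. By uniqueness the modes of a real datum then describe a real function
  at all times.\<close>

lemma mode_solution_cnj:
  assumes "mode_solution \<tau> a c" shows "mode_solution \<tau> a (\<lambda>n t. cnj (c (- n) t))"
  unfolding mode_solution_def
proof (intro allI ballI)
  fix n t assume t: "t \<in> {0..\<tau>}"
  have cr: "cross i (- n) = - cross i n" for i by (simp add: cross_def)
  have tr: "cnj (transport a c (- n) t) = transport a (\<lambda>n t. cnj (c (- n) t)) n t"
    unfolding transport_def cnj_sum
    by (rule sum.cong[OF refl]) (simp add: cr algebra_simps)
  have "(c (- n) has_vector_derivative (- of_real (lap (- n)) * c (- n) t - transport a c (- n) t)) (at t within {0..\<tau>})"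
    using assms t unfolding mode_solution_def by blast
  from bounded_linear.has_vector_derivative[OF bounded_linear_cnj this]
  show "((\<lambda>t. cnj (c (- n) t)) has_vector_derivative
      - of_real (lap n) * cnj (c (- n) t) - transport a (\<lambda>n t. cnj (c (- n) t)) n t) (at t within {0..\<tau>})"
    by (simp add: tr)
qed

text \<open>The decay estimate requires the bound \<open>g\<close> of \<open>mode_flow\<close>,
  which an arbitrary energy solution does not bring along. The Picard solution therefore gives
  existence and the estimate, and uniqueness among bounded mode solutions transfers the estimate to
  every energy solution.\<close>

lemma flow_relaxation:
  assumes \<tau>: "\<tau> > 0" and a: "\<And>i. continuous_on {0..\<tau>} (a i)"
    and decay: "\<And>c g A. mode_flow \<tau> a c g A \<Longrightarrow> mode_flow.energy c UNIV 0 \<le> 1 \<Longrightarrow> c 0 0 = 0 \<Longrightarrow> mode_flow.energy c UNIV \<tau> \<le> \<epsilon>"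
    and v: "\<And>t. t \<in> {0..\<tau>} \<Longrightarrow> AE x in torus. v t x = flow a t x"
    and f: "f \<in> torus_L2" "L2_norm_torus f \<le> 1" "(\<integral>x. f x \<partial>torus) = 0"
  shows "\<exists>\<phi>. advection_diffusion_solution \<tau> v f \<phi>"
    and "advection_diffusion_solution \<tau> v f \<phi> \<Longrightarrow> msq (cx (\<phi> \<tau>)) \<le> \<epsilon>"
proof -
  have \<tau>0: "0 \<le> \<tau>" using \<tau> by simp
  have P: "((\<lambda>n. (cmod (fourier_coeff f n))\<^sup>2) has_sum msq (cx f)) UNIV" by (rule Parseval_real[OF f(1)])
  then have s: "(\<lambda>n. (cmod (fourier_coeff f n))\<^sup>2) summable_on UNIV" by (rule has_sum_imp_summable)
  obtain c g where c: "mode_solution \<tau> a c" "\<And>n. c n 0 = fourier_coeff f n"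
    "\<And>n t. t \<in> {0..\<tau>} \<Longrightarrow> cmod (c n t) \<le> g n" "(\<lambda>n. (g n)\<^sup>2) summable_on UNIV"
    by (rule mode_solution_exists[where a = a, OF \<tau>0 a s]) (rule that)
  obtain A where A: "A \<ge> 0" "\<And>i t. t \<in> {0..\<tau>} \<Longrightarrow> \<bar>a i t\<bar> \<le> A"
    by (rule bounded_on_Icc[where a = a and \<tau> = \<tau>, OF a]) (rule that)
  interpret mode_flow \<tau> a c g A using c(1,3,4) a A(2) \<tau>0 by unfold_locales
  have bound: "\<exists>B. \<forall>n. \<forall>t\<in>{0..\<tau>}. cmod (c n t) \<le> B"
  proof -
    have "cmod (c n t) \<le> sqrt (\<Sum>\<^sub>\<infinity>n. (g n)\<^sup>2)" if "t \<in> {0..\<tau>}" for n t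
    proof -
      have "(cmod (c n t))\<^sup>2 \<le> (g n)\<^sup>2" using c_square_le[OF that] .
      also have "\<dots> = (\<Sum>\<^sub>\<infinity>n\<in>{n}. (g n)\<^sup>2)" by simp
      also have "\<dots> \<le> (\<Sum>\<^sub>\<infinity>n. (g n)\<^sup>2)" by (rule infsum_mono_neutral) (use c(4) in auto)
      finally show ?thesis by (rule real_le_rsqrt)
    qed
    then show ?thesis by blast
  qed
  then obtain B where B: "\<And>n t. t \<in> {0..\<tau>} \<Longrightarrow> cmod (c n t) \<le> B" by blast
  have init: "c n 0 = cnj (c (- n) 0)" for n by (simp add: c(2) fourier_coeff_minus)
  have cs: "c (- n) t = cnj (c n t)" if "t \<in> {0..\<tau>}" for n t
    using mode_solution_unique[OF c(1) mode_solution_cnj[OF c(1)] a init B _ that, of n] B by simp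
  show "\<exists>\<phi>. advection_diffusion_solution \<tau> v f \<phi>"
    by (rule weak_solution_exists[OF \<tau> cs f(1) c(2)[symmetric] v])
  show "msq (cx (\<phi> \<tau>)) \<le> \<epsilon>" if sol: "advection_diffusion_solution \<tau> v f \<phi>"
  proof -
    note m = weak_solution_modes[OF sol v a f(1) \<tau>0]
    have ci: "continuous_into_L2 \<tau> \<phi>" using sol by (simp add: advection_diffusion_solution_def)
    have L: "\<phi> t \<in> torus_L2" if "t \<in> {0..\<tau>}" for t using ci that by (simp add: continuous_into_L2_def)
    obtain D where D: "\<forall>t\<in>{0..\<tau>}. msq (cx (\<phi> t)) \<le> D" using continuous_into_L2_bounded[OF ci] by (rule exE)
    have D': "cmod (fourier_coeff (\<phi> t) n) \<le> sqrt D" if "t \<in> {0..\<tau>}" for n t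
      using fourier_coeff_le_msq[OF L[OF that], of n] bspec[OF D that] by (intro real_le_rsqrt) linarith
    have init: "fourier_coeff (\<phi> 0) n = c n 0" for n by (subst m(2)) (use c(2) in auto)
    have eq: "fourier_coeff (\<phi> \<tau>) n = c n \<tau>" for n
    proof (rule mode_solution_unique[OF m(1) c(1) a init])
      show "cmod (fourier_coeff (\<phi> t) n) \<le> max B (sqrt D)" if "t \<in> {0..\<tau>}" for n t using D'[OF that, of n] by linarith
      show "cmod (c n t) \<le> max B (sqrt D)" if "t \<in> {0..\<tau>}" for n t using B[OF that, of n] by linarith
    qed (use \<tau>0 in auto)
    have "((\<lambda>n. (cmod (fourier_coeff (\<phi> \<tau>) n))\<^sup>2) has_sum msq (cx (\<phi> \<tau>))) UNIV"
      by (rule Parseval_real[OF L]) (use \<tau>0 in auto)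
    then have "msq (cx (\<phi> \<tau>)) = energy UNIV \<tau>"
      unfolding eq energy_def by (rule infsumI[symmetric])
    also have "energy UNIV \<tau> \<le> \<epsilon>"
    proof (rule decay[OF mode_flow_axioms])
      have "energy UNIV 0 = msq (cx f)" unfolding energy_def c(2) by (rule infsumI[OF P])
      also have "\<dots> \<le> 1"
      proof -
        have "sqrt (msq (cx f)) \<le> 2 * pi * sqrt (msq (cx f))" 
          using pi_ge_two mult_right_mono[of 1 "2 * pi" "sqrt (msq (cx f))"] by simp
        also have "\<dots> \<le> 1" using f(2) by (simp add: L2_norm_msq)
        finally show ?thesis by simp
      qed
      finally show "energy UNIV 0 \<le> 1" .
      show "c 0 0 = 0" using f(3) mean_zero_coeff[OF f(1)] by (simp add: c(2))
    qed
    finally show ?thesis .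
  qed
qed

lemma continuous_L2_control:
  assumes "continuous_on {0..\<tau>} u" shows "L2_control \<tau> u"
  unfolding L2_control_def
  by (intro conjI continuous_imp_measurable_on_sets_lebesgue continuous_imp_integrable_real assms continuous_intros) auto

theorem corollary1p5:
  fixes k :: nat and \<theta> :: "4 \<Rightarrow> real^2 \<Rightarrow> real^2"
  assumes "k \<ge> 3"
    and "\<And>x. \<theta> 1 x = sin (x $ 1) *\<^sub>R vector [0, 1]"
    and "\<And>x. \<theta> 2 x = cos (x $ 1) *\<^sub>R vector [0, 1]"
    and "\<And>x. \<theta> 3 x = sin (x $ 1 - x $ 2) *\<^sub>R vector [1, 1]"
    and "\<And>x. \<theta> 4 x = cos (x $ 1 - x $ 2) *\<^sub>R vector [1, 1]"
  shows "relaxation_enhancing k \<theta>"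
    unfolding relaxation_enhancing_def
proof (intro allI impI)
  fix \<tau> \<delta> :: real assume \<tau>: "\<tau> > 0" and \<delta>: "\<delta> > 0"
  \<comment> \<open>As the L2 norm is \<open>2 * pi\<close> times the root of \<open>msq\<close>,
    this leaves at most \<open>\<delta> / 2\<close>, hence the strict inequality.\<close>
  define \<epsilon> where "\<epsilon> = (\<delta> / (4 * pi))\<^sup>2"
  have \<epsilon>: "\<epsilon> > 0" using \<delta> by (simp add: \<epsilon>_def)
  obtain B where decay: "\<And>c g A. mode_flow \<tau> (\<lambda>i r. B * pulse \<tau> i r) c g A \<Longrightarrow> mode_flow.energy c UNIV 0 \<le> 1 \<Longrightarrow> c 0 0 = 0 \<Longrightarrow>
       mode_flow.energy c UNIV \<tau> \<le> \<epsilon>"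
    by (rule two_phase_decay[OF \<tau> \<epsilon>]) (rule that)
  define a where "a i r = B * pulse \<tau> i r" for i r
  define a' where "a' i r = B * pulse_deriv \<tau> i r" for i r
  \<comment> \<open>The sine forces receive the derivatives of the amplitudes, so that the velocity
    itself has the amplitudes \<open>a\<close>.\<close>
  define u :: "real \<Rightarrow> real^4" where "u t = (\<chi> j. if j = 1 then a' 1 t else if j = 3 then a' 2 t else 0)" for t
  have a: "(a i has_real_derivative a' i t) (at t)" for i t
    unfolding a_def[abs_def] a'_def by (rule DERIV_cmult[OF pulse_has_deriv])
  have a': "continuous_on S (a' i)" for i S
    unfolding a'_def[abs_def] by (intro continuous_intros pulse_deriv_cont)
  have ac: "continuous_on S (a i)" for i S
    unfolding a_def[abs_def] by (intro continuous_intros pulse_cont)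
  have a0: "a i 0 = 0" for i by (simp add: a_def)
  have prod: "a 1 t * a 2 t = 0" for t using pulse_product[of \<tau> t] by (auto simp: a_def)
  have force: "control_force \<theta> u = flow a'"
  proof (intro ext)
    fix t x
    have "u t $ 1 = a' 1 t" "u t $ 2 = 0" "u t $ 3 = a' 2 t" "u t $ 4 = 0" by (simp_all add: u_def)
    moreover have "phase 1 x = x $ 1" "phase 2 x = x $ 1 - x $ 2" by (simp_all add: phase_def shift_def sum_2)
    ultimately show "control_force \<theta> u t x = flow a' t x"
      by (simp add: control_force_def sum_4 assms vec_eq_iff forall_2 flow_component perp_def shift_def)
  qed
  have "continuous_on S (\<lambda>t. if j = 1 then a' 1 t else if j = 3 then a' 2 t else 0)" for S and j :: 4
    using a' by (cases "j = 1"; cases "j = 3") simp_all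
  then have "L2_control \<tau> u"
    unfolding u_def[abs_def] by (intro continuous_L2_control continuous_on_vec_lambda)
  moreover have "\<exists>v. euler_solution k \<tau> (flow a') v"
    using flow_euler_solution[OF \<tau> a a' a0 prod] by blast
  moreover have "(\<exists>\<phi>. advection_diffusion_solution \<tau> v f \<phi>) \<and> (\<forall>\<phi>. advection_diffusion_solution \<tau> v f \<phi> \<longrightarrow> L2_norm_torus (\<phi> \<tau>) < \<delta>)"
    if v: "euler_solution k \<tau> (flow a') v" and f: "f \<in> torus_L2" "L2_norm_torus f \<le> 1" "(\<integral>x. f x \<partial>torus) = 0" for v f
  proof -
    have vf: "AE x in torus. v t x = flow a t x" if "t \<in> {0..\<tau>}" for t
      by (rule euler_flow_unique[OF \<tau> a a' a0 prod assms(1) v that])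
    note relax = flow_relaxation[where \<tau> = \<tau> and a = a and v = v and \<epsilon> = \<epsilon>, OF \<tau> ac _ vf f]
    note decay' = decay[folded a_def[abs_def]]
    have "L2_norm_torus (\<phi> \<tau>) < \<delta>" if "advection_diffusion_solution \<tau> v f \<phi>" for \<phi>
    proof -
      have "sqrt (msq (cx (\<phi> \<tau>))) \<le> \<delta> / (4 * pi)"
      proof (rule real_le_lsqrt)
        show "msq (cx (\<phi> \<tau>)) \<le> (\<delta> / (4 * pi))\<^sup>2"
          unfolding \<epsilon>_def[symmetric] by (rule relax(2)[OF _ _ that]) (rule decay')
      qed (use \<delta> in auto)
      then have "2 * pi * sqrt (msq (cx (\<phi> \<tau>))) \<le> 2 * pi * (\<delta> / (4 * pi))" by (intro mult_left_mono) auto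
      also have "\<dots> < \<delta>" using \<delta> by simp
      finally show ?thesis by (simp add: L2_norm_msq)
    qed
    moreover have "\<exists>\<phi>. advection_diffusion_solution \<tau> v f \<phi>" by (rule relax(1)) (rule decay')
    ultimately show ?thesis by blast
  qed
  ultimately show "\<exists>u. L2_control \<tau> u \<and>
        (\<exists>v. euler_solution k \<tau> (control_force \<theta> u) v) \<and>
        (\<forall>v. euler_solution k \<tau> (control_force \<theta> u) v \<longrightarrow>
           (\<forall>f \<in> torus_L2. L2_norm_torus f \<le> 1 \<longrightarrow> (\<integral>x. f x \<partial>torus) = 0 \<longrightarrow>
              (\<exists>\<phi>. advection_diffusion_solution \<tau> v f \<phi>) \<and>
              (\<forall>\<phi>. advection_diffusion_solution \<tau> v f \<phi> \<longrightarrow> L2_norm_torus (\<phi> \<tau>) < \<delta>)))"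
    unfolding force[symmetric] by (intro exI[of _ u]) auto
qed

end
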